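(* For any fixed integers $k$ and $C$, there exists an algorithm running in $n^{O((Ck)^{5^k})}$ time that decides, given a graph $G$ and $k$ pairs of vertices $(s_1,t_1),\dots,(s_k,t_k)$ of $G$, whether there exist $k$ internally vertex-disjoint paths $P_1,\dots,P_k$ in $G$ such that each $P_i$ is a path of length at most $d(s_i,t_i)+C$ between $s_i$ and $t_i$.
   Context: Graphs are undirected, and $n$ denotes the number of vertices of $G$. The length of a path is its number of edges, and $d(x,y)$ denotes the minimum length of a path between $x$ and $y$ in $G$. Paths are internally vertex-disjoint if no internal vertex of one of them is a vertex of another (they may share endpoints).
   Formalization: For C = 0 the stated exponent O((Ck)^{5^k}) is 0, i.e. constant time, which is false already for k = 1 (connectivity); the formal bound replaces Ck by max(1,C)·k. Negative C, where the exponent is negative and no such path exists, is excluded. *)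

theory Defs
  imports
    "Graph_Theory.Pair_Digraph"
    "Graph_Theory.Vertex_Walk"
    "HOL-Library.Extended_Nat"
begin

section \<open>Paths, distance, internally disjoint paths\<close>

definition path_between :: "'a pair_pre_digraph \<Rightarrow> 'a \<Rightarrow> 'a list \<Rightarrow> 'a \<Rightarrow> bool" where
  "path_between G x p y \<longleftrightarrow> vpath p (with_proj G) \<and> hd p = x \<and> last p = y"

text \<open>The distance is \<open>\<infinity>\<close> if there is no path.\<close>

definition gdist :: "'a pair_pre_digraph \<Rightarrow> 'a \<Rightarrow> 'a \<Rightarrow> enat" where
  "gdist G x y = (INF p \<in> {p. path_between G x p y}. enat (vwalk_length p))"

definition internal_vertices :: "'a list \<Rightarrow> 'a set" where
  "internal_vertices p = set (butlast (tl p))"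

definition internally_disjoint :: "'a list list \<Rightarrow> bool" where
  "internally_disjoint Ps \<longleftrightarrow>
     (\<forall>i < length Ps. \<forall>j < length Ps. i \<noteq> j \<longrightarrow> internal_vertices (Ps ! i) \<inter> set (Ps ! j) = {})"

definition has_short_disjoint_paths ::
    "nat \<Rightarrow> 'a pair_pre_digraph \<Rightarrow> ('a \<times> 'a) list \<Rightarrow> bool" where
  "has_short_disjoint_paths C G ts \<longleftrightarrow>
     (\<exists>Ps. length Ps = length ts \<and> internally_disjoint Ps \<and>
        (\<forall>i < length ts. case ts ! i of (s, t) \<Rightarrow>
           path_between G s (Ps ! i) t \<and>
           enat (vwalk_length (Ps ! i)) \<le> gdist G s t + enat C))"


section \<open>Random access machines\<close>

text \<open>
  Structured programs over registers \<open>R 0, R 1, \<dots>\<close> holding natural numbers, with indirect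
  addressing and a read-only input array. Every instruction and every test costs one time unit.
  Since the only arithmetic operations are addition and (truncated) subtraction, unit cost is
  polynomially equivalent to Turing machine time.
\<close>

datatype ram =
    SETC nat nat         \<comment> \<open>\<open>R i := c\<close>\<close>
  | ADD nat nat nat       \<comment> \<open>\<open>R i := R j + R l\<close>\<close>
  | SUB nat nat nat       \<comment> \<open>\<open>R i := R j - R l\<close>\<close>
  | READ nat nat          \<comment> \<open>\<open>R i := input (R j)\<close>\<close>
  | LOAD nat nat          \<comment> \<open>\<open>R i := R (R j)\<close>\<close>
  | STORE nat nat         \<comment> \<open>\<open>R (R i) := R j\<close>\<close>
  | SEQ ram ram
  | IFNZ nat ram ram      \<comment> \<open>if \<open>R i \<noteq> 0\<close> then the first else the second program\<close>
  | WHILENZ nat ram       \<comment> \<open>while \<open>R i \<noteq> 0\<close>\<close>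

definition input_at :: "nat list \<Rightarrow> nat \<Rightarrow> nat" where
  "input_at x i = (if i < length x then x ! i else 0)"

text \<open>\<open>exec x p R t R'\<close>: on input \<open>x\<close>, program \<open>p\<close> started in \<open>R\<close> halts in \<open>R'\<close> after exactly
  \<open>t\<close> time units.\<close>

inductive exec :: "nat list \<Rightarrow> ram \<Rightarrow> (nat \<Rightarrow> nat) \<Rightarrow> nat \<Rightarrow> (nat \<Rightarrow> nat) \<Rightarrow> bool"
  for x :: "nat list" where
  setc: "exec x (SETC i c) R 1 (R(i := c))"
| add: "exec x (ADD i j l) R 1 (R(i := R j + R l))"
| sub: "exec x (SUB i j l) R 1 (R(i := R j - R l))"
| read: "exec x (READ i j) R 1 (R(i := input_at x (R j)))"
| load: "exec x (LOAD i j) R 1 (R(i := R (R j)))"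
| store: "exec x (STORE i j) R 1 (R(R i := R j))"
| seq: "\<lbrakk> exec x p R t R'; exec x q R' t' R'' \<rbrakk> \<Longrightarrow> exec x (SEQ p q) R (t + t') R''"
| if_true: "\<lbrakk> R i \<noteq> 0; exec x p R t R' \<rbrakk> \<Longrightarrow> exec x (IFNZ i p q) R (1 + t) R'"
| if_false: "\<lbrakk> R i = 0; exec x q R t R' \<rbrakk> \<Longrightarrow> exec x (IFNZ i p q) R (1 + t) R'"
| while_false: "R i = 0 \<Longrightarrow> exec x (WHILENZ i p) R 1 R"
| while_true: "\<lbrakk> R i \<noteq> 0; exec x p R t R'; exec x (WHILENZ i p) R' t' R'' \<rbrakk>
    \<Longrightarrow> exec x (WHILENZ i p) R (1 + t + t') R''"

inductive_cases exec_elims: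
  "exec x (SETC i c) R t R'"
  "exec x (ADD i j l) R t R'"
  "exec x (SUB i j l) R t R'"
  "exec x (READ i j) R t R'"
  "exec x (LOAD i j) R t R'"
  "exec x (STORE i j) R t R'"
  "exec x (SEQ p q) R t R'"
  "exec x (IFNZ i p q) R t R'"
  "exec x (WHILENZ i p) R t R'"

lemma exec_deterministic:
  "exec x p R t R' \<Longrightarrow> exec x p R u S \<Longrightarrow> t = u \<and> R' = S"
proof (induction arbitrary: u S rule: exec.induct)
  case (seq p R t R' q t' R'')
  from seq.prems obtain v v' R1 where "exec x p R v R1" "exec x q R1 v' S" "u = v + v'"
    by (rule exec_elims(7))
  with seq.IH(1)[of v R1] seq.IH(2)[of v' S] show ?case by simp
next
  case (if_true R i p t R' q)
  from if_true.prems if_true.hyps(1) obtain v where "exec x p R v S" "u = 1 + v"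
    by cases simp_all
  with if_true.IH[of v S] show ?case by simp
next
  case (if_false R i q t R' p)
  from if_false.prems if_false.hyps(1) obtain v where "exec x q R v S" "u = 1 + v"
    by cases simp_all
  with if_false.IH[of v S] show ?case by simp
next
  case (while_false R i p)
  from while_false.prems while_false.hyps(1) show ?case by cases simp_all
next
  case (while_true R i p t R' t' R'')
  from while_true.prems while_true.hyps(1) obtain v v' R1
    where "exec x p R v R1" "exec x (WHILENZ i p) R1 v' S" "u = 1 + v + v'"
    by cases simp_all
  with while_true.IH(1)[of v R1] while_true.IH(2)[of v' S] show ?case by simp
qed (erule exec_elims, simp)+

text \<open>All registers are initially \<open>0\<close>; a program accepts if it halts with \<open>R 0 \<noteq> 0\<close>.\<close>

definition decides_in_time ::
    "ram \<Rightarrow> 'i set \<Rightarrow> ('i \<Rightarrow> nat list) \<Rightarrow> ('i \<Rightarrow> bool) \<Rightarrow> ('i \<Rightarrow> nat) \<Rightarrow> bool" where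
  "decides_in_time p I enc Q T \<longleftrightarrow>
     (\<forall>a \<in> I. \<exists>t R. exec (enc a) p (\<lambda>_. 0) t R \<and> t \<le> T a \<and> (R 0 \<noteq> 0 \<longleftrightarrow> Q a))"


section \<open>Problem instances\<close>

text \<open>A simple undirected graph (a symmetric, loop-free, finite \<open>pair_graph\<close>) on \<open>{0..<n}\<close>
  with \<open>k\<close> pairs of vertices.\<close>

definition instances :: "nat \<Rightarrow> (nat pair_pre_digraph \<times> (nat \<times> nat) list) set" where
  "instances k = {(G, ts). pair_graph G \<and> pverts G = {..<card (pverts G)} \<and>
     length ts = k \<and> set ts \<subseteq> pverts G \<times> pverts G}"

text \<open>The input array holds \<open>n\<close>, then \<open>s\<^sub>1, t\<^sub>1, \<dots>, s\<^sub>k, t\<^sub>k\<close>, then the adjacency matrix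
  row by row.\<close>

definition encode :: "nat pair_pre_digraph \<times> (nat \<times> nat) list \<Rightarrow> nat list" where
  "encode = (\<lambda>(G, ts). let n = card (pverts G) in
     n # concat (map (\<lambda>(s, t). [s, t]) ts)
       @ [of_bool ((u, v) \<in> parcs G). u \<leftarrow> [0..<n], v \<leftarrow> [0..<n]])"

end

theory Submission
  imports Defs
begin

text \<open>
  Write \<open>d\<^sub>p\<close> for the distance from \<open>s\<^sub>p\<close>. Each path \<open>p\<close> of a solution splits into at most \<open>C + 1\<close>
  pieces along which \<open>d\<^sub>p\<close> increases by one in every step. As \<open>d\<^sub>q\<close> changes by at most one per
  edge, pieces of two paths \<open>p\<close> and \<open>q\<close> are a north-east and a south-east staircase in the plane
  with coordinates \<open>d\<^sub>p + d\<^sub>q\<close> and \<open>d\<^sub>p - d\<^sub>q\<close>. Both can be cut at two edges such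
  that any two parts either cannot be made to meet by exchanging them for other geodesics,
  or both lie in a common hyperplane \<open>d\<^sub>p \<plusminus> d\<^sub>q = c\<close>. In such a hyperplane, \<open>d\<^sub>q\<close> is monotone as well.
  Cutting all pieces \<open>k\<close> times at these hyperplanes leaves at most \<open>(5 N\<^sup>2)\<^sup>k\<^sup>+\<^sup>1\<close> pieces, where
  \<open>N = k + k C\<close>, and every piece can be given a colour \<open>q\<close> such that \<open>d\<^sub>q\<close> is monotone along the piece
  and pieces of different colours never meet, whichever geodesics replace them.

  An algorithm can therefore guess the end points, colours and directions of all pieces and treat
  the colours separately. Within one colour a pebble moves along each piece, and only a pebble closest
  to the source of the colour may move; as that distance grows by one in every move, no pebble
  enters a vertex that another one has left. So disjoint geodesics exist iff the final
  position is reachable in the graph of all positions of the pebbles. These conditions are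
  first-order formulas with one transitive closure operator, which compile to programs
  made of loops over the vertices.
\<close>

section \<open>Planar geometry: two monotone staircases of opposite slope and the edges at which to
  cut them\<close>

section \<open>Staircases in the plane\<close>

text \<open>Disjointness of two pieces must survive an exchange of geodesics, so it is read off
  bounding boxes in the plane or the sign of \<open>d\<^sub>p \<plusminus> d\<^sub>q - c\<close>. A
  common colour for each pair that may meet is not enough, as the choices must agree along chains of
  such pairs. The colour of a piece is therefore taken from the set of all colours linked to its own
  by hyperplanes that contain it, and the cuts make sure that each of these hyperplanes contains a
  second piece or misses all its geodesics; then pieces that may meet have the same set. A chain of
  distinct colours has fewer than \<open>k\<close> links, hence \<open>k\<close> rounds of cuts. A
  path of excess at most \<open>C\<close> has at most \<open>C\<close> edges along which its own
  distance does not grow, which gives \<open>N\<close> pieces. Each of the \<open>N\<^sup>2\<close>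
  ordered pairs adds four cuts and at most one hyperplane, so \<open>5 N\<^sup>2\<close> pieces
  arise, and a round multiplies their number by at most \<open>1 + 2 N\<^sup>2\<close>. For
  \<open>M\<close> pieces the exponent of \<open>n\<close> is \<open>6 M + 15\<close>:
  \<open>2 M\<close> loops guess end points, \<open>4 M\<close> is the price of the closure over
  positions of \<open>M\<close> pebbles, the rest pays for comparing distances.\<close>

text \<open>A north-east staircase \<open>(U, V)\<close> and a south-east staircase \<open>(A, B)\<close> in the rotated plane.\<close>

locale staircases =
  fixes U V A B :: "nat \<Rightarrow> int" and T S :: nat
  assumes stepP: "t < T \<Longrightarrow> U t \<le> U (Suc t) \<and> V t \<le> V (Suc t) \<and> U (Suc t) + V (Suc t) = U t + V t + 2"
    and stepQ: "s < S \<Longrightarrow> A s \<le> A (Suc s) \<and> B (Suc s) \<le> B s \<and> A (Suc s) - B (Suc s) = A s - B s + 2"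
    and evenP: "t \<le> T \<Longrightarrow> even (U t + V t)"
    and evenQ: "s \<le> S \<Longrightarrow> even (A s + B s)"
begin

lemma monoP: "t \<le> t' \<Longrightarrow> t' \<le> T \<Longrightarrow> U t \<le> U t' \<and> V t \<le> V t' \<and> U t' + V t' = U t + V t + 2 * int (t' - t)"
proof (induction t' rule: dec_induct)
  case (step m)
  then show ?case using stepP[of m] by (auto simp: Suc_diff_le)
qed simp

lemma monoQ: "s \<le> s' \<Longrightarrow> s' \<le> S \<Longrightarrow> A s \<le> A s' \<and> B s' \<le> B s \<and> A s' - B s' = A s - B s + 2 * int (s' - s)"
proof (induction s' rule: dec_induct)
  case (step m)
  then show ?case using stepQ[of m] by (auto simp: Suc_diff_le)
qed simp

definition meets :: "nat \<Rightarrow> nat \<Rightarrow> bool" where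
  "meets t s \<longleftrightarrow> t \<le> T \<and> s \<le> S \<and> U t = A s \<and> V t = B s"

text \<open>The bounding boxes \<open>[U a, U b] x [V a, V b]\<close> and
  \<open>[A a', A b'] x [B b', B a']\<close> of the two parts are disjoint. Boxes are used instead
  of the points themselves because geodesics that replace a part may run anywhere in its box, but do
  not leave it.\<close>

definition apart :: "nat \<Rightarrow> nat \<Rightarrow> nat \<Rightarrow> nat \<Rightarrow> bool" where
  "apart a b a' b' \<longleftrightarrow> U b < A a' \<or> A b' < U a \<or> V b < B b' \<or> B a' < V a"

text \<open>A cut \<open>t\<close> is the edge from \<open>t\<close> to \<open>Suc t\<close>, so
  \<open>X \<inter> {a..<b} = {}\<close> describes a part without cut edges. \<open>R\<close> is the
  way out for pairs of parts whose boxes overlap.\<close>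

definition splits :: "nat set \<Rightarrow> nat set \<Rightarrow> (nat \<Rightarrow> nat \<Rightarrow> nat \<Rightarrow> nat \<Rightarrow> bool) \<Rightarrow> bool" where
  "splits X Y R \<longleftrightarrow> (\<forall>a b a' b'. a \<le> b \<and> b \<le> T \<and> a' \<le> b' \<and> b' \<le> S \<and> X \<inter> {a..<b} = {} \<and> Y \<inter> {a'..<b'} = {} \<longrightarrow>
     apart a b a' b' \<or> R a b a' b')"

lemma interval_cases:
  fixes t1 t2 a b N :: nat
  assumes "(if 0 < t1 then {t1 - 1} else {}) \<union> (if t2 < N then {t2} else {}) \<subseteq> X"
    and "t1 \<le> t2" "a \<le> b" "b \<le> N" "X \<inter> {a..<b} = {}"
  obtains "b < t1" | "t1 \<le> a" "b \<le> t2" | "t2 < a"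
proof -
  have "0 < t1 \<longrightarrow> \<not> (a \<le> t1 - 1 \<and> t1 - 1 < b)" using assms(1,5) by auto
  moreover have "t2 < N \<longrightarrow> \<not> (a \<le> t2 \<and> t2 < b)" using assms(1,5) by auto
  ultimately have "b < t1 \<or> (t1 \<le> a \<and> b \<le> t2) \<or> t2 < a" using assms(2-4) by presburger
  then show thesis using that by blast
qed

text \<open>Between the first and the last meeting \<open>V\<close> can only grow and
  \<open>B\<close> can only shrink, while they agree at both ends, so both stay constant. The cuts
  are the edges by which the two staircases enter and leave this common segment. Against the segment
  of the other staircase, a part before or after it is apart because a cut edge strictly changes a
  coordinate. In the four remaining combinations overlapping boxes would produce a meeting that
  contradicts the choice of \<open>t1\<close> and \<open>t2\<close>.\<close>

lemma split_meeting_diag: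
  assumes m1: "meets t1 s1" and m2: "meets t2 s2" and le: "t1 \<le> t2" "s1 \<le> s2"
    and min: "\<And>t s. meets t s \<Longrightarrow> t1 \<le> t" and max: "\<And>t s. meets t s \<Longrightarrow> t \<le> t2"
  shows "splits ((if 0 < t1 then {t1 - 1} else {}) \<union> (if t2 < T then {t2} else {}))
      ((if 0 < s1 then {s1 - 1} else {}) \<union> (if s2 < S then {s2} else {}))
      (\<lambda>a b a' b'. (\<forall>t\<in>{a..b}. V t = V t1) \<and> (\<forall>s\<in>{a'..b'}. B s = V t1))"
  unfolding splits_def
proof (intro allI impI, elim conjE)
  fix a b a' b'
  assume I: "a \<le> b" "b \<le> T" "a' \<le> b'" "b' \<le> S"
    and X: "((if 0 < t1 then {t1 - 1} else {}) \<union> (if t2 < T then {t2} else {})) \<inter> {a..<b} = {}"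
    and Y: "((if 0 < s1 then {s1 - 1} else {}) \<union> (if s2 < S then {s2} else {})) \<inter> {a'..<b'} = {}"
  note e = m1[unfolded meets_def] m2[unfolded meets_def]
  have "V t1 = V t2" "B s1 = V t1" "B s2 = V t1"
    using e le monoP[of t1 t2] monoQ[of s1 s2] by linarith+
  then obtain k where c: "V t1 = k" "V t2 = k" "B s1 = k" "B s2 = k" "U t1 = A s1" "U t2 = A s2"
    using e by metis
  have P1: "U (t1 - 1) \<le> U t1 \<and> V (t1 - 1) \<le> V t1 \<and> U t1 + V t1 = U (t1 - 1) + V (t1 - 1) + 2" if "0 < t1"
  proof -
    have "t1 - 1 < T" "Suc (t1 - 1) = t1" using e that by linarith+
    then show ?thesis using stepP[of "t1 - 1"] by simp
  qed
  have Q1: "A (s1 - 1) \<le> A s1 \<and> B s1 \<le> B (s1 - 1) \<and> A s1 - B s1 = A (s1 - 1) - B (s1 - 1) + 2" if "0 < s1"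
  proof -
    have "s1 - 1 < S" "Suc (s1 - 1) = s1" using e that by linarith+
    then show ?thesis using stepQ[of "s1 - 1"] by simp
  qed
  have uniq: "s1 = s2" if "t1 = t2" using that le monoQ[of s1 s2] e by simp
  note st = stepP[of t2] stepQ[of s2]
  have U12: "U t1 \<le> U t2" using monoP[of t1 t2] le e by simp
  show "apart a b a' b' \<or> (\<forall>t\<in>{a..b}. V t = V t1) \<and> (\<forall>s\<in>{a'..b'}. B s = V t1)"
  proof (cases rule: interval_cases[OF order_refl le(1) I(1,2) X])
    case 1
    then have t: "0 < t1" "b \<le> t1 - 1" by auto
    have b: "U b \<le> U (t1 - 1)" "V b \<le> V (t1 - 1)" using monoP[of b "t1 - 1"] t e by auto
    show ?thesis
    proof (cases rule: interval_cases[OF order_refl le(2) I(3,4) Y])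
      case 1
      then have s: "0 < s1" "b' \<le> s1 - 1" by auto
      have b': "B (s1 - 1) \<le> B b'" using monoQ[of b' "s1 - 1"] s e by auto
      have "\<not> meets (t1 - 1) (s1 - 1)" using min[of "t1 - 1" "s1 - 1"] t by auto
      \<comment> \<open>Equality would force both cut edges to change the first coordinate only, by
        2 each, and then their initial vertices would meet as well.\<close>
      then have "V (t1 - 1) < B (s1 - 1)"
        using P1[OF t(1)] Q1[OF s(1)] c e by (auto simp: meets_def)
      then show ?thesis using b b' by (auto simp: apart_def)
    next
      case 2
      have "A s1 \<le> A a'" "B s2 \<le> B b'" using monoQ[of s1 a'] monoQ[of b' s2] 2 I e by auto
      then show ?thesis using b P1[OF t(1)] c by (auto simp: apart_def)
    next
      case 3
      then have s: "s2 < S" "Suc s2 \<le> a'" using I by auto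
      have a': "A (Suc s2) \<le> A a'" using monoQ[of "Suc s2" a'] s I by auto
      \<comment> \<open>Otherwise the first coordinate is constant along the segment and along both
        cut edges. Then the segment is a single point, and one step back on the first staircase
        meets one step ahead on the second.\<close>
      have "U (t1 - 1) < A (Suc s2)"
      proof (rule ccontr)
        assume "\<not> U (t1 - 1) < A (Suc s2)"
        then have eq: "U (t1 - 1) = U t1" "U t1 = U t2" "A (Suc s2) = A s2"
          using P1[OF t(1)] U12 st(2) s c by auto
        then have "t1 = t2" using c e le monoP[of t1 t2] by simp
        moreover have "meets (t1 - 1) (Suc s2)"
          using eq P1[OF t(1)] st(2) s c e uniq[OF \<open>t1 = t2\<close>] by (auto simp: meets_def)
        ultimately show False using min t by fastforce
      qed
      then show ?thesis using b a' by (auto simp: apart_def)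
    qed
  next
    case 2
    have t: "U t1 \<le> U a" "U b \<le> U t2" "V t1 \<le> V a" "V a \<le> V b" "V b \<le> V t2"
      using monoP[of t1 a] monoP[of b t2] monoP[of a b] 2 I e by auto
    show ?thesis
    proof (cases rule: interval_cases[OF order_refl le(2) I(3,4) Y])
      case 1
      then have s: "0 < s1" "b' \<le> s1 - 1" by auto
      have b': "B (s1 - 1) \<le> B b'" "A b' \<le> A (s1 - 1)" using monoQ[of b' "s1 - 1"] s e by auto
      then show ?thesis using Q1[OF s(1)] t c by (auto simp: apart_def)
    next
      case case2: 2
      have "V t = V t1" if "t \<in> {a..b}" for t
        using monoP[of t1 t] monoP[of t t2] that 2 e c I by auto
      moreover have "B s = V t1" if "s \<in> {a'..b'}" for s
        using monoQ[of s1 s] monoQ[of s s2] that case2 e c I by auto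
      ultimately show ?thesis by blast
    next
      case 3
      then have s: "s2 < S" "Suc s2 \<le> a'" using I by auto
      have a': "A (Suc s2) \<le> A a'" "B a' \<le> B (Suc s2)" using monoQ[of "Suc s2" a'] s I by auto
      then show ?thesis using st(2)[OF s(1)] t c by (auto simp: apart_def)
    qed
  next
    case 3
    then have t: "t2 < T" "Suc t2 \<le> a" using I by auto
    have a: "U (Suc t2) \<le> U a" "V (Suc t2) \<le> V a" using monoP[of "Suc t2" a] t I by auto
    show ?thesis
    proof (cases rule: interval_cases[OF order_refl le(2) I(3,4) Y])
      case 1
      then have s: "0 < s1" "b' \<le> s1 - 1" by auto
      have b': "A b' \<le> A (s1 - 1)" using monoQ[of b' "s1 - 1"] s e by auto
      have "A (s1 - 1) < U (Suc t2)"
      proof (rule ccontr)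
        assume "\<not> A (s1 - 1) < U (Suc t2)"
        then have eq: "U (Suc t2) = U t2" "U t1 = U t2" "A (s1 - 1) = A s1"
          using Q1[OF s(1)] U12 st(1) t c by auto
        then have "t1 = t2" using c e le monoP[of t1 t2] by simp
        moreover have "meets (Suc t2) (s1 - 1)"
          using eq Q1[OF s(1)] st(1) t c e uniq[OF \<open>t1 = t2\<close>] by (auto simp: meets_def)
        ultimately show False using max t by fastforce
      qed
      then show ?thesis using a b' by (auto simp: apart_def)
    next
      case 2
      have "A b' \<le> A s2" "B a' \<le> B s1" using monoQ[of s1 a'] monoQ[of b' s2] 2 I e by auto
      then show ?thesis using a st(1) t c by (auto simp: apart_def)
    next
      case 3
      then have s: "s2 < S" "Suc s2 \<le> a'" using I by auto
      have a': "B a' \<le> B (Suc s2)" using monoQ[of "Suc s2" a'] s I by auto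
      have "\<not> meets (Suc t2) (Suc s2)" using max[of "Suc t2" "Suc s2"] by auto
      then have "B (Suc s2) < V (Suc t2)"
        using st t s c e by (auto simp: meets_def)
      then show ?thesis using a a' by (auto simp: apart_def)
    qed
  qed
qed

text \<open>Swapping the coordinates keeps the first staircase north-east, and walking the second
  one backwards makes it south-east again. This reduces meetings that run backwards along the second
  staircase to those that run forwards.\<close>

lemma reversed: "staircases V U (\<lambda>s. B (S - s)) (\<lambda>s. A (S - s)) T S"
proof
  fix s assume "s < S"
  then have "Suc (S - Suc s) = S - s" "S - Suc s < S" by auto
  then show "B (S - s) \<le> B (S - Suc s) \<and> A (S - Suc s) \<le> A (S - s) \<and>
      B (S - Suc s) - A (S - Suc s) = B (S - s) - A (S - s) + 2"
    using stepQ[of "S - Suc s"] by simp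
qed (use stepP evenP evenQ in \<open>auto simp: add.commute\<close>)

lemma splits_reversed:
  assumes "staircases.splits V U (\<lambda>s. B (S - s)) (\<lambda>s. A (S - s)) T S X Y R" "Y \<subseteq> {..<S}"
  shows "splits X ((\<lambda>s. S - Suc s) ` Y) (\<lambda>a b a' b'. R a b (S - b') (S - a'))"
  unfolding splits_def
proof (intro allI impI, elim conjE)
  interpret rev: staircases V U "\<lambda>s. B (S - s)" "\<lambda>s. A (S - s)" T S by (rule reversed)
  fix a b a' b'
  assume *: "a \<le> b" "b \<le> T" "a' \<le> b'" "b' \<le> S" "X \<inter> {a..<b} = {}" "(\<lambda>s. S - Suc s) ` Y \<inter> {a'..<b'} = {}"
  have "Y \<inter> {S - b'..<S - a'} = {}"
  proof (rule ccontr)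
    assume "Y \<inter> {S - b'..<S - a'} \<noteq> {}"
    then obtain s where "s \<in> Y" "S - b' \<le> s" "s < S - a'" by auto
    then have "S - Suc s \<in> {a'..<b'}" by auto
    with \<open>s \<in> Y\<close> show False using *(6) by blast
  qed
  then have "rev.apart a b (S - b') (S - a') \<or> R a b (S - b') (S - a')"
    using assms(1) * unfolding rev.splits_def by auto
  then show "apart a b a' b' \<or> R a b (S - b') (S - a')"
    using * by (auto simp: rev.apart_def apart_def)
qed

text \<open>If the second staircase had a point weakly to the upper right of
  \<open>(U t, V t)\<close> and one weakly to the lower left, it would be constant in one coordinate
  between them, equal to that of \<open>(U t, V t)\<close>. The other coordinate then moves in steps
  of 2 past the right value, and parity makes it hit this value exactly, which is a meeting.\<close>

lemma above_or_below:
  assumes no: "\<And>s. \<not> meets t s" and t: "t \<le> T"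
  shows "(\<forall>s\<le>S. A s < U t \<or> B s < V t) \<or> (\<forall>s\<le>S. U t < A s \<or> V t < B s)"
proof (rule ccontr)
  assume "\<not> ?thesis"
  then obtain s s' where s: "s \<le> S" "U t \<le> A s" "V t \<le> B s" and s': "s' \<le> S" "A s' \<le> U t" "B s' \<le> V t"
    by force
  show False
  proof (cases "s \<le> s'")
    case True
    then have eq: "A s = U t" "A s' = U t" using monoQ[of s s'] s s' by auto
    have "even (B s - V t)" using evenP[OF t] evenQ[OF s(1)] eq by presburger
    then obtain k where k: "B s - V t = 2 * k" by (rule evenE)
    \<comment> \<open>With \<open>A\<close> constant every step lowers \<open>B\<close> by exactly
      2, so the difference \<open>2 * k\<close> is used up after \<open>k\<close> steps.\<close>
    define r where "r = s + nat k"
    have k0: "0 \<le> k" using k s by auto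
    moreover have "k \<le> int (s' - s)" using monoQ[OF True s'(1)] eq s' k by auto
    ultimately have r: "s \<le> r" "r \<le> s'" using True by (auto simp: r_def)
    then have "A r = U t" using monoQ[of s r] monoQ[of r s'] s' eq by auto
    moreover have "B r = V t" using monoQ[of s r] r s' eq calculation k k0 by (auto simp: r_def)
    ultimately show False using no[of r] r s' t by (auto simp: meets_def)
  next
    case False
    then have le: "s' \<le> s" by simp
    then have eq: "B s = V t" "B s' = V t" using monoQ[of s' s] s s' by auto
    have "even (U t - A s')" using evenP[OF t] evenQ[OF s'(1)] eq by presburger
    then obtain k where k: "U t - A s' = 2 * k" by (rule evenE)
    define r where "r = s' + nat k"
    have k0: "0 \<le> k" using k s' by auto
    moreover have "k \<le> int (s - s')" using monoQ[OF le s(1)] eq s k by auto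
    ultimately have r: "s' \<le> r" "r \<le> s" using le by (auto simp: r_def)
    then have "B r = V t" using monoQ[of s' r] monoQ[of r s] s eq by auto
    moreover have "A r = U t" using monoQ[of s' r] r s eq calculation k k0 by (auto simp: r_def)
    ultimately show False using no[of r] r s t by (auto simp: meets_def)
  qed
qed

lemma threshold:
  obtains s0 where "s0 \<le> Suc N" "\<And>s. s < s0 \<Longrightarrow> s \<le> N \<and> \<not> P s" "s0 \<le> N \<Longrightarrow> P s0"
proof -
  define s0 where "s0 = (LEAST s. s = Suc N \<or> P s)"
  have 1: "s0 = Suc N \<or> P s0" unfolding s0_def by (rule LeastI[of _ "Suc N"]) simp
  have 2: "s0 \<le> Suc N" unfolding s0_def by (rule Least_le) simp
  have 3: "\<not> (s = Suc N \<or> P s)" if "s < s0" for s using not_less_Least that unfolding s0_def by blast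
  show thesis
  proof (rule that[OF 2])
    show "\<And>s. s < s0 \<Longrightarrow> s \<le> N \<and> \<not> P s" using 2 3 by fastforce
    show "s0 \<le> N \<Longrightarrow> P s0" using 1 by auto
  qed
qed

text \<open>Once the first staircase is above the second it stays above, so it crosses at most once,
  along the edge into its first vertex \<open>t\<close> that is above. The second staircase is cut
  where it passes through the gap that this edge leaves: before the cut it is left of
  \<open>U t\<close> and above \<open>V (t - 1)\<close>, after the cut it is right of
  \<open>U (t - 1)\<close> and below \<open>V t\<close>. Each of these four facts makes one of the
  four pairs of parts apart.\<close>

lemma no_meeting_split:
  assumes no: "\<And>t s. \<not> meets t s"
  shows "\<exists>X Y. X \<subseteq> {..<T} \<and> Y \<subseteq> {..<S} \<and> card X \<le> 1 \<and> card Y \<le> 1 \<and> splits X Y (\<lambda>_ _ _ _. False)"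
proof -
  define above where "above = (\<lambda>t. \<forall>s\<le>S. A s < U t \<or> B s < V t)"
  obtain t where t: "t \<le> Suc T" "\<And>t'. t' < t \<Longrightarrow> t' \<le> T \<and> \<not> above t'" "t \<le> T \<Longrightarrow> above t"
    using threshold[of T above] by blast
  have below: "\<forall>s\<le>S. U (t - 1) < A s \<or> V (t - 1) < B s" if "0 < t"
    using above_or_below[OF no, of "t - 1"] t(2)[of "t - 1"] that by (auto simp: above_def)
  \<comment> \<open>The facts that involve \<open>t\<close> allow cuts \<open>s\<close> with
    \<open>s1 \<le> s \<le> s0\<close>, those that involve \<open>t - 1\<close> allow
    \<open>r1 \<le> s \<le> r0\<close>. The inequalities below show that these ranges are nonempty
    and overlap.\<close>
  obtain s0 where s0: "s0 \<le> Suc S" "\<And>s. s < s0 \<Longrightarrow> s \<le> S \<and> \<not> \<not> A s < U t" "s0 \<le> S \<Longrightarrow> \<not> A s0 < U t"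
    using threshold[of S "\<lambda>s. \<not> A s < U t"] by blast
  obtain s1 where s1: "s1 \<le> Suc S" "\<And>s. s < s1 \<Longrightarrow> s \<le> S \<and> \<not> B s < V t" "s1 \<le> S \<Longrightarrow> B s1 < V t"
    using threshold[of S "\<lambda>s. B s < V t"] by blast
  obtain r0 where r0: "r0 \<le> Suc S" "\<And>s. s < r0 \<Longrightarrow> s \<le> S \<and> \<not> \<not> V (t - 1) < B s" "r0 \<le> S \<Longrightarrow> \<not> V (t - 1) < B r0"
    using threshold[of S "\<lambda>s. \<not> V (t - 1) < B s"] by blast
  obtain r1 where r1: "r1 \<le> Suc S" "\<And>s. s < r1 \<Longrightarrow> s \<le> S \<and> \<not> U (t - 1) < A s" "r1 \<le> S \<Longrightarrow> U (t - 1) < A r1"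
    using threshold[of S "\<lambda>s. U (t - 1) < A s"] by blast
  have s10: "s1 \<le> s0" if "t \<le> T"
  proof (rule ccontr)
    assume "\<not> s1 \<le> s0"
    then have "s0 < s1" by simp
    moreover from this have "s0 \<le> S" using s1(1) by simp
    ultimately show False using s0(3) s1(2)[of s0] t(3)[OF that] by (auto simp: above_def)
  qed
  have r10: "r1 \<le> r0" if "0 < t"
  proof (rule ccontr)
    assume "\<not> r1 \<le> r0"
    then have "r0 < r1" by simp
    moreover from this have "r0 \<le> S" using r1(1) by simp
    ultimately show False using r0(3) r1(2)[of r0] below[OF that] by auto
  qed
  have par: "even (U t' + V t')" "even (A s + B s)" if "t' \<le> T" "s \<le> S" for t' s
    using evenP evenQ that by auto
  \<comment> \<open>A violation would place a point of the second staircase at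
    \<open>(U t, V t - 1)\<close>, which has the wrong parity.\<close>
  have r1s0: "r1 \<le> s0" if "0 < t" "t \<le> T"
  proof (rule ccontr)
    assume "\<not> r1 \<le> s0"
    then have lt: "s0 < r1" by simp
    then have S: "s0 \<le> S" using r1(1) by simp
    have st: "U (t - 1) \<le> U t \<and> V (t - 1) \<le> V t \<and> U t + V t = U (t - 1) + V (t - 1) + 2"
      using stepP[of "t - 1"] that by simp
    have "U t = U (t - 1)" "A s0 = U t" using s0(3)[OF S] r1(2)[OF lt] st by auto
    moreover have "V (t - 1) < B s0" using r0(2)[of s0] lt r10[OF that(1)] by auto
    moreover have "B s0 < V t" using t(3)[OF that(2)] s0(3)[OF S] S by (auto simp: above_def)
    ultimately have "B s0 = V t - 1" "A s0 = U t" using st by auto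
    then show False using par[OF that(2) S] by presburger
  qed
  have s1r0: "s1 \<le> r0" if "0 < t" "t \<le> T"
  proof (rule ccontr)
    assume "\<not> s1 \<le> r0"
    then have lt: "r0 < s1" by simp
    then have S: "r0 \<le> S" using s1(1) by simp
    have st: "U (t - 1) \<le> U t \<and> V (t - 1) \<le> V t \<and> U t + V t = U (t - 1) + V (t - 1) + 2"
      using stepP[of "t - 1"] that by simp
    have "V t = V (t - 1)" "B r0 = V t" using r0(3)[OF S] s1(2)[OF lt] st by auto
    moreover have "A r0 < U t" using s0(2)[of r0] lt s10[OF that(2)] by auto
    moreover have "U (t - 1) < A r0" using below[OF that(1)] r0(3)[OF S] S by auto
    ultimately have "A r0 = U t - 1" "B r0 = V t" using st by auto
    then show False using par[OF that(2) S] by presburger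
  qed
  \<comment> \<open>For \<open>t = 0\<close> the first staircase is above from the beginning, for
    \<open>t = Suc T\<close> it never is; in both cases only one of the ranges has to be
    respected.\<close>
  obtain s where s: "s \<le> Suc S" "t \<le> T \<Longrightarrow> s1 \<le> s \<and> s \<le> s0" "0 < t \<Longrightarrow> r1 \<le> s \<and> s \<le> r0"
  proof (cases "0 < t \<and> t \<le> T")
    case True
    show thesis
      by (rule that[of "max s1 r1"]) (use True s10 r10 r1s0 s1r0 s1 r1 in auto)
  next
    case False
    show thesis
    proof (cases "t \<le> T")
      case True
      show thesis by (rule that[of s0]) (use True False s0 s10 in auto)
    next
      case False
      show thesis by (rule that[of r0]) (use False r0 r10 in auto)
    qed
  qed
  have q1: "V (t - 1) < B (s - 1)" if "0 < t" "0 < s" using s(3)[OF that(1)] r0(2)[of "s - 1"] that by auto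
  have q2: "U (t - 1) < A s" if "0 < t" "s \<le> S"
    using s(3)[OF that(1)] r1(3) monoQ[of r1 s] that by auto
  have q3: "A (s - 1) < U t" if "t \<le> T" "0 < s" using s(2)[OF that(1)] s0(2)[of "s - 1"] that by auto
  have q4: "B s < V t" if "t \<le> T" "s \<le> S" using s(2)[OF that(1)] s1(3) monoQ[of s1 s] that by auto
  define X where "X = (if 0 < t \<and> t \<le> T then {t - 1} else {})"
  define Y where "Y = (if 0 < s \<and> s \<le> S then {s - 1} else {})"
  have "splits X Y (\<lambda>_ _ _ _. False)"
    unfolding splits_def
  proof (intro allI impI disjI1, elim conjE)
    fix a b a' b'
    assume *: "a \<le> b" "b \<le> T" "a' \<le> b'" "b' \<le> S" "X \<inter> {a..<b} = {}" "Y \<inter> {a'..<b'} = {}"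
    have "b < t \<or> t \<le> a" using * t(1) by (cases "0 < t \<and> t \<le> T") (auto simp: X_def)
    moreover have "b' < s \<or> s \<le> a'" using * s(1) by (cases "0 < s \<and> s \<le> S") (auto simp: Y_def)
    moreover have "b < t \<Longrightarrow> b \<le> t - 1 \<and> t - 1 \<le> T \<and> 0 < t" "b' < s \<Longrightarrow> b' \<le> s - 1 \<and> s - 1 \<le> S \<and> 0 < s"
      using t(1) s(1) by linarith+
    note lt = this
    ultimately consider "b < t" "b' < s" | "b < t" "s \<le> a'" | "t \<le> a" "b' < s" | "t \<le> a" "s \<le> a'" by blast
    then show "apart a b a' b'"
    proof cases
      case 1
      then show ?thesis using q1 monoP[of b "t - 1"] monoQ[of b' "s - 1"] lt by (auto simp: apart_def)
    next
      case 2
      then show ?thesis using q2 monoP[of b "t - 1"] monoQ[of s a'] lt * by (auto simp: apart_def)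
    next
      case 3
      then show ?thesis using q3 monoP[of t a] monoQ[of b' "s - 1"] lt * by (auto simp: apart_def)
    next
      case 4
      then show ?thesis using q4 monoP[of t a] monoQ[of s a'] * by (auto simp: apart_def)
    qed
  qed
  then show ?thesis
    by (intro exI[of _ X] exI[of _ Y]) (auto simp: X_def Y_def)
qed

lemma meeting_cuts:
  "(if 0 < t1 then {t1 - 1} else {}) \<union> (if t2 < N then {t2} else {}) \<subseteq> {..<N} \<and>
   card ((if 0 < t1 then {t1 - 1} else {}) \<union> (if t2 < N then {t2} else {})) \<le> 2"
  if "t1 \<le> t2" "t2 \<le> N" for t1 t2 N :: nat
  using that by (auto simp: card_insert_if)

text \<open>The meetings at the two extremes of the first staircase agree in the second coordinate
  if they come in the same order on the second staircase, and in the first coordinate otherwise;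
  \<open>\<sigma>\<close> records which. Without any meeting all parts are apart, and
  \<open>\<sigma>\<close> and \<open>c\<close> are arbitrary.\<close>

theorem split_exists:
  "\<exists>X Y \<sigma> c. X \<subseteq> {..<T} \<and> Y \<subseteq> {..<S} \<and> card X \<le> 2 \<and> card Y \<le> 2 \<and>
    splits X Y (\<lambda>a b a' b'. (\<forall>t\<in>{a..b}. (if \<sigma> then U else V) t = c) \<and> (\<forall>s\<in>{a'..b'}. (if \<sigma> then A else B) s = c))"
proof (cases "\<exists>t s. meets t s")
  case False
  then obtain X Y where XY: "X \<subseteq> {..<T}" "Y \<subseteq> {..<S}" "card X \<le> 1" "card Y \<le> 1" "splits X Y (\<lambda>_ _ _ _. False)"
    using no_meeting_split by blast
  then show ?thesis by (intro exI[of _ X] exI[of _ Y] exI[of _ True] exI[of _ 0]) (auto simp: splits_def)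
next
  case True
  define M where "M = {t. \<exists>s. meets t s}"
  have fin: "finite M" "M \<noteq> {}"
    using True finite_subset[of M "{..T}"] by (auto simp: M_def meets_def)
  obtain s1 where m1: "meets (Min M) s1" using Min_in[OF fin] by (auto simp: M_def)
  obtain s2 where m2: "meets (Max M) s2" using Max_in[OF fin] by (auto simp: M_def)
  have le: "Min M \<le> Max M" using fin by (meson Max_ge Min_in)
  have min: "\<And>t s. meets t s \<Longrightarrow> Min M \<le> t" and max: "\<And>t s. meets t s \<Longrightarrow> t \<le> Max M"
    using Min_le[OF fin(1)] Max_ge[OF fin(1)] by (auto simp: M_def)
  let ?X = "(if 0 < Min M then {Min M - 1} else {}) \<union> (if Max M < T then {Max M} else {})"
  have X: "?X \<subseteq> {..<T} \<and> card ?X \<le> 2" by (rule meeting_cuts) (use le m2 in \<open>auto simp: meets_def\<close>)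
  show ?thesis
  proof (cases "s1 \<le> s2")
    case True
    let ?Y = "(if 0 < s1 then {s1 - 1} else {}) \<union> (if s2 < S then {s2} else {})"
    have "?Y \<subseteq> {..<S} \<and> card ?Y \<le> 2" by (rule meeting_cuts) (use True m2 in \<open>auto simp: meets_def\<close>)
    then show ?thesis
      using X split_meeting_diag[OF m1 m2 le True min max]
      by (intro exI[of _ ?X] exI[of _ ?Y] exI[of _ False] exI[of _ "V (Min M)"]) simp
  next
    case False
    interpret rev: staircases V U "\<lambda>s. B (S - s)" "\<lambda>s. A (S - s)" T S by (rule reversed)
    have rm: "rev.meets t s \<longleftrightarrow> s \<le> S \<and> meets t (S - s)" for t s
      by (auto simp: rev.meets_def meets_def)
    have rm12: "rev.meets (Min M) (S - s1)" "rev.meets (Max M) (S - s2)"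
      using m1 m2 by (auto simp: rm meets_def)
    let ?Y = "(if 0 < S - s1 then {S - s1 - 1} else {}) \<union> (if S - s2 < S then {S - s2} else {})"
    have Y: "?Y \<subseteq> {..<S} \<and> card ?Y \<le> 2" by (rule meeting_cuts) (use False in auto)
    have "rev.splits ?X ?Y (\<lambda>a b a' b'. (\<forall>t\<in>{a..b}. U t = U (Min M)) \<and> (\<forall>s\<in>{a'..b'}. A (S - s) = U (Min M)))"
      by (rule rev.split_meeting_diag[OF rm12 le]) (use False rm min max in auto)
    from splits_reversed[OF this] Y
    have *: "splits ?X ((\<lambda>s. S - Suc s) ` ?Y)
        (\<lambda>a b a' b'. (\<forall>t\<in>{a..b}. U t = U (Min M)) \<and> (\<forall>s\<in>{S - b'..S - a'}. A (S - s) = U (Min M)))" by blast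
    have "splits ?X ((\<lambda>s. S - Suc s) ` ?Y)
        (\<lambda>a b a' b'. (\<forall>t\<in>{a..b}. U t = U (Min M)) \<and> (\<forall>s\<in>{a'..b'}. A s = U (Min M)))"
      unfolding splits_def
    proof (intro allI impI)
      fix a b a' b'
      assume I: "a \<le> b \<and> b \<le> T \<and> a' \<le> b' \<and> b' \<le> S \<and> ?X \<inter> {a..<b} = {} \<and> (\<lambda>s. S - Suc s) ` ?Y \<inter> {a'..<b'} = {}"
      have "A s = U (Min M)" if "\<forall>s\<in>{S - b'..S - a'}. A (S - s) = U (Min M)" "s \<in> {a'..b'}" for s
        using bspec[OF that(1), of "S - s"] that(2) I diff_le_mono2[of s b' S] diff_le_mono2[of a' s S] by simp
      then show "apart a b a' b' \<or> (\<forall>t\<in>{a..b}. U t = U (Min M)) \<and> (\<forall>s\<in>{a'..b'}. A s = U (Min M))"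
        using *[unfolded splits_def, rule_format, OF I] by blast
    qed
    moreover have "(\<lambda>s. S - Suc s) ` ?Y \<subseteq> {..<S}" "card ((\<lambda>s. S - Suc s) ` ?Y) \<le> 2"
      using Y card_image_le[of ?Y "\<lambda>s. S - Suc s"] by auto
    ultimately show ?thesis
      using X by (intro exI[of _ ?X] exI[of _ "(\<lambda>s. S - Suc s) ` ?Y"] exI[of _ True] exI[of _ "U (Min M)"]) simp
  qed
qed

end

section \<open>Walks, distances from a source, and the vertices between two ends\<close>

section \<open>Distances and geodesics\<close>

text \<open>A walk of least length repeats no vertex, as the part between two occurrences could be
  cut out; hence it has fewer edges than there are vertices.\<close>

lemma relpowp_short:
  assumes "E\<^sup>*\<^sup>* s v" "finite V" "s \<in> V" "\<And>x y. E x y \<Longrightarrow> y \<in> V"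
  obtains m f where "m < card V" "f 0 = s" "f m = v" "\<And>i. i < m \<Longrightarrow> E (f i) (f (Suc i))"
    "inj_on f {..m}" "\<And>m'. (E ^^ m') s v \<Longrightarrow> m \<le> m'"
proof -
  define m where "m = (LEAST m. (E ^^ m) s v)"
  have ex: "\<exists>m. (E ^^ m) s v" using assms(1) by (simp add: rtranclp_power)
  then have m: "(E ^^ m) s v" unfolding m_def by (rule LeastI_ex)
  have least: "m \<le> m'" if "(E ^^ m') s v" for m' unfolding m_def using that by (rule Least_le)
  obtain f where f: "f 0 = s" "f m = v" "\<And>i. i < m \<Longrightarrow> E (f i) (f (Suc i))"
    using m by (auto simp: relpowp_fun_conv)
  have inj: "f i \<noteq> f j" if "i < j" "j \<le> m" for i j
  proof
    assume eq: "f i = f j"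
    have "(E ^^ i) s (f i)"
      unfolding relpowp_fun_conv using f that by (intro exI[of _ f]) auto
    moreover have "(E ^^ (m - j)) (f j) v"
      unfolding relpowp_fun_conv using f that by (intro exI[of _ "\<lambda>t. f (j + t)"]) auto
    ultimately have "(E ^^ (i + (m - j))) s v" using eq by (auto simp: relpowp_add)
    from least[OF this] that show False by simp
  qed
  have inj: "inj_on f {..m}"
    by (rule inj_onI) (metis inj atMost_iff linorder_neqE_nat)
  have "f i \<in> V" if "i \<le> m" for i
    using that f assms(3,4) by (cases i) (auto simp: Suc_le_eq)
  then have "f ` {..m} \<subseteq> V" by auto
  from card_mono[OF assms(2) this] have "m < card V" using inj by (simp add: card_image)
  with f inj least show thesis using that by blast
qed

locale ugraph =
  fixes E :: "'a \<Rightarrow> 'a \<Rightarrow> bool"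
  assumes E_sym: "E u v \<Longrightarrow> E v u"
begin

definition dist :: "'a \<Rightarrow> 'a \<Rightarrow> nat" where
  "dist s v = (LEAST m. (E ^^ m) s v)"

text \<open>Without the reachability assumption, \<open>dist\<close> would be an arbitrary number.\<close>

definition up :: "'a \<Rightarrow> 'a \<Rightarrow> 'a \<Rightarrow> bool" where
  "up s u v \<longleftrightarrow> E u v \<and> E\<^sup>*\<^sup>* s u \<and> dist s v = Suc (dist s u)"

text \<open>When \<open>m\<close> is the distance of \<open>x\<close> and \<open>y\<close>, this is
  the union of all geodesics from \<open>x\<close> to \<open>y\<close>. Fixing the length of the
  walks avoids \<open>dist\<close>, which is meaningless for unreachable vertices.\<close>

definition between :: "nat \<Rightarrow> 'a \<Rightarrow> 'a \<Rightarrow> 'a set" where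
  "between m x y = {v. \<exists>m1 m2. m1 + m2 = m \<and> (E ^^ m1) x v \<and> (E ^^ m2) v y}"

lemma relpowp_sym: "(E ^^ m) u v \<Longrightarrow> (E ^^ m) v u"
proof (induction m arbitrary: v)
  case (Suc m)
  then obtain w where "(E ^^ m) u w" "E w v" by auto
  then have "E v w" "(E ^^ m) w u" using Suc.IH E_sym by auto
  then show ?case by (rule relpowp_Suc_I2)
qed simp

lemma relpowp_reach: "(E ^^ m) u v \<Longrightarrow> E\<^sup>*\<^sup>* u v"
  by (auto simp: rtranclp_power)

lemma reach_sym: "E\<^sup>*\<^sup>* u v \<Longrightarrow> E\<^sup>*\<^sup>* v u"
  by (metis rtranclp_power relpowp_sym)

lemma dist_walk: "E\<^sup>*\<^sup>* s v \<Longrightarrow> (E ^^ dist s v) s v"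
  unfolding dist_def by (rule LeastI_ex) (simp add: rtranclp_power)

lemma dist_le: "(E ^^ m) s v \<Longrightarrow> dist s v \<le> m"
  unfolding dist_def by (rule Least_le)

lemma dist_self [simp]: "dist s s = 0"
  using dist_le[of 0 s s] by simp

lemma dist_step:
  assumes "E\<^sup>*\<^sup>* s u" "(E ^^ m) u v"
  shows "E\<^sup>*\<^sup>* s v" "dist s v \<le> dist s u + m" "dist s u \<le> dist s v + m"
proof -
  show v: "E\<^sup>*\<^sup>* s v" using assms relpowp_reach by (meson rtranclp_trans)
  show "dist s v \<le> dist s u + m"
    using dist_walk[OF assms(1)] assms(2) by (intro dist_le) (auto simp: relpowp_add)
  show "dist s u \<le> dist s v + m"
    using dist_walk[OF v] relpowp_sym[OF assms(2)] by (intro dist_le) (auto simp: relpowp_add)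
qed

lemma dist_edge:
  assumes "E\<^sup>*\<^sup>* s u" "E u v"
  shows "E\<^sup>*\<^sup>* s v" "dist s v \<le> dist s u + 1" "dist s u \<le> dist s v + 1"
  using dist_step[of s u 1 v] assms by auto

text \<open>The distance from \<open>s\<close> changes by at most one per edge, so a total gain
  equal to the number of edges forces a gain of one along each edge.\<close>

lemma dist_between:
  assumes "E\<^sup>*\<^sup>* s x" "(E ^^ m1) x v" "(E ^^ m2) v y" "dist s y = dist s x + (m1 + m2)"
  shows "dist s v = dist s x + m1"
  using dist_step[OF assms(1,2)] dist_step[OF dist_step(1)[OF assms(1,2)] assms(3)] assms(4) by simp

lemma up_relpowp:
  "(up s ^^ m) u v \<Longrightarrow> (E ^^ m) u v \<and> (E\<^sup>*\<^sup>* s u \<longrightarrow> E\<^sup>*\<^sup>* s v) \<and> dist s v = dist s u + m"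
proof (induction m arbitrary: v)
  case (Suc m)
  then obtain w where "(up s ^^ m) u w" "up s w v" by auto
  moreover from this have "E w v" "E\<^sup>*\<^sup>* s w" "dist s v = Suc (dist s w)" by (auto simp: up_def)
  moreover have "(E ^^ m) u w" "dist s w = dist s u + m" using Suc.IH calculation by auto
  ultimately show ?case by (auto intro: rtranclp.rtrancl_into_rtrancl)
qed simp

lemma between_mono:
  assumes "(E ^^ m1) x x'" "(E ^^ m2) y' y"
  shows "between m x' y' \<subseteq> between (m1 + m + m2) x y"
proof
  fix v assume "v \<in> between m x' y'"
  then obtain a b where "a + b = m" "(E ^^ a) x' v" "(E ^^ b) v y'" by (auto simp: between_def)
  then have "(m1 + a) + (b + m2) = m1 + m + m2" "(E ^^ (m1 + a)) x v" "(E ^^ (b + m2)) v y"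
    using assms by (auto simp: relpowp_add)
  then show "v \<in> between (m1 + m + m2) x y" unfolding between_def by blast
qed

end

section \<open>Intervals of the given paths and distances that are monotone along them\<close>

section \<open>Subdividing geodesics\<close>

text \<open>\<open>B0\<close> has to contain the edges along which a path does not move away from
  its own source. The paths are not assumed to be disjoint or simple: the subdivision is a matter of
  distances only.\<close>

locale segmented_paths = ugraph E for E :: "'a \<Rightarrow> 'a \<Rightarrow> bool" +
  fixes k :: nat and src :: "nat \<Rightarrow> 'a" and P :: "nat \<Rightarrow> nat \<Rightarrow> 'a" and len :: "nat \<Rightarrow> nat"
    and B0 :: "(nat \<times> nat) set"
  assumes P_0: "p < k \<Longrightarrow> P p 0 = src p"
    and P_step: "p < k \<Longrightarrow> t < len p \<Longrightarrow> E (P p t) (P p (Suc t))"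
    and P_up: "p < k \<Longrightarrow> t < len p \<Longrightarrow> (p, t) \<notin> B0 \<Longrightarrow> up (src p) (P p t) (P p (Suc t))"
    and B0: "B0 \<subseteq> {(p, t). p < k \<and> t < len p}"
begin

lemma P_walk: "p < k \<Longrightarrow> a \<le> b \<Longrightarrow> b \<le> len p \<Longrightarrow> (E ^^ (b - a)) (P p a) (P p b)"
  unfolding relpowp_fun_conv using P_step by (intro exI[of _ "\<lambda>t. P p (a + t)"]) auto

lemma P_reach: "p < k \<Longrightarrow> a \<le> b \<Longrightarrow> b \<le> len p \<Longrightarrow> E\<^sup>*\<^sup>* (P p a) (P p b)"
  using P_walk relpowp_reach by blast

lemma src_reach: "p < k \<Longrightarrow> b \<le> len p \<Longrightarrow> E\<^sup>*\<^sup>* (src p) (P p b)"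
  using P_reach[of p 0 b] P_0 by simp

type_synonym interval = "nat \<times> nat \<times> nat"

definition ivl :: "interval \<Rightarrow> bool" where
  "ivl = (\<lambda>(p, a, b). p < k \<and> a \<le> b \<and> b \<le> len p)"

definition sub :: "interval \<Rightarrow> interval \<Rightarrow> bool" where
  "sub = (\<lambda>(p, c, d) (q, a, b). p = q \<and> a \<le> c \<and> c \<le> d \<and> d \<le> b)"

definition edges :: "interval \<Rightarrow> (nat \<times> nat) set" where
  "edges = (\<lambda>(p, a, b). {p} \<times> {a..<b})"

definition geo :: "interval \<Rightarrow> 'a set" where
  "geo = (\<lambda>(p, a, b). between (b - a) (P p a) (P p b))"

definition avoid :: "interval \<Rightarrow> interval \<Rightarrow> bool" where
  "avoid X Y \<longleftrightarrow> geo X \<inter> geo Y = {}"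

definition rise :: "nat \<Rightarrow> interval \<Rightarrow> bool" where
  "rise i = (\<lambda>(p, a, b). \<forall>t\<in>{a..<b}. up (src i) (P p t) (P p (Suc t)))"

definition fall :: "nat \<Rightarrow> interval \<Rightarrow> bool" where
  "fall i = (\<lambda>(p, a, b). \<forall>t\<in>{a..<b}. up (src i) (P p (Suc t)) (P p t))"

text \<open>That the sources lie in one component is demanded explicitly: it makes
  \<open>dist (src i)\<close> meaningful on the path, and for an interval without edges neither
  \<open>rise\<close> nor \<open>fall\<close> would imply it.\<close>

definition monot :: "nat \<Rightarrow> interval \<Rightarrow> bool" where
  "monot i X \<longleftrightarrow> E\<^sup>*\<^sup>* (src i) (src (fst X)) \<and> (rise i X \<or> fall i X)"

lemma ivl_sub: "ivl X \<Longrightarrow> sub Y X \<Longrightarrow> ivl Y"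
  by (auto simp: ivl_def sub_def)

lemma geo_sub:
  assumes "ivl X" "sub Y X"
  shows "geo Y \<subseteq> geo X"
proof -
  obtain p a b c d where X: "X = (p, a, b)" and Y: "Y = (p, c, d)" and *: "a \<le> c" "c \<le> d" "d \<le> b"
    using assms(2) by (auto simp: sub_def split: prod.splits)
  have "p < k" "b \<le> len p" using assms(1) by (auto simp: ivl_def X)
  then have "between (d - c) (P p c) (P p d) \<subseteq> between ((c - a) + (d - c) + (b - d)) (P p a) (P p b)"
    using * by (intro between_mono P_walk) auto
  moreover have "(c - a) + (d - c) + (b - d) = b - a" using * by simp
  ultimately show ?thesis by (simp add: geo_def X Y)
qed

lemma avoid_sub: "avoid X Y \<Longrightarrow> ivl X \<Longrightarrow> ivl Y \<Longrightarrow> sub X' X \<Longrightarrow> sub Y' Y \<Longrightarrow> avoid X' Y'"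
  using geo_sub unfolding avoid_def by blast

lemma avoid_sym: "avoid X Y \<Longrightarrow> avoid Y X"
  by (auto simp: avoid_def)

lemma geo_reach:
  assumes "ivl X" "v \<in> geo X"
  shows "E\<^sup>*\<^sup>* (src (fst X)) v"
proof -
  obtain p a b where X: "X = (p, a, b)" by (cases X)
  then have "p < k" "a \<le> len p" using assms(1) by (auto simp: ivl_def)
  from src_reach[OF this] assms(2) relpowp_reach show ?thesis
    by (auto simp: geo_def between_def X intro: rtranclp_trans)
qed

lemma rise_dist:
  assumes "rise i (p, a, b)" "a \<le> c" "c \<le> b"
  shows "dist (src i) (P p c) = dist (src i) (P p a) + (c - a)"
  using assms(2,3)
proof (induction c rule: dec_induct)
  case (step m)
  then have "up (src i) (P p m) (P p (Suc m))" using assms(1) by (auto simp: rise_def)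
  then show ?case using step by (simp add: up_def Suc_diff_le)
qed simp

lemma fall_dist:
  assumes "fall i (p, a, b)" "a \<le> c" "c \<le> b"
  shows "dist (src i) (P p a) = dist (src i) (P p c) + (c - a)"
  using assms(2,3)
proof (induction c rule: dec_induct)
  case (step m)
  then have "up (src i) (P p (Suc m)) (P p m)" using assms(1) by (auto simp: fall_def)
  then show ?case using step by (simp add: up_def Suc_diff_le)
qed simp

text \<open>Along the interval the distance from \<open>src i\<close> changes by the full number of
  edges. By \<open>dist_between\<close> every walk of that length with the same ends must then
  change it by one in every step, in the same direction \<open>\<delta>\<close>.\<close>

lemma monot_coord:
  assumes "monot i (p, a, b)" "ivl (p, a, b)"
  obtains \<delta> :: int where "\<delta> \<in> {1, -1}"
    "\<And>v m1 m2. (E ^^ m1) (P p a) v \<Longrightarrow> (E ^^ m2) v (P p b) \<Longrightarrow> m1 + m2 = b - a \<Longrightarrow>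
      int (dist (src i) v) = int (dist (src i) (P p a)) + \<delta> * int m1 \<and>
      int (dist (src i) (P p b)) = int (dist (src i) v) + \<delta> * int m2"
proof -
  have ab: "a \<le> b" "p < k" "b \<le> len p" using assms(2) by (auto simp: ivl_def)
  have reach: "E\<^sup>*\<^sup>* (src i) (P p a)" "E\<^sup>*\<^sup>* (src i) (P p b)"
    using assms(1) ab src_reach[of p a] src_reach[of p b] by (auto simp: monot_def intro: rtranclp_trans)
  from assms(1) consider "rise i (p, a, b)" | "fall i (p, a, b)" by (auto simp: monot_def)
  then show thesis
  proof cases
    case 1
    have eq: "dist (src i) (P p b) = dist (src i) (P p a) + (b - a)" using rise_dist[OF 1, of b] ab by blast
    show thesis
    proof (rule that[of 1])
      fix v m1 m2
      assume *: "(E ^^ m1) (P p a) v" "(E ^^ m2) v (P p b)" "m1 + m2 = b - a"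
      have "dist (src i) v = dist (src i) (P p a) + m1"
        by (rule dist_between[OF reach(1) *(1,2)]) (use eq * in simp)
      then show "int (dist (src i) v) = int (dist (src i) (P p a)) + 1 * int m1 \<and>
          int (dist (src i) (P p b)) = int (dist (src i) v) + 1 * int m2"
        using eq * by linarith
    qed simp
  next
    case 2
    have eq: "dist (src i) (P p a) = dist (src i) (P p b) + (b - a)" using fall_dist[OF 2, of b] ab by blast
    show thesis
    proof (rule that[of "-1"])
      fix v m1 m2
      assume *: "(E ^^ m1) (P p a) v" "(E ^^ m2) v (P p b)" "m1 + m2 = b - a"
      have "dist (src i) v = dist (src i) (P p b) + m2"
        by (rule dist_between[OF reach(2) relpowp_sym[OF *(2)] relpowp_sym[OF *(1)]]) (use eq * in simp)
      then show "int (dist (src i) v) = int (dist (src i) (P p a)) + -1 * int m1 \<and>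
          int (dist (src i) (P p b)) = int (dist (src i) v) + -1 * int m2"
        using eq * by linarith
    qed simp
  qed
qed

section \<open>Hyperplanes in terms of two distances, and the position of geodesics relative to
  them\<close>

subsection \<open>Hyperplanes\<close>

text \<open>\<open>(i, j, \<sigma>, c)\<close> stands for \<open>d\<^sub>i + d\<^sub>j = c\<close> or \<open>d\<^sub>i - d\<^sub>j = c\<close>, according to \<open>\<sigma>\<close>.\<close>

type_synonym hyperplane = "nat \<times> nat \<times> bool \<times> int"

definition hval :: "hyperplane \<Rightarrow> 'a \<Rightarrow> int" where
  "hval = (\<lambda>(i, j, \<sigma>, c) v. int (dist (src i) v) + (if \<sigma> then 1 else -1) * int (dist (src j) v) - c)"

definition cols :: "hyperplane \<Rightarrow> nat set" where
  "cols = (\<lambda>(i, j, \<sigma>, c). {i, j})"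

definition proper :: "hyperplane \<Rightarrow> bool" where
  "proper = (\<lambda>(i, j, \<sigma>, c). i < k \<and> j < k \<and> E\<^sup>*\<^sup>* (src i) (src j))"

definition inside :: "hyperplane \<Rightarrow> interval \<Rightarrow> bool" where
  "inside h = (\<lambda>(p, a, b). \<forall>t\<in>{a..b}. hval h (P p t) = 0)"

definition beside :: "hyperplane \<Rightarrow> interval \<Rightarrow> bool" where
  "beside h = (\<lambda>(p, a, b). (\<forall>t\<in>{a..b}. hval h (P p t) < 0) \<or> (\<forall>t\<in>{a..b}. 0 < hval h (P p t)))"

lemma inside_sub: "inside h X \<Longrightarrow> sub Y X \<Longrightarrow> inside h Y"
  by (auto simp: inside_def sub_def)

lemma not_inside_beside: "sub Y X \<Longrightarrow> inside h Y \<Longrightarrow> beside h X \<Longrightarrow> False"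
proof -
  assume *: "sub Y X" "inside h Y" "beside h X"
  then obtain p a b c d where X: "X = (p, a, b)" and Y: "Y = (p, c, d)" and c: "c \<in> {a..b}" "c \<in> {c..d}"
    by (auto simp: sub_def split: prod.splits)
  then have "hval h (P p c) = 0" using *(2) by (auto simp: inside_def)
  moreover have "hval h (P p c) < 0 \<or> 0 < hval h (P p c)" using *(3) X c(1) by (auto simp: beside_def)
  ultimately show False by simp
qed

text \<open>One of the two distances in \<open>hval h\<close> changes by exactly one per step in a
  fixed direction and the other by at most one, so their sum or difference never turns back. This
  holds along every geodesic with the same ends, so the values at the ends enclose those on all of
  \<open>geo\<close>.\<close>

lemma hval_mono:
  assumes X: "ivl (p, a, b)" and h: "proper h" "i \<in> cols h" and m: "monot i (p, a, b)"
  obtains \<delta> :: int where "\<delta> \<in> {1, -1}"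
    "\<And>v. v \<in> geo (p, a, b) \<Longrightarrow> 0 \<le> \<delta> * (hval h v - hval h (P p a)) \<and> 0 \<le> \<delta> * (hval h (P p b) - hval h v)"
proof -
  obtain i1 i2 \<sigma> c where h': "h = (i1, i2, \<sigma>, c)" by (cases h)
  have ab: "a \<le> b" "p < k" "b \<le> len p" using X by (auto simp: ivl_def)
  obtain \<delta> :: int where \<delta>: "\<delta> \<in> {1, -1}"
    "\<And>v m1 m2. (E ^^ m1) (P p a) v \<Longrightarrow> (E ^^ m2) v (P p b) \<Longrightarrow> m1 + m2 = b - a \<Longrightarrow>
      int (dist (src i) v) = int (dist (src i) (P p a)) + \<delta> * int m1 \<and>
      int (dist (src i) (P p b)) = int (dist (src i) v) + \<delta> * int m2"
    using monot_coord[OF m X] by metis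
  have ri: "E\<^sup>*\<^sup>* (src i) (P p a)"
    using m src_reach[of p a] ab by (auto simp: monot_def intro: rtranclp_trans)
  have "E\<^sup>*\<^sup>* (src j) (src i)" if "j \<in> cols h" for j
    using h that by (auto simp: proper_def cols_def h' reach_sym)
  then have reach: "E\<^sup>*\<^sup>* (src j) (P p a)" if "j \<in> cols h" for j
    using ri that by (meson rtranclp_trans)
  \<comment> \<open>The sign with which the monotone distance enters \<open>hval h\<close>.\<close>
  define \<tau> :: int where "\<tau> = (if i = i1 \<or> \<sigma> then 1 else -1)"
  show thesis
  proof (rule that[of "\<tau> * \<delta>"])
    show "\<tau> * \<delta> \<in> {1, -1}" using \<delta>(1) by (auto simp: \<tau>_def)
    fix v assume "v \<in> geo (p, a, b)"
    then obtain m1 m2 where v: "(E ^^ m1) (P p a) v" "(E ^^ m2) v (P p b)" "m1 + m2 = b - a"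
      by (auto simp: geo_def between_def)
    have bound: "\<bar>int (dist (src j) v) - int (dist (src j) (P p a))\<bar> \<le> int m1"
      "\<bar>int (dist (src j) (P p b)) - int (dist (src j) v)\<bar> \<le> int m2" if "j \<in> cols h" for j
      using dist_step[OF reach[OF that] v(1)] dist_step[OF dist_step(1)[OF reach[OF that] v(1)] v(2)] by linarith+
    note i = \<delta>(2)[OF v]
    have h12: "i1 \<in> cols h" "i2 \<in> cols h" by (auto simp: h' cols_def)
    have "i = i1 \<or> i = i2" using h(2) by (auto simp: h' cols_def)
    then show "0 \<le> \<tau> * \<delta> * (hval h v - hval h (P p a)) \<and> 0 \<le> \<tau> * \<delta> * (hval h (P p b) - hval h v)"
      using bound[OF h12(1)] bound[OF h12(2)] i \<delta>(1)
      by (cases "i = i1"; cases \<sigma>) (auto simp: hval_def h' \<tau>_def)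
  qed
qed

text \<open>The value of \<open>h\<close> is 0 at both ends and enclosed by these on every geodesic.
  So lying in a hyperplane is not a property of the chosen path alone but passes to every
  replacement.\<close>

lemma inside_geo:
  assumes X: "ivl X" and h: "proper h" "i \<in> cols h" "monot i X" "inside h X" and v: "v \<in> geo X"
  shows "hval h v = 0"
proof -
  obtain p a b where X': "X = (p, a, b)" by (cases X)
  obtain \<delta> :: int where \<delta>: "\<delta> \<in> {1, -1}"
    "\<And>v. v \<in> geo (p, a, b) \<Longrightarrow> 0 \<le> \<delta> * (hval h v - hval h (P p a)) \<and> 0 \<le> \<delta> * (hval h (P p b) - hval h v)"
    using hval_mono[OF X[unfolded X'] h(1,2) h(3)[unfolded X']] by metis
  have "hval h (P p a) = 0" "hval h (P p b) = 0" using h(4) X by (auto simp: inside_def ivl_def X')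
  then show ?thesis using \<delta>(1) \<delta>(2)[of v] v by (auto simp: X')
qed

lemma beside_geo:
  assumes X: "ivl X" and h: "proper h" "i \<in> cols h" "monot i X" "beside h X" and v: "v \<in> geo X"
  shows "hval h v \<noteq> 0"
proof -
  obtain p a b where X': "X = (p, a, b)" by (cases X)
  obtain \<delta> :: int where \<delta>: "\<delta> \<in> {1, -1}"
    "\<And>v. v \<in> geo (p, a, b) \<Longrightarrow> 0 \<le> \<delta> * (hval h v - hval h (P p a)) \<and> 0 \<le> \<delta> * (hval h (P p b) - hval h v)"
    using hval_mono[OF X[unfolded X'] h(1,2) h(3)[unfolded X']] by metis
  have "(hval h (P p a) < 0 \<and> hval h (P p b) < 0) \<or> (0 < hval h (P p a) \<and> 0 < hval h (P p b))"
    using h(4) X by (auto simp: beside_def ivl_def X')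
  then show ?thesis using \<delta>(1) \<delta>(2)[of v] v by (auto simp: X')
qed

lemma inside_beside_avoid:
  assumes "ivl X" "ivl Y" "proper h" "i \<in> cols h" "monot i X" "inside h X" "j \<in> cols h" "monot j Y" "beside h Y"
  shows "avoid X Y"
  using inside_geo[OF assms(1,3-6)] beside_geo[OF assms(2,3,7-9)] by (auto simp: avoid_def)

text \<open>On a hyperplane \<open>d\<^sub>i \<plusminus> d\<^sub>j = c\<close> every unit step of
  one distance is matched by a unit step of the other. This is how a piece acquires colours other
  than that of its own path.\<close>

lemma inside_monot:
  assumes X: "ivl X" and h: "proper h" "i \<in> cols h" "monot i X" "inside h X" and j: "j \<in> cols h"
  shows "monot j X"
proof -
  obtain p a b where X': "X = (p, a, b)" by (cases X)
  have p: "p < k" "b \<le> len p" using X by (auto simp: ivl_def X')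
  obtain i1 i2 \<sigma> c where h': "h = (i1, i2, \<sigma>, c)" by (cases h)
  have "E\<^sup>*\<^sup>* (src j) (src i)" using h j by (auto simp: proper_def cols_def h' reach_sym)
  then have reach: "E\<^sup>*\<^sup>* (src j) (src p)" using h(3) by (auto simp: monot_def X' intro: rtranclp_trans)
  have jt: "E\<^sup>*\<^sup>* (src j) (P p t)" if "t \<le> b" for t using reach src_reach[of p t] p that by (auto intro: rtranclp_trans)
  have zero: "hval h (P p t) = 0" if "t \<in> {a..b}" for t using h(4) that by (auto simp: inside_def X')
  have step: "E (P p t) (P p (Suc t)) \<and> E (P p (Suc t)) (P p t)" if "t \<in> {a..<b}" for t
    using P_step[of p t] p that E_sym by auto
  have eq: "hval h (P p t) = 0" "hval h (P p (Suc t)) = 0" if "t \<in> {a..<b}" for t using zero that by auto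
  have ij: "(i = i1 \<or> i = i2) \<and> (j = i1 \<or> j = i2)" using h(2) j by (auto simp: cols_def h')
  from h(3) consider "rise i X" | "fall i X" by (auto simp: monot_def)
  then have "rise j X \<or> fall j X"
  proof cases
    case 1
    then have "dist (src i) (P p (Suc t)) = Suc (dist (src i) (P p t))" if "t \<in> {a..<b}" for t
      using that by (auto simp: rise_def X' up_def)
    then have "if i = j \<or> \<not> \<sigma> then dist (src j) (P p (Suc t)) = Suc (dist (src j) (P p t))
        else dist (src j) (P p t) = Suc (dist (src j) (P p (Suc t)))" if "t \<in> {a..<b}" for t
      using eq[OF that] ij that by (auto simp: hval_def h' split: if_splits)
    then show ?thesis
      using step jt unfolding rise_def fall_def X' up_def by (cases "i = j \<or> \<not> \<sigma>") auto
  next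
    case 2
    then have "dist (src i) (P p t) = Suc (dist (src i) (P p (Suc t)))" if "t \<in> {a..<b}" for t
      using that by (auto simp: fall_def X' up_def)
    then have "if i = j \<or> \<not> \<sigma> then dist (src j) (P p t) = Suc (dist (src j) (P p (Suc t)))
        else dist (src j) (P p (Suc t)) = Suc (dist (src j) (P p t))" if "t \<in> {a..<b}" for t
      using eq[OF that] ij that by (auto simp: hval_def h' split: if_splits)
    then show ?thesis
      using step jt unfolding rise_def fall_def X' up_def by (cases "i = j \<or> \<not> \<sigma>") auto
  qed
  then show ?thesis using reach by (auto simp: monot_def X')
qed

end

text \<open>The sign can only grow along the sequence, so each change leaves the sign -1 or the sign
  0, and no sign is left twice.\<close>

lemma card_sgn_changes:
  fixes f :: "nat \<Rightarrow> int"
  assumes "\<And>t. a \<le> t \<Longrightarrow> t < b \<Longrightarrow> f t \<le> f (Suc t)"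
  shows "card {t \<in> {a..<b}. sgn (f t) \<noteq> sgn (f (Suc t))} \<le> 2"
proof -
  let ?S = "{t \<in> {a..<b}. sgn (f t) \<noteq> sgn (f (Suc t))}"
  have mono: "f t \<le> f t'" if "a \<le> t" "t \<le> t'" "t' \<le> b" for t t'
    using that(2,3)
  proof (induction t' rule: dec_induct)
    case (step m)
    then show ?case using assms[of m] that(1) by auto
  qed simp
  have sgn_mono: "x \<le> y \<Longrightarrow> sgn x \<le> sgn y" for x y :: int by (auto simp: sgn_if)
  have lt: "sgn (f t) < sgn (f (Suc t))" if "t \<in> ?S" for t
    using that assms[of t] sgn_mono[of "f t" "f (Suc t)"] by auto
  have lt2: "sgn (f t) < sgn (f t')" if "t \<in> ?S" "t' \<in> ?S" "t < t'" for t t'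
  proof -
    have "sgn (f (Suc t)) \<le> sgn (f t')" using that by (intro sgn_mono mono) auto
    then show ?thesis using lt[OF that(1)] by simp
  qed
  have "inj_on (\<lambda>t. sgn (f t)) ?S"
    by (rule inj_onI) (metis (no_types, lifting) linorder_neqE_nat lt2 order_less_irrefl)
  moreover have "(\<lambda>t. sgn (f t)) ` ?S \<subseteq> {-1, 0}"
  proof
    fix x assume "x \<in> (\<lambda>t. sgn (f t)) ` ?S"
    then obtain t where "t \<in> ?S" "x = sgn (f t)" by blast
    with lt[of t] show "x \<in> {-1, 0}" by (auto simp: sgn_if split: if_splits)
  qed
  ultimately have "card ?S \<le> card {-1, 0 :: int}" by (intro card_inj_on_le) auto
  then show ?thesis by simp
qed

context segmented_paths
begin

lemma finite_edges [simp]: "finite (edges X)"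
  by (auto simp: edges_def split: prod.splits)

text \<open>Up to a sign, \<open>hval h\<close> is monotone along \<open>X\<close>. Cutting where
  its sign changes leaves parts of constant sign, which lie on the hyperplane or strictly to one
  side of it.\<close>

lemma hyperplane_cut:
  assumes X: "ivl X" and h: "proper h" "i \<in> cols h" and m: "monot i X"
  shows "\<exists>S\<subseteq>edges X. card S \<le> 2 \<and> (\<forall>Y. sub Y X \<and> edges Y \<inter> S = {} \<longrightarrow> inside h Y \<or> beside h Y)"
proof -
  obtain p a b where X': "X = (p, a, b)" by (cases X)
  have p: "p < k" "a \<le> b" "b \<le> len p" using X by (auto simp: ivl_def X')
  obtain i1 i2 \<sigma> c where h': "h = (i1, i2, \<sigma>, c)" by (cases h)
  have "E\<^sup>*\<^sup>* (src j) (src i)" if "j \<in> cols h" for j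
    using h that by (auto simp: proper_def cols_def h' reach_sym)
  then have reach: "E\<^sup>*\<^sup>* (src j) (P p t)" if "j \<in> cols h" "t \<le> b" for j t
    using m that src_reach[of p t] p by (auto simp: monot_def X' intro: rtranclp_trans)
  have lip: "\<bar>int (dist (src j) (P p (Suc t))) - int (dist (src j) (P p t))\<bar> \<le> 1" if "j \<in> cols h" "t \<in> {a..<b}" for j t
    using dist_edge[OF reach[OF that(1)] P_step[of p t]] p that(2) by auto
  define \<delta> :: int where "\<delta> = (if rise i X then 1 else -1)"
  have i: "int (dist (src i) (P p (Suc t))) = int (dist (src i) (P p t)) + \<delta>" if "t \<in> {a..<b}" for t
    using m that unfolding monot_def \<delta>_def
    by (auto simp: X' rise_def fall_def up_def split: if_splits)
  have \<delta>: "\<delta> \<in> {1, -1}" by (simp add: \<delta>_def)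
  have i12: "i = i1 \<or> i = i2" "i1 \<in> cols h" "i2 \<in> cols h" using h(2) by (auto simp: cols_def h')
  define \<tau> where "\<tau> = (if i = i1 \<or> \<sigma> then \<delta> else - \<delta>)"
  define f where "f = (\<lambda>t. \<tau> * hval h (P p t))"
  have f: "f t \<le> f (Suc t)" if "t \<in> {a..<b}" for t
    using i[OF that] lip[OF i12(2) that] lip[OF i12(3) that] i12(1) \<delta>
    by (cases "i = i1"; cases \<sigma>) (auto simp: f_def \<tau>_def hval_def h')
  have \<tau>: "\<tau> \<in> {1, -1}" using \<delta> by (auto simp: \<tau>_def)
  define S where "S = {p} \<times> {t \<in> {a..<b}. sgn (f t) \<noteq> sgn (f (Suc t))}"
  have "card S \<le> 2" unfolding S_def card_cartesian_product using card_sgn_changes[of a b f] f by simp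
  moreover have "S \<subseteq> edges X" by (auto simp: S_def edges_def X')
  moreover have "inside h Y \<or> beside h Y" if Y: "sub Y X" "edges Y \<inter> S = {}" for Y
  proof -
    obtain c d where Y': "Y = (p, c, d)" "a \<le> c" "c \<le> d" "d \<le> b" using Y(1) by (auto simp: sub_def X' split: prod.splits)
    have const: "sgn (f t) = sgn (f c)" if "c \<le> t" "t \<le> d" for t
      using that
    proof (induction t rule: dec_induct)
      case (step m)
      then have "(p, m) \<in> edges Y" by (auto simp: edges_def Y')
      then have "(p, m) \<notin> S" using Y(2) by blast
      then show ?case using step Y' by (auto simp: S_def)
    qed simp
    have eq: "hval h (P p t) = \<tau> * f t" for t using \<tau> by (auto simp: f_def)
    have sg: "(f c = 0 \<longrightarrow> f t = 0) \<and> (f c < 0 \<longrightarrow> f t < 0) \<and> (0 < f c \<longrightarrow> 0 < f t)" if "c \<le> t" "t \<le> d" for t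
      using const[OF that] by (auto simp: sgn_if split: if_splits)
    consider "f c = 0" | "f c < 0" | "0 < f c" by linarith
    then show ?thesis
    proof cases
      case 1
      then show ?thesis using sg by (auto simp: inside_def Y' eq)
    next
      case 2
      then show ?thesis using sg \<tau> by (auto simp: beside_def Y' eq)
    next
      case 3
      then show ?thesis using sg \<tau> by (auto simp: beside_def Y' eq)
    qed
  qed
  ultimately show ?thesis by blast
qed

text \<open>As the first distance grows by one in every step and the second changes by at most one,
  both their sum and their difference are monotone along every geodesic with these ends. So the box
  spanned by the end points, to which \<open>apart\<close> refers, contains all possible
  replacements.\<close>

lemma rise_box:
  assumes X: "ivl (p, c, d)" "rise i (p, c, d)" "E\<^sup>*\<^sup>* (src i) (src p)" "E\<^sup>*\<^sup>* (src j) (src p)" and v: "v \<in> geo (p, c, d)"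
  defines "u \<equiv> \<lambda>w. int (dist (src i) w)" and "w \<equiv> \<lambda>w. int (dist (src j) w)"
  shows "u (P p c) + w (P p c) \<le> u v + w v" "u v + w v \<le> u (P p d) + w (P p d)"
    "u (P p c) - w (P p c) \<le> u v - w v" "u v - w v \<le> u (P p d) - w (P p d)"
proof -
  have p: "p < k" "c \<le> d" "d \<le> len p" using X(1) by (auto simp: ivl_def)
  obtain m1 m2 where m: "(E ^^ m1) (P p c) v" "(E ^^ m2) v (P p d)" "m1 + m2 = d - c"
    using v by (auto simp: geo_def between_def)
  have ri: "E\<^sup>*\<^sup>* (src i) (P p c)" "E\<^sup>*\<^sup>* (src j) (P p c)"
    using X(3,4) src_reach[of p c] p by (auto intro: rtranclp_trans)
  have eq: "dist (src i) (P p d) = dist (src i) (P p c) + (m1 + m2)"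
    using rise_dist[OF X(2), of d] p m(3) by simp
  have "dist (src i) v = dist (src i) (P p c) + m1" by (rule dist_between[OF ri(1) m(1,2) eq])
  moreover note eq dist_step[OF ri(2) m(1)] dist_step[OF dist_step(1)[OF ri(2) m(1)] m(2)]
  ultimately show "u (P p c) + w (P p c) \<le> u v + w v" "u v + w v \<le> u (P p d) + w (P p d)"
    "u (P p c) - w (P p c) \<le> u v - w v" "u v - w v \<le> u (P p d) - w (P p d)"
    unfolding u_def w_def by linarith+
qed

text \<open>\<open>split_exists\<close> applied to the coordinates of the two pieces yields the cuts
  and the hyperplane. \<open>H\<close> is left empty when the sources lie in different components,
  where the pieces cannot meet and the mixed distances would be meaningless.\<close>

lemma crossing:
  assumes X: "ivl X" "rise (fst X) X" and Y: "ivl Y" "rise (fst Y) Y"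
  shows "\<exists>S S' H. S \<subseteq> edges X \<and> S' \<subseteq> edges Y \<and> card S \<le> 2 \<and> card S' \<le> 2 \<and> finite H \<and> card H \<le> 1 \<and>
    (\<forall>h\<in>H. proper h \<and> fst X \<in> cols h \<and> fst Y \<in> cols h) \<and>
    (\<forall>X' Y'. sub X' X \<and> sub Y' Y \<and> edges X' \<inter> S = {} \<and> edges Y' \<inter> S' = {} \<longrightarrow>
      avoid X' Y' \<or> (\<exists>h\<in>H. inside h X' \<and> inside h Y'))"
proof (cases "E\<^sup>*\<^sup>* (src (fst X)) (src (fst Y))")
  case False
  have "avoid X Y"
    unfolding avoid_def using geo_reach[OF X(1)] geo_reach[OF Y(1)] False
    by (meson disjoint_iff reach_sym rtranclp_trans)
  then have "avoid X' Y'" if "sub X' X" "sub Y' Y" for X' Y'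
    using avoid_sub X(1) Y(1) that by blast
  then show ?thesis
    by (intro exI[of _ "{}"]) auto
next
  case True
  obtain p a b where X': "X = (p, a, b)" by (cases X)
  obtain q a' b' where Y': "Y = (q, a', b')" by (cases Y)
  have p: "p < k" "a \<le> b" "b \<le> len p" and q: "q < k" "a' \<le> b'" "b' \<le> len q"
    using X Y by (auto simp: ivl_def X' Y')
  have pq: "E\<^sup>*\<^sup>* (src p) (src q)" "E\<^sup>*\<^sup>* (src q) (src p)" using True reach_sym by (auto simp: X' Y')
  define dp where "dp = (\<lambda>v. int (dist (src p) v))"
  define dq where "dq = (\<lambda>v. int (dist (src q) v))"
  have dq: "\<bar>dq (P p (Suc t)) - dq (P p t)\<bar> \<le> 1" if "t \<in> {a..<b}" for t
    using dist_edge[OF rtranclp_trans[OF pq(2) src_reach[of p t]] P_step[of p t]] p that by (auto simp: dq_def)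
  have dp: "\<bar>dp (P q (Suc t)) - dp (P q t)\<bar> \<le> 1" if "t \<in> {a'..<b'}" for t
    using dist_edge[OF rtranclp_trans[OF pq(1) src_reach[of q t]] P_step[of q t]] q that by (auto simp: dp_def)
  have dp1: "dp (P p (Suc t)) = dp (P p t) + 1" if "t \<in> {a..<b}" for t
    using X(2) that by (auto simp: rise_def X' up_def dp_def)
  have dq1: "dq (P q (Suc t)) = dq (P q t) + 1" if "t \<in> {a'..<b'}" for t
    using Y(2) that by (auto simp: rise_def Y' up_def dq_def)
  define U where "U = (\<lambda>t. dp (P p (a + t)) + dq (P p (a + t)))"
  define V where "V = (\<lambda>t. dp (P p (a + t)) - dq (P p (a + t)))"
  define A where "A = (\<lambda>t. dp (P q (a' + t)) + dq (P q (a' + t)))"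
  define B where "B = (\<lambda>t. dp (P q (a' + t)) - dq (P q (a' + t)))"
  interpret st: staircases U V A B "b - a" "b' - a'"
  proof
    fix t assume "t < b - a"
    then have "a + t \<in> {a..<b}" by auto
    from dp1[OF this] dq[OF this]
    show "U t \<le> U (Suc t) \<and> V t \<le> V (Suc t) \<and> U (Suc t) + V (Suc t) = U t + V t + 2"
      by (auto simp: U_def V_def)
  next
    fix t assume "t < b' - a'"
    then have "a' + t \<in> {a'..<b'}" by auto
    from dq1[OF this] dp[OF this]
    show "A t \<le> A (Suc t) \<and> B (Suc t) \<le> B t \<and> A (Suc t) - B (Suc t) = A t - B t + 2"
      by (auto simp: A_def B_def)
  \<comment> \<open>The parity conditions: \<open>U + V\<close> and \<open>A + B\<close> are both
    twice the distance \<open>dp\<close>.\<close>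
  qed (auto simp: U_def V_def A_def B_def)
  obtain SX SY \<sigma> c where S: "SX \<subseteq> {..<b - a}" "SY \<subseteq> {..<b' - a'}" "card SX \<le> 2" "card SY \<le> 2"
    and sp: "st.splits SX SY (\<lambda>a b a' b'. (\<forall>t\<in>{a..b}. (if \<sigma> then U else V) t = c) \<and> (\<forall>s\<in>{a'..b'}. (if \<sigma> then A else B) s = c))"
    using st.split_exists by blast
  define S where "S = {p} \<times> (+) a ` SX"
  define S' where "S' = {q} \<times> (+) a' ` SY"
  define h where "h = (p, q, \<sigma>, c)"
  have fin: "finite SX" "finite SY" using S finite_subset by blast+
  have "S \<subseteq> edges X" using S(1) by (auto simp: S_def edges_def X')
  moreover have "S' \<subseteq> edges Y" using S(2) by (auto simp: S'_def edges_def Y')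
  moreover have "card S \<le> 2" "card S' \<le> 2"
    using S(3,4) by (auto simp: S_def S'_def card_cartesian_product card_image)
  moreover have "proper h" "fst X \<in> cols h" "fst Y \<in> cols h"
    using p q pq by (auto simp: h_def proper_def cols_def X' Y')
  moreover have "avoid X' Y' \<or> (inside h X' \<and> inside h Y')"
    if sub: "sub X' X" "sub Y' Y" "edges X' \<inter> S = {}" "edges Y' \<inter> S' = {}" for X' Y'
  proof -
    obtain c1 d1 where X1: "X' = (p, c1, d1)" "a \<le> c1" "c1 \<le> d1" "d1 \<le> b"
      using sub(1) by (auto simp: sub_def X' split: prod.splits)
    obtain c2 d2 where Y1: "Y' = (q, c2, d2)" "a' \<le> c2" "c2 \<le> d2" "d2 \<le> b'"
      using sub(2) by (auto simp: sub_def Y' split: prod.splits)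
    have no: "SX \<inter> {c1 - a..<d1 - a} = {}" "SY \<inter> {c2 - a'..<d2 - a'} = {}"
    proof -
      show "SX \<inter> {c1 - a..<d1 - a} = {}"
      proof (rule ccontr)
        assume "SX \<inter> {c1 - a..<d1 - a} \<noteq> {}"
        then obtain t where "t \<in> SX" "c1 - a \<le> t" "t < d1 - a" by auto
        then have "(p, a + t) \<in> edges X' \<inter> S" by (auto simp: edges_def X1 S_def)
        then show False using sub(3) by blast
      qed
      show "SY \<inter> {c2 - a'..<d2 - a'} = {}"
      proof (rule ccontr)
        assume "SY \<inter> {c2 - a'..<d2 - a'} \<noteq> {}"
        then obtain t where "t \<in> SY" "c2 - a' \<le> t" "t < d2 - a'" by auto
        then have "(q, a' + t) \<in> edges Y' \<inter> S'" by (auto simp: edges_def Y1 S'_def)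
        then show False using sub(4) by blast
      qed
    qed
    have iv: "ivl X'" "ivl Y'" using ivl_sub X(1) Y(1) sub by blast+
    have ri: "rise p X'" "rise q Y'"
      using X(2) Y(2) X1 Y1 by (auto simp: rise_def X' Y')
    from sp[unfolded st.splits_def, rule_format, of "c1 - a" "d1 - a" "c2 - a'" "d2 - a'"] no X1 Y1
    consider "st.apart (c1 - a) (d1 - a) (c2 - a') (d2 - a')"
      | "\<forall>t\<in>{c1 - a..d1 - a}. (if \<sigma> then U else V) t = c" "\<forall>s\<in>{c2 - a'..d2 - a'}. (if \<sigma> then A else B) s = c"
      by (auto simp: diff_le_mono)
    then show ?thesis
    proof cases
      case 1
      have "v \<notin> geo Y'" if v: "v \<in> geo X'" for v
      proof
        assume vY: "v \<in> geo Y'"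
        note bx = rise_box[OF iv(1)[unfolded X1] ri(1)[unfolded X1] rtranclp.rtrancl_refl pq(2) v[unfolded X1]]
        note bY = rise_box[OF iv(2)[unfolded Y1] ri(2)[unfolded Y1] rtranclp.rtrancl_refl pq(1) vY[unfolded Y1]]
        show False
          using 1[unfolded st.apart_def] bx bY X1 Y1 by (auto simp: U_def V_def A_def B_def dp_def dq_def)
      qed
      then show ?thesis by (auto simp: avoid_def)
    next
      case 2
      have "inside h X'"
        unfolding inside_def X1(1) prod.case
      proof
        fix t assume t: "t \<in> {c1..d1}"
        then have "t - a \<in> {c1 - a..d1 - a}" using X1 by (auto simp: diff_le_mono)
        with 2(1) have "(if \<sigma> then U else V) (t - a) = c" by blast
        then show "hval h (P p t) = 0"
          using t X1 by (cases \<sigma>) (auto simp: U_def V_def hval_def h_def dp_def dq_def)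
      qed
      moreover have "inside h Y'"
        unfolding inside_def Y1(1) prod.case
      proof
        fix t assume t: "t \<in> {c2..d2}"
        then have "t - a' \<in> {c2 - a'..d2 - a'}" using Y1 by (auto simp: diff_le_mono)
        with 2(2) have "(if \<sigma> then A else B) (t - a') = c" by blast
        then show "hval h (P q t) = 0"
          using t Y1 by (cases \<sigma>) (auto simp: A_def B_def hval_def h_def dp_def dq_def)
      qed
      ultimately show ?thesis by blast
    qed
  qed
  ultimately show ?thesis
    by (intro exI[of _ S] exI[of _ S'] exI[of _ "{h}"]) auto
qed

section \<open>Maximal intervals between breaks, and how refining the breaks affects them\<close>

subsection \<open>Pieces between breaks\<close>

definition slots :: "(nat \<times> nat) set" where
  "slots = {(p, t). p < k \<and> t < len p}"

definition pieces :: "(nat \<times> nat) set \<Rightarrow> interval set" where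
  "pieces Bk = {(p, a, b). ivl (p, a, b) \<and> (a = 0 \<or> (p, a - 1) \<in> Bk) \<and> (b = len p \<or> (p, b) \<in> Bk) \<and>
     edges (p, a, b) \<inter> Bk = {}}"

lemma finite_slots [simp]: "finite slots"
proof -
  have "slots = (SIGMA p:{..<k}. {..<len p})" by (auto simp: slots_def)
  then show ?thesis by simp
qed

lemma piece_ivl: "X \<in> pieces Bk \<Longrightarrow> ivl X"
  by (auto simp: pieces_def)

text \<open>A piece is determined by its path and its first vertex, which is either the start of the
  path or the vertex after a break.\<close>

lemma card_pieces:
  assumes "Bk \<subseteq> slots"
  shows "finite (pieces Bk)" "card (pieces Bk) \<le> k + card Bk"
proof -
  define T where "T = (\<lambda>p. (p, 0 :: nat)) ` {..<k} \<union> (\<lambda>(p, t). (p, Suc t)) ` Bk"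
  have fin: "finite Bk" by (rule finite_subset[OF assms]) simp
  have inj: "inj_on (\<lambda>(p, a, b). (p, a)) (pieces Bk)"
  proof (rule inj_onI, clarsimp)
    fix p a b b'
    assume *: "(p, a, b) \<in> pieces Bk" "(p, a, b') \<in> pieces Bk"
    have "\<not> b < b'" if "(p, a, b) \<in> pieces Bk" "(p, a, b') \<in> pieces Bk" for b b'
    proof
      assume "b < b'"
      with that have "(p, b) \<in> Bk" "(p, b) \<in> edges (p, a, b')"
        by (auto simp: pieces_def ivl_def edges_def)
      then show False using that by (auto simp: pieces_def)
    qed
    with * show "b = b'" by (meson linorder_neqE_nat)
  qed
  have sub: "(\<lambda>(p, a, b). (p, a)) ` pieces Bk \<subseteq> T"
  proof
    fix y assume "y \<in> (\<lambda>(p, a, b). (p, a)) ` pieces Bk"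
    then obtain p a b where y: "y = (p, a)" "(p, a, b) \<in> pieces Bk" by auto
    then have "p < k" "a = 0 \<or> (p, a - 1) \<in> Bk" by (auto simp: pieces_def ivl_def)
    then show "y \<in> T" unfolding y(1) T_def by (cases a) (auto intro: rev_image_eqI)
  qed
  have finT: "finite T" using fin by (simp add: T_def)
  show "finite (pieces Bk)" using inj_on_finite[OF inj sub finT] .
  have "card (pieces Bk) \<le> card T" using card_inj_on_le[OF inj sub finT] .
  also have "\<dots> \<le> card ((\<lambda>p. (p, 0 :: nat)) ` {..<k}) + card ((\<lambda>(p, t). (p, Suc t)) ` Bk)"
    unfolding T_def by (rule card_Un_le)
  also have "\<dots> \<le> k + card Bk" using card_image_le[OF fin] card_image_le[of "{..<k}"] by (intro add_mono) auto
  finally show "card (pieces Bk) \<le> k + card Bk" .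
qed

text \<open>Extend the interval in both directions as far as no break is crossed.\<close>

lemma parent_piece:
  assumes Y: "ivl Y" "edges Y \<inter> Bk = {}"
  obtains X where "X \<in> pieces Bk" "sub Y X"
proof -
  obtain p c d where Y': "Y = (p, c, d)" by (cases Y)
  have p: "p < k" "c \<le> d" "d \<le> len p" using Y(1) by (auto simp: ivl_def Y')
  define AA where "AA = {a. a \<le> c \<and> (\<forall>t\<in>{a..<c}. (p, t) \<notin> Bk)}"
  define BB where "BB = {b. d \<le> b \<and> b \<le> len p \<and> (\<forall>t\<in>{d..<b}. (p, t) \<notin> Bk)}"
  have A: "finite AA" "AA \<noteq> {}" and B: "finite BB" "BB \<noteq> {}"
    using p by (auto simp: AA_def BB_def intro: finite_subset[of _ "{..c}"] finite_subset[of _ "{..len p}"])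
  define a where "a = Min AA"
  define b where "b = Max BB"
  have a: "a \<in> AA" "\<And>a'. a' \<in> AA \<Longrightarrow> a \<le> a'" and b: "b \<in> BB" "\<And>b'. b' \<in> BB \<Longrightarrow> b' \<le> b"
    using A B by (auto simp: a_def b_def)
  have "a = 0 \<or> (p, a - 1) \<in> Bk"
  proof (rule ccontr)
    assume *: "\<not> (a = 0 \<or> (p, a - 1) \<in> Bk)"
    have "(p, t) \<notin> Bk" if "t \<in> {a - 1..<c}" for t
      using that * a(1) by (cases "t = a - 1") (auto simp: AA_def)
    then have "a - 1 \<in> AA" using a(1) by (auto simp: AA_def)
    from a(2)[OF this] have "a = 0" by linarith
    then show False using * by simp
  qed
  moreover have "b = len p \<or> (p, b) \<in> Bk"
  proof (rule ccontr)
    assume *: "\<not> (b = len p \<or> (p, b) \<in> Bk)"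
    have "(p, t) \<notin> Bk" if "t \<in> {d..<Suc b}" for t
      using that * b(1) by (cases "t = b") (auto simp: BB_def)
    then have "Suc b \<in> BB" using b(1) * by (auto simp: BB_def)
    from b(2)[OF this] show False by simp
  qed
  moreover have "edges (p, a, b) \<inter> Bk = {}"
  proof -
    have "(p, t) \<notin> Bk" if t: "t \<in> {a..<b}" for t
    proof -
      consider "t \<in> {a..<c}" | "t \<in> {c..<d}" | "t \<in> {d..<b}"
        using t by (cases "t < c"; cases "t < d") auto
      moreover have "(p, t) \<notin> Bk" if "t \<in> {c..<d}" using Y(2) that by (force simp: edges_def Y')
      ultimately show ?thesis using a(1) b(1) by cases (auto simp: AA_def BB_def)
    qed
    then show ?thesis by (auto simp: edges_def)
  qed
  ultimately have "(p, a, b) \<in> pieces Bk" "sub Y (p, a, b)"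
    using a(1) b(1) p by (auto simp: pieces_def ivl_def AA_def BB_def sub_def Y')
  then show thesis using that by blast
qed

lemma parent_refine:
  assumes "Bk \<subseteq> Bk'" "Y \<in> pieces Bk'"
  obtains X where "X \<in> pieces Bk" "sub Y X" "edges Y \<inter> Bk' = {}" "ivl X"
proof -
  have Y: "ivl Y" "edges Y \<inter> Bk' = {}" using assms(2) by (auto simp: pieces_def)
  then have "edges Y \<inter> Bk = {}" using assms(1) by blast
  from parent_piece[OF Y(1) this] obtain X where "X \<in> pieces Bk" "sub Y X" .
  then show thesis using that Y piece_ivl by blast
qed

lemma edges_slots: "ivl X \<Longrightarrow> edges X \<subseteq> slots"
  by (auto simp: ivl_def edges_def slots_def)

lemma piece_rise:
  assumes "B0 \<subseteq> Bk" "X \<in> pieces Bk"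
  shows "rise (fst X) X" "monot (fst X) X"
proof -
  obtain p a b where X: "X = (p, a, b)" by (cases X)
  have "p < k" "b \<le> len p" "edges X \<inter> B0 = {}" using assms by (auto simp: pieces_def X ivl_def)
  then have "up (src p) (P p t) (P p (Suc t))" if "t \<in> {a..<b}" for t
    using P_up[of p t] that by (force simp: edges_def X)
  then show "rise (fst X) X" by (simp add: rise_def X)
  then show "monot (fst X) X" by (simp add: monot_def)
qed

end

context segmented_paths
begin

lemma card_UN_bound:
  assumes "finite Z" "\<And>z. z \<in> Z \<Longrightarrow> card (f z) \<le> c"
  shows "card (\<Union>z\<in>Z. f z) \<le> c * card Z"
proof -
  have "card (\<Union>z\<in>Z. f z) \<le> (\<Sum>z\<in>Z. card (f z))" by (rule card_UN_le[OF assms(1)])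
  also have "\<dots> \<le> card Z * c" using sum_bounded_above[of Z "\<lambda>z. card (f z)" c] assms(2) by simp
  finally show ?thesis by (simp add: mult.commute)
qed

text \<open>Pairs on one path are exempt: both pieces are monotone in the distance from their common
  source and thus share a colour from the start.\<close>

definition crossed :: "hyperplane set \<Rightarrow> (nat \<times> nat) set \<Rightarrow> bool" where
  "crossed H Bk \<longleftrightarrow> (\<forall>X\<in>pieces Bk. \<forall>Y\<in>pieces Bk. fst X \<noteq> fst Y \<longrightarrow>
     avoid X Y \<or> (\<exists>h\<in>H. fst X \<in> cols h \<and> fst Y \<in> cols h \<and> inside h X \<and> inside h Y))"

lemma fst_sub: "sub X Y \<Longrightarrow> fst X = fst Y"
  by (auto simp: sub_def split: prod.splits)

lemma crossed_refine:
  assumes "crossed H Bk" "Bk \<subseteq> Bk'"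
  shows "crossed H Bk'"
  unfolding crossed_def
proof (intro ballI impI)
  fix X Y assume XY: "X \<in> pieces Bk'" "Y \<in> pieces Bk'" "fst X \<noteq> fst Y"
  obtain X0 where X0: "X0 \<in> pieces Bk" "sub X X0" "ivl X0" using parent_refine[OF assms(2) XY(1)] by metis
  obtain Y0 where Y0: "Y0 \<in> pieces Bk" "sub Y Y0" "ivl Y0" using parent_refine[OF assms(2) XY(2)] by metis
  have f: "fst X0 = fst X" "fst Y0 = fst Y" using fst_sub X0 Y0 by auto
  with assms(1) X0(1) Y0(1) XY(3) consider "avoid X0 Y0"
    | h where "h \<in> H" "fst X \<in> cols h" "fst Y \<in> cols h" "inside h X0" "inside h Y0"
    unfolding crossed_def by metis
  then show "avoid X Y \<or> (\<exists>h\<in>H. fst X \<in> cols h \<and> fst Y \<in> cols h \<and> inside h X \<and> inside h Y)"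
  proof cases
    case 1
    then show ?thesis using avoid_sub X0 Y0 by blast
  next
    case 2
    then show ?thesis using inside_sub X0 Y0 by blast
  qed
qed

text \<open>There are at most \<open>N\<close> pieces between the breaks in \<open>B0\<close>. Each
  of the at most \<open>N\<^sup>2\<close> ordered pairs contributes up to 4 cuts and one hyperplane,
  and \<open>N + 4 * N\<^sup>2 \<le> 5 * N\<^sup>2\<close>.\<close>

lemma base_crossings:
  defines "N \<equiv> k + card B0"
  shows "\<exists>Bk H. B0 \<subseteq> Bk \<and> Bk \<subseteq> slots \<and> k + card Bk \<le> 5 * N\<^sup>2 \<and> finite H \<and> card H \<le> N\<^sup>2 \<and>
    (\<forall>h\<in>H. proper h) \<and> crossed H Bk"
proof -
  define Z where "Z = pieces B0 \<times> pieces B0"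
  have B0s: "B0 \<subseteq> slots" using B0 by (simp add: slots_def)
  have Z: "finite Z" "card Z \<le> N\<^sup>2"
    using card_pieces[OF B0s] mult_le_mono[of "card (pieces B0)" N "card (pieces B0)" N]
    by (auto simp: Z_def N_def card_cartesian_product power2_eq_square)
  define Q where "Q = (\<lambda>z w. case (z, w) of ((X, Y), (S, S', H)) \<Rightarrow>
    S \<subseteq> edges X \<and> S' \<subseteq> edges Y \<and> card S \<le> 2 \<and> card S' \<le> 2 \<and> finite H \<and> card H \<le> 1 \<and>
    (\<forall>h\<in>H. proper h \<and> fst X \<in> cols h \<and> fst Y \<in> cols h) \<and>
    (\<forall>X' Y'. sub X' X \<and> sub Y' Y \<and> edges X' \<inter> S = {} \<and> edges Y' \<inter> S' = {} \<longrightarrow>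
      avoid X' Y' \<or> (\<exists>h\<in>H. inside h X' \<and> inside h Y')))"
  have "\<exists>w. Q z w" if zZ: "z \<in> Z" for z
  proof -
    obtain X Y where z: "z = (X, Y)" "X \<in> pieces B0" "Y \<in> pieces B0" using zZ unfolding Z_def by (metis SigmaE)
    show ?thesis
      using crossing[OF piece_ivl[OF z(2)] piece_rise(1)[OF order_refl z(2)] piece_ivl[OF z(3)] piece_rise(1)[OF order_refl z(3)]]
      unfolding Q_def z(1) by auto
  qed
  then obtain w where w: "\<And>z. z \<in> Z \<Longrightarrow> Q z (w z)" by metis
  define cut where "cut = (\<lambda>z. fst (w z) \<union> fst (snd (w z)))"
  define hyp where "hyp = (\<lambda>z. snd (snd (w z)))"
  have Qz: "fst (w (X, Y)) \<subseteq> edges X" "fst (snd (w (X, Y))) \<subseteq> edges Y" "card (fst (w (X, Y))) \<le> 2"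
    "card (fst (snd (w (X, Y)))) \<le> 2" "finite (hyp (X, Y))" "card (hyp (X, Y)) \<le> 1"
    "\<And>h. h \<in> hyp (X, Y) \<Longrightarrow> proper h \<and> fst X \<in> cols h \<and> fst Y \<in> cols h"
    "\<And>X' Y'. sub X' X \<Longrightarrow> sub Y' Y \<Longrightarrow> edges X' \<inter> cut (X, Y) = {} \<Longrightarrow> edges Y' \<inter> cut (X, Y) = {} \<Longrightarrow>
      avoid X' Y' \<or> (\<exists>h\<in>hyp (X, Y). inside h X' \<and> inside h Y')"
    if "(X, Y) \<in> Z" for X Y
  proof -
    obtain S S' L where eq: "w (X, Y) = (S, S', L)" by (cases "w (X, Y)")
    have c: "cut (X, Y) = S \<union> S'" and l: "hyp (X, Y) = L" by (simp_all add: cut_def hyp_def eq)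
    note q = w[OF that, unfolded Q_def eq prod.case]
    show "fst (w (X, Y)) \<subseteq> edges X" "fst (snd (w (X, Y))) \<subseteq> edges Y" "card (fst (w (X, Y))) \<le> 2"
      "card (fst (snd (w (X, Y)))) \<le> 2" "finite (hyp (X, Y))" "card (hyp (X, Y)) \<le> 1"
      using q by (simp_all add: eq l)
    show "\<And>h. h \<in> hyp (X, Y) \<Longrightarrow> proper h \<and> fst X \<in> cols h \<and> fst Y \<in> cols h" using q by (simp add: l)
    fix X' Y'
    assume "sub X' X" "sub Y' Y" "edges X' \<inter> cut (X, Y) = {}" "edges Y' \<inter> cut (X, Y) = {}"
    then have "sub X' X \<and> sub Y' Y \<and> edges X' \<inter> S = {} \<and> edges Y' \<inter> S' = {}" unfolding c by blast
    then show "avoid X' Y' \<or> (\<exists>h\<in>hyp (X, Y). inside h X' \<and> inside h Y')" unfolding l using q by blast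
  qed
  define Bk where "Bk = B0 \<union> (\<Union>z\<in>Z. cut z)"
  define H where "H = (\<Union>z\<in>Z. hyp z)"
  have cut: "card (cut z) \<le> 4 \<and> cut z \<subseteq> slots" if zZ: "z \<in> Z" for z
  proof -
    obtain X Y where z: "z = (X, Y)" "X \<in> pieces B0" "Y \<in> pieces B0" using zZ unfolding Z_def by (metis SigmaE)
    have "card (cut z) \<le> card (fst (w z)) + card (fst (snd (w z)))" unfolding cut_def by (rule card_Un_le)
    then show ?thesis
      using Qz(1-4)[of X Y] zZ edges_slots[OF piece_ivl[OF z(2)]] edges_slots[OF piece_ivl[OF z(3)]]
      unfolding z(1) cut_def by auto
  qed
  have "card Bk \<le> card B0 + card (\<Union>z\<in>Z. cut z)" unfolding Bk_def by (rule card_Un_le)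
  also have "card (\<Union>z\<in>Z. cut z) \<le> 4 * card Z" using cut by (intro card_UN_bound Z) auto
  finally have "k + card Bk \<le> N + 4 * N\<^sup>2" using Z(2) by (simp add: N_def)
  also have "\<dots> \<le> 5 * N\<^sup>2" using le_square[of N] by (simp add: power2_eq_square)
  finally have "k + card Bk \<le> 5 * N\<^sup>2" .
  moreover have "card H \<le> N\<^sup>2"
    using card_UN_bound[of Z hyp 1] Z Qz(6) unfolding H_def by (force simp: Z_def)
  moreover have "finite H" using Z(1) Qz(5) by (auto simp: H_def)
  moreover have "\<forall>h\<in>H. proper h" using Qz(7) by (force simp: H_def)
  moreover have "crossed H Bk"
    unfolding crossed_def
  proof (intro ballI impI)
    fix X Y assume XY: "X \<in> pieces Bk" "Y \<in> pieces Bk" "fst X \<noteq> fst Y"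
    have B0Bk: "B0 \<subseteq> Bk" by (auto simp: Bk_def)
    obtain X0 where X0: "X0 \<in> pieces B0" "sub X X0" "edges X \<inter> Bk = {}" using parent_refine[OF B0Bk XY(1)] by metis
    obtain Y0 where Y0: "Y0 \<in> pieces B0" "sub Y Y0" "edges Y \<inter> Bk = {}" using parent_refine[OF B0Bk XY(2)] by metis
    have z: "(X0, Y0) \<in> Z" using X0 Y0 by (simp add: Z_def)
    then have "edges X \<inter> cut (X0, Y0) = {}" "edges Y \<inter> cut (X0, Y0) = {}"
      using X0(3) Y0(3) unfolding Bk_def by blast+
    from Qz(8)[OF z X0(2) Y0(2) this] Qz(7)[OF z] z fst_sub[OF X0(2)] fst_sub[OF Y0(2)]
    show "avoid X Y \<or> (\<exists>h\<in>H. fst X \<in> cols h \<and> fst Y \<in> cols h \<and> inside h X \<and> inside h Y)"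
      unfolding H_def by fastforce
  qed
  moreover have "B0 \<subseteq> Bk" "Bk \<subseteq> slots" using cut B0s unfolding Bk_def by blast+
  ultimately show ?thesis by blast
qed

section \<open>Closing the set of colours of each piece under the hyperplanes through it\<close>

subsection \<open>Saturation\<close>

definition rel :: "hyperplane set \<Rightarrow> interval \<Rightarrow> nat \<Rightarrow> nat \<Rightarrow> bool" where
  "rel H X i j \<longleftrightarrow> (\<exists>h\<in>H. i \<in> cols h \<and> j \<in> cols h \<and> inside h X)"

text \<open>The colours reachable from \<open>fst X\<close> by \<open>rel H X\<close> are those whose distance is monotone along \<open>X\<close>
  because of the hyperplanes that contain \<open>X\<close>. Cutting extends their exploration by one step.\<close>

definition decided_upto :: "hyperplane set \<Rightarrow> nat \<Rightarrow> (nat \<times> nat) set \<Rightarrow> bool" where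
  "decided_upto H r Bk \<longleftrightarrow> (\<forall>X\<in>pieces Bk. \<forall>m<r. \<forall>i. (rel H X ^^ m) (fst X) i \<longrightarrow>
     (\<forall>h\<in>H. i \<in> cols h \<longrightarrow> inside h X \<or> beside h X))"

lemma rel_monot:
  assumes "\<forall>h\<in>H. proper h" "ivl X" "monot i X" "rel H X i j"
  shows "monot j X"
  using assms inside_monot unfolding rel_def by blast

lemma relpowp_monot:
  assumes "\<forall>h\<in>H. proper h" "ivl X" "monot i X" "(rel H X ^^ m) i j"
  shows "monot j X"
  using assms(4)
proof (induction m arbitrary: j)
  case (Suc m)
  then show ?case using rel_monot[OF assms(1,2)] by auto
qed (use assms in auto)

text \<open>A colour reached within \<open>r\<close> steps is monotone along the piece, so two cuts
  per hyperplane decide all hyperplanes through that colour. The smaller pieces do not reach new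
  colours within \<open>r\<close> steps: if one of them lies inside a hyperplane that was already
  decided for its parent, the parent cannot be beside it and is therefore inside as well.\<close>

lemma saturation_round:
  assumes H: "finite H" "\<forall>h\<in>H. proper h" and Bk: "B0 \<subseteq> Bk" "Bk \<subseteq> slots" "decided_upto H r Bk"
  shows "\<exists>Bk'. Bk \<subseteq> Bk' \<and> Bk' \<subseteq> slots \<and> k + card Bk' \<le> (1 + 2 * card H) * (k + card Bk) \<and> decided_upto H (Suc r) Bk'"
proof -
  define Z where "Z = {(X, h). X \<in> pieces Bk \<and> h \<in> H \<and> (\<exists>i\<in>cols h. monot i X)}"
  have Zs: "Z \<subseteq> pieces Bk \<times> H" by (auto simp: Z_def)
  have fin: "finite (pieces Bk \<times> H)" using card_pieces[OF Bk(2)] H(1) by simp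
  then have Z: "finite Z" using Zs finite_subset by blast
  have "card Z \<le> card (pieces Bk) * card H" using card_mono[OF fin Zs] by (simp add: card_cartesian_product)
  also have "\<dots> \<le> (k + card Bk) * card H" using card_pieces[OF Bk(2)] by (intro mult_le_mono1) auto
  finally have cardZ: "card Z \<le> (k + card Bk) * card H" .
  have "\<exists>S. S \<subseteq> edges X \<and> card S \<le> 2 \<and> (\<forall>Y. sub Y X \<and> edges Y \<inter> S = {} \<longrightarrow> inside h Y \<or> beside h Y)"
    if "(X, h) \<in> Z" for X h
    using that hyperplane_cut[OF piece_ivl[of X Bk], of h] H(2) unfolding Z_def by blast
  then have "\<forall>z\<in>Z. \<exists>S. S \<subseteq> edges (fst z) \<and> card S \<le> 2 \<and>
      (\<forall>Y. sub Y (fst z) \<and> edges Y \<inter> S = {} \<longrightarrow> inside (snd z) Y \<or> beside (snd z) Y)" by auto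
  then obtain cut where cut: "\<And>z. z \<in> Z \<Longrightarrow> cut z \<subseteq> edges (fst z) \<and> card (cut z) \<le> 2 \<and>
      (\<forall>Y. sub Y (fst z) \<and> edges Y \<inter> cut z = {} \<longrightarrow> inside (snd z) Y \<or> beside (snd z) Y)"
    by metis
  define Bk' where "Bk' = Bk \<union> (\<Union>z\<in>Z. cut z)"
  have sub: "Bk \<subseteq> Bk'" by (auto simp: Bk'_def)
  moreover have "Bk' \<subseteq> slots"
  proof -
    have "cut z \<subseteq> slots" if "z \<in> Z" for z
    proof -
      have "ivl (fst z)" using that piece_ivl by (auto simp: Z_def)
      then show ?thesis using edges_slots cut[OF that] by blast
    qed
    then show ?thesis unfolding Bk'_def using Bk(2) by blast
  qed
  moreover have "k + card Bk' \<le> (1 + 2 * card H) * (k + card Bk)"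
  proof -
    have "card Bk' \<le> card Bk + card (\<Union>z\<in>Z. cut z)" unfolding Bk'_def by (rule card_Un_le)
    also have "card (\<Union>z\<in>Z. cut z) \<le> 2 * card Z" using cut by (intro card_UN_bound Z) auto
    finally have "k + card Bk' \<le> (k + card Bk) + 2 * ((k + card Bk) * card H)" using cardZ by simp
    then show ?thesis by (simp add: algebra_simps)
  qed
  moreover have "decided_upto H (Suc r) Bk'"
    unfolding decided_upto_def
  proof (intro ballI allI impI)
    fix Y m i h
    assume Y: "Y \<in> pieces Bk'" and m: "m < Suc r" "(rel H Y ^^ m) (fst Y) i" and h: "h \<in> H" "i \<in> cols h"
    obtain X where X: "X \<in> pieces Bk" "sub Y X" "edges Y \<inter> Bk' = {}" "ivl X" using parent_refine[OF sub Y] by metis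
    have f: "fst Y = fst X" using fst_sub[OF X(2)] .
    have lift: "(rel H X ^^ m') (fst X) j" if "m' \<le> r" "(rel H Y ^^ m') (fst Y) j" for m' j
      using that
    proof (induction m' arbitrary: j)
      case (Suc m')
      then obtain i' where i': "(rel H Y ^^ m') (fst Y) i'" "rel H Y i' j" by auto
      then have X': "(rel H X ^^ m') (fst X) i'" using Suc by simp
      obtain h' where h': "h' \<in> H" "i' \<in> cols h'" "j \<in> cols h'" "inside h' Y" using i'(2) by (auto simp: rel_def)
      have "inside h' X \<or> beside h' X"
        using Bk(3) X(1) X' h' Suc.prems(1) unfolding decided_upto_def by (metis Suc_le_lessD)
      then have "inside h' X" using not_inside_beside[OF X(2) h'(4)] by blast
      then have "rel H X i' j" using h' by (auto simp: rel_def)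
      with X' show ?case by auto
    qed (use f in auto)
    have "(rel H X ^^ m) (fst X) i" using lift m by simp
    then have "monot i X" using relpowp_monot[OF H(2) X(4) piece_rise(2)[OF Bk(1) X(1)]] by blast
    then have "(X, h) \<in> Z" using X(1) h by (auto simp: Z_def)
    moreover from this have "edges Y \<inter> cut (X, h) = {}" using X(3) unfolding Bk'_def by blast
    ultimately show "inside h Y \<or> beside h Y" using cut[of "(X, h)"] X(2) unfolding fst_conv snd_conv by blast
  qed
  ultimately show ?thesis by blast
qed

lemma saturation:
  assumes H: "finite H" "\<forall>h\<in>H. proper h" and Bk: "B0 \<subseteq> Bk" "Bk \<subseteq> slots"
  shows "\<exists>Bk'. Bk \<subseteq> Bk' \<and> Bk' \<subseteq> slots \<and> k + card Bk' \<le> (1 + 2 * card H) ^ r * (k + card Bk) \<and> decided_upto H r Bk'"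
proof (induction r)
  case 0
  show ?case using Bk by (intro exI[of _ Bk]) (auto simp: decided_upto_def)
next
  case (Suc r)
  then obtain B1 where B1: "Bk \<subseteq> B1" "B1 \<subseteq> slots" "k + card B1 \<le> (1 + 2 * card H) ^ r * (k + card Bk)" "decided_upto H r B1"
    by blast
  obtain B2 where B2: "B1 \<subseteq> B2" "B2 \<subseteq> slots" "k + card B2 \<le> (1 + 2 * card H) * (k + card B1)" "decided_upto H (Suc r) B2"
    using saturation_round[OF H _ B1(2,4)] Bk(1) B1(1) by blast
  have "k + card B2 \<le> (1 + 2 * card H) * ((1 + 2 * card H) ^ r * (k + card Bk))"
    using B2(3) mult_le_mono2[OF B1(3)] le_trans by blast
  then have "k + card B2 \<le> (1 + 2 * card H) ^ Suc r * (k + card Bk)" by (simp only: power_Suc mult.assoc)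
  then show ?case using B1(1) B2(1,2,4) by (intro exI[of _ B2]) blast
qed

text \<open>The two pieces share a colour, given by the common path or by the hyperplane that
  contains both. From there the chain of hyperplanes around \<open>X\<close> can be copied to
  \<open>Y\<close> step by step: the next hyperplane contains \<open>X\<close> and involves a colour
  along which \<open>Y\<close> is monotone, so it contains \<open>Y\<close> or \<open>Y\<close> is
  beside it, and in the latter case the pieces would avoid each other.\<close>

lemma labels_agree:
  assumes H: "\<forall>h\<in>H. proper h" and Bk: "B0 \<subseteq> Bk" "decided_upto H k Bk" "crossed H Bk"
    and XY: "X \<in> pieces Bk" "Y \<in> pieces Bk" "\<not> avoid X Y"
  shows "(rel H X)\<^sup>*\<^sup>* (fst X) j \<Longrightarrow> (rel H Y)\<^sup>*\<^sup>* (fst Y) j"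
proof -
  have iv: "ivl X" "ivl Y" using XY piece_ivl by auto
  have fk: "fst X < k" "fst Y < k" using iv by (auto simp: ivl_def)
  have sym: "symp (rel H X)" by (auto simp: symp_def rel_def)
  have dec: "inside h Z \<or> beside h Z"
    if Z: "Z \<in> pieces Bk" "(rel H Z)\<^sup>*\<^sup>* (fst Z) i" "h \<in> H" "i \<in> cols h" for Z i h
  proof -
    have "fst Z < k" using piece_ivl[OF Z(1)] by (auto simp: ivl_def)
    moreover have "y < k" if "rel H Z x y" for x y using that H by (auto simp: rel_def proper_def cols_def)
    \<comment> \<open>A chain among \<open>k\<close> colours can be shortened to fewer than
      \<open>k\<close> steps, so \<open>k\<close> rounds of cuts have decided every colour that is
      reachable at all.\<close>
    ultimately obtain m f where m: "m < card {..<k}" "f 0 = fst Z" "f m = i" "\<And>t. t < m \<Longrightarrow> rel H Z (f t) (f (Suc t))"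
      using relpowp_short[OF Z(2), of "{..<k}"] by (metis finite_lessThan lessThan_iff)
    then have "(rel H Z ^^ m) (fst Z) i" unfolding relpowp_fun_conv by blast
    then show ?thesis using Bk(2) Z m(1) unfolding decided_upto_def by auto
  qed
  have mon: "monot i Z" if "Z \<in> pieces Bk" "(rel H Z)\<^sup>*\<^sup>* (fst Z) i" for Z i
    using that relpowp_monot[OF H piece_ivl piece_rise(2)[OF Bk(1)]] by (metis rtranclp_power)
  obtain i where i: "(rel H X)\<^sup>*\<^sup>* (fst X) i" "(rel H Y)\<^sup>*\<^sup>* (fst Y) i"
  proof (cases "fst X = fst Y")
    case True
    then show thesis using that[of "fst X"] by simp
  next
    case False
    then obtain h where h: "h \<in> H" "fst X \<in> cols h" "fst Y \<in> cols h" "inside h X" "inside h Y"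
      using Bk(3) XY unfolding crossed_def by blast
    then have "rel H X (fst X) (fst Y)" by (auto simp: rel_def)
    then show thesis using that[of "fst Y"] by auto
  qed
  assume j: "(rel H X)\<^sup>*\<^sup>* (fst X) j"
  have "(rel H X)\<^sup>*\<^sup>* i (fst X)" using i(1) sym by (metis symp_rtranclp sympD)
  then have "(rel H X)\<^sup>*\<^sup>* i j" using j by simp
  then show "(rel H Y)\<^sup>*\<^sup>* (fst Y) j"
  proof (induction rule: rtranclp_induct)
    case base
    show ?case by (rule i(2))
  next
    case (step y z)
    obtain h where h: "h \<in> H" "y \<in> cols h" "z \<in> cols h" "inside h X" using step.hyps(2) by (auto simp: rel_def)
    have Xy: "(rel H X)\<^sup>*\<^sup>* (fst X) y" using i(1) step.hyps(1) by simp
    have "\<not> beside h Y"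
      using inside_beside_avoid[OF iv _ h(2) mon[OF XY(1) Xy] h(4) h(2) mon[OF XY(2) step.IH]] H h(1) XY(3) by blast
    then have "inside h Y" using dec[OF XY(2) step.IH h(1,2)] by blast
    then have "rel H Y y z" using h by (auto simp: rel_def)
    with step.IH show ?case by simp
  qed
qed

text \<open>A single path needs no cuts beyond \<open>B0\<close>. This case is kept apart for the
  sake of the final constant: for \<open>k = 1\<close> and \<open>C \<le> 1\<close> the base of the
  final power is 1, which absorbs no factor.\<close>

lemma labelling:
  defines "N \<equiv> k + card B0"
  shows "\<exists>Bk \<chi>. B0 \<subseteq> Bk \<and> Bk \<subseteq> slots \<and> k + card Bk \<le> (if k = 1 then N else (5 * N\<^sup>2) ^ Suc k) \<and>
    (\<forall>X\<in>pieces Bk. \<chi> X < k \<and> monot (\<chi> X) X \<and> (\<forall>Y\<in>pieces Bk. avoid X Y \<or> \<chi> X = \<chi> Y))"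
proof (cases "k = 1")
  case True
  have fst0: "fst X = 0" if "X \<in> pieces B0" for X
  proof -
    have "fst X < k" using piece_ivl[OF that] by (auto simp: ivl_def)
    then show ?thesis using True by simp
  qed
  have "monot 0 X" if "X \<in> pieces B0" for X
    using piece_rise(2)[OF order_refl that] fst0[OF that] by simp
  moreover have "0 < k" "k + card B0 \<le> (if k = 1 then N else (5 * N\<^sup>2) ^ Suc k)" using True by (simp_all add: N_def)
  moreover have "B0 \<subseteq> slots" using B0 by (simp add: slots_def)
  ultimately show ?thesis
    by (intro exI[of _ B0] exI[of _ "\<lambda>_. 0"]) blast
next
  case False
  obtain B1 H where B1: "B0 \<subseteq> B1" "B1 \<subseteq> slots" "k + card B1 \<le> 5 * N\<^sup>2" "finite H" "card H \<le> N\<^sup>2"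
    "\<forall>h\<in>H. proper h" "crossed H B1"
    using base_crossings unfolding N_def by blast
  obtain Bk where Bk: "B1 \<subseteq> Bk" "Bk \<subseteq> slots" "k + card Bk \<le> (1 + 2 * card H) ^ k * (k + card B1)" "decided_upto H k Bk"
    using saturation[OF B1(4,6,1,2)] by blast
  \<comment> \<open>The predicate under \<open>SOME\<close> is the set of reachable colours, so
    pieces with the same set get the same colour.\<close>
  define \<chi> where "\<chi> = (\<lambda>X. SOME j. (rel H X)\<^sup>*\<^sup>* (fst X) j)"
  have \<chi>: "(rel H X)\<^sup>*\<^sup>* (fst X) (\<chi> X)" for X
    unfolding \<chi>_def by (rule someI[of _ "fst X"]) simp
  have B0k: "B0 \<subseteq> Bk" using B1 Bk by blast
  have "\<chi> X < k \<and> monot (\<chi> X) X \<and> (\<forall>Y\<in>pieces Bk. avoid X Y \<or> \<chi> X = \<chi> Y)" if X: "X \<in> pieces Bk" for X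
  proof (intro conjI ballI)
    have "fst X < k" using piece_ivl[OF X] by (auto simp: ivl_def)
    with \<chi>[of X] show "\<chi> X < k"
      by (induction rule: rtranclp_induct) (use B1(6) in \<open>auto simp: rel_def proper_def cols_def\<close>)
    obtain m where "(rel H X ^^ m) (fst X) (\<chi> X)" using \<chi>[of X] by (auto simp: rtranclp_power)
    then show "monot (\<chi> X) X" by (rule relpowp_monot[OF B1(6) piece_ivl[OF X] piece_rise(2)[OF B0k X]])
    fix Y assume Y: "Y \<in> pieces Bk"
    show "avoid X Y \<or> \<chi> X = \<chi> Y"
    proof (cases "avoid X Y")
      case False
      then have "\<not> avoid X Y" "\<not> avoid Y X" using avoid_sym by blast+
      note la = labels_agree[OF B1(6) B0k Bk(4) crossed_refine[OF B1(7) Bk(1)]]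
      have "(rel H X)\<^sup>*\<^sup>* (fst X) = (rel H Y)\<^sup>*\<^sup>* (fst Y)"
        using la[OF X Y \<open>\<not> avoid X Y\<close>] la[OF Y X \<open>\<not> avoid Y X\<close>] by (intro ext) blast
      then show ?thesis by (simp add: \<chi>_def)
    qed simp
  qed
  moreover have "k + card Bk \<le> (5 * N\<^sup>2) ^ Suc k"
  proof (cases "k = 0")
    case True
    then have "slots = {}" unfolding slots_def by auto
    then have "Bk = {}" using Bk(2) by blast
    then show ?thesis using True by simp
  next
    case False
    then have "1 \<le> N\<^sup>2" by (simp add: N_def)
    then have "1 + 2 * card H \<le> 5 * N\<^sup>2" using B1(5) by linarith
    then have "(1 + 2 * card H) ^ k * (k + card B1) \<le> (5 * N\<^sup>2) ^ k * (5 * N\<^sup>2)"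
      using B1(3) by (intro mult_le_mono power_mono) auto
    then show ?thesis using Bk(3) unfolding power_Suc2 by linarith
  qed
  ultimately show ?thesis using False B0k Bk(2) by (intro exI[of _ Bk] exI[of _ \<chi>]) auto
qed

end

section \<open>The pebble game: its invariant, soundness and completeness\<close>

section \<open>The pebble game\<close>

context ugraph
begin

text \<open>Among the unfinished pebbles of one colour only one that is closest to the source of the colour
  may move. Hence no pebble can enter a vertex that another pebble of its colour has left.\<close>

definition move :: "(nat \<Rightarrow> 'a) \<Rightarrow> 'i set \<Rightarrow> ('i \<Rightarrow> nat) \<Rightarrow> 'a set \<Rightarrow> ('i \<Rightarrow> 'a) \<Rightarrow> ('i \<Rightarrow> 'a) \<Rightarrow> ('i \<Rightarrow> 'a) \<Rightarrow> bool" where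
  "move src Ix col G b z z' \<longleftrightarrow> (\<exists>i\<in>Ix. z i \<noteq> b i \<and> up (src (col i)) (z i) (z' i) \<and>
     (z' i = b i \<or> (z' i \<notin> G \<and> (\<forall>j\<in>Ix. j \<noteq> i \<longrightarrow> z' i \<noteq> z j))) \<and> (\<forall>j\<in>Ix. j \<noteq> i \<longrightarrow> z' j = z j) \<and>
     (\<forall>j\<in>Ix. col j = col i \<and> z j \<noteq> b j \<and> E\<^sup>*\<^sup>* (src (col i)) (z j) \<longrightarrow>
        dist (src (col i)) (z i) \<le> dist (src (col i)) (z j)))"

text \<open>The invariant of a play, where \<open>W i\<close> is the trail of pebble
  \<open>i\<close>. A pebble that rests in \<open>G\<close> away from its target has not moved yet.
  Trails of equal colour meet only in \<open>G\<close>, and a vertex that some pebble has left is no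
  farther from the source than any unfinished pebble of that colour. The reachability premise
  excludes meaningless distances.\<close>

definition tracks :: "(nat \<Rightarrow> 'a) \<Rightarrow> 'i set \<Rightarrow> ('i \<Rightarrow> nat) \<Rightarrow> 'a set \<Rightarrow> ('i \<Rightarrow> 'a) \<Rightarrow> ('i \<Rightarrow> 'a) \<Rightarrow>
    ('i \<Rightarrow> 'a) \<Rightarrow> ('i \<Rightarrow> 'a list) \<Rightarrow> bool" where
  "tracks src Ix col G a b z W \<longleftrightarrow>
    (\<forall>i\<in>Ix. W i \<noteq> [] \<and> hd (W i) = a i \<and> last (W i) = z i \<and> successively (up (src (col i))) (W i) \<and>
       set (butlast (tl (W i))) \<inter> G = {} \<and> (z i \<in> G \<and> z i \<noteq> b i \<longrightarrow> tl (W i) = [])) \<and>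
    (\<forall>i\<in>Ix. \<forall>j\<in>Ix. i \<noteq> j \<and> col i = col j \<longrightarrow> set (tl (W i)) \<inter> set (tl (W j)) \<subseteq> G \<and>
       (z j \<noteq> b j \<and> E\<^sup>*\<^sup>* (src (col j)) (z j) \<longrightarrow> (\<forall>v\<in>set (butlast (W i)). dist (src (col i)) v \<le> dist (src (col i)) (z j))))"

text \<open>Suppose pebble \<open>i\<close> enters a vertex outside \<open>G\<close> on the trail of
  \<open>l\<close>. The vertex is not occupied, so \<open>l\<close> has left it, and by the
  invariant it is no farther from the source than \<open>i\<close> was before its move. But the move
  increases that distance.\<close>

lemma tracks_move:
  assumes T: "tracks src Ix col G a b z W" and m: "move src Ix col G b z z'" and b: "\<And>i. i \<in> Ix \<Longrightarrow> b i \<in> G"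
  shows "\<exists>W'. tracks src Ix col G a b z' W'"
proof -
  obtain i where i: "i \<in> Ix" "z i \<noteq> b i" "up (src (col i)) (z i) (z' i)"
    "z' i = b i \<or> (z' i \<notin> G \<and> (\<forall>j\<in>Ix. j \<noteq> i \<longrightarrow> z' i \<noteq> z j))" "\<And>j. j \<in> Ix \<Longrightarrow> j \<noteq> i \<Longrightarrow> z' j = z j"
    "\<And>j. j \<in> Ix \<Longrightarrow> col j = col i \<Longrightarrow> z j \<noteq> b j \<Longrightarrow> E\<^sup>*\<^sup>* (src (col i)) (z j) \<Longrightarrow> dist (src (col i)) (z i) \<le> dist (src (col i)) (z j)"
    using m unfolding move_def by blast
  note T1 = T[unfolded tracks_def, THEN conjunct1, rule_format]
  note T2 = T[unfolded tracks_def, THEN conjunct2, rule_format]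
  define W' where "W' = W(i := W i @ [z' i])"
  have Wi: "W i \<noteq> []" "last (W i) = z i" using T1[OF i(1)] by auto
  have split: "W i = butlast (W i) @ [z i]" using Wi by (metis append_butlast_last_id)
  have tlW: "tl (W i) = [] \<or> tl (W i) = butlast (tl (W i)) @ [z i]"
    using Wi by (metis append_butlast_last_id last_tl)
  have d: "dist (src (col i)) (z' i) = Suc (dist (src (col i)) (z i))" and ri: "E\<^sup>*\<^sup>* (src (col i)) (z i)"
    using i(3) by (simp_all add: up_def)
  have "tracks src Ix col G a b z' W'"
    unfolding tracks_def
  proof (intro conjI ballI impI)
    fix j assume j: "j \<in> Ix"
    show "W' j \<noteq> []" "hd (W' j) = a j" "last (W' j) = z' j"
      using T1[OF j] i(5)[OF j] by (auto simp: W'_def)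
    show "successively (up (src (col j))) (W' j)"
      using T1[OF j] i(3) by (auto simp: W'_def successively_append_iff)
    show "set (butlast (tl (W' j))) \<inter> G = {}"
    proof (cases "j = i")
      case True
      have "butlast (tl (W' i)) = tl (W i)" using Wi by (simp add: W'_def butlast_append)
      moreover have "set (tl (W i)) \<inter> G = {}"
        using tlW T1[OF i(1)] i(2) by (metis Int_insert_left_if0 Un_empty_right empty_set inf_bot_left insert_is_Un list.simps(15) set_append sup_commute)
      ultimately show ?thesis using True by simp
    qed (use T1[OF j] in \<open>simp add: W'_def\<close>)
    show "tl (W' j) = []" if "z' j \<in> G \<and> z' j \<noteq> b j"
      using that T1[OF j] i(4) i(5)[OF j] by (cases "j = i") (auto simp: W'_def)
  next
    fix j l assume jl: "j \<in> Ix" "l \<in> Ix" "j \<noteq> l \<and> col j = col l"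
    have key: "set (tl (W i @ [z' i])) \<inter> set (tl (W l)) \<subseteq> G" if l: "l \<in> Ix" "l \<noteq> i" "col l = col i" for l
    proof -
      have "z' i \<in> G" if v: "z' i \<in> set (tl (W l))"
      proof (rule ccontr)
        assume nG: "z' i \<notin> G"
        then have ne: "z' i \<noteq> z l" using i(4) b[OF i(1)] l by metis
        have "W l = butlast (W l) @ [z l]" using T1[OF l(1)] by (metis append_butlast_last_id)
        moreover have "z' i \<in> set (W l)" using v by (metis list.set_sel(2) list.sel(2))
        ultimately have "z' i \<in> set (butlast (W l))" using ne by (metis Un_iff empty_iff empty_set insert_iff list.simps(15) set_append)
        then have "dist (src (col i)) (z' i) \<le> dist (src (col i)) (z i)"
          using T2[of l i] l i(1,2) ri by auto
        then show False using d by simp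
      qed
      moreover have "set (tl (W i)) \<inter> set (tl (W l)) \<subseteq> G" using T2[of i l] l i(1) by auto
      moreover have "tl (W i @ [z' i]) = tl (W i) @ [z' i]" using Wi by simp
      ultimately show ?thesis by auto
    qed
    show "set (tl (W' j)) \<inter> set (tl (W' l)) \<subseteq> G"
      using key[of l] key[of j] T2[of j l] jl by (cases "j = i"; cases "l = i") (auto simp: W'_def)
    show "dist (src (col j)) v \<le> dist (src (col j)) (z' l)" if zl: "z' l \<noteq> b l \<and> E\<^sup>*\<^sup>* (src (col l)) (z' l)" and v: "v \<in> set (butlast (W' j))" for v
    proof (cases "j = i")
      case True
      then have l: "l \<noteq> i" "z' l = z l" using jl i(5) by auto
      have "butlast (W' j) = W i" using True by (simp add: W'_def)
      then have "v \<in> set (butlast (W i)) \<or> v = z i" using v split by (metis Un_iff empty_iff empty_set insert_iff list.simps(15) set_append)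
      \<comment> \<open>For the vertex that \<open>i\<close> leaves just now the bound is the rule
        that only a closest pebble moves.\<close>
      then show ?thesis
        using T2[of i l] i(1) i(6)[of l] jl l zl True by auto
    next
      case False
      then have W': "W' j = W j" by (simp add: W'_def)
      show ?thesis
      proof (cases "l = i")
        case True
        then have "dist (src (col j)) v \<le> dist (src (col j)) (z i)" using T2[of j i] jl i(1,2) v W' ri by auto
        then show ?thesis using d True jl by simp
      next
        case False
        then have "z' l = z l" using i(5) jl by auto
        then show ?thesis using T2[of j l] jl zl v W' by auto
      qed
    qed
  qed
  then show ?thesis by blast
qed

text \<open>Disjointness is claimed for equal colours only; pieces of different colours are to be
  kept apart by a separate condition on their geodesics.\<close>

lemma game_sound:
  assumes "(move src Ix col G b)\<^sup>*\<^sup>* a z" "\<And>i. i \<in> Ix \<Longrightarrow> z i = b i" and b: "\<And>i. i \<in> Ix \<Longrightarrow> b i \<in> G"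
  obtains W where "\<And>i. i \<in> Ix \<Longrightarrow> W i \<noteq> [] \<and> hd (W i) = a i \<and> last (W i) = b i \<and>
      successively (up (src (col i))) (W i) \<and> set (butlast (tl (W i))) \<inter> G = {}"
    "\<And>i j. i \<in> Ix \<Longrightarrow> j \<in> Ix \<Longrightarrow> i \<noteq> j \<Longrightarrow> col i = col j \<Longrightarrow> set (butlast (tl (W i))) \<inter> set (butlast (tl (W j))) = {}"
proof -
  have "\<exists>W. tracks src Ix col G a b z W"
    using assms(1)
  proof (induction rule: rtranclp_induct)
    case base
    show ?case by (rule exI[of _ "\<lambda>i. [a i]"]) (auto simp: tracks_def)
  next
    case (step y z)
    then show ?case using tracks_move b by blast
  qed
  then obtain W where W: "tracks src Ix col G a b z W" by blast
  note T1 = W[unfolded tracks_def, THEN conjunct1, rule_format]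
  note T2 = W[unfolded tracks_def, THEN conjunct2, rule_format]
  show thesis
  proof (rule that[of W])
    show "i \<in> Ix \<Longrightarrow> W i \<noteq> [] \<and> hd (W i) = a i \<and> last (W i) = b i \<and>
      successively (up (src (col i))) (W i) \<and> set (butlast (tl (W i))) \<inter> G = {}" for i
      using T1[of i] assms(2)[of i] by auto
    show "set (butlast (tl (W i))) \<inter> set (butlast (tl (W j))) = {}"
      if "i \<in> Ix" "j \<in> Ix" "i \<noteq> j" "col i = col j" for i j
    proof -
      have "set (butlast (tl (W i))) \<inter> set (butlast (tl (W j))) \<subseteq> set (tl (W i)) \<inter> set (tl (W j))"
        by (auto dest: in_set_butlastD)
      then show ?thesis using T1[OF that(1)] T2[of i j] that by blast
    qed
  qed
qed

lemma successively_up: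
  "successively (up s) (x # xs) \<Longrightarrow> t \<le> length xs \<Longrightarrow> dist s ((x # xs) ! t) = dist s x + t \<and> (up s ^^ t) x ((x # xs) ! t)"
proof (induction t)
  case (Suc t)
  then have "up s ((x # xs) ! t) ((x # xs) ! Suc t)"
    by (simp add: successively_conv_nth)
  moreover have IH: "dist s ((x # xs) ! t) = dist s x + t \<and> (up s ^^ t) x ((x # xs) ! t)" using Suc by simp
  ultimately have "(up s ^^ Suc t) x ((x # xs) ! Suc t)" by (meson relpowp_Suc_I)
  moreover have "dist s ((x # xs) ! Suc t) = dist s x + Suc t"
    using \<open>up s ((x # xs) ! t) ((x # xs) ! Suc t)\<close> IH by (simp add: up_def)
  ultimately show ?case by blast
qed simp

lemma successively_up_distinct:
  assumes "successively (up s) w"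
  shows "distinct w"
proof (cases w)
  case (Cons x xs)
  have "w ! i \<noteq> w ! j" if "i < length w" "j < length w" "i \<noteq> j" for i j
    using successively_up[of s x xs i] successively_up[of s x xs j] assms that unfolding Cons
    by (metis (no_types, lifting) add_left_cancel length_Cons less_Suc_eq_le)
  then show ?thesis by (auto simp: distinct_conv_nth)
qed simp

lemma successively_relpowp:
  assumes "successively R w" "i \<le> j" "j < length w"
  shows "(R ^^ (j - i)) (w ! i) (w ! j)"
  unfolding relpowp_fun_conv using assms
  by (intro exI[of _ "\<lambda>t. w ! (i + t)"]) (auto simp: successively_conv_nth)

end

text \<open>Among the unfinished pebbles of some colour, one that is closest to the source advances
  along its prescribed geodesic. The total remaining length decreases, and disjointness of inner
  vertices guarantees that each vertex entered before the target is free. \<open>VV\<close> confines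
  the positions to the set over which the algorithm can loop.\<close>

lemma (in ugraph) game_complete:
  fixes W :: "'i \<Rightarrow> nat \<Rightarrow> 'a"
  assumes fin: "finite Ix"
    and up: "\<And>i t. i \<in> Ix \<Longrightarrow> t < l i \<Longrightarrow> up (src (col i)) (W i t) (W i (Suc t))"
    and inner: "\<And>i t. i \<in> Ix \<Longrightarrow> 0 < t \<Longrightarrow> t < l i \<Longrightarrow> W i t \<notin> G"
    and disj: "\<And>i j t t'. i \<in> Ix \<Longrightarrow> j \<in> Ix \<Longrightarrow> i \<noteq> j \<Longrightarrow> 0 < t \<Longrightarrow> t < l i \<Longrightarrow> t' \<le> l j \<Longrightarrow> W i t \<noteq> W j t'"
    and VV: "\<And>i t. i \<in> Ix \<Longrightarrow> t \<le> l i \<Longrightarrow> W i t \<in> VV"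
    and b: "\<And>i. i \<in> Ix \<Longrightarrow> b i = W i (l i)"
    and z: "\<And>i. i \<in> Ix \<Longrightarrow> z i = W i (\<tau> i) \<and> \<tau> i \<le> l i"
  shows "\<exists>z'. (\<lambda>z z'. move src Ix col G b z z' \<and> (\<forall>i\<in>Ix. z i \<in> VV \<and> z' i \<in> VV))\<^sup>*\<^sup>* z z' \<and> (\<forall>i\<in>Ix. z' i = b i)"
  using z
proof (induction "\<Sum>i\<in>Ix. l i - \<tau> i" arbitrary: z \<tau> rule: less_induct)
  case less
  note z = less.prems
  have inj: "W i t \<noteq> W i t'" if "i \<in> Ix" "t < t'" "t' \<le> l i" for i t t'
  proof -
    have "dist (src (col i)) (W i (t + m)) = dist (src (col i)) (W i t) + m" if "t + m \<le> l i" for m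
      using that
    proof (induction m)
      case (Suc m)
      then show ?case using up[OF \<open>i \<in> Ix\<close>, of "t + m"] by (simp add: up_def)
    qed simp
    from this[of "t' - t"] that show ?thesis by auto
  qed
  show ?case
  proof (cases "\<forall>i\<in>Ix. \<tau> i = l i")
    case True
    then show ?thesis using z b by (intro exI[of _ z]) auto
  next
    case False
    then obtain i0 where i0: "i0 \<in> Ix" "\<tau> i0 < l i0" using z by (meson le_neq_implies_less)
    define U where "U = {i \<in> Ix. col i = col i0 \<and> \<tau> i < l i}"
    define dd where "dd = (\<lambda>i. dist (src (col i0)) (W i (\<tau> i)))"
    have U: "finite U" "U \<noteq> {}" using fin i0 by (auto simp: U_def)
    define i where "i = arg_min_on dd U"
    have iU: "i \<in> U" and min: "\<And>j. j \<in> U \<Longrightarrow> dd i \<le> dd j"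
      using arg_min_if_finite[OF U, of dd] by (auto simp: i_def not_less)
    then have i: "i \<in> Ix" "col i = col i0" "\<tau> i < l i" by (auto simp: U_def)
    define z1 where "z1 = z(i := W i (Suc (\<tau> i)))"
    define \<tau>1 where "\<tau>1 = \<tau>(i := Suc (\<tau> i))"
    have z1: "z1 j = W j (\<tau>1 j) \<and> \<tau>1 j \<le> l j" if "j \<in> Ix" for j
      using z[OF that] i by (auto simp: z1_def \<tau>1_def)
    have less_sum: "(\<Sum>j\<in>Ix. l j - \<tau>1 j) < (\<Sum>j\<in>Ix. l j - \<tau> j)"
      by (rule sum_strict_mono_ex1[OF fin]) (use i in \<open>auto simp: \<tau>1_def intro!: bexI[of _ i]\<close>)
    have "move src Ix col G b z z1"
      unfolding move_def
    proof (intro bexI[of _ i] conjI ballI impI)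
      show "z i \<noteq> b i" using inj[of i "\<tau> i" "l i"] i z b by auto
      show "up (src (col i)) (z i) (z1 i)" using up[of i "\<tau> i"] i z by (auto simp: z1_def)
      show "z1 i = b i \<or> (z1 i \<notin> G \<and> (\<forall>j\<in>Ix. j \<noteq> i \<longrightarrow> z1 i \<noteq> z j))"
      proof (cases "Suc (\<tau> i) = l i")
        case True
        then show ?thesis using b i by (auto simp: z1_def)
      next
        case False
        then have lt: "0 < Suc (\<tau> i)" "Suc (\<tau> i) < l i" using i by auto
        have "z1 i \<noteq> z j" if "j \<in> Ix" "j \<noteq> i" for j
          using disj[OF i(1) that(1) _ lt, of "\<tau> j"] that z[OF that(1)] by (auto simp: z1_def)
        then show ?thesis using inner[OF i(1) lt] by (auto simp: z1_def)
      qed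
      show "z1 j = z j" if "j \<in> Ix" "j \<noteq> i" for j using that by (simp add: z1_def)
      show "dist (src (col i)) (z i) \<le> dist (src (col i)) (z j)" if "j \<in> Ix" "col j = col i \<and> z j \<noteq> b j \<and> E\<^sup>*\<^sup>* (src (col i)) (z j)" for j
      proof -
        have "\<tau> j < l j" using z[OF that(1)] that b by (metis le_neq_implies_less)
        then have "j \<in> U" using that i by (simp add: U_def)
        from min[OF this] show ?thesis using z[OF that(1)] z[OF i(1)] i by (simp add: dd_def)
      qed
    qed (rule i(1))
    moreover have "\<forall>j\<in>Ix. z j \<in> VV \<and> z1 j \<in> VV" using z z1 VV by auto
    moreover obtain z' where "(\<lambda>z z'. move src Ix col G b z z' \<and> (\<forall>i\<in>Ix. z i \<in> VV \<and> z' i \<in> VV))\<^sup>*\<^sup>* z1 z'" "\<forall>i\<in>Ix. z' i = b i"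
      using less.hyps[OF less_sum z1] by blast
    ultimately show ?thesis
      by (intro exI[of _ z'] conjI, intro converse_rtranclp_into_rtranclp[of _ z z1]) auto
  qed
qed

section \<open>Certificates: end points, costs, colours and directions of the pieces, equivalent to
  solutions\<close>

section \<open>Certificates\<close>

locale terminals = ugraph E for E :: "'a \<Rightarrow> 'a \<Rightarrow> bool" +
  fixes VV :: "'a set" and k :: nat and C :: nat and s t :: "nat \<Rightarrow> 'a"
  assumes E_VV: "E u v \<Longrightarrow> v \<in> VV"
    and s_VV: "p < k \<Longrightarrow> s p \<in> VV"
begin

definition solution :: "(nat \<Rightarrow> 'a list) \<Rightarrow> bool" where
  "solution Q \<longleftrightarrow>
    (\<forall>p<k. Q p \<noteq> [] \<and> hd (Q p) = s p \<and> last (Q p) = t p \<and> successively E (Q p) \<and> distinct (Q p) \<and>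
       length (Q p) \<le> dist (s p) (t p) + C + 1) \<and>
    (\<forall>p<k. \<forall>p'<k. p \<noteq> p' \<longrightarrow> set (butlast (tl (Q p))) \<inter> set (Q p') = {})"

text \<open>Piece \<open>r\<close> of path \<open>p\<close> leads from \<open>x (p, r)\<close> to \<open>y (p, r)\<close>, and \<open>cost (p, Suc r)\<close> is the number
  of units that the edge from \<open>y (p, r)\<close> to \<open>x (p, Suc r)\<close> falls short of increasing the distance
  from \<open>s p\<close> by one.\<close>

definition Ix :: "(nat \<Rightarrow> nat) \<Rightarrow> (nat \<times> nat) set" where
  "Ix m = (SIGMA p:{..<k}. {..<m p})"

text \<open>Costs 0, 1 and 2 stand for edges that increase the distance, do not decrease it, or are
  arbitrary; no edge falls short by more than 2. A certificate may thus overstate a cost, which does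
  no harm in an upper bound on the length.\<close>

definition link :: "nat \<Rightarrow> nat \<Rightarrow> 'a \<Rightarrow> 'a \<Rightarrow> bool" where
  "link c p u v \<longleftrightarrow> E u v \<and> (c = 0 \<longrightarrow> up (s p) u v) \<and> (c = 1 \<longrightarrow> \<not> up (s p) v u)"

definition shape :: "(nat \<Rightarrow> nat) \<Rightarrow> (nat \<times> nat \<Rightarrow> nat) \<Rightarrow> (nat \<times> nat \<Rightarrow> nat) \<Rightarrow> bool" where
  "shape m cost col \<longleftrightarrow> (\<forall>p<k. 1 \<le> m p \<and> (\<Sum>r\<in>{1..<m p}. cost (p, r)) \<le> C) \<and> (\<forall>i\<in>Ix m. col i < k \<and> cost i \<le> 2)"

abbreviation "startv ori x y i \<equiv> if ori i then x i else y i"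
abbreviation "endv ori x y i \<equiv> if ori i then y i else x i"

definition guess :: "(nat \<Rightarrow> nat) \<Rightarrow> (nat \<times> nat \<Rightarrow> 'a) \<Rightarrow> (nat \<times> nat \<Rightarrow> 'a) \<Rightarrow> 'a set" where
  "guess m x y = x ` Ix m \<union> y ` Ix m"

text \<open>Each piece is a geodesic for the source of its own path, whatever colour it is routed
  by; this is what bounds the lengths. The last clause admits coinciding end points only for
  different paths and at terminals of both, which is exactly what internal disjointness
  permits.\<close>

definition local_ok :: "(nat \<Rightarrow> nat) \<Rightarrow> (nat \<times> nat \<Rightarrow> nat) \<Rightarrow> (nat \<times> nat \<Rightarrow> 'a) \<Rightarrow> (nat \<times> nat \<Rightarrow> 'a) \<Rightarrow> bool" where
  "local_ok m cost x y \<longleftrightarrow>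
    (\<forall>p\<in>{..<k}. x (p, 0) = s p \<and> y (p, m p - 1) = t p) \<and>
    (\<forall>p\<in>{..<k}. \<forall>r\<in>{1..<m p}. link (cost (p, r)) p (y (p, r - 1)) (x (p, r))) \<and>
    (\<forall>i\<in>Ix m. (up (s (fst i)))\<^sup>*\<^sup>* (x i) (y i)) \<and>
    (\<forall>i\<in>Ix m. \<forall>j\<in>Ix m. i \<noteq> j \<longrightarrow> (\<forall>f\<in>{x, y}. \<forall>g\<in>{x, y}. f i = g j \<longrightarrow>
       fst i \<noteq> fst j \<and> (f i = s (fst i) \<or> f i = t (fst i)) \<and> (g j = s (fst j) \<or> g j = t (fst j))))"

text \<open>The geodesics of the piece as seen from the source of its colour. The piece may run
  towards that source, so \<open>ori\<close> decides which end is the start.\<close>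

definition onint :: "(nat \<times> nat \<Rightarrow> nat) \<Rightarrow> (nat \<times> nat \<Rightarrow> bool) \<Rightarrow> (nat \<times> nat \<Rightarrow> 'a) \<Rightarrow> (nat \<times> nat \<Rightarrow> 'a) \<Rightarrow> nat \<times> nat \<Rightarrow> 'a \<Rightarrow> bool" where
  "onint col ori x y i v \<longleftrightarrow> (up (s (col i)))\<^sup>*\<^sup>* (startv ori x y i) v \<and> (up (s (col i)))\<^sup>*\<^sup>* v (endv ori x y i)"

definition separated where
  "separated m col ori x y \<longleftrightarrow> (\<forall>i\<in>Ix m. \<forall>j\<in>Ix m. col i \<noteq> col j \<longrightarrow>
     \<not> (\<exists>v\<in>VV. v \<notin> guess m x y \<and> onint col ori x y i v \<and> onint col ori x y j v))"

text \<open>Positions are prescribed on \<open>Ix m\<close> and confined to \<open>VV\<close>, so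
  that plays correspond to walks in a graph of tuples of vertices.\<close>

definition routable where
  "routable m col ori x y \<longleftrightarrow> (\<exists>z0 z. (\<forall>i\<in>Ix m. z0 i = startv ori x y i) \<and>
     (\<lambda>z z'. move s (Ix m) col (guess m x y) (\<lambda>i. endv ori x y i) z z' \<and>
      (\<forall>i\<in>Ix m. z i \<in> VV \<and> z' i \<in> VV))\<^sup>*\<^sup>* z0 z \<and> (\<forall>i\<in>Ix m. z i = endv ori x y i))"

lemma finite_Ix [simp]: "finite (Ix m)"
  by (simp add: Ix_def)

lemma successively_rev_E: "successively E w \<Longrightarrow> successively E (rev w)"
  using E_sym by (auto simp: successively_rev elim!: successively_mono)

lemma set_ends: "v \<in> set l \<Longrightarrow> v = hd l \<or> v = last l \<or> v \<in> set (butlast (tl l))"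
proof (cases l)
  case (Cons a l')
  assume v: "v \<in> set l"
  show ?thesis
  proof (cases "l' = []")
    case False
    then have "l' = butlast l' @ [last l']" by simp
    then have "set l' = insert (last l') (set (butlast l'))" by (metis list.simps(15) rotate1.simps(2) set_rotate1)
    then show ?thesis using v Cons False by auto
  qed (use v Cons in simp)
qed simp

lemma inner_nth: "0 < e \<Longrightarrow> Suc e < length l \<Longrightarrow> l ! e \<in> set (butlast (tl l))"
proof -
  assume e: "0 < e" "Suc e < length l"
  then have "butlast (tl l) ! (e - 1) = l ! e" "e - 1 < length (butlast (tl l))"
    by (simp_all add: nth_butlast nth_tl)
  then show ?thesis by (metis nth_mem)
qed

end

context terminals
begin

text \<open>The trails of the game, reversed where \<open>ori\<close> is false, replace the pieces.
  A vertex common to two trails is an end point of both: outside the guessed points, equal colours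
  are kept apart by the game and different colours by \<open>separated\<close>. The lengths
  telescope, since a piece gains as much distance from its own source as it has edges and a link
  loses at most its cost.\<close>

lemma certificate_sound:
  assumes sh: "shape m cost col" and lo: "local_ok m cost x y" and se: "separated m col ori x y"
    and ro: "routable m col ori x y"
  shows "\<exists>Q. solution Q"
proof -
  define G where "G = guess m x y"
  have G: "startv ori x y i \<in> G" "endv ori x y i \<in> G" "x i \<in> G" "y i \<in> G" if "i \<in> Ix m" for i
    using that by (auto simp: G_def guess_def)
  obtain z0 z where z: "(\<lambda>z z'. move s (Ix m) col G (\<lambda>i. endv ori x y i) z z' \<and>
      (\<forall>i\<in>Ix m. z i \<in> VV \<and> z' i \<in> VV))\<^sup>*\<^sup>* z0 z" "\<forall>i\<in>Ix m. z i = endv ori x y i"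
    and z0: "\<And>i. i \<in> Ix m \<Longrightarrow> z0 i = startv ori x y i"
    using ro unfolding routable_def G_def by blast
  have mv: "(move s (Ix m) col G (\<lambda>i. endv ori x y i))\<^sup>*\<^sup>* z0 z"
    by (rule rtranclp_mono[THEN predicate2D, OF _ z(1)]) blast
  have zb: "\<And>i. i \<in> Ix m \<Longrightarrow> z i = endv ori x y i" using z(2) by blast
  obtain W where
    W0: "\<And>i. i \<in> Ix m \<Longrightarrow> W i \<noteq> [] \<and> hd (W i) = z0 i \<and> last (W i) = endv ori x y i \<and>
      successively (up (s (col i))) (W i) \<and> set (butlast (tl (W i))) \<inter> G = {}"
    and Wd: "\<And>i j. i \<in> Ix m \<Longrightarrow> j \<in> Ix m \<Longrightarrow> i \<noteq> j \<Longrightarrow> col i = col j \<Longrightarrow>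
      set (butlast (tl (W i))) \<inter> set (butlast (tl (W j))) = {}"
    by (rule game_sound[OF mv]) (rule zb, assumption, rule G(2), assumption, rule that)
  have W: "W i \<noteq> [] \<and> hd (W i) = startv ori x y i \<and> last (W i) = endv ori x y i \<and>
      successively (up (s (col i))) (W i) \<and> set (butlast (tl (W i))) \<inter> G = {}" if "i \<in> Ix m" for i
    using W0[OF that] z0[OF that] by simp
  define w where "w = (\<lambda>i. if ori i then W i else rev (W i))"
  have w: "w i \<noteq> []" "hd (w i) = x i" "last (w i) = y i" "successively E (w i)" "distinct (w i)" "set (w i) = set (W i)"
    if i: "i \<in> Ix m" for i
  proof -
    have "successively E (W i)" using W[OF i] by (auto elim!: successively_mono simp: up_def)
    then show "successively E (w i)" using successively_rev_E by (auto simp: w_def)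
    show "w i \<noteq> []" "set (w i) = set (W i)" using W[OF i] by (auto simp: w_def)
    show "hd (w i) = x i" "last (w i) = y i" using W[OF i] by (auto simp: w_def hd_rev last_rev)
    show "distinct (w i)" using W[OF i] successively_up_distinct by (auto simp: w_def)
  qed
  have verts: "v \<in> {x i, y i} \<or> (v \<notin> G \<and> v \<in> set (butlast (tl (W i))))" if i: "i \<in> Ix m" and v: "v \<in> set (W i)" for i v
  proof -
    have "v = hd (W i) \<or> v = last (W i) \<or> v \<in> set (butlast (tl (W i)))"
      by (rule set_ends[OF v])
    then show ?thesis using W[OF i] by (auto split: if_splits)
  qed
  have onW: "onint col ori x y i v" if i: "i \<in> Ix m" and v: "v \<in> set (W i)" for i v
  proof -
    obtain n where n: "n < length (W i)" "W i ! n = v" using v by (auto simp: in_set_conv_nth)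
    have su: "successively (up (s (col i))) (W i)" using W[OF i] by simp
    have "n \<le> length (W i) - 1" "length (W i) - 1 < length (W i)" using n(1) by linarith+
    then have "(up (s (col i)))\<^sup>*\<^sup>* (W i ! 0) v" "(up (s (col i)))\<^sup>*\<^sup>* v (W i ! (length (W i) - 1))"
      using successively_relpowp[OF su le0 n(1)] successively_relpowp[OF su, of n "length (W i) - 1"] n
      by (auto dest!: relpowp_imp_rtranclp)
    moreover have "W i ! 0 = startv ori x y i" "W i ! (length (W i) - 1) = endv ori x y i"
      using W[OF i] hd_conv_nth[of "W i"] last_conv_nth[of "W i"] by simp_all
    ultimately show ?thesis by (simp only: onint_def)
  qed
  have W_VV: "v \<in> VV" if i: "i \<in> Ix m" and v: "v \<in> set (butlast (tl (W i)))" for i v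
  proof -
    have "v \<in> set (tl (W i))" using v by (rule in_set_butlastD)
    then obtain n where "n < length (tl (W i))" "tl (W i) ! n = v" by (auto simp: in_set_conv_nth)
    then have "Suc n < length (W i)" "W i ! Suc n = v" by (simp_all add: nth_tl)
    moreover from this have "up (s (col i)) (W i ! n) (W i ! Suc n)"
      using W[OF i] unfolding successively_conv_nth by blast
    ultimately show ?thesis using E_VV by (auto simp: up_def)
  qed
  have meet: "v \<in> {x i, y i} \<and> v \<in> {x j, y j}" if ij: "i \<in> Ix m" "j \<in> Ix m" "i \<noteq> j" and v: "v \<in> set (W i)" "v \<in> set (W j)" for i j v
  proof (cases "v \<in> G")
    case True
    then show ?thesis using verts[OF ij(1) v(1)] verts[OF ij(2) v(2)] by blast
  next
    case False
    then have int: "v \<in> set (butlast (tl (W i)))" "v \<in> set (butlast (tl (W j)))"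
      using verts[OF ij(1) v(1)] verts[OF ij(2) v(2)] G(3,4)[OF ij(1)] G(3,4)[OF ij(2)] by blast+
    then have "col i \<noteq> col j" using Wd[OF ij] by blast
    then show ?thesis
      using se onW[OF ij(1) v(1)] onW[OF ij(2) v(2)] W_VV[OF ij(1) int(1)] False ij unfolding separated_def G_def by blast
  qed
  note lo1 = lo[unfolded local_ok_def, THEN conjunct1, rule_format]
  note lo2 = lo[unfolded local_ok_def, THEN conjunct2, THEN conjunct1, rule_format]
  note lo3 = lo[unfolded local_ok_def, THEN conjunct2, THEN conjunct2, THEN conjunct1, rule_format]
  have lo4: "fst i \<noteq> fst j \<and> (v = s (fst i) \<or> v = t (fst i)) \<and> (v = s (fst j) \<or> v = t (fst j))"
    if "i \<in> Ix m" "j \<in> Ix m" "i \<noteq> j" "v \<in> {x i, y i}" "v \<in> {x j, y j}" for i j v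
    using lo that unfolding local_ok_def by (elim conjE) fastforce
  \<comment> \<open>The trail is a geodesic for the source of its colour, but its length is needed
    in terms of the source of its path. The \<open>n\<close> edges that the latter allows between
    the same two ends bound the change of every distance, hence also the number of edges of the
    trail.\<close>
  have len_w: "length (w i) + dist (s (fst i)) (x i) \<le> dist (s (fst i)) (y i) + 1" if i: "i \<in> Ix m" for i
  proof -
    obtain n where "(up (s (fst i)) ^^ n) (x i) (y i)" using lo3[OF i] by (auto simp: rtranclp_power)
    from up_relpowp[OF this] have n: "(E ^^ n) (x i) (y i)" "dist (s (fst i)) (y i) = dist (s (fst i)) (x i) + n" by auto
    have su: "successively (up (s (col i))) (W i)" and ne: "W i \<noteq> []" using W[OF i] by auto
    have "length (W i) \<le> n + 1"
    \<comment> \<open>Only the first edge of a trail shows that it is reachable from the source of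
      its colour, so a trail of one vertex is treated apart.\<close>
    proof (cases "length (W i) \<le> 1")
      case False
      then have "up (s (col i)) (W i ! 0) (W i ! 1)" using su by (simp add: successively_conv_nth)
      then have r: "E\<^sup>*\<^sup>* (s (col i)) (hd (W i))" using ne by (simp add: up_def hd_conv_nth)
      have "(up (s (col i)) ^^ (length (W i) - 1)) (hd (W i)) (last (W i))"
        using successively_relpowp[OF su, of 0 "length (W i) - 1"] ne by (simp add: hd_conv_nth last_conv_nth)
      from up_relpowp[OF this] have "dist (s (col i)) (last (W i)) = dist (s (col i)) (hd (W i)) + (length (W i) - 1)" by simp
      moreover have "(E ^^ n) (hd (W i)) (last (W i))" using W[OF i] n(1) relpowp_sym by auto
      ultimately show ?thesis using dist_step(2)[OF r] by fastforce
    qed simp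
    moreover have "length (w i) = length (W i)" by (simp add: w_def)
    ultimately show ?thesis using n by simp
  qed
  define Q where "Q = (\<lambda>p r. concat (map (\<lambda>r. w (p, r)) [0..<Suc r]))"
  have setQ: "set (Q p r) = (\<Union>r'\<in>{..r}. set (w (p, r')))" for p r
    unfolding Q_def set_concat set_map set_upt by (auto simp: less_Suc_eq_le)
  have Q: "Q p r \<noteq> [] \<and> hd (Q p r) = s p \<and> last (Q p r) = y (p, r) \<and> successively E (Q p r) \<and> distinct (Q p r) \<and>
      E\<^sup>*\<^sup>* (s p) (y (p, r)) \<and> length (Q p r) \<le> dist (s p) (y (p, r)) + (\<Sum>r'\<in>{1..<Suc r}. cost (p, r')) + 1"
    if p: "p < k" and "r < m p" for p r
    using that(2)
  proof (induction r)
    case 0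
    then have i: "(p, 0) \<in> Ix m" using p by (simp add: Ix_def)
    have "x (p, 0) = s p" using lo1 p by simp
    moreover have "E\<^sup>*\<^sup>* (x (p, 0)) (y (p, 0))"
      using lo3[OF i] by (rule rtranclp_mono[THEN predicate2D, rotated]) (auto simp: up_def)
    ultimately show ?case using w[OF i] len_w[OF i] by (simp add: Q_def)
  next
    case (Suc r)
    then have i: "(p, Suc r) \<in> Ix m" and i0: "(p, r) \<in> Ix m" using p by (auto simp: Ix_def)
    note IH = Suc.IH[OF Suc_lessD[OF Suc.prems]]
    have Qs: "Q p (Suc r) = Q p r @ w (p, Suc r)" by (simp add: Q_def)
    have li: "link (cost (p, Suc r)) p (y (p, r)) (x (p, Suc r))" using lo2[of p "Suc r"] p Suc.prems by simp
    then have E: "E (y (p, r)) (x (p, Suc r))" by (simp add: link_def)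
    have r1: "E\<^sup>*\<^sup>* (s p) (x (p, Suc r))" using IH E by (auto intro: rtranclp.rtrancl_into_rtrancl)
    moreover have "E\<^sup>*\<^sup>* (x (p, Suc r)) (y (p, Suc r))"
      using lo3[OF i] by (rule rtranclp_mono[THEN predicate2D, rotated]) (auto simp: up_def)
    ultimately have r2: "E\<^sup>*\<^sup>* (s p) (y (p, Suc r))" by auto
    \<comment> \<open>For cost 2 this is just the fact that an edge changes the distance by at most
      one.\<close>
    have d: "dist (s p) (y (p, r)) + 1 \<le> dist (s p) (x (p, Suc r)) + cost (p, Suc r)"
      using li dist_edge[OF _ E, of "s p"] IH E_sym[OF E] r1 by (fastforce simp: link_def up_def)
    have "set (Q p r) \<inter> set (w (p, Suc r)) = {}"
    proof (rule ccontr)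
      assume "set (Q p r) \<inter> set (w (p, Suc r)) \<noteq> {}"
      then obtain v r' where v: "v \<in> set (w (p, Suc r))" "r' \<le> r" "v \<in> set (w (p, r'))" by (auto simp: setQ)
      have i': "(p, r') \<in> Ix m" using i0 v(2) by (auto simp: Ix_def)
      have ne: "(p, r') \<noteq> (p, Suc r)" using v(2) by simp
      have "v \<in> {x (p, r'), y (p, r')} \<and> v \<in> {x (p, Suc r), y (p, Suc r)}"
        using meet[OF i' i ne] v w(6)[OF i] w(6)[OF i'] by blast
      with lo4[OF i' i ne] show False by auto
    qed
    then show ?case
      unfolding Qs using IH w[OF i] E r2 d len_w[OF i] Suc.prems
      by (auto simp: successively_append_iff)
  qed
  define R where "R = (\<lambda>p. Q p (m p - 1))"
  have mp: "1 \<le> m p" if "p < k" for p using sh that by (simp add: shape_def)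
  have R: "R p \<noteq> [] \<and> hd (R p) = s p \<and> last (R p) = t p \<and> successively E (R p) \<and> distinct (R p) \<and>
      length (R p) \<le> dist (s p) (t p) + C + 1" if p: "p < k" for p
  proof -
    have 1: "m p - 1 < m p" "Suc (m p - 1) = m p" using mp[OF p] by auto
    have "(\<Sum>r\<in>{1..<m p}. cost (p, r)) \<le> C" using sh p by (simp add: shape_def)
    moreover have "y (p, m p - 1) = t p" using lo1 p by simp
    ultimately show ?thesis using Q[OF p 1(1)] unfolding R_def 1(2) by auto
  qed
  moreover have "set (butlast (tl (R p))) \<inter> set (R p') = {}" if p: "p < k" "p' < k" "p \<noteq> p'" for p p'
  proof (rule ccontr)
    assume "set (butlast (tl (R p))) \<inter> set (R p') \<noteq> {}"
    then obtain v where v: "v \<in> set (butlast (tl (R p)))" "v \<in> set (R p')" by blast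
    have vR: "v \<in> set (R p)" using v(1) by (cases "R p") (auto dest: in_set_butlastD)
    obtain r where r: "r \<le> m p - 1" "v \<in> set (w (p, r))" using vR by (auto simp: R_def setQ)
    obtain r' where r': "r' \<le> m p' - 1" "v \<in> set (w (p', r'))" using v(2) by (auto simp: R_def setQ)
    have "r < m p" "r' < m p'" using r(1) r'(1) mp[OF p(1)] mp[OF p(2)] by linarith+
    then have i: "(p, r) \<in> Ix m" "(p', r') \<in> Ix m" using p by (auto simp: Ix_def)
    have ne: "(p, r) \<noteq> (p', r')" using p by simp
    have "v \<in> {x (p, r), y (p, r)} \<and> v \<in> {x (p', r'), y (p', r')}"
      using meet[OF i ne] r(2) r'(2) w(6)[OF i(1)] w(6)[OF i(2)] by blast
    \<comment> \<open>A vertex on two paths is a terminal of both, whereas \<open>v\<close> is an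
      inner vertex of a path without repetitions.\<close>
    with lo4[OF i ne] have "v = s p \<or> v = t p" by auto
    moreover have "v \<noteq> hd (R p)" "v \<noteq> last (R p)"
    proof -
      have ne: "R p \<noteq> []" "distinct (R p)" using R p by auto
      then obtain a l where l: "R p = a # l" by (cases "R p") auto
      show "v \<noteq> hd (R p)" using v(1) ne l by (auto dest: in_set_butlastD)
      have "l \<noteq> []" using v(1) l by auto
      then have "l = butlast l @ [last l]" by simp
      then have "last l \<notin> set (butlast l)" using ne l by (metis distinct.simps(2) distinct_append disjoint_iff list.set_intros(1))
      then show "v \<noteq> last (R p)" using v(1) l \<open>l \<noteq> []\<close> by auto
    qed
    ultimately show False using R p by auto
  qed
  ultimately show ?thesis unfolding solution_def by (intro exI[of _ R]) auto
qed

end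

context terminals
begin

text \<open>The certificate is read off the subdivision of the solution, and the game is played
  along the solution itself. Each edge that does not lead away from the own source is charged to the
  excess length, so all paths together have at most \<open>k * C\<close> such edges.\<close>

lemma certificate_complete:
  assumes sol: "solution Q"
  defines "N \<equiv> k + k * C"
  shows "\<exists>m cost col ori x y. shape m cost col \<and> (\<Sum>p<k. m p) \<le> (if k = 1 then N else (5 * N\<^sup>2) ^ Suc k) \<and>
    (\<forall>i\<in>Ix m. x i \<in> VV \<and> y i \<in> VV) \<and> local_ok m cost x y \<and> separated m col ori x y \<and> routable m col ori x y"
proof -
  define P where "P = (\<lambda>p u. Q p ! u)"
  define len where "len = (\<lambda>p. length (Q p) - 1)"
  have Qp: "Q p \<noteq> []" "hd (Q p) = s p" "last (Q p) = t p" "successively E (Q p)" "distinct (Q p)"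
    "length (Q p) \<le> dist (s p) (t p) + C + 1" "length (Q p) = Suc (len p)" if "p < k" for p
    using sol that by (auto simp: solution_def len_def)
  have Qd: "set (butlast (tl (Q p))) \<inter> set (Q p') = {}" if "p < k" "p' < k" "p \<noteq> p'" for p p'
    using sol that by (auto simp: solution_def)
  have P0: "P p 0 = s p" and Plen: "P p (len p) = t p" if "p < k" for p
    using Qp(1-3)[OF that] by (auto simp: P_def len_def hd_conv_nth last_conv_nth)
  have PE: "E (P p u) (P p (Suc u))" if "p < k" "u < len p" for p u
    using Qp[OF that(1)] that(2) by (simp add: P_def successively_conv_nth)
  have Pinj: "P p u = P p u' \<longleftrightarrow> u = u'" if "p < k" "u \<le> len p" "u' \<le> len p" for p u u'
    using Qp[OF that(1)] that by (simp add: P_def nth_eq_iff_index_eq)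
  have Pmem: "P p u \<in> set (Q p)" if "p < k" "u \<le> len p" for p u
    using Qp[OF that(1)] that by (simp add: P_def)
  have Pinner: "P p u \<in> set (butlast (tl (Q p)))" if "p < k" "0 < u" "u < len p" for p u
    using Qp[OF that(1)] that inner_nth[of u "Q p"] by (simp add: P_def)
  have PVV: "P p u \<in> VV" if "p < k" "u \<le> len p" for p u
    using that P0[OF that(1)] s_VV[OF that(1)] E_VV[OF PE[of p "u - 1"]] by (cases u) auto
  \<comment> \<open>The amount by which an edge falls short of increasing the distance by one: 0 for
    a gain, 1 for no change, 2 for a loss.\<close>
  define tc where "tc = (\<lambda>p u. if up (s p) (P p u) (P p (Suc u)) then 0
     else if up (s p) (P p (Suc u)) (P p u) then 2 else 1 :: nat)"
  define B0 where "B0 = {(p, u). p < k \<and> u < len p \<and> tc p u \<noteq> 0}"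
  interpret segmented_paths E k s P len B0
  proof
    fix p u assume "p < k" "u < len p" "(p, u) \<notin> B0"
    then show "up (s p) (P p u) (P p (Suc u))" by (auto simp: B0_def tc_def split: if_splits)
  qed (use P0 PE in \<open>auto simp: B0_def\<close>)
  \<comment> \<open>Every edge adds exactly one to the sum of distance and total shortfall. At the
    end of the path the total shortfall is therefore its excess length.\<close>
  have tele: "dist (s p) (P p u) + (\<Sum>u'<u. tc p u') = u" if "p < k" "u \<le> len p" for p u
    using that(2)
  proof (induction u)
    case 0
    then show ?case using P0[OF \<open>p < k\<close>] by simp
  next
    case (Suc u)
    have r: "E\<^sup>*\<^sup>* (s p) (P p u)" using src_reach[of p u] that(1) Suc.prems by simp
    have e: "E (P p u) (P p (Suc u))" using PE that(1) Suc.prems by simp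
    have "dist (s p) (P p (Suc u)) + tc p u = dist (s p) (P p u) + 1"
      using dist_edge[OF r e] r e E_sym[OF e] by (auto simp: tc_def up_def)
    then show ?case using Suc by simp
  qed
  have tc_C: "(\<Sum>u<len p. tc p u) \<le> C" if "p < k" for p
    using tele[OF that order_refl] Plen[OF that] Qp(6,7)[OF that] by simp
  have "card B0 \<le> k * C"
  proof -
    have "B0 = (SIGMA p:{..<k}. {u. u < len p \<and> tc p u \<noteq> 0})" by (auto simp: B0_def)
    then have "card B0 = (\<Sum>p<k. card {u. u < len p \<and> tc p u \<noteq> 0})" by simp
    also have "\<dots> \<le> (\<Sum>p<k. C)"
    proof (rule sum_mono)
      fix p assume "p \<in> {..<k}"
      have "card {u. u < len p \<and> tc p u \<noteq> 0} = (\<Sum>u\<in>{u. u < len p \<and> tc p u \<noteq> 0}. 1)" by simp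
      also have "\<dots> \<le> (\<Sum>u\<in>{u. u < len p \<and> tc p u \<noteq> 0}. tc p u)" by (rule sum_mono) auto
      also have "\<dots> \<le> (\<Sum>u<len p. tc p u)" by (rule sum_mono2) auto
      finally show "card {u. u < len p \<and> tc p u \<noteq> 0} \<le> C" using tc_C \<open>p \<in> {..<k}\<close> by fastforce
    qed
    finally show ?thesis by simp
  qed
  then have N: "k + card B0 \<le> N" by (simp add: N_def)
  obtain Bk \<chi> where Bk: "B0 \<subseteq> Bk" "Bk \<subseteq> slots" "k + card Bk \<le> (if k = 1 then k + card B0 else (5 * (k + card B0)\<^sup>2) ^ Suc k)"
    and \<chi>: "\<And>X. X \<in> pieces Bk \<Longrightarrow> \<chi> X < k \<and> monot (\<chi> X) X"
    and \<chi>2: "\<And>X Y. X \<in> pieces Bk \<Longrightarrow> Y \<in> pieces Bk \<Longrightarrow> avoid X Y \<or> \<chi> X = \<chi> Y"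
    using labelling by metis
  define br where "br = (\<lambda>p. {u. (p, u) \<in> Bk})"
  define bl where "bl = (\<lambda>p. sorted_list_of_set (br p))"
  have br_len: "u < len p \<and> p < k" if "(p, u) \<in> Bk" for p u using that Bk(2) by (auto simp: slots_def)
  have fin_br: "finite (br p)" for p
    using finite_subset[of "br p" "{..<len p}"] br_len by (auto simp: br_def)
  have bl: "set (bl p) = br p" "sorted (bl p)" "distinct (bl p)" for p using fin_br by (auto simp: bl_def)
  have bl_mem: "(p, bl p ! r) \<in> Bk" if "r < length (bl p)" for p r
    using nth_mem[OF that] bl(1) by (auto simp: br_def)
  have bl_less: "bl p ! r < bl p ! r'" if "r < r'" "r' < length (bl p)" for p r r'
    using sorted_nth_mono[OF bl(2), of r r'] that nth_eq_iff_index_eq[OF bl(3), of r p r'] by fastforce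
  define m where "m = (\<lambda>p. Suc (length (bl p)))"
  \<comment> \<open>Piece \<open>r\<close> starts after break number \<open>r - 1\<close> of its
    path and ends at break number \<open>r\<close>; the break edge leads from
    \<open>hi p (r - 1)\<close> to \<open>lo p r\<close>.\<close>
  define lo where "lo = (\<lambda>p r. if r = 0 then 0 else Suc (bl p ! (r - 1)))"
  define hi where "hi = (\<lambda>p r. if r < length (bl p) then bl p ! r else len p)"
  define iv where "iv = (\<lambda>(p, r). (p, lo p r, hi p r))"
  have lohi: "lo p r \<le> hi p r \<and> hi p r \<le> len p" if "p < k" "r < m p" for p r
    using that bl_less[of "r - 1" r p] br_len[OF bl_mem[of r p]] br_len[OF bl_mem[of "r - 1" p]]
    by (auto simp: lo_def hi_def m_def Suc_le_eq)
  have iv_piece: "iv (p, r) \<in> pieces Bk" if pr: "p < k" "r < m p" for p r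
  proof -
    have "(p, u) \<notin> Bk" if u: "u \<in> {lo p r..<hi p r}" for u
    proof
      assume "(p, u) \<in> Bk"
      then have "u \<in> set (bl p)" using bl by (simp add: br_def)
      then obtain q where q: "q < length (bl p)" "u = bl p ! q" by (auto simp: in_set_conv_nth)
      show False
      proof (cases "q < r")
        case True
        then have "bl p ! q \<le> bl p ! (r - 1)" using pr by (intro sorted_nth_mono[OF bl(2)]) (auto simp: m_def)
        then show False using u q True by (auto simp: lo_def split: if_splits)
      next
        case False
        then have "bl p ! r \<le> bl p ! q" using q by (intro sorted_nth_mono[OF bl(2)]) auto
        then show False using u q False by (auto simp: hi_def split: if_splits)
      qed
    qed
    moreover have "lo p r = 0 \<or> (p, lo p r - 1) \<in> Bk" using bl_mem[of "r - 1" p] pr by (auto simp: lo_def m_def)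
    moreover have "hi p r = len p \<or> (p, hi p r) \<in> Bk" using bl_mem[of r p] by (auto simp: hi_def)
    ultimately show ?thesis using lohi[OF pr] pr by (auto simp: iv_def pieces_def ivl_def edges_def)
  qed
  have next_lo: "lo p (Suc r) = Suc (hi p r)" if "Suc r < m p" for p r
    using that by (auto simp: lo_def hi_def m_def)
  have hi_lo: "hi p r < lo p r'" if "r < r'" "r' < m p" for p r r'
    using that sorted_nth_mono[OF bl(2), of r "r' - 1" p] by (auto simp: lo_def hi_def m_def less_Suc_eq_le)
  \<comment> \<open>A break that was added by the subdivision is an edge with gain one and costs
    nothing; only breaks in \<open>B0\<close> have positive cost.\<close>
  define cost where "cost = (\<lambda>(p, r). if r = 0 then 0 else tc p (bl p ! (r - 1)))"
  define x where "x = (\<lambda>(p, r). P p (lo p r))"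
  define y where "y = (\<lambda>(p, r). P p (hi p r))"
  define col where "col = (\<lambda>i. \<chi> (iv i))"
  define ori where "ori = (\<lambda>i. rise (col i) (iv i))"
  have Ix: "i \<in> Ix m \<longleftrightarrow> fst i < k \<and> snd i < m (fst i)" for i by (cases i) (auto simp: Ix_def)
  have pos: "P p e = P p' e' \<longrightarrow> p \<noteq> p' \<and> (e = 0 \<or> e = len p) \<and> (e' = 0 \<or> e' = len p')"
    if i: "(p, r) \<in> Ix m" "(p', r') \<in> Ix m" and e: "e \<in> {lo p r..hi p r}" "e' \<in> {lo p' r'..hi p' r'}"
      and ne: "(p, r) \<noteq> (p', r')" for p r p' r' e e'
  proof
    assume eq: "P p e = P p' e'"
    have k: "p < k" "p' < k" "r < m p" "r' < m p'" using i by (auto simp: Ix)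
    have le: "e \<le> len p" "e' \<le> len p'" using lohi[OF k(1,3)] lohi[OF k(2,4)] e by auto
    have pp: "p \<noteq> p'"
    proof
      assume "p = p'"
      then have "e = e'" using eq Pinj k le by auto
      then show False using hi_lo[of r r' p] hi_lo[of r' r p] k e ne \<open>p = p'\<close> by (cases r r' rule: linorder_cases) auto
    qed
    have "\<not> (0 < e \<and> e < len p)"
      using Pinner[OF k(1), of e] Pmem[OF k(2) le(2)] Qd[OF k(1,2) pp] eq by (metis disjoint_iff)
    moreover have "\<not> (0 < e' \<and> e' < len p')"
      using Pinner[OF k(2), of e'] Pmem[OF k(1) le(1)] Qd[OF k(2,1)] pp eq by (metis disjoint_iff)
    ultimately show "p \<noteq> p' \<and> (e = 0 \<or> e = len p) \<and> (e' = 0 \<or> e' = len p')" using pp le by auto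
  qed
  have "(\<Sum>p<k. m p) = k + card Bk"
  proof -
    have "Bk = (SIGMA p:{..<k}. br p)" using br_len by (auto simp: br_def)
    then have "card Bk = (\<Sum>p<k. card (br p))" using fin_br by simp
    moreover have "card (br p) = length (bl p)" for p using distinct_card[OF bl(3)] bl(1) by metis
    ultimately show ?thesis by (simp add: m_def sum_Suc)
  qed
  also have "\<dots> \<le> (if k = 1 then N else (5 * N\<^sup>2) ^ Suc k)"
  proof (cases "k = 1")
    case False
    have "(5 * (k + card B0)\<^sup>2) ^ Suc k \<le> (5 * N\<^sup>2) ^ Suc k"
      using N by (intro power_mono mult_le_mono) auto
    then show ?thesis using Bk(3) False by (simp only: if_False)
  qed (use Bk(3) N in simp)
  finally have size: "(\<Sum>p<k. m p) \<le> (if k = 1 then N else (5 * N\<^sup>2) ^ Suc k)" .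
  have shape: "shape m cost col"
    unfolding shape_def
  proof (intro conjI allI impI ballI)
    fix p assume p: "p < k"
    show "1 \<le> m p" by (simp add: m_def)
    have "(\<Sum>r\<in>{1..<m p}. cost (p, r)) = (\<Sum>r\<in>{0..<length (bl p)}. tc p (bl p ! r))"
      unfolding m_def One_nat_def sum.shift_bounds_Suc_ivl by (simp add: cost_def)
    also have "\<dots> = (\<Sum>u\<in>br p. tc p u)"
      using sum.reindex_bij_betw[OF bij_betw_nth[OF bl(3) refl bl(1)[symmetric], of p], of "tc p"]
      by (simp add: lessThan_atLeast0)
    also have "\<dots> \<le> (\<Sum>u<len p. tc p u)" using br_len by (intro sum_mono2) (auto simp: br_def)
    also have "\<dots> \<le> C" by (rule tc_C[OF p])
    finally show "(\<Sum>r\<in>{1..<m p}. cost (p, r)) \<le> C" .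
  next
    fix i assume "i \<in> Ix m"
    then show "col i < k" using \<chi>[OF iv_piece] by (cases i) (auto simp: Ix col_def)
    show "cost i \<le> 2" by (cases i) (auto simp: cost_def tc_def)
  qed
  have "local_ok m cost x y"
    unfolding local_ok_def
  proof (intro conjI ballI impI)
    fix p assume "p \<in> {..<k}"
    then show "x (p, 0) = s p" "y (p, m p - 1) = t p" using P0 Plen by (auto simp: x_def y_def lo_def hi_def m_def)
    fix r assume r: "r \<in> {1..<m p}"
    then have h: "hi p (r - 1) = bl p ! (r - 1)" "lo p r = Suc (bl p ! (r - 1))" "bl p ! (r - 1) < len p"
      using br_len[OF bl_mem[of "r - 1" p]] by (auto simp: hi_def lo_def m_def)
    then show "link (cost (p, r)) p (y (p, r - 1)) (x (p, r))"
      using PE[of p "bl p ! (r - 1)"] \<open>p \<in> {..<k}\<close> r by (auto simp: link_def cost_def x_def y_def tc_def)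
  next
    fix i assume i: "i \<in> Ix m"
    obtain p r where i': "i = (p, r)" by (cases i)
    have ip: "iv (p, r) \<in> pieces Bk" using i iv_piece by (auto simp: Ix i')
    have "rise p (p, lo p r, hi p r)" using piece_rise(1)[OF Bk(1) ip] by (simp add: iv_def)
    then have "(up (s p) ^^ (hi p r - lo p r)) (P p (lo p r)) (P p (hi p r))"
      unfolding relpowp_fun_conv using lohi[of p r] i
      by (intro exI[of _ "\<lambda>u. P p (lo p r + u)"]) (auto simp: rise_def Ix i')
    then show "(up (s (fst i)))\<^sup>*\<^sup>* (x i) (y i)" by (auto simp: i' x_def y_def dest: relpowp_imp_rtranclp)
  next
    fix i j f g assume ij: "i \<in> Ix m" "j \<in> Ix m" "i \<noteq> j" "f \<in> {x, y}" "g \<in> {x, y}" "f i = g j"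
    obtain p r where i': "i = (p, r)" by (cases i)
    obtain p' r' where j': "j = (p', r')" by (cases j)
    have k: "p < k" "p' < k" "r < m p" "r' < m p'" using ij by (auto simp: Ix i' j')
    obtain e where e: "f i = P p e" "e \<in> {lo p r..hi p r}" using ij(4) lohi[OF k(1,3)] by (auto simp: i' x_def y_def)
    obtain e' where e': "g j = P p' e'" "e' \<in> {lo p' r'..hi p' r'}" using ij(5) lohi[OF k(2,4)] by (auto simp: j' x_def y_def)
    have "p \<noteq> p' \<and> (e = 0 \<or> e = len p) \<and> (e' = 0 \<or> e' = len p')"
      using pos[OF ij(1)[unfolded i'] ij(2)[unfolded j'] e(2) e'(2)] ij(3,6) e(1) e'(1) by (auto simp: i' j')
    then show "fst i \<noteq> fst j" "f i = s (fst i) \<or> f i = t (fst i)" "g j = s (fst j) \<or> g j = t (fst j)"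
      using P0 Plen k e(1) e'(1) by (auto simp: i' j')
  qed
  moreover have "separated m col ori x y"
    unfolding separated_def
  proof (intro ballI impI notI, elim bexE conjE)
    fix i j v assume ij: "i \<in> Ix m" "j \<in> Ix m" "col i \<noteq> col j" "onint col ori x y i v" "onint col ori x y j v"
    \<comment> \<open>The two chains of \<open>up\<close> steps through \<open>v\<close> together
      have as many edges as the piece, because both numbers are the difference of the colour
      distances of its ends. So \<open>v\<close> lies on a walk of exactly that length.\<close>
    have geo: "v \<in> geo (iv i)" if i: "i \<in> Ix m" "onint col ori x y i v" for i
    proof -
      obtain p r where i': "i = (p, r)" by (cases i)
      have ip: "iv i \<in> pieces Bk" using i iv_piece by (auto simp: Ix i')
      have ivi: "iv i = (p, lo p r, hi p r)" by (simp add: i' iv_def)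
      have le: "lo p r \<le> hi p r" using lohi[of p r] i by (auto simp: Ix i')
      obtain m1 m2 where m: "(up (s (col i)) ^^ m1) (startv ori x y i) v" "(up (s (col i)) ^^ m2) v (endv ori x y i)"
        using i(2) by (auto simp: onint_def rtranclp_power)
      note m' = up_relpowp[OF m(1)] up_relpowp[OF m(2)]
      have d: "dist (s (col i)) (endv ori x y i) = dist (s (col i)) (startv ori x y i) + (m1 + m2)" using m' by simp
      show ?thesis
      proof (cases "ori i")
        case True
        then have "rise (col i) (p, lo p r, hi p r)" by (simp add: ori_def ivi)
        from rise_dist[OF this le order_refl] have "m1 + m2 = hi p r - lo p r" using d True by (simp add: i' x_def y_def)
        then show ?thesis using m' True unfolding ivi geo_def between_def by (auto simp: i' x_def y_def)
      next
        case False
        then have "fall (col i) (p, lo p r, hi p r)" using \<chi>[OF ip] by (auto simp: ori_def ivi monot_def col_def)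
        from fall_dist[OF this le order_refl] have eq: "m2 + m1 = hi p r - lo p r" using d False by (simp add: i' x_def y_def)
        have "(E ^^ m2) (P p (lo p r)) v" "(E ^^ m1) v (P p (hi p r))"
          using m' False relpowp_sym by (auto simp: i' x_def y_def)
        then show ?thesis using eq unfolding ivi geo_def between_def by auto
      qed
    qed
    have "iv i \<in> pieces Bk" "iv j \<in> pieces Bk" using ij iv_piece by (cases i; cases j; auto simp: Ix)+
    from \<chi>2[OF this] have "avoid (iv i) (iv j)" using ij(3) by (auto simp: col_def)
    then show False using geo[OF ij(1,4)] geo[OF ij(2,5)] by (auto simp: avoid_def)
  qed
  moreover have "routable m col ori x y"
    unfolding routable_def
  proof -
    \<comment> \<open>The pieces of the solution, traversed so that the distance from the source of
      the colour grows, are the routes of the pebbles.\<close>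
    define W where "W = (\<lambda>(p, r) u. if ori (p, r) then P p (lo p r + u) else P p (hi p r - u))"
    define l where "l = (\<lambda>(p, r). hi p r - lo p r)"
    have W: "\<exists>e. W (p, r) u = P p e \<and> e \<in> {lo p r..hi p r} \<and> (0 < u \<and> u < l (p, r) \<longrightarrow> lo p r < e \<and> e < hi p r)"
      if "u \<le> l (p, r)" "lo p r \<le> hi p r" for p r u
      using that by (intro exI[of _ "if ori (p, r) then lo p r + u else hi p r - u"]) (auto simp: W_def l_def)
    have inner: "W i u \<noteq> P p' e'" if i: "i \<in> Ix m" "0 < u" "u < l i" and j: "(p', r') \<in> Ix m" "e' \<in> {lo p' r'..hi p' r'}"
      and ne: "i \<noteq> (p', r') \<or> e' = lo p' r' \<or> e' = hi p' r'" for i u p' r' e'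
    proof -
      obtain p r where i': "i = (p, r)" by (cases i)
      have k: "p < k" "r < m p" using i by (auto simp: Ix i')
      obtain e where e: "W i u = P p e" "lo p r < e" "e < hi p r" using W[of u p r] lohi[OF k] i by (auto simp: i')
      have len: "0 < e" "e < len p" using e lohi[OF k] by auto
      show ?thesis
      proof (cases "i = (p', r')")
        case True
        then have pr: "p' = p" "r' = r" by (auto simp: i')
        then have "e' \<le> len p" using j(2) lohi[OF k] by simp
        moreover have "e \<noteq> e'" using ne True e(2,3) pr by auto
        ultimately show ?thesis using Pinj[OF k(1), of e e'] e(1) len(2) pr by simp
      next
        case False
        have "e \<in> {lo p r..hi p r}" using e by simp
        from pos[OF i(1)[unfolded i'] j(1) this j(2)] False i'
        have "P p e = P p' e' \<longrightarrow> e = 0 \<or> e = len p" by blast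
        then show ?thesis using len e(1) by force
      qed
    qed
    have lo_hi: "lo (fst i) (snd i) \<le> hi (fst i) (snd i)" if "i \<in> Ix m" for i using that lohi by (simp add: Ix)
    have start: "startv ori x y i = W i 0" and fin: "endv ori x y i = W i (l i)" if "i \<in> Ix m" for i
      using lo_hi[OF that] by (cases i; auto simp: W_def l_def x_def y_def)+
    have "\<exists>z. (\<lambda>z z'. move s (Ix m) col (guess m x y) (\<lambda>i. endv ori x y i) z z' \<and>
      (\<forall>i\<in>Ix m. z i \<in> VV \<and> z' i \<in> VV))\<^sup>*\<^sup>* (\<lambda>i. startv ori x y i) z \<and> (\<forall>i\<in>Ix m. z i = endv ori x y i)"
    proof (rule game_complete[where W = W and l = l and \<tau> = "\<lambda>_. 0"])
      fix i u assume i: "i \<in> Ix m"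
      obtain p r where i': "i = (p, r)" by (cases i)
      have k: "p < k" "r < m p" using i by (auto simp: Ix i')
      note lh = lohi[OF k]
      have mo: "rise (col i) (p, lo p r, hi p r) \<or> fall (col i) (p, lo p r, hi p r)"
        using \<chi>[OF iv_piece[OF k]] by (auto simp: monot_def col_def i' iv_def)
      show "up (s (col i)) (W i u) (W i (Suc u))" if "u < l i"
      proof (cases "ori i")
        case True
        then show ?thesis using that by (auto simp: ori_def i' iv_def rise_def W_def l_def)
      next
        case False
        then have "fall (col i) (p, lo p r, hi p r)" using mo by (simp add: ori_def i' iv_def)
        moreover have mem: "hi p r - Suc u \<in> {lo p r..<hi p r}" "Suc (hi p r - Suc u) = hi p r - u"
          using that by (auto simp: l_def i')
        ultimately have "up (s (col i)) (P p (Suc (hi p r - Suc u))) (P p (hi p r - Suc u))"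
          unfolding fall_def prod.case by blast
        then show ?thesis unfolding mem(2) using False by (simp add: W_def i')
      qed
      show "W i u \<notin> guess m x y" if u: "0 < u" "u < l i"
      proof
        assume "W i u \<in> guess m x y"
        then obtain p' r' e' where j: "(p', r') \<in> Ix m" "W i u = P p' e'" "e' = lo p' r' \<or> e' = hi p' r'"
          by (auto simp: guess_def x_def y_def)
        then have "e' \<in> {lo p' r'..hi p' r'}" using lo_hi[OF j(1)] by auto
        then show False using inner[OF i u j(1), of e'] j by auto
      qed
      show "W i u \<in> VV" if uu: "u \<le> l i"
      proof -
        obtain e where "W i u = P p e" "e \<in> {lo p r..hi p r}" using W[of u p r] lh uu by (auto simp: i')
        then show ?thesis using PVV[OF k(1), of e] lh by auto
      qed
    next
      fix i j u u' assume ij: "i \<in> Ix m" "j \<in> Ix m" "i \<noteq> j" "0 < u" "u < l i" "u' \<le> l j"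
      obtain p' r' where j': "j = (p', r')" by (cases j)
      obtain e' where e': "W j u' = P p' e'" "e' \<in> {lo p' r'..hi p' r'}"
        using W[of u' p' r'] lo_hi[OF ij(2)] ij(6) by (auto simp: j')
      show "W i u \<noteq> W j u'" using inner[OF ij(1,4,5) ij(2)[unfolded j'] e'(2)] ij(3) e'(1) by (auto simp: j')
    qed (use start fin in auto)
    then obtain z where z: "(\<lambda>z z'. move s (Ix m) col (guess m x y) (\<lambda>i. endv ori x y i) z z' \<and>
      (\<forall>i\<in>Ix m. z i \<in> VV \<and> z' i \<in> VV))\<^sup>*\<^sup>* (\<lambda>i. startv ori x y i) z" "\<forall>i\<in>Ix m. z i = endv ori x y i" by blast
    show "\<exists>z0 z. (\<forall>i\<in>Ix m. z0 i = startv ori x y i) \<and>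
     (\<lambda>z z'. move s (Ix m) col (guess m x y) (\<lambda>i. endv ori x y i) z z' \<and>
      (\<forall>i\<in>Ix m. z i \<in> VV \<and> z' i \<in> VV))\<^sup>*\<^sup>* z0 z \<and> (\<forall>i\<in>Ix m. z i = endv ori x y i)"
      by (rule exI[where x = "\<lambda>i. startv ori x y i"], rule exI[where x = z]) (use z in simp)
  qed
  moreover have "\<forall>i\<in>Ix m. x i \<in> VV \<and> y i \<in> VV"
    using PVV lohi by (force simp: Ix x_def y_def)
  ultimately show ?thesis using shape size by blast
qed

end

section \<open>Timed program logic, loops over tuples, and compilation of first-order
  formulas\<close>

section \<open>Programs for formulas with transitive closure\<close>

text \<open>A total-correctness triple with a time bound. The postcondition is an arbitrary
  predicate, so the rule for sequences can nest the claim about the rest of the program in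
  it.\<close>

definition runs :: "nat list \<Rightarrow> ram \<Rightarrow> (nat \<Rightarrow> nat) \<Rightarrow> nat \<Rightarrow> ((nat \<Rightarrow> nat) \<Rightarrow> bool) \<Rightarrow> bool" where
  "runs x p R T Q \<longleftrightarrow> (\<exists>t R'. exec x p R t R' \<and> t \<le> T \<and> Q R')"

lemma runs_mono:
  "runs x p R T Q \<Longrightarrow> T \<le> T' \<Longrightarrow> (\<And>R'. Q R' \<Longrightarrow> Q' R') \<Longrightarrow> runs x p R T' Q'"
  unfolding runs_def by (meson le_trans)

lemma runs_SETC: "Q (R(i := c)) \<Longrightarrow> runs x (SETC i c) R 1 Q"
  and runs_ADD: "Q (R(i := R j + R l)) \<Longrightarrow> runs x (ADD i j l) R 1 Q"
  and runs_SUB: "Q (R(i := R j - R l)) \<Longrightarrow> runs x (SUB i j l) R 1 Q"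
  and runs_READ: "Q (R(i := input_at x (R j))) \<Longrightarrow> runs x (READ i j) R 1 Q"
  and runs_LOAD: "Q (R(i := R (R j))) \<Longrightarrow> runs x (LOAD i j) R 1 Q"
  and runs_STORE: "Q (R(R i := R j)) \<Longrightarrow> runs x (STORE i j) R 1 Q"
  unfolding runs_def by (meson exec.intros order_refl)+

lemma runs_SEQ:
  assumes "runs x p R S (\<lambda>R'. runs x q R' T Q)"
  shows "runs x (SEQ p q) R (S + T) Q"
  using assms unfolding runs_def by (meson add_mono exec.seq)

lemma runs_IFNZ:
  assumes "R i \<noteq> 0 \<Longrightarrow> runs x p R T Q" "R i = 0 \<Longrightarrow> runs x q R T Q"
  shows "runs x (IFNZ i p q) R (1 + T) Q"
proof (cases "R i = 0")
  case True
  then obtain t R' where "exec x q R t R'" "t \<le> T" "Q R'"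
    using assms(2) unfolding runs_def by blast
  then show ?thesis
    unfolding runs_def using exec.if_false[of R i x q t R' p] True by (meson add_left_mono)
next
  case False
  then obtain t R' where "exec x p R t R'" "t \<le> T" "Q R'"
    using assms(1) unfolding runs_def by blast
  then show ?thesis
    unfolding runs_def using exec.if_true[of R i x p t R' q] False by (meson add_left_mono)
qed

text \<open>The counter \<open>v\<close> runs downwards from \<open>R 1 - 1\<close> to \<open>0\<close>; \<open>u\<close> holds the constant 1.\<close>

definition FOR :: "nat \<Rightarrow> nat \<Rightarrow> ram \<Rightarrow> ram" where
  "FOR v u body = SEQ (ADD v 1 1) (SEQ (SUB v v 1)
     (WHILENZ v (SEQ (SETC u 1) (SEQ (SUB v v u) body))))"

text \<open>The invariant is indexed by the number of rounds still to come and must survive changes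
  of the counter and of \<open>u\<close>, which are overwritten at the start of each round.\<close>

lemma runs_countdown:
  assumes "R v = m" "m \<le> n" "Inv m R" "u \<noteq> v"
  assumes body: "\<And>j R. j < n \<Longrightarrow> Inv (Suc j) R \<Longrightarrow> R v = j \<Longrightarrow>
      runs x body R T (\<lambda>R'. Inv j R' \<and> R' v = j)"
  assumes stable: "\<And>j R c. Inv j R \<Longrightarrow> Inv j (R(v := c))" "\<And>j R c. Inv j R \<Longrightarrow> Inv j (R(u := c))"
  shows "runs x (WHILENZ v (SEQ (SETC u 1) (SEQ (SUB v v u) body))) R (m * (T + 3) + 1) (Inv 0)"
  using assms(1-3)
proof (induction m arbitrary: R)
  case 0
  then show ?case
    unfolding runs_def using exec.while_false[of R v] by auto
next
  case (Suc m)
  define R1 where "R1 = (R(u := 1))(v := m)"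
  have "Inv (Suc m) R1"
    unfolding R1_def using Suc.prems by (intro stable)
  moreover have "R1 v = m" by (simp add: R1_def)
  ultimately obtain t R2 where R2: "exec x body R1 t R2" "t \<le> T" "Inv m R2" "R2 v = m"
    using body[of m R1] Suc.prems unfolding runs_def by auto
  have "exec x (SETC u 1) R 1 (R(u := 1))" by (rule exec.setc)
  moreover have "exec x (SUB v v u) (R(u := 1)) 1 R1"
    using exec.sub[of x v v u "R(u := 1)"] \<open>u \<noteq> v\<close> Suc.prems by (simp add: R1_def)
  ultimately have ex: "exec x (SEQ (SETC u 1) (SEQ (SUB v v u) body)) R (1 + (1 + t)) R2"
    using R2(1) by (meson exec.seq)
  obtain t' R3 where R3: "exec x (WHILENZ v (SEQ (SETC u 1) (SEQ (SUB v v u) body))) R2 t' R3"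
      "t' \<le> m * (T + 3) + 1" "Inv 0 R3"
    using Suc.IH[OF R2(4) _ R2(3)] Suc.prems unfolding runs_def by auto
  have "exec x (WHILENZ v (SEQ (SETC u 1) (SEQ (SUB v v u) body))) R (1 + (1 + (1 + t)) + t') R3"
    using exec.while_true[OF _ ex R3(1)] Suc.prems by simp
  moreover have "1 + (1 + (1 + t)) + t' \<le> Suc m * (T + 3) + 1"
    using R2(2) R3(2) by simp
  ultimately show ?case
    unfolding runs_def using R3(3) by blast
qed

lemma runs_FOR:
  assumes "R 1 = n" "Inv n R" "u \<noteq> v" "v \<noteq> 1"
  assumes "\<And>j R. j < n \<Longrightarrow> Inv (Suc j) R \<Longrightarrow> R v = j \<Longrightarrow>
      runs x body R T (\<lambda>R'. Inv j R' \<and> R' v = j)"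
  assumes stable: "\<And>j R c. Inv j R \<Longrightarrow> Inv j (R(v := c))" "\<And>j R c. Inv j R \<Longrightarrow> Inv j (R(u := c))"
  shows "runs x (FOR v u body) R (n * (T + 3) + 3) (Inv 0)"
proof -
  have eq: "n * (T + 3) + 3 = 1 + (1 + (n * (T + 3) + 1))" by simp
  have "Inv n (R(v := n))" by (rule stable(1)[OF assms(2)])
  then have "runs x (WHILENZ v (SEQ (SETC u 1) (SEQ (SUB v v u) body))) (R(v := n))
      (n * (T + 3) + 1) (Inv 0)"
    using runs_countdown[of "R(v := n)" v n n Inv u x body T] assms(3,5) stable by simp
  \<comment> \<open>The two instructions before the loop copy register 1 as \<open>2 n - n\<close>;
    there is no instruction for copying.\<close>
  moreover have "R(v := R 1 + R 1, v := (R(v := R 1 + R 1)) v - (R(v := R 1 + R 1)) 1) = R(v := n)"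
    using assms(1,4) by auto
  ultimately show ?thesis
    unfolding FOR_def eq
    by - ((rule runs_SEQ runs_ADD runs_SUB)+, simp only:)
qed

primrec FORT :: "nat list \<Rightarrow> nat \<Rightarrow> ram \<Rightarrow> ram" where
  "FORT [] u body = body"
| "FORT (v # vs) u body = FOR v u (FORT vs u body)"

definition tuples :: "nat \<Rightarrow> nat \<Rightarrow> nat list set" where
  "tuples n d = {ys. length ys = d \<and> set ys \<subseteq> {..<n}}"

lemma tuples_0 [simp]: "tuples n 0 = {[]}"
  by (auto simp: tuples_def)

lemma Cons_mem_tuples [simp]: "j # ys \<in> tuples n (Suc d) \<longleftrightarrow> j < n \<and> ys \<in> tuples n d"
  by (auto simp: tuples_def)

lemma tuples_Suc: "tuples n (Suc d) = (\<Union>j<n. (#) j ` tuples n d)"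
  by (auto simp: tuples_def length_Suc_conv)

lemma finite_tuples [simp]: "finite (tuples n d)"
  by (induction d) (auto simp: tuples_Suc)

lemma card_tuples: "card (tuples n d) = n ^ d"
  using card_lists_length_eq[of "{..<n}" d] by (simp add: tuples_def conj_commute)

text \<open>The invariant is indexed by the set of tuples visited so far, which hides the order of
  the visits. One level of nesting adds \<open>3 * n + 3 \<le> 6 * n\<close> steps to
  \<open>n\<close> runs of the inner loops, whence the summand 6 per level.\<close>

lemma runs_FORT:
  assumes "0 < n" "Inv {} R" "distinct vs" "u \<notin> set vs" "1 \<notin> set vs"
  assumes size: "\<And>S R. Inv S R \<Longrightarrow> R 1 = n"
  assumes "\<And>S ys R. ys \<in> tuples n (length vs) \<Longrightarrow> S \<subseteq> tuples n (length vs) \<Longrightarrow> ys \<notin> S \<Longrightarrow>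
      Inv S R \<Longrightarrow> map R vs = ys \<Longrightarrow>
      runs x body R T (\<lambda>R'. Inv (insert ys S) R' \<and> map R' vs = ys)"
  assumes "\<And>S R v c. v \<in> insert u (set vs) \<Longrightarrow> Inv S R \<Longrightarrow> Inv S (R(v := c))"
  shows "runs x (FORT vs u body) R (n ^ length vs * (T + 6 * length vs))
    (Inv (tuples n (length vs)))"
  using assms(2-)
proof (induction vs arbitrary: Inv R)
  case Nil
  then show ?case
    using Nil(6)[of "[]" "{}" R] by (auto elim!: runs_mono)
next
  case (Cons v vs)
  let ?D = "length vs"
  let ?U = "n ^ ?D * (T + 6 * ?D)"
  define Out where "Out = (\<lambda>j. Inv (\<Union>i\<in>{j..<n}. (#) i ` tuples n ?D))"
  have "runs x (FOR v u (FORT vs u body)) R (n * (?U + 3) + 3) (Out 0)"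
  proof (rule runs_FOR)
    show "R 1 = n" using Cons.prems by blast
    show "Out n R" using Cons.prems(1) by (simp add: Out_def)
    show "u \<noteq> v" "v \<noteq> 1" using Cons.prems by auto
    show "\<And>j R c. Out j R \<Longrightarrow> Out j (R(v := c))" "\<And>j R c. Out j R \<Longrightarrow> Out j (R(u := c))"
      unfolding Out_def by (rule Cons.prems(7); simp)+
    fix j R
    assume j: "j < n" "Out (Suc j) R" "R v = j"
    define S0 where "S0 = (\<Union>i\<in>{Suc j..<n}. (#) i ` tuples n ?D)"
    define In where "In = (\<lambda>S R. Inv (S0 \<union> (#) j ` S) R \<and> R v = j)"
    have S0: "S0 \<subseteq> tuples n (Suc ?D)" "\<And>ys. j # ys \<notin> S0"
      by (auto simp: S0_def tuples_Suc)
    have "runs x (FORT vs u body) R ?U (In (tuples n ?D))"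
    proof (rule Cons.IH)
      show "In {} R" using j by (simp add: In_def S0_def Out_def)
      show "distinct vs" "u \<notin> set vs" "1 \<notin> set vs" using Cons.prems by auto
      show "\<And>S R. In S R \<Longrightarrow> R 1 = n" unfolding In_def using Cons.prems(5) by blast
    next
      fix S ys R
      assume ys: "ys \<in> tuples n ?D" "S \<subseteq> tuples n ?D" "ys \<notin> S" "In S R" "map R vs = ys"
      have "runs x body R T (\<lambda>R'. Inv (insert (j # ys) (S0 \<union> (#) j ` S)) R' \<and> map R' (v # vs) = j # ys)"
      proof (rule Cons.prems(6))
        show "j # ys \<in> tuples n (length (v # vs))" using ys j by simp
        show "S0 \<union> (#) j ` S \<subseteq> tuples n (length (v # vs))" using S0 ys j by auto
        show "j # ys \<notin> S0 \<union> (#) j ` S" using S0 ys by auto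
        show "Inv (S0 \<union> (#) j ` S) R" "map R (v # vs) = j # ys" using ys by (auto simp: In_def)
      qed
      then show "runs x body R T (\<lambda>R'. In (insert ys S) R' \<and> map R' vs = ys)"
        by (rule runs_mono) (auto simp: In_def)
    next
      fix S R w c
      assume w: "w \<in> insert u (set vs)" "In S R"
      then have "w \<noteq> v" using Cons.prems by auto
      then show "In S (R(w := c))" using w Cons.prems(7)[of w] by (simp add: In_def del: fun_upd_apply) (simp add: w)
    qed
    then show "runs x (FORT vs u body) R ?U (\<lambda>R'. Out j R' \<and> R' v = j)"
    proof (rule runs_mono)
      fix R' assume "In (tuples n ?D) R'"
      moreover have "{j..<n} = insert j {Suc j..<n}"
        using j(1) by auto
      then have "S0 \<union> (#) j ` tuples n ?D = (\<Union>i\<in>{j..<n}. (#) i ` tuples n ?D)"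
        unfolding S0_def by auto
      ultimately show "Out j R' \<and> R' v = j" by (simp add: In_def Out_def)
    qed simp
  qed
  then show ?case
    unfolding FORT.simps
  proof (rule runs_mono)
    have "n * (?U + 3) + 3 \<le> n * ?U + 6 * n" using \<open>0 < n\<close> by (simp add: algebra_simps)
    also have "\<dots> \<le> n * ?U + 6 * (n * n ^ ?D)" using \<open>0 < n\<close> by simp
    finally show "n * (?U + 3) + 3 \<le> n ^ length (v # vs) * (T + 6 * length (v # vs))"
      by (simp add: algebra_simps)
  qed (simp add: Out_def tuples_Suc lessThan_atLeast0)
qed

locale sized_input =
  fixes I :: "'i set" and enc :: "'i \<Rightarrow> nat list" and sz :: "'i \<Rightarrow> nat"
  assumes sz_pos: "a \<in> I \<Longrightarrow> 0 < sz a"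
begin

lemma sz_pow: "a \<in> I \<Longrightarrow> c \<le> c * sz a ^ e"
  using sz_pos[of a] by simp

text \<open>Register \<open>1\<close> holds the size of the universe and register \<open>0\<close> the first address of the free
  heap. The program may only change registers \<open>\<ge> b\<close> that are below \<open>w\<close> or in the free heap, and
  returns the truth value in register \<open>b\<close>; \<open>\<rho>\<close> assigns registers to variables.\<close>

definition evaluates ::
    "'v set \<Rightarrow> ('i \<Rightarrow> ('v \<Rightarrow> nat) \<Rightarrow> bool) \<Rightarrow> ('v \<Rightarrow> nat) \<Rightarrow> nat \<Rightarrow> ram \<Rightarrow> nat \<Rightarrow> nat \<Rightarrow> nat \<Rightarrow> bool" where
  "evaluates V \<phi> \<rho> b p w K e \<longleftrightarrow> b < w \<and>
    (\<forall>a\<in>I. \<forall>R. R 1 = sz a \<and> w \<le> R 0 \<and> (\<forall>v\<in>V. R (\<rho> v) < sz a) \<longrightarrow>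
      runs (enc a) p R (K * sz a ^ e)
        (\<lambda>R'. R' b = of_bool (\<phi> a (R \<circ> \<rho>)) \<and> (\<forall>i. i < b \<or> w \<le> i \<and> i < R 0 \<longrightarrow> R' i = R i)))"

text \<open>\<open>e\<close> is the exponent of the running time. A program is required for every
  placement of the variables below every \<open>b\<close>, so that subformulas can be compiled into
  fresh registers above those in use; \<open>w\<close> and the factor \<open>K\<close> may depend on
  the placement. The first conjunct says that \<open>\<phi>\<close> depends on the variables in
  \<open>V\<close> only.\<close>

definition dec :: "'v set \<Rightarrow> ('i \<Rightarrow> ('v \<Rightarrow> nat) \<Rightarrow> bool) \<Rightarrow> nat \<Rightarrow> bool" where
  "dec V \<phi> e \<longleftrightarrow>
    (\<forall>a\<in>I. \<forall>f g. (\<forall>v\<in>V. f v < sz a \<and> f v = g v) \<longrightarrow> \<phi> a f = \<phi> a g) \<and>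
    (\<forall>\<rho> b. 2 \<le> b \<and> \<rho> ` V \<subseteq> {2..<b} \<longrightarrow> (\<exists>p w K. evaluates V \<phi> \<rho> b p w K e))"

lemma decI:
  assumes "\<And>a f g. a \<in> I \<Longrightarrow> (\<And>v. v \<in> V \<Longrightarrow> f v < sz a) \<Longrightarrow> (\<And>v. v \<in> V \<Longrightarrow> f v = g v) \<Longrightarrow> \<phi> a f = \<phi> a g"
    and "\<And>\<rho> b. 2 \<le> b \<Longrightarrow> \<rho> ` V \<subseteq> {2..<b} \<Longrightarrow> \<exists>p w K. evaluates V \<phi> \<rho> b p w K e"
  shows "dec V \<phi> e"
  using assms unfolding dec_def by metis

lemma dec_local:
  "dec V \<phi> e \<Longrightarrow> a \<in> I \<Longrightarrow> (\<And>v. v \<in> V \<Longrightarrow> f v < sz a) \<Longrightarrow> (\<And>v. v \<in> V \<Longrightarrow> f v = g v) \<Longrightarrow> \<phi> a f = \<phi> a g"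
  unfolding dec_def by metis

lemma dec_evaluates:
  assumes "dec V \<phi> e" "2 \<le> b" "\<rho> ` V \<subseteq> {2..<b}"
  obtains p w K where "evaluates V \<phi> \<rho> b p w K e"
  using assms unfolding dec_def by metis

lemma evaluatesI:
  assumes "b < w"
    and "\<And>a R. a \<in> I \<Longrightarrow> R 1 = sz a \<Longrightarrow> w \<le> R 0 \<Longrightarrow> (\<And>v. v \<in> V \<Longrightarrow> R (\<rho> v) < sz a) \<Longrightarrow>
      runs (enc a) p R (K * sz a ^ e)
        (\<lambda>R'. R' b = of_bool (\<phi> a (R \<circ> \<rho>)) \<and> (\<forall>i. i < b \<or> w \<le> i \<and> i < R 0 \<longrightarrow> R' i = R i))"
  shows "evaluates V \<phi> \<rho> b p w K e"
  using assms unfolding evaluates_def by blast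

lemma evaluatesD:
  assumes "evaluates V \<phi> \<rho> b p w K e" "a \<in> I" "R 1 = sz a" "w \<le> R 0" "\<And>v. v \<in> V \<Longrightarrow> R (\<rho> v) < sz a"
  shows "runs (enc a) p R (K * sz a ^ e)
        (\<lambda>R'. R' b = of_bool (\<phi> a (R \<circ> \<rho>)) \<and> (\<forall>i. i < b \<or> w \<le> i \<and> i < R 0 \<longrightarrow> R' i = R i))"
  using assms unfolding evaluates_def by blast

lemma evaluates_mono:
  assumes "evaluates V \<phi> \<rho> b p w K e" "w \<le> w'" "K \<le> K'" "e \<le> e'"
  shows "evaluates V \<phi> \<rho> b p w' K' e'"
proof (rule evaluatesI)
  show "b < w'" using assms by (simp add: evaluates_def)
  fix a R
  assume a: "a \<in> I" "R 1 = sz a" "w' \<le> R 0" "\<And>v. v \<in> V \<Longrightarrow> R (\<rho> v) < sz a"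
  have "K * sz a ^ e \<le> K' * sz a ^ e'"
    using assms sz_pos[OF a(1)] by (intro mult_le_mono power_increasing) auto
  with evaluatesD[OF assms(1) a(1,2) _ a(4)] a(3) assms(2)
  show "runs (enc a) p R (K' * sz a ^ e')
        (\<lambda>R'. R' b = of_bool (\<phi> a (R \<circ> \<rho>)) \<and> (\<forall>i. i < b \<or> w' \<le> i \<and> i < R 0 \<longrightarrow> R' i = R i))"
    by (auto elim!: runs_mono)
qed

lemma dec_cong:
  assumes "dec V \<phi> e" "\<And>a f. a \<in> I \<Longrightarrow> (\<And>v. v \<in> V \<Longrightarrow> f v < sz a) \<Longrightarrow> \<psi> a f = \<phi> a f"
  shows "dec V \<psi> e"
proof (rule decI)
  fix a f g
  assume "a \<in> I" "\<And>v. v \<in> V \<Longrightarrow> f v < sz a" "\<And>v. v \<in> V \<Longrightarrow> f v = g v"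
  then show "\<psi> a f = \<psi> a g"
    using dec_local[OF assms(1), of a f g] assms(2)[of a f] assms(2)[of a g] by simp
next
  fix \<rho> :: "_ \<Rightarrow> nat" and b :: nat
  assume "2 \<le> b" "\<rho> ` V \<subseteq> {2..<b}"
  then obtain p w K where ev: "evaluates V \<phi> \<rho> b p w K e" by (rule dec_evaluates[OF assms(1)])
  have "evaluates V \<psi> \<rho> b p w K e"
    by (rule evaluatesI) (use ev assms(2) in \<open>auto simp: evaluates_def elim!: runs_mono\<close>)
  then show "\<exists>p w K. evaluates V \<psi> \<rho> b p w K e" by blast
qed

lemma dec_mono:
  assumes "dec V \<phi> e" "e \<le> e'"
  shows "dec V \<phi> e'"
  using assms(1) evaluates_mono[OF _ order_refl order_refl assms(2)] unfolding dec_def by metis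

text \<open>The program is compiled for the placement \<open>\<rho> \<circ> \<sigma>\<close>, so
  substituting variables costs no time.\<close>

lemma dec_subst:
  assumes "dec V \<phi> e" "\<sigma> ` V \<subseteq> W"
  shows "dec W (\<lambda>a f. \<phi> a (f \<circ> \<sigma>)) e"
proof (rule decI)
  fix a f g
  assume "a \<in> I" "\<And>v. v \<in> W \<Longrightarrow> f v < sz a" "\<And>v. v \<in> W \<Longrightarrow> f v = g v"
  then show "\<phi> a (f \<circ> \<sigma>) = \<phi> a (g \<circ> \<sigma>)"
    using assms by (intro dec_local[OF assms(1)]) auto
next
  fix \<rho> :: "_ \<Rightarrow> nat" and b :: nat
  assume b: "2 \<le> b" "\<rho> ` W \<subseteq> {2..<b}"
  with assms(2) have "(\<rho> \<circ> \<sigma>) ` V \<subseteq> {2..<b}" by auto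
  with b obtain p w K where ev: "evaluates V \<phi> (\<rho> \<circ> \<sigma>) b p w K e"
    using dec_evaluates[OF assms(1)] by metis
  have "evaluates W (\<lambda>a f. \<phi> a (f \<circ> \<sigma>)) \<rho> b p w K e"
  proof (rule evaluatesI)
    show "b < w" using ev by (simp add: evaluates_def)
    fix a R
    assume "a \<in> I" "R 1 = sz a" "w \<le> R 0" "\<And>v. v \<in> W \<Longrightarrow> R (\<rho> v) < sz a"
    then show "runs (enc a) p R (K * sz a ^ e)
        (\<lambda>R'. R' b = of_bool (\<phi> a (R \<circ> \<rho> \<circ> \<sigma>)) \<and> (\<forall>i. i < b \<or> w \<le> i \<and> i < R 0 \<longrightarrow> R' i = R i))"
      using evaluatesD[OF ev, of a R] assms(2) by (simp add: comp_assoc image_subset_iff)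
  qed
  then show "\<exists>p w K. evaluates W (\<lambda>a f. \<phi> a (f \<circ> \<sigma>)) \<rho> b p w K e" by blast
qed

lemma dec_weaken:
  assumes "dec V \<phi> e" "V \<subseteq> W" "e \<le> e'"
  shows "dec W \<phi> e'"
  using dec_subst[of V \<phi> e' id W] dec_mono[OF assms(1,3)] assms(2) by simp

lemma dec_const: "dec V (\<lambda>a f. P) e"
proof (rule decI)
  fix \<rho> :: "'a \<Rightarrow> nat" and b :: nat
  have "evaluates V (\<lambda>a f. P) \<rho> b (SETC b (of_bool P)) (Suc b) 1 e"
  proof (rule evaluatesI)
    fix a and R :: "nat \<Rightarrow> nat"
    assume "a \<in> I" "Suc b \<le> R 0"
    then show "runs (enc a) (SETC b (of_bool P)) R (1 * sz a ^ e)
        (\<lambda>R'. R' b = of_bool P \<and> (\<forall>i. i < b \<or> Suc b \<le> i \<and> i < R 0 \<longrightarrow> R' i = R i))"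
      using sz_pos[of a] by (intro runs_mono[OF runs_SETC[where Q = "(=) (R(b := of_bool P))"]]) auto
  qed simp
  then show "\<exists>p w K. evaluates V (\<lambda>a f. P) \<rho> b p w K e" by blast
qed simp

lemma dec_not:
  assumes "dec V \<phi> e"
  shows "dec V (\<lambda>a f. \<not> \<phi> a f) e"
proof (rule decI)
  fix a f g
  assume "a \<in> I" "\<And>v. v \<in> V \<Longrightarrow> f v < sz a" "\<And>v. v \<in> V \<Longrightarrow> f v = g v"
  then show "(\<not> \<phi> a f) = (\<not> \<phi> a g)" using dec_local[OF assms] by blast
next
  fix \<rho> :: "_ \<Rightarrow> nat" and b :: nat
  assume b: "2 \<le> b" "\<rho> ` V \<subseteq> {2..<b}"
  then obtain p w K where ev: "evaluates V \<phi> \<rho> b p w K e" by (rule dec_evaluates[OF assms])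
  have "evaluates V (\<lambda>a f. \<not> \<phi> a f) \<rho> b (SEQ p (IFNZ b (SETC b 0) (SETC b 1))) w (K + 2) e"
  proof (rule evaluatesI)
    show "b < w" using ev by (simp add: evaluates_def)
    fix a R
    assume a: "a \<in> I" "R 1 = sz a" "w \<le> R 0" "\<And>v. v \<in> V \<Longrightarrow> R (\<rho> v) < sz a"
    have "runs (enc a) (SEQ p (IFNZ b (SETC b 0) (SETC b 1))) R (K * sz a ^ e + (1 + 1))
        (\<lambda>R'. R' b = of_bool (\<not> \<phi> a (R \<circ> \<rho>)) \<and> (\<forall>i. i < b \<or> w \<le> i \<and> i < R 0 \<longrightarrow> R' i = R i))"
      by (rule runs_SEQ, rule runs_mono[OF evaluatesD[OF ev a(1-3)] order_refl], erule a(4))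
        (rule runs_IFNZ; rule runs_SETC; use \<open>b < w\<close> in auto)
    then show "runs (enc a) (SEQ p (IFNZ b (SETC b 0) (SETC b 1))) R ((K + 2) * sz a ^ e)
        (\<lambda>R'. R' b = of_bool (\<not> \<phi> a (R \<circ> \<rho>)) \<and> (\<forall>i. i < b \<or> w \<le> i \<and> i < R 0 \<longrightarrow> R' i = R i))"
      proof (rule runs_mono)
      show "K * sz a ^ e + (1 + 1) \<le> (K + 2) * sz a ^ e"
        unfolding add_mult_distrib using sz_pow[OF a(1), of 2 e] by linarith
    qed
  qed
  then show "\<exists>p w K. evaluates V (\<lambda>a f. \<not> \<phi> a f) \<rho> b p w K e" by blast
qed

lemma dec_and:
  assumes "dec V \<phi> e" "dec V \<psi> e"
  shows "dec V (\<lambda>a f. \<phi> a f \<and> \<psi> a f) e"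
proof (rule decI)
  fix a f g
  assume "a \<in> I" "\<And>v. v \<in> V \<Longrightarrow> f v < sz a" "\<And>v. v \<in> V \<Longrightarrow> f v = g v"
  then show "(\<phi> a f \<and> \<psi> a f) = (\<phi> a g \<and> \<psi> a g)"
    using dec_local[OF assms(1)] dec_local[OF assms(2)] by blast
next
  fix \<rho> :: "_ \<Rightarrow> nat" and b :: nat
  assume b: "2 \<le> b" "\<rho> ` V \<subseteq> {2..<b}"
  obtain p w1 K where ev1': "evaluates V \<phi> \<rho> b p w1 K e" using b by (rule dec_evaluates[OF assms(1)])
  obtain q w2 L where ev2': "evaluates V \<psi> \<rho> b q w2 L e" using b by (rule dec_evaluates[OF assms(2)])
  define w where "w = max w1 w2"
  have ev1: "evaluates V \<phi> \<rho> b p w K e" by (rule evaluates_mono[OF ev1']) (auto simp: w_def)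
  have ev2: "evaluates V \<psi> \<rho> b q w L e" by (rule evaluates_mono[OF ev2']) (auto simp: w_def)
  have "evaluates V (\<lambda>a f. \<phi> a f \<and> \<psi> a f) \<rho> b (SEQ p (IFNZ b q (SETC b 0))) w (K + L + 2) e"
  proof (rule evaluatesI)
    show "b < w" using ev1 by (simp add: evaluates_def)
    fix a R
    assume a: "a \<in> I" "R 1 = sz a" "w \<le> R 0" "\<And>v. v \<in> V \<Longrightarrow> R (\<rho> v) < sz a"
    let ?Q = "\<lambda>R'. R' b = of_bool (\<phi> a (R \<circ> \<rho>) \<and> \<psi> a (R \<circ> \<rho>)) \<and> (\<forall>i. i < b \<or> w \<le> i \<and> i < R 0 \<longrightarrow> R' i = R i)"
    have "runs (enc a) (SEQ p (IFNZ b q (SETC b 0))) R (K * sz a ^ e + (1 + (L * sz a ^ e + 1))) ?Q"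
    proof (rule runs_SEQ, rule runs_mono[OF evaluatesD[OF ev1 a] order_refl])
      fix R'
      assume R': "R' b = of_bool (\<phi> a (R \<circ> \<rho>)) \<and> (\<forall>i. i < b \<or> w \<le> i \<and> i < R 0 \<longrightarrow> R' i = R i)"
      have low: "\<And>v. v \<in> V \<Longrightarrow> R' (\<rho> v) = R (\<rho> v)" "R' 1 = R 1" "R' 0 = R 0" using R' b by auto
      have "runs (enc a) q R' (L * sz a ^ e)
          (\<lambda>S. S b = of_bool (\<psi> a (R' \<circ> \<rho>)) \<and> (\<forall>i. i < b \<or> w \<le> i \<and> i < R' 0 \<longrightarrow> S i = R' i))"
        by (rule evaluatesD[OF ev2 a(1)]) (use low a in auto)
      moreover have "\<psi> a (R' \<circ> \<rho>) = \<psi> a (R \<circ> \<rho>)"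
        by (rule dec_local[OF assms(2) a(1)]) (use low a(4) in auto)
      ultimately show "runs (enc a) (IFNZ b q (SETC b 0)) R' (1 + (L * sz a ^ e + 1)) ?Q"
      proof (intro runs_IFNZ, goal_cases)
        case 1
        show ?case by (rule runs_mono[OF 1(1)]) (use 1 R' low in auto)
      next
        case 2
        show ?case by (rule runs_mono[OF runs_SETC[where Q = "?Q"]]) (use 2 R' low \<open>b < w\<close> in auto)
      qed
    qed
    then show "runs (enc a) (SEQ p (IFNZ b q (SETC b 0))) R ((K + L + 2) * sz a ^ e) ?Q"
      proof (rule runs_mono)
      show "K * sz a ^ e + (1 + (L * sz a ^ e + 1)) \<le> (K + L + 2) * sz a ^ e"
        unfolding add_mult_distrib using sz_pow[OF a(1), of 2 e] by linarith
    qed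
  qed
  then show "\<exists>p w K. evaluates V (\<lambda>a f. \<phi> a f \<and> \<psi> a f) \<rho> b p w K e" by blast
qed

lemma dec_or:
  assumes "dec V \<phi> e" "dec V \<psi> e"
  shows "dec V (\<lambda>a f. \<phi> a f \<or> \<psi> a f) e"
  using dec_not[OF dec_and[OF dec_not[OF assms(1)] dec_not[OF assms(2)]]] by simp

lemma dec_Bex:
  assumes "finite S" "\<And>s. s \<in> S \<Longrightarrow> dec V (\<phi> s) e"
  shows "dec V (\<lambda>a f. \<exists>s\<in>S. \<phi> s a f) e"
  using assms
proof (induction S)
  case empty
  then show ?case using dec_const[of V False e] by simp
next
  case (insert s S)
  then show ?case using dec_or[of V "\<phi> s" e "\<lambda>a f. \<exists>s\<in>S. \<phi> s a f"] by simp
qed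

lemma dec_Ball:
  assumes "finite S" "\<And>s. s \<in> S \<Longrightarrow> dec V (\<phi> s) e"
  shows "dec V (\<lambda>a f. \<forall>s\<in>S. \<phi> s a f) e"
proof -
  have "dec V (\<lambda>a f. \<exists>s\<in>S. \<not> \<phi> s a f) e"
    using assms by (intro dec_Bex dec_not)
  then show ?thesis using dec_not by fastforce
qed

lemma dec_imp:
  assumes "dec V \<phi> e" "dec V \<psi> e"
  shows "dec V (\<lambda>a f. \<phi> a f \<longrightarrow> \<psi> a f) e"
  unfolding imp_conv_disj using assms by (intro dec_or dec_not)

text \<open>Register \<open>b\<close> runs through the universe as the value of \<open>x\<close>,
  \<open>b + 1\<close> is the constant of the loop, \<open>b + 2\<close> collects the disjunction,
  and the body is compiled from \<open>b + 3\<close> on. The single loop raises the exponent by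
  one.\<close>

lemma dec_ex:
  assumes "dec (insert x V) \<phi> e"
  shows "dec V (\<lambda>a f. \<exists>y<sz a. \<phi> a (f(x := y))) (Suc e)"
proof (rule decI)
  fix a f g
  assume "a \<in> I" "\<And>v. v \<in> V \<Longrightarrow> f v < sz a" "\<And>v. v \<in> V \<Longrightarrow> f v = g v"
  then have "y < sz a \<Longrightarrow> \<phi> a (f(x := y)) = \<phi> a (g(x := y))" for y
    by (intro dec_local[OF assms]) auto
  then show "(\<exists>y<sz a. \<phi> a (f(x := y))) = (\<exists>y<sz a. \<phi> a (g(x := y)))" by blast
next
  fix \<rho> :: "_ \<Rightarrow> nat" and b :: nat
  assume b: "2 \<le> b" "\<rho> ` V \<subseteq> {2..<b}"
  define \<rho>' where "\<rho>' = \<rho>(x := b)"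
  have "\<rho>' ` insert x V \<subseteq> {2..<b + 3}" using b by (auto simp: \<rho>'_def)
  then obtain p w0 K where ev': "evaluates (insert x V) \<phi> \<rho>' (b + 3) p w0 K e"
    by (rule dec_evaluates[OF assms, rotated]) simp_all
  define w where "w = max w0 (b + 4)"
  have ev: "evaluates (insert x V) \<phi> \<rho>' (b + 3) p w K e" by (rule evaluates_mono[OF ev']) (auto simp: w_def)
  have w: "b + 3 < w" by (simp add: w_def)
  \<comment> \<open>The else branch is a dummy, as the language has no empty program: register
    \<open>b + 3\<close> is already 0 there.\<close>
  define q where "q = SEQ p (IFNZ (b + 3) (SETC (b + 2) 1) (SETC (b + 3) 0))"
  define P where "P = SEQ (SETC (b + 2) 0) (SEQ (FOR b (b + 1) q) (SEQ (SETC b 0) (ADD b b (b + 2))))"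
  have "evaluates V (\<lambda>a f. \<exists>y<sz a. \<phi> a (f(x := y))) \<rho> b P w (K + 11) (Suc e)"
  proof (rule evaluatesI)
    show "b < w" using w by simp
    fix a R
    assume a: "a \<in> I" "R 1 = sz a" "w \<le> R 0" "\<And>v. v \<in> V \<Longrightarrow> R (\<rho> v) < sz a"
    let ?n = "sz a"
    define F where "F = (\<lambda>y. \<phi> a ((R \<circ> \<rho>)(x := y)))"
    define Inv where "Inv = (\<lambda>j R'. R' (b + 2) = of_bool (\<exists>y<?n. j \<le> y \<and> F y) \<and>
      (\<forall>i. i < b \<or> w \<le> i \<and> i < R 0 \<longrightarrow> R' i = R i))"
    let ?Q = "\<lambda>R'. R' b = of_bool (\<exists>y<sz a. \<phi> a ((R \<circ> \<rho>)(x := y))) \<and>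
      (\<forall>i. i < b \<or> w \<le> i \<and> i < R 0 \<longrightarrow> R' i = R i)"
    have FOR: "runs (enc a) (FOR b (b + 1) q) (R(b + 2 := 0)) (?n * ((K * ?n ^ e + 2) + 3) + 3) (Inv 0)"
    proof (rule runs_FOR)
      show "(R(b + 2 := 0)) 1 = ?n" using a b by simp
      show "Inv ?n (R(b + 2 := 0))" using a w b by (auto simp: Inv_def)
      show "b + 1 \<noteq> b" "b \<noteq> 1" using b by auto
      show "Inv j S \<Longrightarrow> Inv j (S(b := c))" "Inv j S \<Longrightarrow> Inv j (S(b + 1 := c))" for j S c
        using w by (auto simp: Inv_def)
      fix j S
      assume j: "j < ?n" "Inv (Suc j) S" "S b = j"
      have low: "\<And>i. i < b \<Longrightarrow> S i = R i" using j by (auto simp: Inv_def)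
      have S\<rho>: "S (\<rho>' v) = ((R \<circ> \<rho>)(x := j)) v" if "v \<in> insert x V" for v
        using that b low j by (auto simp: \<rho>'_def)
      have lt: "\<And>v. v \<in> insert x V \<Longrightarrow> S (\<rho>' v) < ?n" using S\<rho> j a by auto
      have F: "\<phi> a (S \<circ> \<rho>') = F j"
        unfolding F_def by (rule dec_local[OF assms a(1)]) (use S\<rho> lt in auto)
      have split: "(\<exists>y<?n. j \<le> y \<and> F y) = (F j \<or> (\<exists>y<?n. Suc j \<le> y \<and> F y))"
        using j(1) by (metis Suc_le_eq le_less less_imp_le_nat)
      have "runs (enc a) q S (K * ?n ^ e + (1 + 1)) (\<lambda>R'. Inv j R' \<and> R' b = j)"
        unfolding q_def
      proof (rule runs_SEQ, rule runs_mono[OF evaluatesD[OF ev a(1)] order_refl])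
        show "S 1 = ?n" "w \<le> S 0" using low a b by auto
        show "\<And>v. v \<in> insert x V \<Longrightarrow> S (\<rho>' v) < ?n" by (rule lt)
        fix S'
        assume S': "S' (b + 3) = of_bool (\<phi> a (S \<circ> \<rho>')) \<and> (\<forall>i. i < b + 3 \<or> w \<le> i \<and> i < S 0 \<longrightarrow> S' i = S i)"
        have S0: "S 0 = R 0" using low b by simp
        show "runs (enc a) (IFNZ (b + 3) (SETC (b + 2) 1) (SETC (b + 3) 0)) S' (1 + 1) (\<lambda>R'. Inv j R' \<and> R' b = j)"
          by (rule runs_IFNZ; rule runs_SETC; use S' j w S0 F in \<open>auto simp: Inv_def split\<close>)
      qed
      then show "runs (enc a) q S (K * ?n ^ e + 2) (\<lambda>R'. Inv j R' \<and> R' b = j)" by simp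
    qed
    have "runs (enc a) P R (1 + ((?n * ((K * ?n ^ e + 2) + 3) + 3) + (1 + 1))) ?Q"
      unfolding P_def
    proof (rule runs_SEQ, rule runs_SETC, rule runs_SEQ, rule runs_mono[OF FOR order_refl])
      fix S
      assume "Inv 0 S"
      then show "runs (enc a) (SEQ (SETC b 0) (ADD b b (b + 2))) S (1 + 1) ?Q"
        by (intro runs_SEQ runs_SETC runs_ADD) (use w in \<open>auto simp: Inv_def F_def\<close>)
    qed
    then show "runs (enc a) P R ((K + 11) * ?n ^ Suc e) ?Q"
    proof (rule runs_mono)
      have "?n \<ge> 1" "?n ^ e \<ge> 1" using sz_pos[OF a(1)] by auto
      then have h: "?n * ?n ^ e \<ge> ?n" "?n * ?n ^ e \<ge> 1" by auto
      have "1 + ((?n * ((K * ?n ^ e + 2) + 3) + 3) + (1 + 1)) = K * (?n * ?n ^ e) + 5 * ?n + 6"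
        by (simp add: algebra_simps)
      also have "\<dots> \<le> (K + 11) * ?n ^ Suc e"
        unfolding power_Suc add_mult_distrib using h by linarith
      finally show "1 + ((?n * ((K * ?n ^ e + 2) + 3) + 3) + (1 + 1)) \<le> (K + 11) * ?n ^ Suc e" .
    qed
  qed
  then show "\<exists>p w K. evaluates V (\<lambda>a f. \<exists>y<sz a. \<phi> a (f(x := y))) \<rho> b p w K (Suc e)" by blast
qed

end

section \<open>A table indexed by tuples and the transitive-closure operator\<close>

subsection \<open>Reachability\<close>

text \<open>The number with digits \<open>ys\<close> in base \<open>n\<close>, continuing from the
  value \<open>c\<close>. It serves as the offset of a tuple in a table.\<close>

definition horner :: "nat \<Rightarrow> nat \<Rightarrow> nat list \<Rightarrow> nat" where
  "horner n = foldl (\<lambda>acc y. acc * n + y)"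

lemma horner_simps [simp]:
  "horner n c [] = c" "horner n c (y # ys) = horner n (c * n + y) ys"
  by (simp_all add: horner_def)

lemma horner_eq: "horner n c ys = c * n ^ length ys + horner n 0 ys"
proof (induction ys arbitrary: c)
  case (Cons y ys)
  have "horner n c (y # ys) = (c * n + y) * n ^ length ys + horner n 0 ys"
    using Cons[of "c * n + y"] by simp
  moreover have "horner n 0 (y # ys) = y * n ^ length ys + horner n 0 ys"
    using Cons[of y] by simp
  ultimately show ?case by (simp add: algebra_simps)
qed simp

lemma horner_replicate_0: "horner n c (replicate d 0) = c * n ^ d"
  by (induction d arbitrary: c) (simp_all add: mult.assoc)

lemma horner_less: "ys \<in> tuples n d \<Longrightarrow> horner n 0 ys < n ^ d"
proof (induction ys arbitrary: d)
  case (Cons y ys)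
  then obtain d' where d: "d = Suc d'" by (cases d) (auto simp: tuples_def)
  with Cons have y: "y < n" "ys \<in> tuples n d'" "length ys = d'" by (auto simp: tuples_def)
  have "horner n 0 (y # ys) = y * n ^ d' + horner n 0 ys"
    using horner_eq[of n y ys] y by simp
  also have "\<dots> < y * n ^ d' + n ^ d'" using Cons.IH[OF y(2)] by simp
  also have "\<dots> = Suc y * n ^ d'" by simp
  also have "\<dots> \<le> n * n ^ d'" using y(1) by (intro mult_le_mono1) simp
  finally show ?case using d by simp
qed (auto simp: tuples_def)

lemma horner_inject:
  assumes "xs \<in> tuples n d" "ys \<in> tuples n d" "horner n c xs = horner n c' ys"
  shows "c = c' \<and> xs = ys"
  using assms
proof (induction d arbitrary: xs ys c c')
  case (Suc d)
  then obtain x xs' y ys' where "xs = x # xs'" "ys = y # ys'" "x < n" "y < n"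
      "xs' \<in> tuples n d" "ys' \<in> tuples n d"
    by (auto simp: tuples_Suc)
  moreover from this Suc have "c * n + x = c' * n + y" "xs' = ys'"
    by (metis horner_simps(2))+
  moreover from this(1) \<open>x < n\<close> \<open>y < n\<close> have "x = y"
    by (metis mod_less mod_mult_self3)
  ultimately show ?case by simp
qed simp

text \<open>Register \<open>c\<close> becomes \<open>horner n (R c)\<close> of the registers \<open>vs\<close>, with scratch registers
  \<open>c + 1\<close>, \<open>c + 2\<close> and \<open>c + 3\<close>.\<close>

primrec HORNER :: "nat \<Rightarrow> nat list \<Rightarrow> ram" where
  "HORNER c [] = SETC (c + 1) 0"
| "HORNER c (v # vs) = SEQ (SETC (c + 1) 0) (SEQ (ADD (c + 1) (c + 1) c) (SEQ (SETC c 0)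
     (SEQ (FOR (c + 2) (c + 3) (ADD c c (c + 1))) (SEQ (ADD c c v) (HORNER c vs)))))"

lemma runs_HORNER:
  assumes "R 1 = n" "0 < n" "1 < c" "set vs \<inter> {c..c + 3} = {}"
  shows "runs x (HORNER c vs) R (11 * n * length vs + 1)
    (\<lambda>R'. R' c = horner n (R c) (map R vs) \<and> (\<forall>i. i \<notin> {c..c + 3} \<longrightarrow> R' i = R i))"
  using assms(1,4)
proof (induction vs arbitrary: R)
  case Nil
  then show ?case by (auto intro!: runs_mono[OF runs_SETC[where Q = "(=) (R(c + 1 := 0))"]])
next
  case (Cons v vs)
  define R1 where "R1 = R(c + 1 := R c, c := 0)"
  define Inv where "Inv = (\<lambda>j S. S c = (n - j) * R c \<and> S (c + 1) = R c \<and> (\<forall>i. i \<notin> {c..c + 3} \<longrightarrow> S i = R i))"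
  have FOR: "runs x (FOR (c + 2) (c + 3) (ADD c c (c + 1))) R1 (n * (1 + 3) + 3) (Inv 0)"
  proof (rule runs_FOR)
    show "R1 1 = n" using Cons.prems \<open>1 < c\<close> by (simp add: R1_def)
    show "Inv n R1" by (simp add: Inv_def R1_def)
    show "c + 3 \<noteq> c + 2" "c + 2 \<noteq> 1" by simp_all
    show "Inv j S \<Longrightarrow> Inv j (S(c + 2 := y))" "Inv j S \<Longrightarrow> Inv j (S(c + 3 := y))" for j S y
      by (auto simp: Inv_def)
    fix j S
    assume j: "j < n" "Inv (Suc j) S" "S (c + 2) = j"
    then have "n - j = Suc (n - Suc j)" by simp
    with j show "runs x (ADD c c (c + 1)) S 1 (\<lambda>R'. Inv j R' \<and> R' (c + 2) = j)"
      by (intro runs_ADD) (auto simp: Inv_def)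
  qed
  have "runs x (HORNER c (v # vs)) R
      (1 + (1 + (1 + ((n * (1 + 3) + 3) + (1 + (11 * n * length vs + 1))))))
      (\<lambda>R'. R' c = horner n (R c) (map R (v # vs)) \<and> (\<forall>i. i \<notin> {c..c + 3} \<longrightarrow> R' i = R i))"
    unfolding HORNER.simps
  proof (rule runs_SEQ, rule runs_SETC, rule runs_SEQ, rule runs_ADD, rule runs_SEQ, rule runs_SETC)
    have "R(c + 1 := 0, c + 1 := (R(c + 1 := 0)) (c + 1) + (R(c + 1 := 0)) c, c := 0) = R1"
      by (auto simp: R1_def)
    moreover have "runs x (SEQ (FOR (c + 2) (c + 3) (ADD c c (c + 1))) (SEQ (ADD c c v) (HORNER c vs)))
        R1 ((n * (1 + 3) + 3) + (1 + (11 * n * length vs + 1)))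
      (\<lambda>R'. R' c = horner n (R c) (map R (v # vs)) \<and> (\<forall>i. i \<notin> {c..c + 3} \<longrightarrow> R' i = R i))"
    proof (rule runs_SEQ, rule runs_mono[OF FOR order_refl], rule runs_SEQ, rule runs_ADD)
      fix S
      assume S: "Inv 0 S"
      define S1 where "S1 = S(c := S c + S v)"
      have other: "i \<notin> {c..c + 3} \<Longrightarrow> S1 i = R i" for i using S by (auto simp: S1_def Inv_def)
      have "v \<notin> {c..c + 3}" using Cons.prems by auto
      then have S1c: "S1 c = R c * n + R v"
        using S by (simp add: S1_def Inv_def)
      have "runs x (HORNER c vs) S1 (11 * n * length vs + 1)
          (\<lambda>R'. R' c = horner n (S1 c) (map S1 vs) \<and> (\<forall>i. i \<notin> {c..c + 3} \<longrightarrow> R' i = S1 i))"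
      proof (rule Cons.IH)
        show "S1 1 = n" using other[of 1] Cons.prems \<open>1 < c\<close> by simp
        show "set vs \<inter> {c..c + 3} = {}" using Cons.prems by auto
      qed
      moreover have "map S1 vs = map R vs" using Cons.prems by (intro map_cong other) auto
      ultimately show "runs x (HORNER c vs) (S(c := S c + S v)) (11 * n * length vs + 1)
          (\<lambda>R'. R' c = horner n (R c) (map R (v # vs)) \<and> (\<forall>i. i \<notin> {c..c + 3} \<longrightarrow> R' i = R i))"
        unfolding S1_def[symmetric] using S1c other by (auto elim!: runs_mono)
    qed
    ultimately show "runs x (SEQ (FOR (c + 2) (c + 3) (ADD c c (c + 1))) (SEQ (ADD c c v) (HORNER c vs)))
        (R(c + 1 := 0, c + 1 := (R(c + 1 := 0)) (c + 1) + (R(c + 1 := 0)) c, c := 0))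
        ((n * (1 + 3) + 3) + (1 + (11 * n * length vs + 1)))
        (\<lambda>R'. R' c = horner n (R c) (map R (v # vs)) \<and> (\<forall>i. i \<notin> {c..c + 3} \<longrightarrow> R' i = R i))"
      by simp
  qed
  then show ?case
    by (rule runs_mono) (use \<open>0 < n\<close> in auto)
qed

definition ADDRESS :: "nat \<Rightarrow> nat \<Rightarrow> nat list \<Rightarrow> ram" where
  "ADDRESS c A vs = SEQ (SETC c 0) (SEQ (HORNER c vs) (ADD c c A))"

lemma runs_ADDRESS:
  assumes "R 1 = n" "0 < n" "1 < c" "set vs \<inter> {c..c + 3} = {}" "A \<notin> {c..c + 3}"
  shows "runs x (ADDRESS c A vs) R ((11 * length vs + 3) * n)
    (\<lambda>R'. R' c = R A + horner n 0 (map R vs) \<and> (\<forall>i. i \<notin> {c..c + 3} \<longrightarrow> R' i = R i))"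
proof -
  let ?R = "R(c := 0)"
  have map: "map ?R vs = map R vs" using assms(4) by auto
  have "runs x (HORNER c vs) ?R (11 * n * length vs + 1)
      (\<lambda>R'. R' c = horner n (?R c) (map ?R vs) \<and> (\<forall>i. i \<notin> {c..c + 3} \<longrightarrow> R' i = ?R i))"
    by (rule runs_HORNER) (use assms in auto)
  then have *: "runs x (HORNER c vs) ?R (11 * n * length vs + 1)
      (\<lambda>R'. R' c = horner n 0 (map R vs) \<and> (\<forall>i. i \<notin> {c..c + 3} \<longrightarrow> R' i = R i))"
    unfolding map by (rule runs_mono) auto
  have "runs x (ADDRESS c A vs) R (1 + ((11 * n * length vs + 1) + 1))
    (\<lambda>R'. R' c = R A + horner n 0 (map R vs) \<and> (\<forall>i. i \<notin> {c..c + 3} \<longrightarrow> R' i = R i))"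
    unfolding ADDRESS_def
    by (rule runs_SEQ, rule runs_SETC, rule runs_SEQ, rule runs_mono[OF * order_refl], rule runs_ADD)
      (use assms(5) in auto)
  then show ?thesis
    by (rule runs_mono) (use \<open>0 < n\<close> in \<open>auto simp: algebra_simps\<close>)
qed

fun upds :: "('v \<Rightarrow> nat) \<Rightarrow> 'v list \<Rightarrow> nat list \<Rightarrow> 'v \<Rightarrow> nat" where
  "upds f (x # xs) (y # ys) = (upds f xs ys)(x := y)"
| "upds f _ _ = f"

lemma upds_comp: "length xs = length rs \<Longrightarrow> R \<circ> upds \<rho> xs rs = upds (R \<circ> \<rho>) xs (map R rs)"
  by (induction xs rs rule: list_induct2) (auto simp: fun_eq_iff)

lemma upds_outside: "length xs = length ys \<Longrightarrow> v \<notin> set xs \<Longrightarrow> upds f xs ys v = f v"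
  by (induction xs ys rule: list_induct2) auto

lemma upds_nth:
  "length xs = length ys \<Longrightarrow> distinct xs \<Longrightarrow> i < length xs \<Longrightarrow> upds f xs ys (xs ! i) = ys ! i"
proof (induction xs ys arbitrary: i rule: list_induct2)
  case (Cons x xs y ys)
  then show ?case by (cases i) auto
qed simp

lemma upds_mem: "length xs = length ys \<Longrightarrow> v \<in> set xs \<Longrightarrow> upds f xs ys v \<in> set ys"
  by (induction xs ys rule: list_induct2) auto

lemma upds_eq: "length xs = length ys \<Longrightarrow> (v \<notin> set xs \<Longrightarrow> f v = g v) \<Longrightarrow> upds f xs ys v = upds g xs ys v"
  by (induction xs ys rule: list_induct2) auto

lemma upds_less:
  assumes "ys \<in> tuples n (length xs)" "v \<notin> set xs \<Longrightarrow> f v < n"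
  shows "upds f xs ys v < n"
  using assms upds_mem[of xs ys v f] upds_outside[of xs ys v f] by (cases "v \<in> set xs") (auto simp: tuples_def)

lemma upds_less_image:
  assumes "length xs = length rs" "v \<notin> set xs \<Longrightarrow> \<rho> v \<in> A" "set rs \<subseteq> A"
  shows "upds \<rho> xs rs v \<in> A"
  using assms upds_mem[of xs rs v \<rho>] upds_outside[of xs rs v \<rho>] by (cases "v \<in> set xs") auto

context sized_input
begin

definition tc_step :: "('i \<Rightarrow> ('v \<Rightarrow> nat) \<Rightarrow> bool) \<Rightarrow> 'v list \<Rightarrow> 'v list \<Rightarrow> 'i \<Rightarrow> ('v \<Rightarrow> nat) \<Rightarrow> (nat list \<times> nat list) set" where
  "tc_step \<psi> xs ys a f = {(p, q). p \<in> tuples (sz a) (length xs) \<and> q \<in> tuples (sz a) (length xs) \<and>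
     \<psi> a (upds f (xs @ ys) (p @ q))}"

text \<open>A transitive-closure operator on tuples. Start and end are given by conditions instead
  of tuples of variables, so they may involve input values and constants.\<close>

definition tc :: "('i \<Rightarrow> ('v \<Rightarrow> nat) \<Rightarrow> bool) \<Rightarrow> ('i \<Rightarrow> ('v \<Rightarrow> nat) \<Rightarrow> bool) \<Rightarrow> ('i \<Rightarrow> ('v \<Rightarrow> nat) \<Rightarrow> bool) \<Rightarrow>
    'v list \<Rightarrow> 'v list \<Rightarrow> 'i \<Rightarrow> ('v \<Rightarrow> nat) \<Rightarrow> bool" where
  "tc \<alpha> \<psi> \<omega> xs ys a f \<longleftrightarrow> (\<exists>p\<in>tuples (sz a) (length xs). \<exists>q\<in>tuples (sz a) (length xs).
     \<alpha> a (upds f xs p) \<and> (p, q) \<in> (tc_step \<psi> xs ys a f)\<^sup>* \<and> \<omega> a (upds f xs q))"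

end

lemma runs_FORT_pow:
  assumes "0 < n" "Inv {} R" "distinct vs" "u \<notin> set vs" "1 \<notin> set vs" "d = length vs"
  assumes "\<And>S R. Inv S R \<Longrightarrow> R 1 = n"
  assumes "\<And>S ys R. ys \<in> tuples n d \<Longrightarrow> S \<subseteq> tuples n d \<Longrightarrow> ys \<notin> S \<Longrightarrow>
      Inv S R \<Longrightarrow> map R vs = ys \<Longrightarrow>
      runs x body R (K * n ^ e) (\<lambda>R'. Inv (insert ys S) R' \<and> map R' vs = ys)"
  assumes "\<And>S R v c. v \<in> insert u (set vs) \<Longrightarrow> Inv S R \<Longrightarrow> Inv S (R(v := c))"
  shows "runs x (FORT vs u body) R ((K + 6 * d) * n ^ (d + e)) (Inv (tuples n d))"
proof -
  have "runs x (FORT vs u body) R (n ^ length vs * (K * n ^ e + 6 * length vs)) (Inv (tuples n (length vs)))"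
    by (rule runs_FORT[where Inv = Inv]) (use assms in \<open>simp_all del: fun_upd_apply\<close>)
  then show ?thesis
  proof (rule runs_mono)
    have "6 * d \<le> 6 * d * n ^ e" using assms(1) by simp
    then have "K * n ^ e + 6 * d \<le> (K + 6 * d) * n ^ e" by (simp add: add_mult_distrib)
    then have "n ^ d * (K * n ^ e + 6 * d) \<le> n ^ d * ((K + 6 * d) * n ^ e)" by simp
    then show "n ^ length vs * (K * n ^ e + 6 * length vs) \<le> (K + 6 * d) * n ^ (d + e)"
      using assms(6) by (simp add: power_add mult_ac)
  qed (use assms(6) in simp)
qed

lemma mono_power_sum:
  fixes n :: nat
  assumes "0 < n" "e \<le> e'" "e1 \<le> e'"
  shows "K * n ^ e + L * n ^ e1 \<le> (K + L) * n ^ e'"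
  unfolding add_mult_distrib using assms by (intro add_mono mult_le_mono power_increasing) auto

context sized_input
begin

lemma tc_local:
  assumes \<psi>: "dec (V \<union> set xs \<union> set ys) \<psi> e" and \<alpha>: "dec (V \<union> set xs) \<alpha> e" and \<omega>: "dec (V \<union> set xs) \<omega> e"
    and len: "length ys = length xs" and a: "a \<in> I"
    and f: "\<And>v. v \<in> V \<Longrightarrow> f v < sz a" "\<And>v. v \<in> V \<Longrightarrow> f v = g v"
  shows "p \<in> tuples (sz a) (length xs) \<Longrightarrow> \<alpha> a (upds f xs p) = \<alpha> a (upds g xs p)"
    and "p \<in> tuples (sz a) (length xs) \<Longrightarrow> \<omega> a (upds f xs p) = \<omega> a (upds g xs p)"
    and "tc_step \<psi> xs ys a f = tc_step \<psi> xs ys a g"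
proof -
  have init: "upds f xs p v < sz a \<and> upds f xs p v = upds g xs p v"
    if "p \<in> tuples (sz a) (length xs)" "v \<in> V \<union> set xs" for p v
    using that f by (intro conjI upds_less upds_eq) (auto simp: tuples_def)
  show "p \<in> tuples (sz a) (length xs) \<Longrightarrow> \<alpha> a (upds f xs p) = \<alpha> a (upds g xs p)"
    using init by (intro dec_local[OF \<alpha> a]) blast+
  show "p \<in> tuples (sz a) (length xs) \<Longrightarrow> \<omega> a (upds f xs p) = \<omega> a (upds g xs p)"
    using init by (intro dec_local[OF \<omega> a]) blast+
  have step: "upds f (xs @ ys) (p @ q) v < sz a \<and> upds f (xs @ ys) (p @ q) v = upds g (xs @ ys) (p @ q) v"
    if "p \<in> tuples (sz a) (length xs)" "q \<in> tuples (sz a) (length xs)" "v \<in> V \<union> set xs \<union> set ys" for p q v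
    using that f len by (intro conjI upds_less upds_eq) (auto simp: tuples_def)
  have "\<psi> a (upds f (xs @ ys) (p @ q)) = \<psi> a (upds g (xs @ ys) (p @ q))"
    if "p \<in> tuples (sz a) (length xs)" "q \<in> tuples (sz a) (length xs)" for p q
    using step[OF that] by (intro dec_local[OF \<psi> a]) blast+
  then show "tc_step \<psi> xs ys a f = tc_step \<psi> xs ys a g"
    unfolding tc_step_def by blast
qed

text \<open>A bit table in the free heap, indexed by tuples in base \<open>n\<close>, marks the tuples found reachable.
  Each of \<open>n ^ (2 * d)\<close> rounds, as many as there are pairs of tuples, looks for successors of all
  marked tuples.\<close>

lemma dec_tc:
  fixes xs ys :: "'v list"
  assumes \<psi>: "dec (V \<union> set xs \<union> set ys) \<psi> e" and \<alpha>: "dec (V \<union> set xs) \<alpha> e" and \<omega>: "dec (V \<union> set xs) \<omega> e"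
    and len: "length ys = length xs" and "1 \<le> e"
  shows "dec V (tc \<alpha> \<psi> \<omega> xs ys) (4 * length xs + e)"
proof (rule decI)
  fix a f g
  assume *: "a \<in> I" "\<And>v. v \<in> V \<Longrightarrow> f v < sz a" "\<And>v. v \<in> V \<Longrightarrow> f v = g v"
  show "tc \<alpha> \<psi> \<omega> xs ys a f = tc \<alpha> \<psi> \<omega> xs ys a g"
    unfolding tc_def using tc_local[OF \<psi> \<alpha> \<omega> len *] by auto
next
  fix \<rho> :: "'v \<Rightarrow> nat" and b :: nat
  assume b: "2 \<le> b" "\<rho> ` V \<subseteq> {2..<b}"
  \<comment> \<open>Layout: \<open>b\<close> holds the address of the table, \<open>b + 1\<close>
    the result flag, \<open>u\<close> the constant of the loops, \<open>c\<close> to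
    \<open>c + 3\<close> the scratch area of \<open>ADDRESS\<close>, \<open>z\<close> a zero. Then
    come the loop registers for two tuples and for the rounds, and from \<open>B\<close> on the
    registers of the subformulas.\<close>
  define d where "d = length xs"
  define u where "u = b + 2"
  define c where "c = b + 3"
  define z where "z = b + 7"
  define xr where "xr = [b + 8..<b + 8 + d]"
  define yr where "yr = [b + 8 + d..<b + 8 + 2 * d]"
  define rr where "rr = [b + 8 + 2 * d..<b + 8 + 4 * d]"
  define B where "B = b + 8 + 4 * d"
  define \<rho>i where "\<rho>i = upds \<rho> xs yr"
  define \<rho>s where "\<rho>s = upds \<rho> (xs @ ys) (xr @ yr)"
  note regs = u_def c_def z_def xr_def yr_def rr_def B_def
  have lens: "length xr = d" "length yr = d" "length rr = 2 * d" "length ys = d" "length xs = d"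
    using len by (auto simp: regs d_def)
  have "\<rho>i ` (V \<union> set xs) \<subseteq> {2..<B}"
  proof
    fix r assume "r \<in> \<rho>i ` (V \<union> set xs)"
    then obtain v where v: "r = \<rho>i v" "v \<in> V \<union> set xs" by blast
    show "r \<in> {2..<B}"
      unfolding v(1) \<rho>i_def
      by (rule upds_less_image) (use v b lens in \<open>auto simp: regs\<close>)
  qed
  moreover have "2 \<le> B" by (simp add: B_def)
  ultimately obtain pi wi Ki pf wf Kf where
    evi': "evaluates (V \<union> set xs) \<alpha> \<rho>i B pi wi Ki e" and
    evf': "evaluates (V \<union> set xs) \<omega> \<rho>i B pf wf Kf e"
    using dec_evaluates[OF \<alpha>] dec_evaluates[OF \<omega>] by metis
  have "\<rho>s ` (V \<union> set xs \<union> set ys) \<subseteq> {2..<B}"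
  proof
    fix r assume "r \<in> \<rho>s ` (V \<union> set xs \<union> set ys)"
    then obtain v where v: "r = \<rho>s v" "v \<in> V \<union> set xs \<union> set ys" by blast
    show "r \<in> {2..<B}"
      unfolding v(1) \<rho>s_def
      by (rule upds_less_image) (use v b lens in \<open>auto simp: regs\<close>)
  qed
  with \<open>2 \<le> B\<close> obtain ps ws Ks where evs': "evaluates (V \<union> set xs \<union> set ys) \<psi> \<rho>s B ps ws Ks e"
    using dec_evaluates[OF \<psi>] by metis
  define w where "w = Max {wi, wf, ws}"
  define K where "K = Max {Ki, Kf, Ks}"
  have evi: "evaluates (V \<union> set xs) \<alpha> \<rho>i B pi w K e" by (rule evaluates_mono[OF evi']) (auto simp: w_def K_def)
  have evf: "evaluates (V \<union> set xs) \<omega> \<rho>i B pf w K e" by (rule evaluates_mono[OF evf']) (auto simp: w_def K_def)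
  have evs: "evaluates (V \<union> set xs \<union> set ys) \<psi> \<rho>s B ps w K e" by (rule evaluates_mono[OF evs']) (auto simp: w_def K_def)
  have Bw: "B < w" using evi by (simp add: evaluates_def)
  define FETCH where "FETCH = (\<lambda>vs. SEQ (ADDRESS c b vs) (LOAD c c))"
  define PUT where "PUT = SEQ (ADDRESS c b yr) (STORE c B)"
  define body1 where "body1 = SEQ pi PUT"
  define bodyY where "bodyY = SEQ ps (IFNZ B PUT (SETC c 0))"
  define bodyX where "bodyX = SEQ (FETCH xr) (IFNZ c (FORT yr u bodyY) (SETC c 0))"
  define bodyF where "bodyF = SEQ (FETCH yr) (IFNZ c (SEQ pf (IFNZ B (SETC (b + 1) 1) (SETC c 0))) (SETC c 0))"
  \<comment> \<open>\<open>HORNER\<close> with start value 1 and \<open>d\<close> zero digits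
    computes \<open>n ^ d\<close>. Moving the start of the free heap by this amount protects the
    table from the subprograms.\<close>
  define PRO where "PRO = SEQ (SETC b 0) (SEQ (ADD b b 0) (SEQ (SETC z 0) (SEQ (SETC c 1)
     (SEQ (HORNER c (replicate d z)) (ADD 0 0 c)))))"
  \<comment> \<open>Register 0 gets back its old value, which returns the table to the free heap,
    and the flag becomes the result.\<close>
  define EPI where "EPI = SEQ (SETC 0 0) (SEQ (ADD 0 0 b) (SEQ (SETC b 0) (ADD b b (b + 1))))"
  define P where "P = SEQ PRO (SEQ (FORT yr u body1) (SEQ (FORT rr u (FORT xr u bodyX))
     (SEQ (SETC (b + 1) 0) (SEQ (FORT yr u bodyF) EPI))))"
  define KA where "KA = 11 * d + 3"
  define L where "L = 100 + 100 * d + 10 * K"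
  have "evaluates V (tc \<alpha> \<psi> \<omega> xs ys) \<rho> b P w (10 * L) (4 * length xs + e)"
  proof (rule evaluatesI)
    show "b < w" using Bw by (simp add: B_def)
    fix a and R0 :: "nat \<Rightarrow> nat"
    assume a: "a \<in> I" "R0 1 = sz a" "w \<le> R0 0" "\<And>v. v \<in> V \<Longrightarrow> R0 (\<rho> v) < sz a"
    define n where "n = sz a"
    define H where "H = R0 0"
    define f where "f = R0 \<circ> \<rho>"
    have n: "0 < n" "n ^ j \<ge> 1" for j using sz_pos[OF a(1)] by (auto simp: n_def)
    have Hw: "w \<le> H" using a by (simp add: H_def)
    define T where "T = tuples n d"
    \<comment> \<open>\<open>S\<close> is the set of tuples whose table entries are known to be
      valid and \<open>M\<close> the set of marked tuples. \<open>R0\<close> is the initial state,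
      which survives below \<open>b\<close> apart from register 0 and in the part of the heap below
      the table.\<close>
    define St where "St = (\<lambda>S M R. R 1 = n \<and> R 0 = H + n ^ d \<and> R b = H \<and>
      (\<forall>i. 0 < i \<and> i < b \<longrightarrow> R i = R0 i) \<and> (\<forall>i. w \<le> i \<and> i < H \<longrightarrow> R i = R0 i) \<and>
      (\<forall>y\<in>S. R (H + horner n 0 y) = of_bool (y \<in> M)))"
    have St_upd: "St S M (R(i := v))" if "St S M R" "b < i" "i < w" for S M R i v
      using that b Hw by (auto simp: St_def)
    have cw: "b < c" "c < w" using Bw by (simp_all add: c_def B_def)
    have St_1: "R 1 = n" if "St S M R" for S M R using that by (simp add: St_def)
    have hl: "horner n 0 y < n ^ d" if "y \<in> T" for y using that horner_less by (simp add: T_def)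
    have St_other: "St S M R'"
      if "St S M R" "S \<subseteq> T" "\<And>i. i \<le> b \<or> w \<le> i \<and> i < H + n ^ d \<Longrightarrow> R' i = R i" for S M R R'
      using that b Hw hl unfolding St_def by (auto simp: subset_iff)
    have call: "runs (enc a) p R (K * n ^ e) (\<lambda>R'. St S M R' \<and> R' B = of_bool (\<phi> a (R \<circ> \<rho>')) \<and> (\<forall>i<B. R' i = R i))"
      if ev: "evaluates W \<phi> \<rho>' B p w K e" and St: "St S M R" "S \<subseteq> T" "\<And>v. v \<in> W \<Longrightarrow> R (\<rho>' v) < n"
      for W \<phi> p \<rho>' S M R
    proof -
      have "runs (enc a) p R (K * sz a ^ e)
        (\<lambda>R'. R' B = of_bool (\<phi> a (R \<circ> \<rho>')) \<and> (\<forall>i. i < B \<or> w \<le> i \<and> i < R 0 \<longrightarrow> R' i = R i))"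
        by (rule evaluatesD[OF ev a(1)]) (use St Hw in \<open>auto simp: St_def n_def\<close>)
      then show ?thesis
      proof (rule runs_mono)
        fix R'
        assume R': "R' B = of_bool (\<phi> a (R \<circ> \<rho>')) \<and> (\<forall>i. i < B \<or> w \<le> i \<and> i < R 0 \<longrightarrow> R' i = R i)"
        moreover have "St S M R'"
          by (rule St_other[OF St(1,2)]) (use R' St(1) in \<open>auto simp: B_def St_def\<close>)
        ultimately show "St S M R' \<and> R' B = of_bool (\<phi> a (R \<circ> \<rho>')) \<and> (\<forall>i<B. R' i = R i)" by blast
      qed (simp add: n_def)
    qed
    have f_lt: "f v < sz a" if "v \<in> V" for v using a(4) that by (simp add: f_def)
    have f_eq: "f v = (R \<circ> \<rho>) v" if "St S M R" "v \<in> V" for S M R v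
    proof -
      have "0 < \<rho> v" "\<rho> v < b" using that(2) b by force+
      then show ?thesis using that(1) by (simp add: St_def f_def)
    qed
    note loc = tc_local[OF \<psi> \<alpha> \<omega> len a(1), of f, OF f_lt]
    have env_i: "(\<forall>v\<in>V \<union> set xs. R (\<rho>i v) < n) \<and> \<alpha> a (R \<circ> \<rho>i) = \<alpha> a (upds f xs y) \<and> \<omega> a (R \<circ> \<rho>i) = \<omega> a (upds f xs y)"
      if St: "St S M R" "map R yr = y" "y \<in> T" for S M R y
    proof -
      have R\<rho>: "R \<circ> \<rho>i = upds (R \<circ> \<rho>) xs y"
        unfolding \<rho>i_def using upds_comp[of xs yr R \<rho>] lens St(2) by simp
      have y: "y \<in> tuples (sz a) (length xs)" using St(3) by (simp add: T_def n_def lens)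
      have "\<forall>v\<in>V \<union> set xs. (R \<circ> \<rho>i) v < n"
        unfolding R\<rho> n_def using y f_lt f_eq[OF St(1)] by (auto intro!: upds_less)
      moreover have "\<alpha> a (upds f xs y) = \<alpha> a (upds (R \<circ> \<rho>) xs y)" "\<omega> a (upds f xs y) = \<omega> a (upds (R \<circ> \<rho>) xs y)"
        using loc(1,2)[of "R \<circ> \<rho>" y] f_eq[OF St(1)] y by blast+
      ultimately show ?thesis by (simp add: R\<rho>[symmetric])
    qed
    define Rl where "Rl = tc_step \<psi> xs ys a f"
    have Rl_T: "Rl \<subseteq> T \<times> T" by (auto simp: Rl_def tc_step_def T_def n_def lens)
    have env_s: "(\<forall>v\<in>V \<union> set xs \<union> set ys. R (\<rho>s v) < n) \<and> \<psi> a (R \<circ> \<rho>s) = ((x, y) \<in> Rl)"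
      if St: "St S M R" "map R xr = x" "map R yr = y" "x \<in> T" "y \<in> T" for S M R x y
    proof -
      have R\<rho>: "R \<circ> \<rho>s = upds (R \<circ> \<rho>) (xs @ ys) (x @ y)"
        unfolding \<rho>s_def using upds_comp[of "xs @ ys" "xr @ yr" R \<rho>] lens St(2,3) by simp
      have xy: "x \<in> tuples (sz a) (length xs)" "y \<in> tuples (sz a) (length xs)"
        using St(4,5) by (auto simp: T_def n_def lens)
      then have "x @ y \<in> tuples (sz a) (length (xs @ ys))" by (auto simp: tuples_def len)
      then have "\<forall>v\<in>V \<union> set xs \<union> set ys. (R \<circ> \<rho>s) v < n"
        unfolding R\<rho> n_def using f_lt f_eq[OF St(1)] by (auto intro!: upds_less)
      moreover have "Rl = tc_step \<psi> xs ys a (R \<circ> \<rho>)"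
        unfolding Rl_def using loc(3)[of "R \<circ> \<rho>"] f_eq[OF St(1)] by blast
      then have "\<psi> a (upds (R \<circ> \<rho>) (xs @ ys) (x @ y)) = ((x, y) \<in> Rl)"
        using xy by (simp add: tc_step_def)
      ultimately show ?thesis by (simp add: R\<rho>[symmetric])
    qed
    have ADDR: "runs (enc a) (ADDRESS c b vs) R (KA * n)
        (\<lambda>R'. R' c = H + horner n 0 y \<and> St S M R' \<and> (\<forall>i. i \<notin> {c..c + 3} \<longrightarrow> R' i = R i))"
      if "St S M R" "S \<subseteq> T" "map R vs = y" "vs = xr \<or> vs = yr" for S M R vs y
    proof -
      have "runs (enc a) (ADDRESS c b vs) R ((11 * length vs + 3) * n)
        (\<lambda>R'. R' c = R b + horner n 0 (map R vs) \<and> (\<forall>i. i \<notin> {c..c + 3} \<longrightarrow> R' i = R i))"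
        by (rule runs_ADDRESS) (use that n St_1 in \<open>auto simp: regs\<close>)
      then show ?thesis
      proof (rule runs_mono)
        fix R'
        assume R': "R' c = R b + horner n 0 (map R vs) \<and> (\<forall>i. i \<notin> {c..c + 3} \<longrightarrow> R' i = R i)"
        moreover have "St S M R'"
          by (rule St_other[OF that(1,2)]) (use R' Bw in \<open>auto simp: B_def c_def\<close>)
        ultimately show "R' c = H + horner n 0 y \<and> St S M R' \<and> (\<forall>i. i \<notin> {c..c + 3} \<longrightarrow> R' i = R i)"
          using that by (auto simp: St_def)
      qed (use that lens in \<open>auto simp: KA_def\<close>)
    qed
    have PUT: "runs (enc a) PUT R ((KA + 1) * n ^ e)
        (\<lambda>R'. St (insert y S) (if Q then insert y M else M - {y}) R' \<and> (\<forall>i<B. i \<notin> {c..c + 3} \<longrightarrow> R' i = R i))"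
      if "St S M R" "S \<subseteq> T" "map R yr = y" "y \<in> T" "R B = of_bool Q" for S M R y Q
    proof -
      have "runs (enc a) PUT R (KA * n + 1)
        (\<lambda>R'. St (insert y S) (if Q then insert y M else M - {y}) R' \<and> (\<forall>i<B. i \<notin> {c..c + 3} \<longrightarrow> R' i = R i))"
        unfolding PUT_def
      proof (rule runs_SEQ, rule runs_mono[OF ADDR[OF that(1-3)] order_refl], simp, rule runs_STORE)
        fix R'
        assume R': "R' c = H + horner n 0 y \<and> St S M R' \<and> (\<forall>i. i \<notin> {c..c + 3} \<longrightarrow> R' i = R i)"
        have B: "R' B = of_bool Q" using R' that by (auto simp: B_def c_def)
        have inj: "horner n 0 y' = horner n 0 y \<Longrightarrow> y' = y" if "y' \<in> S" for y'
          using horner_inject[of y' n d y 0 0] that \<open>S \<subseteq> T\<close> \<open>y \<in> T\<close> by (auto simp: T_def)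
        have "St (insert y S) (if Q then insert y M else M - {y}) (R'(R' c := R' B))"
          unfolding St_def
        proof (intro conjI ballI allI impI)
          fix y' assume "y' \<in> insert y S"
          then show "(R'(R' c := R' B)) (H + horner n 0 y') = of_bool (y' \<in> (if Q then insert y M else M - {y}))"
            using R' B inj[of y'] by (auto simp: St_def)
        qed (use R' b Hw Bw B_def in \<open>auto simp: St_def\<close>)
        moreover have "(R'(R' c := R' B)) i = R i" if "i < B" "i \<notin> {c..c + 3}" for i
          using that R' Bw Hw by auto
        ultimately show "St (insert y S) (if Q then insert y M else M - {y}) (R'(R' c := R' B)) \<and>
            (\<forall>i<B. i \<notin> {c..c + 3} \<longrightarrow> (R'(R' c := R' B)) i = R i)" by blast
      qed
      then show ?thesis
        by (rule runs_mono) (use mono_power_sum[of n 1 e 0 KA 1] n \<open>1 \<le> e\<close> in auto)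
    qed
    have FETCH: "runs (enc a) (FETCH vs) R ((KA + 1) * n ^ e)
        (\<lambda>R'. R' c = of_bool (y \<in> M) \<and> St S M R' \<and> (\<forall>i. i \<notin> {c..c + 3} \<longrightarrow> R' i = R i))"
      if "St S M R" "S \<subseteq> T" "map R vs = y" "vs = xr \<or> vs = yr" "y \<in> S" for S M R vs y
    proof -
      have "runs (enc a) (FETCH vs) R (KA * n + 1)
        (\<lambda>R'. R' c = of_bool (y \<in> M) \<and> St S M R' \<and> (\<forall>i. i \<notin> {c..c + 3} \<longrightarrow> R' i = R i))"
        unfolding FETCH_def
      proof (rule runs_SEQ, rule runs_mono[OF ADDR[OF that(1-4)] order_refl], rule runs_LOAD)
        fix R'
        assume R': "R' c = H + horner n 0 y \<and> St S M R' \<and> (\<forall>i. i \<notin> {c..c + 3} \<longrightarrow> R' i = R i)"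
        have "St S M (R'(c := R' (R' c)))"
          using R' cw by (blast intro: St_upd)
        moreover have "R' (R' c) = of_bool (y \<in> M)" using R' \<open>y \<in> S\<close> by (simp add: St_def)
        moreover have "(R'(c := R' (R' c))) i = R i" if "i \<notin> {c..c + 3}" for i
          using R' that by (metis atLeastAtMost_iff fun_upd_other le_add1 order_refl)
        ultimately show "(R'(c := R' (R' c))) c = of_bool (y \<in> M) \<and> St S M (R'(c := R' (R' c))) \<and>
            (\<forall>i. i \<notin> {c..c + 3} \<longrightarrow> (R'(c := R' (R' c))) i = R i)"
          by (simp only: fun_upd_same) blast
      qed
      then show ?thesis
        by (rule runs_mono) (use mono_power_sum[of n 1 e 0 KA 1] n \<open>1 \<le> e\<close> in auto)
    qed
    have xyr: "i \<in> set xr \<Longrightarrow> b < i \<and> i < B \<and> i \<notin> {c..c + 3} \<and> i \<noteq> u \<and> i \<noteq> b + 1"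
      "i \<in> set yr \<Longrightarrow> b < i \<and> i < B \<and> i \<notin> {c..c + 3} \<and> i \<noteq> u \<and> i \<noteq> b + 1"
      "i \<in> set rr \<Longrightarrow> b < i \<and> i < B \<and> i \<notin> {c..c + 3} \<and> i \<noteq> u \<and> i \<noteq> b + 1" for i
      by (auto simp: regs)
    have disj: "set xr \<inter> set yr = {}" "set xr \<inter> set rr = {}" "set yr \<inter> set rr = {}"
      "distinct xr" "distinct yr" "distinct rr" "u \<notin> set xr" "u \<notin> set yr" "u \<notin> set rr"
      "1 \<notin> set xr" "1 \<notin> set yr" "1 \<notin> set rr" "b < u" "u < B"
      by (auto simp: regs)

    have cni: "c \<notin> set xr" "c \<notin> set yr" "c \<notin> set rr" "b + 1 \<notin> set yr"
      by (auto simp: regs)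

    define Init where "Init = {y \<in> T. \<alpha> a (upds f xs y)}"
    have loop1: "runs (enc a) (FORT yr u body1) R (((K + (KA + 1)) + 6 * d) * n ^ (d + e)) (St T Init)"
      if "St {} Init R" for R
      unfolding T_def
    proof (rule runs_FORT_pow[where Inv = "\<lambda>S. St S Init"])
      fix S y R
      assume *: "y \<in> tuples n d" "S \<subseteq> tuples n d" "St S Init R" "map R yr = y"
      have "runs (enc a) body1 R (K * n ^ e + (KA + 1) * n ^ e) (\<lambda>R'. St (insert y S) Init R' \<and> map R' yr = y)"
        unfolding body1_def
      proof (rule runs_SEQ, rule runs_mono[OF call[OF evi *(3)] order_refl])
        show "S \<subseteq> T" using * by (simp add: T_def)
        show "\<And>v. v \<in> V \<union> set xs \<Longrightarrow> R (\<rho>i v) < n" using env_i[OF *(3,4)] * by (simp add: T_def)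
        fix R1
        assume R1: "St S Init R1 \<and> R1 B = of_bool (\<alpha> a (R \<circ> \<rho>i)) \<and> (\<forall>i<B. R1 i = R i)"
        have "R1 B = of_bool (\<alpha> a (upds f xs y))" using R1 env_i[OF *(3,4)] * by (simp add: T_def)
        moreover have my: "map R1 yr = y" using R1 *(4) xyr(2) by (auto simp: map_eq_conv)
        ultimately have "runs (enc a) PUT R1 ((KA + 1) * n ^ e)
          (\<lambda>R'. St (insert y S) (if \<alpha> a (upds f xs y) then insert y Init else Init - {y}) R' \<and> (\<forall>i<B. i \<notin> {c..c + 3} \<longrightarrow> R' i = R1 i))"
          using PUT[of S Init R1 y] R1 * by (auto simp: T_def)
        then show "runs (enc a) PUT R1 ((KA + 1) * n ^ e) (\<lambda>R'. St (insert y S) Init R' \<and> map R' yr = y)"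
        proof (rule runs_mono[OF _ order_refl])
          fix R'
          assume R': "St (insert y S) (if \<alpha> a (upds f xs y) then insert y Init else Init - {y}) R' \<and> (\<forall>i<B. i \<notin> {c..c + 3} \<longrightarrow> R' i = R1 i)"
          have "(if \<alpha> a (upds f xs y) then insert y Init else Init - {y}) = Init"
            using *(1) by (auto simp: Init_def T_def)
          moreover have "map R' yr = map R1 yr" using R' xyr(2) by (auto simp: map_eq_conv)
          ultimately show "St (insert y S) Init R' \<and> map R' yr = y" using R' my by simp
        qed
      qed
      then show "runs (enc a) body1 R ((K + (KA + 1)) * n ^ e) (\<lambda>R'. St (insert y S) Init R' \<and> map R' yr = y)"
        by (simp only: add_mult_distrib)
    next
      fix S R v y
      assume v: "v \<in> insert u (set yr)" "St S Init R"
      then have "b < v" "v < w" using disj xyr(2)[of v] Bw by auto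
      then show "St S Init (R(v := y))" by (rule St_upd[OF v(2)])
    qed (use that n disj lens St_1 in auto)

    define Reach where "Reach = Rl\<^sup>* `` Init"
    have Reach_T: "Reach \<subseteq> T"
    proof
      fix y assume "y \<in> Reach"
      then obtain x where "x \<in> Init" "(x, y) \<in> Rl\<^sup>*" by (auto simp: Reach_def)
      then show "y \<in> T" using Rl_T by (auto elim: rtranclE simp: Init_def)
    qed
    define K2 where "K2 = K + KA + 3 + 6 * d"
    have loopY: "runs (enc a) (FORT yr u bodyY) R (K2 * n ^ (d + e))
        (\<lambda>R'. \<exists>M'. St T M' R' \<and> map R' xr = x \<and> map R' rr = r \<and> M \<union> Rl `` {x} \<subseteq> M' \<and> M' \<subseteq> Reach)"
      if that: "St T M R" "map R xr = x" "map R rr = r" "M \<subseteq> Reach" "x \<in> M" for M R x r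
    proof -
      define Inv where "Inv = (\<lambda>S R'. \<exists>M'. St T M' R' \<and> map R' xr = x \<and> map R' rr = r \<and> M \<union> (Rl `` {x} \<inter> S) \<subseteq> M' \<and> M' \<subseteq> Reach)"
      have xT: "x \<in> T" using that Reach_T by auto
      have "runs (enc a) (FORT yr u bodyY) R (((K + KA + 3) + 6 * d) * n ^ (d + e)) (Inv (tuples n d))"
      proof (rule runs_FORT_pow)
        show "Inv {} R" using that by (auto simp: Inv_def)
        fix S y R
        assume *: "y \<in> tuples n d" "S \<subseteq> tuples n d" "Inv S R" "map R yr = y"
        then obtain M' where M': "St T M' R" "map R xr = x" "map R rr = r" "M \<union> (Rl `` {x} \<inter> S) \<subseteq> M'" "M' \<subseteq> Reach"
          by (auto simp: Inv_def)
        have yT: "y \<in> T" using * by (simp add: T_def)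
        note env = env_s[OF M'(1,2) *(4) xT yT]
        have "runs (enc a) bodyY R (K * n ^ e + (1 + ((KA + 1) * n ^ e + 1))) (\<lambda>R'. Inv (insert y S) R' \<and> map R' yr = y)"
          unfolding bodyY_def
        proof (rule runs_SEQ, rule runs_mono[OF call[OF evs M'(1)] order_refl])
          show "\<And>v. v \<in> V \<union> set xs \<union> set ys \<Longrightarrow> R (\<rho>s v) < n" using env by simp
          fix R1
          assume R1: "St T M' R1 \<and> R1 B = of_bool (\<psi> a (R \<circ> \<rho>s)) \<and> (\<forall>i<B. R1 i = R i)"
          have B: "R1 B = of_bool ((x, y) \<in> Rl)" using R1 env by simp
          have m: "map R1 yr = y" "map R1 xr = x" "map R1 rr = r"
            using R1 *(4) M' xyr by (auto simp: map_eq_conv)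
          show "runs (enc a) (IFNZ B PUT (SETC c 0)) R1 (1 + ((KA + 1) * n ^ e + 1)) (\<lambda>R'. Inv (insert y S) R' \<and> map R' yr = y)"
          proof (rule runs_IFNZ)
            assume "R1 B \<noteq> 0"
            then have Q: "(x, y) \<in> Rl" using B by (auto split: if_splits)
            then have "R1 B = of_bool True" using B by simp
            have "runs (enc a) PUT R1 ((KA + 1) * n ^ e)
              (\<lambda>R'. St (insert y T) (if True then insert y M' else M' - {y}) R' \<and> (\<forall>i<B. i \<notin> {c..c + 3} \<longrightarrow> R' i = R1 i))"
              by (rule PUT[OF _ _ m(1) yT \<open>R1 B = of_bool True\<close>]) (use R1 in auto)
            then show "runs (enc a) PUT R1 ((KA + 1) * n ^ e + 1) (\<lambda>R'. Inv (insert y S) R' \<and> map R' yr = y)"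
            proof (rule runs_mono)
              fix R'
              assume R': "St (insert y T) (if True then insert y M' else M' - {y}) R' \<and> (\<forall>i<B. i \<notin> {c..c + 3} \<longrightarrow> R' i = R1 i)"
              have "map R' yr = y" "map R' xr = x" "map R' rr = r"
                using R' m xyr by (auto simp: map_eq_conv)
              moreover have "St T (insert y M') R'" using R' yT by (simp add: insert_absorb)
              moreover have "y \<in> Reach"
                using Q that(4,5) unfolding Reach_def by (meson ImageE ImageI rtrancl.rtrancl_into_rtrancl subsetD)
              ultimately show "Inv (insert y S) R' \<and> map R' yr = y"
                unfolding Inv_def using M' by blast
            qed auto
          next
            assume "R1 B = 0"
            then have Q: "(x, y) \<notin> Rl" using B by (auto split: if_splits)
            have "St T M' (R1(c := 0))" using R1 cw by (blast intro: St_upd)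
            moreover have "map (R1(c := 0)) yr = y" "map (R1(c := 0)) xr = x" "map (R1(c := 0)) rr = r"
              using m cni by (simp_all add: map_fun_upd del: fun_upd_apply)
            ultimately have "Inv (insert y S) (R1(c := 0)) \<and> map (R1(c := 0)) yr = y"
              unfolding Inv_def using M' Q by blast
            then show "runs (enc a) (SETC c 0) R1 ((KA + 1) * n ^ e + 1) (\<lambda>R'. Inv (insert y S) R' \<and> map R' yr = y)"
              by (rule runs_mono[OF runs_SETC]) auto
          qed
        qed simp
        then show "runs (enc a) bodyY R ((K + KA + 3) * n ^ e) (\<lambda>R'. Inv (insert y S) R' \<and> map R' yr = y)"
          by (rule runs_mono) (use n(2)[of e] in \<open>auto simp: add_mult_distrib\<close>)
      next
        fix S R v y
        assume v: "v \<in> insert u (set yr)" "Inv S R"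
        then have "v \<notin> set xr" "v \<notin> set rr" "b < v" "v < w" using disj xyr(2)[of v] Bw by auto
        with v show "Inv S (R(v := y))"
          unfolding Inv_def using St_upd by (metis map_fun_upd)
      qed (use n disj lens St_1 in \<open>auto simp: Inv_def\<close>)
      then show ?thesis
        by (rule runs_mono) (use Rl_T in \<open>auto simp: Inv_def K2_def T_def\<close>)
    qed

    define K3 where "K3 = K2 + KA + 3 + 6 * d"
    \<comment> \<open>A tuple marked during the pass may already be expanded in the same pass. So
      the new marks are only enclosed: from below by one full step, from above by
      \<open>Reach\<close>.\<close>
    have loopX: "runs (enc a) (FORT xr u bodyX) R (K3 * n ^ (2 * d + e))
        (\<lambda>R'. \<exists>M'. St T M' R' \<and> map R' rr = r \<and> M \<union> Rl `` M \<subseteq> M' \<and> M' \<subseteq> Reach)"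
      if that: "St T M R" "map R rr = r" "M \<subseteq> Reach" for M R r
    proof -
      define Inv where "Inv = (\<lambda>S R'. \<exists>M'. St T M' R' \<and> map R' rr = r \<and> M \<union> Rl `` (M \<inter> S) \<subseteq> M' \<and> M' \<subseteq> Reach)"
      have "runs (enc a) (FORT xr u bodyX) R (((K2 + KA + 3) + 6 * d) * n ^ (d + (d + e))) (Inv (tuples n d))"
      proof (rule runs_FORT_pow)
        show "Inv {} R" using that by (auto simp: Inv_def)
        fix S x R
        assume *: "x \<in> tuples n d" "S \<subseteq> tuples n d" "Inv S R" "map R xr = x"
        then obtain M' where M': "St T M' R" "map R rr = r" "M \<union> Rl `` (M \<inter> S) \<subseteq> M'" "M' \<subseteq> Reach"
          by (auto simp: Inv_def)
        have xT: "x \<in> T" using * by (simp add: T_def)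
        have "runs (enc a) bodyX R ((KA + 1) * n ^ e + (1 + (K2 * n ^ (d + e) + 1))) (\<lambda>R'. Inv (insert x S) R' \<and> map R' xr = x)"
          unfolding bodyX_def
        proof (rule runs_SEQ, rule runs_mono[OF FETCH[OF M'(1) _ *(4)] order_refl])
          fix R1
          assume R1: "R1 c = of_bool (x \<in> M') \<and> St T M' R1 \<and> (\<forall>i. i \<notin> {c..c + 3} \<longrightarrow> R1 i = R i)"
          have m: "map R1 xr = x" "map R1 rr = r"
            using R1 *(4) M' xyr by (auto simp: map_eq_conv)
          show "runs (enc a) (IFNZ c (FORT yr u bodyY) (SETC c 0)) R1 (1 + (K2 * n ^ (d + e) + 1)) (\<lambda>R'. Inv (insert x S) R' \<and> map R' xr = x)"
          proof (rule runs_IFNZ)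
            assume "R1 c \<noteq> 0"
            then have "x \<in> M'" using R1 by (auto split: if_splits)
            with loopY[of M' R1 x r] R1 m M'(4)
            have "runs (enc a) (FORT yr u bodyY) R1 (K2 * n ^ (d + e))
              (\<lambda>R'. \<exists>M''. St T M'' R' \<and> map R' xr = x \<and> map R' rr = r \<and> M' \<union> Rl `` {x} \<subseteq> M'' \<and> M'' \<subseteq> Reach)" by blast
            then show "runs (enc a) (FORT yr u bodyY) R1 (K2 * n ^ (d + e) + 1) (\<lambda>R'. Inv (insert x S) R' \<and> map R' xr = x)"
            proof (rule runs_mono)
              fix R' assume "\<exists>M''. St T M'' R' \<and> map R' xr = x \<and> map R' rr = r \<and> M' \<union> Rl `` {x} \<subseteq> M'' \<and> M'' \<subseteq> Reach"
              then obtain M'' where M'': "St T M'' R'" "map R' xr = x" "map R' rr = r" "M' \<union> Rl `` {x} \<subseteq> M''" "M'' \<subseteq> Reach" by blast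
              moreover have "M \<union> Rl `` (M \<inter> insert x S) \<subseteq> M''" using M'(3) M''(4) by blast
              ultimately show "Inv (insert x S) R' \<and> map R' xr = x" unfolding Inv_def by blast
            qed simp
          next
            assume "R1 c = 0"
            then have Q: "x \<notin> M'" using R1 by (auto split: if_splits)
            have "St T M' (R1(c := 0))" using R1 cw by (blast intro: St_upd)
            moreover have "map (R1(c := 0)) xr = x" "map (R1(c := 0)) rr = r"
              using m cni by (simp_all add: map_fun_upd del: fun_upd_apply)
            moreover have "M \<union> Rl `` (M \<inter> insert x S) \<subseteq> M'" using M'(3) Q by blast
            ultimately have "Inv (insert x S) (R1(c := 0)) \<and> map (R1(c := 0)) xr = x"
              unfolding Inv_def using M' by blast
            then show "runs (enc a) (SETC c 0) R1 (K2 * n ^ (d + e) + 1) (\<lambda>R'. Inv (insert x S) R' \<and> map R' xr = x)"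
              by (rule runs_mono[OF runs_SETC]) auto
          qed
        qed (use xT in auto)
        then show "runs (enc a) bodyX R ((K2 + KA + 3) * n ^ (d + e)) (\<lambda>R'. Inv (insert x S) R' \<and> map R' xr = x)"
        proof (rule runs_mono)
          have "(KA + 1) * n ^ e \<le> (KA + 1) * n ^ (d + e)"
            using n by (intro mult_le_mono power_increasing) auto
          then show "(KA + 1) * n ^ e + (1 + (K2 * n ^ (d + e) + 1)) \<le> (K2 + KA + 3) * n ^ (d + e)"
            using n(2)[of "d + e"] by (simp only: add_mult_distrib)
        qed
      next
        fix S R v y
        assume v: "v \<in> insert u (set xr)" "Inv S R"
        then have "v \<notin> set rr" "b < v" "v < w" using disj xyr(1)[of v] Bw by auto
        with v show "Inv S (R(v := y))"
          unfolding Inv_def using St_upd by (metis map_fun_upd)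
      qed (use n disj lens St_1 in \<open>auto simp: Inv_def\<close>)
      then show ?thesis
        by (rule runs_mono) (use that Reach_T in \<open>auto simp: Inv_def K3_def T_def Int_absorb2 mult_2 add.assoc\<close>)
    qed

    have loopR: "runs (enc a) (FORT rr u (FORT xr u bodyX)) R ((K3 + 6 * (2 * d)) * n ^ (2 * d + (2 * d + e))) (St T Reach)"
      if that: "St T Init R" for R
    proof -
      \<comment> \<open>What is reachable in at most \<open>k\<close> steps. The registers
        \<open>rr\<close> merely count the rounds, and \<open>card S\<close> is the number of rounds
        done.\<close>
      define Base where "Base = (\<lambda>k. \<Union>m\<in>{..k}. (Rl ^^ m) `` Init)"
      define Inv where "Inv = (\<lambda>(S :: nat list set) R'. \<exists>M. St T M R' \<and> Base (card S) \<subseteq> M \<and> M \<subseteq> Reach)"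
      have "runs (enc a) (FORT rr u (FORT xr u bodyX)) R ((K3 + 6 * (2 * d)) * n ^ (2 * d + (2 * d + e))) (Inv (tuples n (2 * d)))"
      proof (rule runs_FORT_pow)
        have "Init \<subseteq> Reach" by (auto simp: Reach_def)
        then show "Inv {} R" using that by (auto simp: Inv_def Base_def)
        fix S r R
        assume *: "r \<in> tuples n (2 * d)" "S \<subseteq> tuples n (2 * d)" "r \<notin> S" "Inv S R" "map R rr = r"
        then obtain M where M: "St T M R" "Base (card S) \<subseteq> M" "M \<subseteq> Reach" by (auto simp: Inv_def)
        have "finite S" by (rule finite_subset[OF *(2) finite_tuples])
        then have card: "card (insert r S) = Suc (card S)" using *(3) by simp
        have "(Rl ^^ m) `` Init \<subseteq> M \<union> Rl `` M" if "m \<le> Suc (card S)" for m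
        proof (cases "m \<le> card S")
          case True
          then show ?thesis using M(2) by (auto simp: Base_def)
        next
          case False
          then have m: "m = Suc (card S)" using that by simp
          have "(Rl ^^ card S) `` Init \<subseteq> M" using M(2) by (auto simp: Base_def)
          then show ?thesis unfolding m by (auto simp: relcomp_Image)
        qed
        then have Base: "Base (card (insert r S)) \<subseteq> M \<union> Rl `` M" unfolding card Base_def by blast
        show "runs (enc a) (FORT xr u bodyX) R (K3 * n ^ (2 * d + e)) (\<lambda>R'. Inv (insert r S) R' \<and> map R' rr = r)"
        proof (rule runs_mono[OF loopX[OF M(1) *(5) M(3)] order_refl])
          fix R' assume "\<exists>M'. St T M' R' \<and> map R' rr = r \<and> M \<union> Rl `` M \<subseteq> M' \<and> M' \<subseteq> Reach"
          then show "Inv (insert r S) R' \<and> map R' rr = r" using Base unfolding Inv_def by (meson order_trans)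
        qed
      next
        fix S R v y
        assume v: "v \<in> insert u (set rr)" "Inv S R"
        then have "b < v" "v < w" using disj xyr(3)[of v] Bw by auto
        with v show "Inv S (R(v := y))"
          unfolding Inv_def using St_upd by metis
      qed (use n disj lens St_1 in \<open>auto simp: Inv_def\<close>)
      then show ?thesis
      proof (rule runs_mono[OF _ order_refl])
        fix R' assume "Inv (tuples n (2 * d)) R'"
        then obtain M where M: "St T M R'" "Base (n ^ (2 * d)) \<subseteq> M" "M \<subseteq> Reach"
          by (auto simp: Inv_def card_tuples)
        have fT: "finite (T \<times> T)" by (simp add: T_def)
        have fin: "finite Rl" using finite_subset[OF Rl_T fT] .
        \<comment> \<open>A finite relation reaches everything it can reach within as many steps as
          it has pairs, so the number of rounds suffices.\<close>
        have "card Rl \<le> card (T \<times> T)" by (rule card_mono[OF fT Rl_T])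
        also have "\<dots> = n ^ (2 * d)" by (simp add: card_cartesian_product T_def card_tuples mult_2 power_add)
        finally have "Reach \<subseteq> Base (n ^ (2 * d))"
          unfolding Reach_def Base_def rtrancl_finite_eq_relpow[OF fin] by (auto intro: order_trans)
        then have "M = Reach" using M by blast
        then show "St T Reach R'" using M(1) by simp
      qed
    qed

    define Fin where "Fin = (\<lambda>S. \<exists>y\<in>S. y \<in> Reach \<and> \<omega> a (upds f xs y))"
    have loopF: "runs (enc a) (FORT yr u bodyF) R (((K + KA + 5) + 6 * d) * n ^ (d + e))
        (\<lambda>R'. St T Reach R' \<and> R' (b + 1) = of_bool (Fin T))"
      if "St T Reach R" "R (b + 1) = 0" for R
      unfolding T_def
    proof (rule runs_FORT_pow[where Inv = "\<lambda>S R. St (tuples n d) Reach R \<and> R (b + 1) = of_bool (Fin S)"])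
      show "St (tuples n d) Reach R \<and> R (b + 1) = of_bool (Fin {})" using that by (simp add: Fin_def T_def)
      fix S y R
      assume *: "y \<in> tuples n d" "S \<subseteq> tuples n d" "St (tuples n d) Reach R \<and> R (b + 1) = of_bool (Fin S)" "map R yr = y"
      then have yT: "y \<in> T" and St: "St T Reach R" and fl: "R (b + 1) = of_bool (Fin S)" by (auto simp: T_def)
      define Q where "Q = (\<lambda>R'. (St T Reach R' \<and> R' (b + 1) = of_bool (Fin (insert y S))) \<and> map R' yr = y)"
      have "runs (enc a) bodyF R ((KA + 1) * n ^ e + (1 + ((K * n ^ e + (1 + 1)) + 1))) Q"
        unfolding bodyF_def
      proof (rule runs_SEQ, rule runs_mono[OF FETCH[OF St _ *(4)] order_refl])
        fix R1
        assume R1: "R1 c = of_bool (y \<in> Reach) \<and> St T Reach R1 \<and> (\<forall>i. i \<notin> {c..c + 3} \<longrightarrow> R1 i = R i)"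
        have my: "map R1 yr = y" using R1 *(4) xyr by (auto simp: map_eq_conv)
        have fl1: "R1 (b + 1) = of_bool (Fin S)" using R1 fl by (simp add: c_def)
        show "runs (enc a) (IFNZ c (SEQ pf (IFNZ B (SETC (b + 1) 1) (SETC c 0))) (SETC c 0)) R1 (1 + ((K * n ^ e + (1 + 1)) + 1)) Q"
        proof (rule runs_IFNZ)
          assume "R1 c \<noteq> 0"
          then have yR: "y \<in> Reach" using R1 by (auto split: if_splits)
          have St1: "St T Reach R1" using R1 by simp
          note env = env_i[OF St1 my yT]
          have "runs (enc a) (SEQ pf (IFNZ B (SETC (b + 1) 1) (SETC c 0))) R1 (K * n ^ e + (1 + 1)) Q"
          proof (rule runs_SEQ, rule runs_mono[OF call[OF evf St1] order_refl])
            show "\<And>v. v \<in> V \<union> set xs \<Longrightarrow> R1 (\<rho>i v) < n" using env by simp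
            fix R2
            assume R2: "St T Reach R2 \<and> R2 B = of_bool (\<omega> a (R1 \<circ> \<rho>i)) \<and> (\<forall>i<B. R2 i = R1 i)"
            have my2: "map R2 yr = y" using R2 my xyr by (auto simp: map_eq_conv)
            have fl2: "R2 (b + 1) = of_bool (Fin S)" using R2 fl1 by (simp add: B_def)
            have B: "R2 B = of_bool (\<omega> a (upds f xs y))" using R2 env by simp
            have FI: "Fin (insert y S) = (\<omega> a (upds f xs y) \<or> Fin S)" using yR by (auto simp: Fin_def)
            have St2: "St T Reach (R2(b + 1 := 1))" "St T Reach (R2(c := 0))"
              using R2 Bw by (auto intro!: St_upd simp: c_def B_def)
            have my3: "map (R2(b + 1 := 1)) yr = y" "map (R2(c := 0)) yr = y"
              using my2 cni by (simp_all add: map_fun_upd del: fun_upd_apply)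
            show "runs (enc a) (IFNZ B (SETC (b + 1) 1) (SETC c 0)) R2 (1 + 1) Q"
              by (rule runs_IFNZ; rule runs_SETC) (use St2 my3 fl2 B FI in \<open>auto simp: Q_def c_def\<close>)
          qed simp
          then show "runs (enc a) (SEQ pf (IFNZ B (SETC (b + 1) 1) (SETC c 0))) R1 ((K * n ^ e + (1 + 1)) + 1) Q"
            by (rule runs_mono) auto
        next
          assume "R1 c = 0"
          then have yR: "y \<notin> Reach" using R1 by (auto split: if_splits)
          have "Q (R1(c := 0))"
            unfolding Q_def
          proof (intro conjI)
            show "St T Reach (R1(c := 0))" using R1 cw by (blast intro: St_upd)
            show "(R1(c := 0)) (b + 1) = of_bool (Fin (insert y S))" using fl1 yR by (simp add: c_def Fin_def)
            show "map (R1(c := 0)) yr = y" using my cni by (simp add: map_fun_upd del: fun_upd_apply)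
          qed
          then show "runs (enc a) (SETC c 0) R1 ((K * n ^ e + (1 + 1)) + 1) Q"
            by (rule runs_mono[OF runs_SETC]) auto
        qed
      qed (use yT in auto)
      then show "runs (enc a) bodyF R ((K + KA + 5) * n ^ e)
          (\<lambda>R'. (St (tuples n d) Reach R' \<and> R' (b + 1) = of_bool (Fin (insert y S))) \<and> map R' yr = y)"
      proof (rule runs_mono)
        show "(KA + 1) * n ^ e + (1 + ((K * n ^ e + (1 + 1)) + 1)) \<le> (K + KA + 5) * n ^ e"
          using n(2)[of e] unfolding add_mult_distrib by linarith
      qed (simp add: Q_def T_def)
    next
      fix S R v y
      assume v: "v \<in> insert u (set yr)" "St (tuples n d) Reach R \<and> R (b + 1) = of_bool (Fin S)"
      then have "b + 1 < v" "v < w" using disj xyr(2)[of v] Bw by (auto simp: u_def)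
      with v show "St (tuples n d) Reach (R(v := y)) \<and> (R(v := y)) (b + 1) = of_bool (Fin S)"
        using St_upd by auto
    qed (use n disj lens St_1 in auto)

    have PRO: "runs (enc a) PRO R0 (1 + (1 + (1 + (1 + ((11 * n * d + 1) + 1))))) (St {} Init)"
    proof -
      define R1 where "R1 = R0(b := H, z := 0, c := 1)"
      have "runs (enc a) (HORNER c (replicate d z)) R1 (11 * n * length (replicate d z) + 1)
        (\<lambda>R'. R' c = horner n (R1 c) (map R1 (replicate d z)) \<and> (\<forall>i. i \<notin> {c..c + 3} \<longrightarrow> R' i = R1 i))"
        by (rule runs_HORNER) (use a b n in \<open>auto simp: R1_def n_def regs\<close>)
      moreover have "R1 z = 0" "R1 c = 1" by (simp_all add: R1_def z_def c_def)
      ultimately have HO: "runs (enc a) (HORNER c (replicate d z)) R1 (11 * n * d + 1)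
        (\<lambda>R'. R' c = n ^ d \<and> (\<forall>i. i \<notin> {c..c + 3} \<longrightarrow> R' i = R1 i))"
        by (simp add: horner_replicate_0)
      have eqR: "R0(b := 0, b := (R0(b := 0)) b + (R0(b := 0)) 0, z := 0, c := 1) = R1"
        using b by (auto simp: R1_def H_def)
      have "runs (enc a) (SEQ (HORNER c (replicate d z)) (ADD 0 0 c)) R1 ((11 * n * d + 1) + 1) (St {} Init)"
      proof (rule runs_SEQ, rule runs_mono[OF HO order_refl], rule runs_ADD)
        fix R' assume R': "R' c = n ^ d \<and> (\<forall>i. i \<notin> {c..c + 3} \<longrightarrow> R' i = R1 i)"
        have R'i: "R' i = R0 i" if "i < b \<or> w \<le> i" for i
          using R' that Bw by (auto simp: R1_def z_def c_def B_def)
        have "R' b = H" using R' by (auto simp: R1_def z_def c_def)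
        then show "St {} Init (R'(0 := R' 0 + R' c))"
          using R'i R' b a Hw Bw by (auto simp: St_def n_def H_def)
      qed
      then show ?thesis
        unfolding PRO_def
        by - (rule runs_SEQ, rule runs_SETC, rule runs_SEQ, rule runs_ADD, rule runs_SEQ, rule runs_SETC,
            rule runs_SEQ, rule runs_SETC, simp only: eqR)
    qed
    have FT: "Fin T = tc \<alpha> \<psi> \<omega> xs ys a f"
      using Reach_T unfolding Fin_def tc_def Reach_def Rl_def[symmetric] Init_def
      by (auto simp: T_def n_def d_def)
    have EPI: "runs (enc a) EPI R (1 + (1 + (1 + 1)))
        (\<lambda>R'. R' b = of_bool (tc \<alpha> \<psi> \<omega> xs ys a (R0 \<circ> \<rho>)) \<and> (\<forall>i. i < b \<or> w \<le> i \<and> i < R0 0 \<longrightarrow> R' i = R0 i))"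
      if "St T Reach R \<and> R (b + 1) = of_bool (Fin T)" for R
    proof -
      have E: "R(0 := 0, 0 := (R(0 := 0)) 0 + (R(0 := 0)) b, b := 0,
          b := (R(0 := 0, 0 := (R(0 := 0)) 0 + (R(0 := 0)) b, b := 0)) b +
               (R(0 := 0, 0 := (R(0 := 0)) 0 + (R(0 := 0)) b, b := 0)) (b + 1)) =
          R(0 := H, b := of_bool (Fin T))"
        using that b by (auto simp: St_def)
      have "(R(0 := H, b := of_bool (Fin T))) i = R0 i" if "i < b \<or> w \<le> i \<and> i < R0 0" for i
        using that \<open>St T Reach R \<and> R (b + 1) = of_bool (Fin T)\<close> Bw
        by (cases "i = 0") (auto simp: St_def H_def B_def)
      then have "(R(0 := H, b := of_bool (Fin T))) b = of_bool (tc \<alpha> \<psi> \<omega> xs ys a (R0 \<circ> \<rho>)) \<and>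
          (\<forall>i. i < b \<or> w \<le> i \<and> i < R0 0 \<longrightarrow> (R(0 := H, b := of_bool (Fin T))) i = R0 i)"
        by (simp only: FT f_def fun_upd_same) blast
      then show ?thesis
        unfolding EPI_def
        by - (rule runs_SEQ, rule runs_SETC, rule runs_SEQ, rule runs_ADD, rule runs_SEQ, rule runs_SETC,
            rule runs_ADD, unfold E, assumption)
    qed
    let ?Q = "\<lambda>R'. R' b = of_bool (tc \<alpha> \<psi> \<omega> xs ys a (R0 \<circ> \<rho>)) \<and> (\<forall>i. i < b \<or> w \<le> i \<and> i < R0 0 \<longrightarrow> R' i = R0 i)"
    have "runs (enc a) P R0 ((1 + (1 + (1 + (1 + ((11 * n * d + 1) + 1))))) +
       ((((K + (KA + 1)) + 6 * d) * n ^ (d + e)) + (((K3 + 6 * (2 * d)) * n ^ (2 * d + (2 * d + e))) +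
        (1 + ((((K + KA + 5) + 6 * d) * n ^ (d + e)) + (1 + (1 + (1 + 1)))))))) ?Q"
      unfolding P_def
      apply (rule runs_SEQ, rule runs_mono[OF PRO order_refl])
      apply (rule runs_SEQ, rule runs_mono[OF loop1 order_refl], assumption)
      apply (rule runs_SEQ, rule runs_mono[OF loopR order_refl], assumption)
      apply (rule runs_SEQ, rule runs_SETC)
      apply (rule runs_SEQ, rule runs_mono[OF loopF order_refl])
        apply (rule St_upd, assumption, simp)
      subgoal using Bw by (simp add: B_def)
       apply simp
      apply (rule EPI, assumption)
      done
    then show "runs (enc a) P R0 (10 * L * sz a ^ (4 * length xs + e)) ?Q"
    proof (rule runs_mono)
      \<comment> \<open>The dominating cost is that of all rounds, in each of them all pairs of
        tuples, and for each pair one evaluation of the step formula: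
        \<open>2 * d + 2 * d + e\<close>.\<close>
      define X where "X = n ^ (4 * d + e)"
      have X1: "1 \<le> X" unfolding X_def by (rule n(2))
      have X0: "n ^ 1 \<le> X" "n ^ (d + e) \<le> X" "n ^ (2 * d + (2 * d + e)) \<le> X"
        unfolding X_def using n(1) \<open>1 \<le> e\<close> by (intro power_increasing; simp)+
      then have X2: "11 * d * n \<le> 11 * d * X" "((K + (KA + 1)) + 6 * d) * n ^ (d + e) \<le> ((K + (KA + 1)) + 6 * d) * X"
         "((K + KA + 5) + 6 * d) * n ^ (d + e) \<le> ((K + KA + 5) + 6 * d) * X"
         "(K3 + 6 * (2 * d)) * n ^ (2 * d + (2 * d + e)) \<le> (K3 + 6 * (2 * d)) * X"
        by (intro mult_le_mono2 X0(1)[unfolded power_one_right] X0(2,3))+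
      have X3: "d * X \<ge> d" using X1 by simp
      have "(1 + (1 + (1 + (1 + ((11 * n * d + 1) + 1))))) +
       ((((K + (KA + 1)) + 6 * d) * n ^ (d + e)) + (((K3 + 6 * (2 * d)) * n ^ (2 * d + (2 * d + e))) +
        (1 + ((((K + KA + 5) + 6 * d) * n ^ (d + e)) + (1 + (1 + (1 + 1))))))) \<le>
        11 * X + 11 * d * X + ((K + (KA + 1)) + 6 * d) * X + ((K + KA + 5) + 6 * d) * X + (K3 + 6 * (2 * d)) * X"
        using X1 X2 by (simp only: mult.commute[of n d] mult.assoc)
      also have "\<dots> = (11 + 11 * d + ((K + (KA + 1)) + 6 * d) + ((K + KA + 5) + 6 * d) + (K3 + 6 * (2 * d))) * X"
        by (simp only: add_mult_distrib)
      also have "\<dots> \<le> (10 * L) * X"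
        by (rule mult_le_mono1) (simp add: K3_def K2_def KA_def L_def)
      finally show "(1 + (1 + (1 + (1 + ((11 * n * d + 1) + 1))))) +
       ((((K + (KA + 1)) + 6 * d) * n ^ (d + e)) + (((K3 + 6 * (2 * d)) * n ^ (2 * d + (2 * d + e))) +
        (1 + ((((K + KA + 5) + 6 * d) * n ^ (d + e)) + (1 + (1 + (1 + 1))))))) \<le> 10 * L * sz a ^ (4 * length xs + e)"
        by (simp add: X_def n_def d_def)
    qed
  qed
  then show "\<exists>p w K. evaluates V (tc \<alpha> \<psi> \<omega> xs ys) \<rho> b p w K (4 * length xs + e)" by blast
qed

end

section \<open>The encoding of instances and the atomic formulas\<close>

section \<open>Reading the input\<close>

definition vnum :: "nat pair_pre_digraph \<times> (nat \<times> nat) list \<Rightarrow> nat" where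
  "vnum = (\<lambda>(G, ts). card (pverts G))"

definition adj :: "nat pair_pre_digraph \<times> (nat \<times> nat) list \<Rightarrow> nat \<Rightarrow> nat \<Rightarrow> bool" where
  "adj = (\<lambda>(G, ts) u v. (u, v) \<in> parcs G)"

definition source :: "nat pair_pre_digraph \<times> (nat \<times> nat) list \<Rightarrow> nat \<Rightarrow> nat" where
  "source = (\<lambda>(G, ts) p. fst (ts ! p))"

definition target :: "nat pair_pre_digraph \<times> (nat \<times> nat) list \<Rightarrow> nat \<Rightarrow> nat" where
  "target = (\<lambda>(G, ts) p. snd (ts ! p))"

lemma instanceD:
  assumes "a \<in> instances k"
  shows "adj a u v \<Longrightarrow> adj a v u" "adj a u v \<Longrightarrow> v < vnum a" "adj a u v \<Longrightarrow> u < vnum a"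
    "p < k \<Longrightarrow> source a p < vnum a" "p < k \<Longrightarrow> target a p < vnum a"
proof -
  obtain G ts where a: "a = (G, ts)" by (cases a)
  have *: "pair_graph G" "pverts G = {..<card (pverts G)}" "length ts = k" "set ts \<subseteq> pverts G \<times> pverts G"
    using assms by (auto simp: instances_def a)
  interpret pair_graph G by (rule *(1))
  show "adj a u v \<Longrightarrow> adj a v u" using arcs_symmetric by (auto simp: adj_def a)
  have "u \<in> pverts G \<and> v \<in> pverts G" if "adj a u v" for u v
    using that arc_fst_in_verts arc_snd_in_verts by (force simp: adj_def a)
  then show "adj a u v \<Longrightarrow> v < vnum a" "adj a u v \<Longrightarrow> u < vnum a"
    using *(2) by (auto simp: vnum_def a)
  have "ts ! p \<in> pverts G \<times> pverts G" if "p < k" using that *(3,4) nth_mem by blast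
  then show "p < k \<Longrightarrow> source a p < vnum a" "p < k \<Longrightarrow> target a p < vnum a"
    using *(2) by (auto simp: source_def target_def vnum_def a mem_Times_iff)
qed

lemma concat_pairs_nth:
  "p < length ts \<Longrightarrow> concat (map (\<lambda>(s, t). [s, t]) ts) ! (2 * p) = fst (ts ! p) \<and>
     concat (map (\<lambda>(s, t). [s, t]) ts) ! (2 * p + 1) = snd (ts ! p)"
proof (induction ts arbitrary: p)
  case (Cons a ts)
  then show ?case by (cases p; cases a) auto
qed simp

lemma length_concat_pairs: "length (concat (map (\<lambda>(s, t). [s, t]) ts)) = 2 * length ts"
  by (induction ts) auto

lemma concat_blocks_nth:
  "(\<And>l. l \<in> set ls \<Longrightarrow> length l = n) \<Longrightarrow> u < length ls \<Longrightarrow> v < n \<Longrightarrow>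
     n * u + v < length (concat ls) \<and> concat ls ! (n * u + v) = ls ! u ! v"
proof (induction ls arbitrary: u)
  case (Cons l ls)
  show ?case
  proof (cases u)
    case 0
    then show ?thesis using Cons.prems by (simp add: nth_append)
  next
    case (Suc u')
    have "n * u' + v < length (concat ls) \<and> concat ls ! (n * u' + v) = ls ! u' ! v"
      using Cons Suc by simp
    moreover have "n * u + v = length l + (n * u' + v)" using Cons.prems Suc by simp
    ultimately show ?thesis using Suc by (simp add: nth_append)
  qed
qed simp

lemma encode_reads:
  assumes "a \<in> instances k"
  shows "input_at (encode a) 0 = vnum a"
    "p < k \<Longrightarrow> input_at (encode a) (1 + 2 * p) = source a p"
    "p < k \<Longrightarrow> input_at (encode a) (2 + 2 * p) = target a p"
    "u < vnum a \<Longrightarrow> v < vnum a \<Longrightarrow> input_at (encode a) (1 + 2 * k + (vnum a * u + v)) = of_bool (adj a u v)"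
proof -
  obtain G ts where a: "a = (G, ts)" by (cases a)
  have len: "length ts = k" using assms by (simp add: instances_def a)
  define n where "n = card (pverts G)"
  define A where "A = concat (map (\<lambda>(s, t). [s, t]) ts)"
  define B where "B = concat (map (\<lambda>u. map (\<lambda>v. of_bool ((u, v) \<in> parcs G) :: nat) [0..<n]) [0..<n])"
  have e: "encode (G, ts) = n # A @ B" by (simp add: encode_def n_def A_def B_def Let_def)
  have lA: "length A = 2 * k" by (simp add: A_def length_concat_pairs len)
  show "input_at (encode a) 0 = vnum a" by (simp add: a e input_at_def vnum_def n_def)
  show "input_at (encode a) (1 + 2 * p) = source a p" "input_at (encode a) (2 + 2 * p) = target a p" if "p < k"
    using concat_pairs_nth[of p ts] that len lA
    by (simp_all add: a e input_at_def nth_append A_def[symmetric] source_def target_def)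
  show "input_at (encode a) (1 + 2 * k + (vnum a * u + v)) = of_bool (adj a u v)" if "u < vnum a" "v < vnum a"
  proof -
    have "n * u + v < length B \<and> B ! (n * u + v) = of_bool ((u, v) \<in> parcs G)"
    proof -
      define L where "L = map (\<lambda>u. map (\<lambda>v. of_bool ((u, v) \<in> parcs G) :: nat) [0..<n]) [0..<n]"
      have uv: "u < n" "v < n" using that by (simp_all add: vnum_def a n_def)
      then have "n * u + v < length (concat L) \<and> concat L ! (n * u + v) = L ! u ! v"
        by (intro concat_blocks_nth) (auto simp: L_def)
      then show ?thesis using uv by (simp add: B_def L_def)
    qed
    then show ?thesis
      using lA by (simp add: a e input_at_def nth_append vnum_def n_def[symmetric] adj_def)
  qed
qed

text \<open>A pair of terminals guarantees a vertex, so the universe is nonempty and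
  \<open>K * n ^ e\<close> can absorb constant summands.\<close>

locale positive_k =
  fixes k :: nat
  assumes k_pos: "0 < k"

sublocale positive_k \<subseteq> sized_input "instances k" encode vnum
proof
  fix a assume "a \<in> instances k"
  from instanceD(4)[OF this k_pos] show "0 < vnum a" by simp
qed

context positive_k
begin

text \<open>Two numbers are equal iff both of their truncated differences vanish, so the sum of the
  differences is tested for 0.\<close>

lemma dec_eq_value:
  fixes v :: 'v
  assumes v: "v \<in> V"
    and loc: "\<And>a f g. a \<in> instances k \<Longrightarrow> (\<And>v. v \<in> V \<Longrightarrow> f v = g v) \<Longrightarrow> val a f = val a g"
    and prog: "\<And>\<rho> b. 2 \<le> b \<Longrightarrow> \<rho> ` V \<subseteq> {2..<b} \<Longrightarrow> \<exists>q T. \<forall>a\<in>instances k. \<forall>R.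
      runs (encode a) q R T (\<lambda>R'. R' b = val a (R \<circ> \<rho>) \<and> (\<forall>i. i \<noteq> b \<and> i \<noteq> b + 1 \<longrightarrow> R' i = R i))"
  shows "dec V (\<lambda>a f. f v = val a f) e"
proof (rule decI)
  fix a and f g :: "'v \<Rightarrow> nat"
  assume "a \<in> instances k" "\<And>v. v \<in> V \<Longrightarrow> f v = g v"
  then show "(f v = val a f) = (g v = val a g)" using loc[of a f g] v by simp
next
  fix \<rho> :: "'v \<Rightarrow> nat" and b :: nat
  assume b: "2 \<le> b" "\<rho> ` V \<subseteq> {2..<b}"
  from prog[OF this] obtain q T where "\<forall>a\<in>instances k. \<forall>R.
      runs (encode a) q R T (\<lambda>R'. R' b = val a (R \<circ> \<rho>) \<and> (\<forall>i. i \<noteq> b \<and> i \<noteq> b + 1 \<longrightarrow> R' i = R i))"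
    by blast
  note q = this[rule_format]
  define x where "x = \<rho> v"
  have x: "x < b" using b v by (auto simp: x_def)
  define p where "p = SEQ q (SEQ (SUB (b + 1) b x) (SEQ (SUB (b + 2) x b) (SEQ (ADD (b + 1) (b + 1) (b + 2))
      (IFNZ (b + 1) (SETC b 0) (SETC b 1)))))"
  have "evaluates V (\<lambda>a f. f v = val a f) \<rho> b p (b + 3) (T + (1 + (1 + (1 + (1 + 1))))) e"
  proof (rule evaluatesI)
    fix a and R :: "nat \<Rightarrow> nat"
    assume a: "a \<in> instances k" "b + 3 \<le> R 0"
    let ?Q = "\<lambda>R'. R' b = of_bool ((R \<circ> \<rho>) v = val a (R \<circ> \<rho>)) \<and> (\<forall>i. i < b \<or> b + 3 \<le> i \<and> i < R 0 \<longrightarrow> R' i = R i)"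
    have "runs (encode a) p R (T + (1 + (1 + (1 + (1 + 1))))) ?Q"
      unfolding p_def
    proof (rule runs_SEQ, rule runs_mono[OF q[OF a(1)] order_refl])
      fix R1
      assume R1: "R1 b = val a (R \<circ> \<rho>) \<and> (\<forall>i. i \<noteq> b \<and> i \<noteq> b + 1 \<longrightarrow> R1 i = R i)"
      have "R1 x = R x" using R1 x by simp
      then show "runs (encode a) (SEQ (SUB (b + 1) b x) (SEQ (SUB (b + 2) x b) (SEQ (ADD (b + 1) (b + 1) (b + 2))
          (IFNZ (b + 1) (SETC b 0) (SETC b 1))))) R1 (1 + (1 + (1 + (1 + 1)))) ?Q"
        by - (rule runs_SEQ, rule runs_SUB, rule runs_SEQ, rule runs_SUB, rule runs_SEQ, rule runs_ADD,
          rule runs_IFNZ; rule runs_SETC; use x R1 in \<open>auto simp: x_def\<close>)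
    qed
    then show "runs (encode a) p R ((T + (1 + (1 + (1 + (1 + 1))))) * vnum a ^ e) ?Q"
      by (rule runs_mono[OF _ sz_pow[OF a(1)]])
  qed simp
  then show "\<exists>p w K. evaluates V (\<lambda>a f. f v = val a f) \<rho> b p w K e" by blast
qed

lemma dec_eq_const: "v \<in> V \<Longrightarrow> dec V (\<lambda>a f. f v = c) e"
proof (rule dec_eq_value[where val = "\<lambda>_ _. c"])
  fix \<rho> :: "'a \<Rightarrow> nat" and b
  show "\<exists>q T. \<forall>a\<in>instances k. \<forall>R. runs (encode a) q R T (\<lambda>R'. R' b = c \<and> (\<forall>i. i \<noteq> b \<and> i \<noteq> b + 1 \<longrightarrow> R' i = R i))"
    by (rule exI[of _ "SETC b c"], rule exI[of _ 1]) (intro ballI allI runs_SETC, simp)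
qed simp_all

lemma dec_eq_read:
  assumes "v \<in> V"
  shows "dec V (\<lambda>a f. f v = input_at (encode a) c) e"
proof (rule dec_eq_value[OF assms, where val = "\<lambda>a _. input_at (encode a) c"])
  fix \<rho> :: "'a \<Rightarrow> nat" and b
  show "\<exists>q T. \<forall>a\<in>instances k. \<forall>R. runs (encode a) q R T
      (\<lambda>R'. R' b = input_at (encode a) c \<and> (\<forall>i. i \<noteq> b \<and> i \<noteq> b + 1 \<longrightarrow> R' i = R i))"
    by (rule exI[of _ "SEQ (SETC b c) (READ b b)"], rule exI[of _ "1 + 1"])
      (intro ballI allI runs_SEQ, rule runs_SETC, rule runs_READ, simp)
qed simp_all

lemma dec_source: "v \<in> V \<Longrightarrow> p < k \<Longrightarrow> dec V (\<lambda>a f. f v = source a p) e"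
  by (rule dec_cong[OF dec_eq_read[of v V "1 + 2 * p"]]) (simp_all add: encode_reads(2)[simplified])

lemma dec_target: "v \<in> V \<Longrightarrow> p < k \<Longrightarrow> dec V (\<lambda>a f. f v = target a p) e"
  by (rule dec_cong[OF dec_eq_read[of v V "2 + 2 * p"]]) (simp_all add: encode_reads(3)[simplified])

lemma dec_eq: "u \<in> V \<Longrightarrow> v \<in> V \<Longrightarrow> dec V (\<lambda>a f. f v = f u) e"
proof (rule dec_eq_value[where val = "\<lambda>_ f. f u"])
  fix \<rho> :: "'a \<Rightarrow> nat" and b :: nat
  assume b: "2 \<le> b" "\<rho> ` V \<subseteq> {2..<b}" and u: "u \<in> V"
  then have "\<rho> u < b" by auto
  then show "\<exists>q T. \<forall>a\<in>instances k. \<forall>R. runs (encode a) q R T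
      (\<lambda>R'. R' b = (R \<circ> \<rho>) u \<and> (\<forall>i. i \<noteq> b \<and> i \<noteq> b + 1 \<longrightarrow> R' i = R i))"
    by (intro exI[of _ "SEQ (SETC b 0) (ADD b b (\<rho> u))"] exI[of _ "1 + 1"])
      (intro ballI allI runs_SEQ, rule runs_SETC, rule runs_ADD, simp)
qed simp_all

lemma dec_eq_Suc: "u \<in> V \<Longrightarrow> v \<in> V \<Longrightarrow> dec V (\<lambda>a f. f v = Suc (f u)) e"
proof (rule dec_eq_value[where val = "\<lambda>_ f. Suc (f u)"])
  fix \<rho> :: "'a \<Rightarrow> nat" and b :: nat
  assume b: "2 \<le> b" "\<rho> ` V \<subseteq> {2..<b}" and u: "u \<in> V"
  then have "\<rho> u < b" by auto
  then show "\<exists>q T. \<forall>a\<in>instances k. \<forall>R. runs (encode a) q R T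
      (\<lambda>R'. R' b = Suc ((R \<circ> \<rho>) u) \<and> (\<forall>i. i \<noteq> b \<and> i \<noteq> b + 1 \<longrightarrow> R' i = R i))"
    by (intro exI[of _ "SEQ (SETC b 1) (ADD b b (\<rho> u))"] exI[of _ "1 + 1"])
      (intro ballI allI runs_SEQ, rule runs_SETC, rule runs_ADD, simp)
qed simp_all

text \<open>The adjacency matrix starts after \<open>n\<close> and the \<open>2 * k\<close>
  terminals. Without a multiplication instruction the position in the matrix is computed by a loop,
  hence the exponent 1.\<close>

lemma dec_adj:
  fixes u v :: 'v
  assumes "u \<in> V" "v \<in> V"
  shows "dec V (\<lambda>a f. adj a (f u) (f v)) 1"
proof (rule decI)
  fix \<rho> :: "'v \<Rightarrow> nat" and b :: nat
  assume b: "2 \<le> b" "\<rho> ` V \<subseteq> {2..<b}"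
  then have r: "\<rho> u < b" "\<rho> v < b" using assms by auto
  define p where "p = SEQ (SETC (b + 5) (1 + 2 * k)) (SEQ (ADDRESS b (b + 5) [\<rho> u, \<rho> v]) (READ b b))"
  have "evaluates V (\<lambda>a f. adj a (f u) (f v)) \<rho> b p (b + 6) 27 1"
  proof (rule evaluatesI)
    fix a and R :: "nat \<Rightarrow> nat"
    assume a: "a \<in> instances k" "R 1 = vnum a" "b + 6 \<le> R 0" "\<And>v. v \<in> V \<Longrightarrow> R (\<rho> v) < vnum a"
    define R1 where "R1 = R(b + 5 := 1 + 2 * k)"
    let ?Q = "\<lambda>R'. R' b = of_bool (adj a ((R \<circ> \<rho>) u) ((R \<circ> \<rho>) v)) \<and> (\<forall>i. i < b \<or> b + 6 \<le> i \<and> i < R 0 \<longrightarrow> R' i = R i)"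
    have n: "0 < vnum a" using sz_pos a by simp
    have ad: "runs (encode a) (ADDRESS b (b + 5) [\<rho> u, \<rho> v]) R1 ((11 * length [\<rho> u, \<rho> v] + 3) * vnum a)
      (\<lambda>R'. R' b = R1 (b + 5) + horner (vnum a) 0 (map R1 [\<rho> u, \<rho> v]) \<and> (\<forall>i. i \<notin> {b..b + 3} \<longrightarrow> R' i = R1 i))"
      by (rule runs_ADDRESS) (use a b r n in \<open>auto simp: R1_def\<close>)
    have "runs (encode a) p R (1 + ((11 * length [\<rho> u, \<rho> v] + 3) * vnum a + 1)) ?Q"
      unfolding p_def
    proof (rule runs_SEQ, rule runs_SETC, fold R1_def, rule runs_SEQ, rule runs_mono[OF ad order_refl], rule runs_READ)
      fix R'
      assume R': "R' b = R1 (b + 5) + horner (vnum a) 0 (map R1 [\<rho> u, \<rho> v]) \<and> (\<forall>i. i \<notin> {b..b + 3} \<longrightarrow> R' i = R1 i)"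
      have "R' b = 1 + 2 * k + (vnum a * R (\<rho> u) + R (\<rho> v))"
        using R' r by (simp add: R1_def mult.commute)
      then have "input_at (encode a) (R' b) = of_bool (adj a (R (\<rho> u)) (R (\<rho> v)))"
        using encode_reads(4)[OF a(1)] a(4) assms by simp
      then show "?Q (R'(b := input_at (encode a) (R' b)))"
        using R' by (auto simp: R1_def)
    qed
    then show "runs (encode a) p R (27 * vnum a ^ 1) ?Q"
      by (rule runs_mono) (use n in auto)
  qed simp
  then show "\<exists>p w K. evaluates V (\<lambda>a f. adj a (f u) (f v)) \<rho> b p w K 1" by blast
qed (use assms in auto)

lemma dec_exs:
  assumes "dec (set vs \<union> V) \<phi> e"
  shows "dec V (\<lambda>a f. \<exists>ys\<in>tuples (vnum a) (length vs). \<phi> a (upds f vs ys)) (length vs + e)"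
  using assms
proof (induction vs arbitrary: \<phi> e)
  case (Cons v vs)
  have "dec (set vs \<union> V) (\<lambda>a f. \<exists>y<vnum a. \<phi> a (f(v := y))) (Suc e)"
    by (rule dec_ex) (use Cons.prems in simp)
  from Cons.IH[OF this]
  have "dec V (\<lambda>a f. \<exists>ys\<in>tuples (vnum a) (length vs). \<exists>y<vnum a. \<phi> a ((upds f vs ys)(v := y))) (length (v # vs) + e)" by (simp del: fun_upd_apply)
  then show ?case
    by (rule dec_cong) (auto simp: tuples_Suc)
qed simp

end

section \<open>Formulas for distances and for certificates of a fixed shape\<close>

section \<open>Distances and certificates as formulas\<close>

lemma ugraph_adj: "a \<in> instances k \<Longrightarrow> ugraph (adj a)"
  by unfold_locales (rule instanceD)

abbreviation aup :: "nat pair_pre_digraph \<times> (nat \<times> nat) list \<Rightarrow> nat \<Rightarrow> nat \<Rightarrow> nat \<Rightarrow> bool" where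
  "aup a p \<equiv> ugraph.up (adj a) (source a p)"

abbreviation adist :: "nat pair_pre_digraph \<times> (nat \<times> nat) list \<Rightarrow> nat \<Rightarrow> nat \<Rightarrow> nat" where
  "adist a p \<equiv> ugraph.dist (adj a) (source a p)"

text \<open>Bounded reachability is meaningful for all vertices and definable by a closure, so
  comparisons of distances are expressed by quantifying over the bound \<open>l\<close>.\<close>

definition dle :: "nat pair_pre_digraph \<times> (nat \<times> nat) list \<Rightarrow> nat \<Rightarrow> nat \<Rightarrow> nat \<Rightarrow> bool" where
  "dle a p u l \<longleftrightarrow> (\<exists>m\<le>l. (adj a ^^ m) (source a p) u)"

lemma dist_less_vnum:
  assumes "a \<in> instances k" "p < k" "(adj a)\<^sup>*\<^sup>* (source a p) u"
  shows "adist a p u < vnum a"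
proof -
  interpret ugraph "adj a" by (rule ugraph_adj[OF assms(1)])
  obtain m f where "m < card {..<vnum a}" "f 0 = source a p" "f m = u" "\<And>i. i < m \<Longrightarrow> adj a (f i) (f (Suc i))"
    using relpowp_short[OF assms(3), of "{..<vnum a}"] instanceD[OF assms(1)] assms(2)
    by (metis finite_lessThan lessThan_iff)
  then have "m < vnum a" "(adj a ^^ m) (source a p) u" by (auto simp: relpowp_fun_conv)
  then show ?thesis using dist_le by (meson le_less_trans)
qed

lemma dle_dist:
  assumes "a \<in> instances k"
  shows "dle a p u l \<longleftrightarrow> (adj a)\<^sup>*\<^sup>* (source a p) u \<and> adist a p u \<le> l"
proof -
  interpret ugraph "adj a" by (rule ugraph_adj[OF assms])
  show ?thesis
    unfolding dle_def using dist_le dist_walk relpowp_reach by (meson le_trans)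
qed

context positive_k
begin

lemma dec_binary:
  fixes u v :: 'v
  assumes "dec {0, 1 :: nat} (\<lambda>a f. r a (f 0) (f 1)) e" "u \<in> V" "v \<in> V" "e \<le> e'"
  shows "dec V (\<lambda>a f. r a (f u) (f v)) e'"
  using dec_mono[OF dec_subst[OF assms(1), of "\<lambda>i. if i = 0 then u else v" V] assms(4)] assms(2,3)
  by (simp add: image_subset_iff)

lemma Bex_tuples_1: "Bex (tuples n (Suc 0)) Q \<longleftrightarrow> (\<exists>x<n. Q [x])"
  by (auto simp: tuples_Suc)

lemma Bex_tuples_2: "Bex (tuples n 2) Q \<longleftrightarrow> (\<exists>x<n. \<exists>y<n. Q [x, y])"
  by (auto simp: tuples_Suc numeral_2_eq_2)

lemma tuples_2: "ys \<in> tuples n 2 \<longleftrightarrow> (\<exists>x<n. \<exists>y<n. ys = [x, y])"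
  by (auto simp: tuples_def length_Suc_conv numeral_2_eq_2)

text \<open>A closure on pairs of a vertex and a counter: a step increments the counter and follows
  an edge or stays, so the counter bounds the length of a walk from above. Tuples of length 2 and
  atomic steps give \<open>4 * 2 + 1\<close>.\<close>

lemma dec_dle:
  assumes p: "p < k"
  shows "dec {0, 1 :: nat} (\<lambda>a f. dle a p (f 0) (f 1)) 9"
proof -
  define \<alpha> where "\<alpha> = (\<lambda>a (f :: nat \<Rightarrow> nat). f 2 = source a p \<and> f 3 = 0)"
  define \<psi> where "\<psi> = (\<lambda>a (f :: nat \<Rightarrow> nat). f 5 = Suc (f 3) \<and> (adj a (f 2) (f 4) \<or> f 4 = f 2))"
  define \<omega> where "\<omega> = (\<lambda>(a :: nat pair_pre_digraph \<times> (nat \<times> nat) list) (f :: nat \<Rightarrow> nat). f 2 = f 0 \<and> f 3 = f 1)"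
  have "dec {0, 1 :: nat} (tc \<alpha> \<psi> \<omega> [2, 3] [4, 5]) (4 * length [2, 3 :: nat] + 1)"
  proof (rule dec_tc)
    show "dec ({0, 1 :: nat} \<union> set [2, 3] \<union> set [4, 5]) \<psi> 1"
      unfolding \<psi>_def by (intro dec_and dec_or dec_eq_Suc dec_adj dec_eq) auto
    show "dec ({0, 1 :: nat} \<union> set [2, 3]) \<alpha> 1"
      unfolding \<alpha>_def by (intro dec_and dec_source dec_eq_const) (use p in auto)
    show "dec ({0, 1 :: nat} \<union> set [2, 3]) \<omega> 1"
      unfolding \<omega>_def by (intro dec_and dec_eq) auto
  qed auto
  then have tc: "dec {0, 1 :: nat} (tc \<alpha> \<psi> \<omega> [2, 3] [4, 5]) 9" by simp
  show ?thesis
  proof (rule dec_cong[OF tc])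
    fix a and f :: "nat \<Rightarrow> nat"
    assume a: "a \<in> instances k" and f: "\<And>v. v \<in> {0, 1} \<Longrightarrow> f v < vnum a"
    define R where "R = tc_step \<psi> [2, 3] [4, 5] a f"
    have R: "([w, c], [w', c']) \<in> R \<longleftrightarrow> w < vnum a \<and> c < vnum a \<and> w' < vnum a \<and> c' < vnum a \<and>
        c' = Suc c \<and> (adj a w w' \<or> w' = w)" for w c w' c'
      by (auto simp: R_def tc_step_def \<psi>_def tuples_def)
    have f01: "f 0 < vnum a" "f 1 < vnum a" using f by auto
    have s: "source a p < vnum a" using instanceD(4)[OF a p] .
    have to: "dle a p w c" if "([source a p, 0], [w, c]) \<in> R\<^sup>*" for w c
    proof -
      have "\<exists>w c. q = [w, c] \<and> dle a p w c" if "([source a p, 0], q) \<in> R\<^sup>*" for q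
        using that
      proof (induction rule: rtrancl_induct)
        case base
        then show ?case by (auto simp: dle_def intro!: exI[of _ 0])
      next
        case (step y z)
        then obtain w c where y: "y = [w, c]" "dle a p w c" by blast
        have "z \<in> tuples (vnum a) 2" using step(2) by (auto simp: R_def tc_step_def numeral_2_eq_2)
        then obtain w' c' where z: "z = [w', c']" by (auto simp: tuples_2)
        have st: "c' = Suc c" "adj a w w' \<or> w' = w" using step(2) R y z by auto
        obtain m where m: "m \<le> c" "(adj a ^^ m) (source a p) w" using y by (auto simp: dle_def)
        have "dle a p w' c'"
        proof (cases "w' = w")
          case True
          then show ?thesis unfolding dle_def using m st by (intro exI[of _ m]) auto
        next
          case False
          then have "(adj a ^^ Suc m) (source a p) w'" using m st by auto
          then show ?thesis unfolding dle_def using m st by (intro exI[of _ "Suc m"]) auto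
        qed
        then show ?case using z by blast
      qed
      from this[OF that] show ?thesis by auto
    qed
    have "([source a p, 0], [w, c]) \<in> R\<^sup>*" if "w < vnum a" "c < vnum a" "m \<le> c" "(adj a ^^ m) (source a p) w" for w c m
      using that
    proof (induction c arbitrary: w m)
      case (Suc c)
      show ?case
      proof (cases "m \<le> c")
        case True
        then have "([source a p, 0], [w, c]) \<in> R\<^sup>*" using Suc by auto
        moreover have "([w, c], [w, Suc c]) \<in> R" using Suc.prems R by auto
        ultimately show ?thesis by auto
      next
        case False
        then have "m = Suc c" using Suc.prems by simp
        then obtain u where u: "(adj a ^^ c) (source a p) u" "adj a u w" using Suc.prems by auto
        have un: "u < vnum a" using instanceD(3)[OF a u(2)] .
        then have "([source a p, 0], [u, c]) \<in> R\<^sup>*" using Suc.IH[OF un _ order_refl u(1)] Suc.prems by auto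
        moreover have "([u, c], [w, Suc c]) \<in> R" using Suc.prems R u un by auto
        ultimately show ?thesis by auto
      qed
    qed auto
    then have iff: "([source a p, 0], [f 0, f 1]) \<in> R\<^sup>* \<longleftrightarrow> dle a p (f 0) (f 1)"
      using to f01 by (auto simp: dle_def)
    have "tc \<alpha> \<psi> \<omega> [2, 3] [4, 5] a f \<longleftrightarrow>
        (\<exists>P\<in>tuples (vnum a) 2. \<exists>Q\<in>tuples (vnum a) 2. \<alpha> a (upds f [2, 3] P) \<and> (P, Q) \<in> R\<^sup>* \<and> \<omega> a (upds f [2, 3] Q))"
      by (simp add: tc_def R_def numeral_2_eq_2)
    also have "\<dots> \<longleftrightarrow> ([source a p, 0], [f 0, f 1]) \<in> R\<^sup>*"
      using s f01 by (auto simp: Bex_tuples_2 \<alpha>_def \<omega>_def)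
    finally show "dle a p (f 0) (f 1) = tc \<alpha> \<psi> \<omega> [2, 3] [4, 5] a f" using iff by simp
  qed
qed

text \<open>Along an edge the distance grows by at most one, so it suffices to express that it
  grows: some bound holds for the first vertex and fails for the second. The distance of the first
  vertex is such a bound and less than \<open>n\<close>.\<close>

lemma dec_up01:
  assumes p: "p < k"
  shows "dec {0, 1 :: nat} (\<lambda>a f. aup a p (f 0) (f 1)) 10"
proof -
  have "dec (insert 2 {0, 1 :: nat}) (\<lambda>a f. dle a p (f 0) (f 2) \<and> \<not> dle a p (f 1) (f 2)) 9"
    by (intro dec_and dec_not dec_binary[OF dec_dle[OF p]]) auto
  from dec_ex[OF this]
  have "dec {0, 1 :: nat} (\<lambda>a f. adj a (f 0) (f 1) \<and> (\<exists>l<vnum a. dle a p (f 0) l \<and> \<not> dle a p (f 1) l)) 10"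
    by (intro dec_and dec_weaken[OF dec_adj[of 0 "{0, 1}" 1]]) auto
  then show ?thesis
  proof (rule dec_cong)
    fix a and f :: "nat \<Rightarrow> nat"
    assume a: "a \<in> instances k"
    interpret ugraph "adj a" by (rule ugraph_adj[OF a])
    let ?s = "source a p" and ?u = "f 0" and ?v = "f 1"
    show "up ?s ?u ?v = (adj a ?u ?v \<and> (\<exists>l<vnum a. dle a p ?u l \<and> \<not> dle a p ?v l))"
    proof
      assume up: "up ?s ?u ?v"
      then have "dist ?s ?u < vnum a" using dist_less_vnum[OF a p] by (simp add: up_def)
      then show "adj a ?u ?v \<and> (\<exists>l<vnum a. dle a p ?u l \<and> \<not> dle a p ?v l)"
        using up by (auto simp: up_def dle_dist[OF a] intro!: exI[of _ "dist ?s ?u"])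
    next
      assume *: "adj a ?u ?v \<and> (\<exists>l<vnum a. dle a p ?u l \<and> \<not> dle a p ?v l)"
      then obtain l where l: "(adj a)\<^sup>*\<^sup>* ?s ?u" "dist ?s ?u \<le> l" "\<not> ((adj a)\<^sup>*\<^sup>* ?s ?v \<and> dist ?s ?v \<le> l)"
        by (auto simp: dle_dist[OF a])
      then show "up ?s ?u ?v" using dist_edge[OF l(1), of ?v] * by (auto simp: up_def)
    qed
  qed
qed

lemma dec_up: "u \<in> V \<Longrightarrow> v \<in> V \<Longrightarrow> p < k \<Longrightarrow> 10 \<le> e \<Longrightarrow> dec V (\<lambda>a f. aup a p (f u) (f v)) e"
  by (rule dec_binary[OF dec_up01])

text \<open>Expressed as: every bound that holds for \<open>f v\<close> holds for
  \<open>f u\<close>. If \<open>f v\<close> is reachable, its own distance is among these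
  bounds.\<close>

lemma dec_closer:
  assumes p: "p < k" and V: "u \<in> V" "v \<in> V" and e: "10 \<le> e"
  shows "dec V (\<lambda>a f. (adj a)\<^sup>*\<^sup>* (source a p) (f v) \<longrightarrow> (adj a)\<^sup>*\<^sup>* (source a p) (f u) \<and> adist a p (f u) \<le> adist a p (f v)) e"
proof -
  have "dec (insert 2 {0, 1 :: nat}) (\<lambda>a f. dle a p (f 1) (f 2) \<and> \<not> dle a p (f 0) (f 2)) 9"
    by (intro dec_and dec_not dec_binary[OF dec_dle[OF p]]) auto
  from dec_not[OF dec_ex[OF this]]
  have "dec {0, 1 :: nat} (\<lambda>a f. \<not> (\<exists>l<vnum a. dle a p (f 1) l \<and> \<not> dle a p (f 0) l)) 10" by simp
  then have "dec {0, 1 :: nat} (\<lambda>a f. (adj a)\<^sup>*\<^sup>* (source a p) (f 1) \<longrightarrow> (adj a)\<^sup>*\<^sup>* (source a p) (f 0) \<and> adist a p (f 0) \<le> adist a p (f 1)) 10"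
  proof (rule dec_cong)
    fix a and f :: "nat \<Rightarrow> nat"
    assume a: "a \<in> instances k"
    show "((adj a)\<^sup>*\<^sup>* (source a p) (f 1) \<longrightarrow> (adj a)\<^sup>*\<^sup>* (source a p) (f 0) \<and> adist a p (f 0) \<le> adist a p (f 1)) =
        (\<not> (\<exists>l<vnum a. dle a p (f 1) l \<and> \<not> dle a p (f 0) l))"
      unfolding dle_dist[OF a] using dist_less_vnum[OF a p, of "f 1"] by (meson le_trans order_refl)
  qed
  from dec_binary[OF this V e] show ?thesis .
qed

text \<open>A closure on single vertices with a step formula of exponent 10, hence
  \<open>4 * 1 + 10\<close>.\<close>

lemma dec_ups01:
  assumes p: "p < k"
  shows "dec {0, 1 :: nat} (\<lambda>a f. (aup a p)\<^sup>*\<^sup>* (f 0) (f 1)) 14"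
proof -
  define \<alpha> where "\<alpha> = (\<lambda>(a :: nat pair_pre_digraph \<times> (nat \<times> nat) list) (f :: nat \<Rightarrow> nat). f 2 = f 0)"
  define \<psi> where "\<psi> = (\<lambda>a (f :: nat \<Rightarrow> nat). aup a p (f 2) (f 3))"
  define \<omega> where "\<omega> = (\<lambda>(a :: nat pair_pre_digraph \<times> (nat \<times> nat) list) (f :: nat \<Rightarrow> nat). f 2 = f 1)"
  have "dec {0, 1 :: nat} (tc \<alpha> \<psi> \<omega> [2] [3]) (4 * length [2 :: nat] + 10)"
  proof (rule dec_tc)
    show "dec ({0, 1 :: nat} \<union> set [2] \<union> set [3]) \<psi> 10"
      unfolding \<psi>_def by (intro dec_up p) auto
    show "dec ({0, 1 :: nat} \<union> set [2]) \<alpha> 10" "dec ({0, 1 :: nat} \<union> set [2]) \<omega> 10"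
      unfolding \<alpha>_def \<omega>_def by (intro dec_eq; simp)+
  qed auto
  then have tc: "dec {0, 1 :: nat} (tc \<alpha> \<psi> \<omega> [2] [3]) 14" by simp
  show ?thesis
  proof (rule dec_cong[OF tc])
    fix a and f :: "nat \<Rightarrow> nat"
    assume a: "a \<in> instances k" and f: "\<And>v. v \<in> {0, 1} \<Longrightarrow> f v < vnum a"
    interpret ugraph "adj a" by (rule ugraph_adj[OF a])
    let ?s = "source a p"
    define R where "R = tc_step \<psi> [2] [3] a f"
    have up_less: "u < vnum a \<and> v < vnum a" if "up ?s u v" for u v
      using that instanceD(2,3)[OF a, of u v] by (auto simp: up_def)
    have R: "R = {([u], [v]) | u v. up ?s u v}"
      using up_less by (fastforce simp: R_def tc_step_def \<psi>_def tuples_def length_Suc_conv)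
    have f01: "f 0 < vnum a" "f 1 < vnum a" using f by auto
    have "([u], [v]) \<in> R\<^sup>*" if "(up ?s)\<^sup>*\<^sup>* u v" for u v
      using that by (induction rule: rtranclp_induct) (auto simp: R intro: rtrancl_into_rtrancl)
    moreover have "\<exists>v. q = [v] \<and> (up ?s)\<^sup>*\<^sup>* u v" if "([u], q) \<in> R\<^sup>*" for u q
      using that by (induction rule: rtrancl_induct) (auto simp: R intro: rtranclp.rtrancl_into_rtrancl)
    ultimately have iff: "([f 0], [f 1]) \<in> R\<^sup>* \<longleftrightarrow> (up ?s)\<^sup>*\<^sup>* (f 0) (f 1)" by blast
    have "tc \<alpha> \<psi> \<omega> [2] [3] a f \<longleftrightarrow> ([f 0], [f 1]) \<in> R\<^sup>*"
      using f01 by (auto simp: tc_def R_def[symmetric] Bex_tuples_1 \<alpha>_def \<omega>_def)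
    then show "(up ?s)\<^sup>*\<^sup>* (f 0) (f 1) = tc \<alpha> \<psi> \<omega> [2] [3] a f" using iff by simp
  qed
qed

lemma dec_ups: "u \<in> V \<Longrightarrow> v \<in> V \<Longrightarrow> p < k \<Longrightarrow> 14 \<le> e \<Longrightarrow> dec V (\<lambda>a f. (aup a p)\<^sup>*\<^sup>* (f u) (f v)) e"
  by (rule dec_binary[OF dec_ups01])

end

context terminals
begin

text \<open>Allows to normalise the tables of a certificate outside \<open>Ix m\<close>, so that
  finitely many of them remain to be tried.\<close>

lemma certificate_cong:
  assumes m: "\<And>p. p < k \<Longrightarrow> m p = m' p" and i: "\<And>i. i \<in> Ix m \<Longrightarrow> cost i = cost' i \<and> col i = col' i \<and> ori i = ori' i"
  shows "Ix m = Ix m'" "shape m cost col = shape m' cost' col'" "local_ok m cost x y = local_ok m' cost' x y"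
    "separated m col ori x y = separated m' col' ori' x y" "routable m col ori x y = routable m' col' ori' x y"
proof -
  show Ix: "Ix m = Ix m'" using m by (auto simp: Ix_def)
  have mem: "(p, r) \<in> Ix m" if "p < k" "r < m p" for p r using that by (simp add: Ix_def)
  have "(\<Sum>r = 1..<m p. cost (p, r)) = (\<Sum>r = 1..<m p. cost' (p, r))" if "p < k" for p
    using i mem[OF that] by (intro sum.cong) auto
  then show "shape m cost col = shape m' cost' col'"
    using m i unfolding shape_def Ix[symmetric] by (intro conj_cong all_cong ball_cong) auto
  have "link (cost (p, r)) p (y (p, r - 1)) (x (p, r)) = link (cost' (p, r)) p (y (p, r - 1)) (x (p, r))"
    if "p \<in> {..<k}" "r \<in> {1..<m p}" for p r
    using i[OF mem[of p r]] that by simp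
  then have "(\<forall>p\<in>{..<k}. \<forall>r\<in>{1..<m p}. link (cost (p, r)) p (y (p, r - 1)) (x (p, r))) =
      (\<forall>p\<in>{..<k}. \<forall>r\<in>{1..<m' p}. link (cost' (p, r)) p (y (p, r - 1)) (x (p, r)))"
    using m by (intro ball_cong refl) auto
  moreover have "(\<forall>p\<in>{..<k}. x (p, 0) = s p \<and> y (p, m p - 1) = t p) = (\<forall>p\<in>{..<k}. x (p, 0) = s p \<and> y (p, m' p - 1) = t p)"
    using m by (intro ball_cong refl) auto
  ultimately show "local_ok m cost x y = local_ok m' cost' x y"
    unfolding local_ok_def Ix[symmetric] by simp
  have on: "onint col ori x y j v = onint col' ori' x y j v" if "j \<in> Ix m" for j v
    using i[OF that] by (simp add: onint_def)
  have G: "guess m x y = guess m' x y" by (simp add: guess_def Ix)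
  show "separated m col ori x y = separated m' col' ori' x y"
    unfolding separated_def G Ix[symmetric] using i on by (intro ball_cong refl) auto
  have mv: "move s (Ix m) col (guess m x y) (\<lambda>i. endv ori x y i) z z' = move s (Ix m') col' (guess m' x y) (\<lambda>i. endv ori' x y i) z z'" for z z'
    unfolding move_def G Ix[symmetric] by (intro bex_cong refl) (auto simp: i)
  show "routable m col ori x y = routable m' col' ori' x y"
    unfolding routable_def mv Ix[symmetric] using i by (intro ex_cong1 conj_cong ball_cong refl) auto
qed

lemma move_cong_on:
  assumes "\<And>i. i \<in> J \<Longrightarrow> z i = y i \<and> z' i = y' i"
  shows "move s J col G b z z' = move s J col G b y y'"
  unfolding move_def using assms by (intro bex_cong refl) auto

end

text \<open>The end points of the pieces, the positions of the pebbles before and after a move, and an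
  auxiliary vertex.\<close>

datatype var = VX "nat \<times> nat" | VY "nat \<times> nat" | VZ "nat \<times> nat" | VW "nat \<times> nat" | VU

lemma upds_append:
  "length xs = length ps \<Longrightarrow> upds f (xs @ ys) (ps @ qs) = upds (upds f ys qs) xs ps"
  by (induction xs ps rule: list_induct2) auto

lemma upds_map_index:
  assumes "inj g" "distinct js" "i \<in> set js" "length P = length js"
  shows "upds f (map g js) P (g i) = P ! (THE r. r < length js \<and> js ! r = i)"
proof -
  obtain r where r: "r < length js" "js ! r = i" using assms(3) by (auto simp: in_set_conv_nth)
  then have "(THE r. r < length js \<and> js ! r = i) = r"
    using assms(2) by (intro the_equality) (auto simp: nth_eq_iff_index_eq)
  moreover have "upds f (map g js) P (map g js ! r) = P ! r"
    using assms r by (intro upds_nth) (auto simp: distinct_map inj_on_def inj_def)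
  ultimately show ?thesis using r by simp
qed

lemma upds_map_map:
  assumes "inj g" "i \<in> set js"
  shows "upds f (map g js) (map z js) (g i) = z i"
  using assms(2) by (induction js) (auto simp: inj_eq[OF assms(1)])

lemma inj_var [simp]: "inj VX" "inj VY" "inj VZ" "inj VW"
  by (auto simp: inj_def)

text \<open>The combinatorial data of a certificate are fixed and built into the program; only the
  end points of the pieces become variables.\<close>

locale certificate_formula = positive_k +
  fixes m :: "nat \<Rightarrow> nat" and cost col :: "nat \<times> nat \<Rightarrow> nat" and ori :: "nat \<times> nat \<Rightarrow> bool"
  assumes m_pos: "p < k \<Longrightarrow> 1 \<le> m p"
    and col_k: "i \<in> terminals.Ix k m \<Longrightarrow> col i < k"
begin

definition J :: "(nat \<times> nat) set" where
  "J = (SIGMA p:{..<k}. {..<m p})"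

definition js :: "(nat \<times> nat) list" where
  "js = (SOME l. set l = J \<and> distinct l)"

lemma finite_J [simp]: "finite J" by (simp add: J_def)

lemma js: "set js = J" "distinct js" "length js = card J"
proof -
  have "set js = J \<and> distinct js"
    unfolding js_def by (rule someI_ex) (rule finite_distinct_list[OF finite_J])
  then show "set js = J" "distinct js" "length js = card J" by (auto simp: distinct_card[symmetric])
qed

definition V0 :: "var set" where "V0 = VX ` J \<union> VY ` J"

definition st :: "nat \<times> nat \<Rightarrow> var" where "st i = (if ori i then VX i else VY i)"
definition en :: "nat \<times> nat \<Rightarrow> var" where "en i = (if ori i then VY i else VX i)"

lemma inst_terminals: "a \<in> instances k \<Longrightarrow> terminals (adj a) {..<vnum a} k (source a)"
  using instanceD[of a k] by unfold_locales auto

lemma Ix_J: "a \<in> instances k \<Longrightarrow> terminals.Ix k m = J"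
  using terminals.Ix_def[OF inst_terminals] by (simp add: J_def)

lemma col_J: "a \<in> instances k \<Longrightarrow> i \<in> J \<Longrightarrow> col i < k"
  using col_k Ix_J by metis

definition locF where
  "locF a f \<longleftrightarrow> terminals.local_ok (adj a) k (source a) (target a) m cost (\<lambda>i. f (VX i)) (\<lambda>i. f (VY i))"

definition sepF where
  "sepF a f \<longleftrightarrow> terminals.separated (adj a) {..<vnum a} k (source a) m col ori (\<lambda>i. f (VX i)) (\<lambda>i. f (VY i))"

definition rouF where
  "rouF a f \<longleftrightarrow> terminals.routable (adj a) {..<vnum a} k (source a) m col ori (\<lambda>i. f (VX i)) (\<lambda>i. f (VY i))"

text \<open>The index set of \<open>terminals\<close> can be unfolded only with an instance at hand;
  if there is none, everything is decided vacuously.\<close>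

lemma dec_empty: "instances k = {} \<Longrightarrow> dec V \<phi> e"
  by (rule dec_cong[OF dec_const[of V True]]) simp

lemma dec_locF: "dec V0 locF 14"
proof -
  define L where "L = (\<lambda>a (f :: var \<Rightarrow> nat).
    (\<forall>p\<in>{..<k}. f (VX (p, 0)) = source a p \<and> f (VY (p, m p - 1)) = target a p) \<and>
    (\<forall>p\<in>{..<k}. \<forall>r\<in>{1..<m p}. adj a (f (VY (p, r - 1))) (f (VX (p, r))) \<and>
      (cost (p, r) = 0 \<longrightarrow> aup a p (f (VY (p, r - 1))) (f (VX (p, r)))) \<and>
      (cost (p, r) = 1 \<longrightarrow> \<not> aup a p (f (VX (p, r))) (f (VY (p, r - 1))))) \<and>
    (\<forall>i\<in>J. (aup a (fst i))\<^sup>*\<^sup>* (f (VX i)) (f (VY i))) \<and>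
    (\<forall>i\<in>J. \<forall>j\<in>J. i \<noteq> j \<longrightarrow> (\<forall>u\<in>{VX i, VY i}. \<forall>v\<in>{VX j, VY j}. f u = f v \<longrightarrow>
       fst i \<noteq> fst j \<and> (f u = source a (fst i) \<or> f u = target a (fst i)) \<and>
       (f v = source a (fst j) \<or> f v = target a (fst j)))))"
  have J: "p < k \<Longrightarrow> r < m p \<Longrightarrow> (p, r) \<in> J" "i \<in> J \<Longrightarrow> fst i < k" for p r i by (auto simp: J_def)
  have V: "i \<in> J \<Longrightarrow> VX i \<in> V0" "i \<in> J \<Longrightarrow> VY i \<in> V0" for i by (auto simp: V0_def)
  have "dec V0 L 14"
    unfolding L_def
  proof (intro dec_and dec_Ball finite_lessThan finite_atLeastLessThan finite_J dec_imp dec_const dec_or dec_not)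
    fix p assume p: "p \<in> {..<k}"
    show "dec V0 (\<lambda>a f. f (VX (p, 0)) = source a p) 14"
      by (rule dec_source) (use p m_pos[of p] in \<open>auto intro!: V J\<close>)
    show "dec V0 (\<lambda>a f. f (VY (p, m p - 1)) = target a p) 14"
      by (rule dec_target) (use p m_pos[of p] in \<open>auto intro!: V J\<close>)
    fix r assume r: "r \<in> {1..<m p}"
    have v: "VY (p, r - 1) \<in> V0" "VX (p, r) \<in> V0" using p r by (auto intro!: V J)
    show "dec V0 (\<lambda>a f. adj a (f (VY (p, r - 1))) (f (VX (p, r)))) 14"
      by (rule dec_mono[OF dec_adj[OF v]]) simp
    show "dec V0 (\<lambda>a f. aup a p (f (VY (p, r - 1))) (f (VX (p, r)))) 14"
      "dec V0 (\<lambda>a f. aup a p (f (VX (p, r))) (f (VY (p, r - 1)))) 14"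
      using v p by (auto intro!: dec_up)
  next
    fix i assume i: "i \<in> J"
    show "dec V0 (\<lambda>a f. (aup a (fst i))\<^sup>*\<^sup>* (f (VX i)) (f (VY i))) 14"
      by (rule dec_ups) (use V J i in auto)
    fix j assume j: "j \<in> J"
    show "finite {VX i, VY i}" "finite {VX j, VY j}" by simp_all
    fix u v assume "u \<in> {VX i, VY i}" "v \<in> {VX j, VY j}"
    then have uv: "u \<in> V0" "v \<in> V0" using V[OF i] V[OF j] by blast+
    show "dec V0 (\<lambda>a f. f u = f v) 14" using uv(2,1) by (rule dec_eq)
    show "dec V0 (\<lambda>a f. f u = source a (fst i)) 14" "dec V0 (\<lambda>a f. f u = target a (fst i)) 14"
      "dec V0 (\<lambda>a f. f v = source a (fst j)) 14" "dec V0 (\<lambda>a f. f v = target a (fst j)) 14"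
      using uv J(2)[OF i] J(2)[OF j] by (auto intro!: dec_source dec_target)
  qed
  then show ?thesis
  proof (rule dec_cong)
    fix a and f :: "var \<Rightarrow> nat"
    assume a: "a \<in> instances k"
    interpret terminals "adj a" "{..<vnum a}" k C "source a" "target a" for C by (rule inst_terminals[OF a])
    show "locF a f = L a f"
      unfolding locF_def L_def local_ok_def link_def Ix_J[OF a] by simp
  qed
qed

lemma dec_sepF: "dec V0 sepF 15"
proof (cases "instances k = {}")
  case False
  then obtain a0 where a0: "a0 \<in> instances k" by blast
  define L where "L = (\<lambda>a (f :: var \<Rightarrow> nat). \<forall>i\<in>J. \<forall>j\<in>J. col i \<noteq> col j \<longrightarrow> \<not> (\<exists>v<vnum a.
     (\<lambda>a f. (\<forall>g\<in>J. f VU \<noteq> f (VX g) \<and> f VU \<noteq> f (VY g)) \<and>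
       (aup a (col i))\<^sup>*\<^sup>* (f (st i)) (f VU) \<and> (aup a (col i))\<^sup>*\<^sup>* (f VU) (f (en i)) \<and>
       (aup a (col j))\<^sup>*\<^sup>* (f (st j)) (f VU) \<and> (aup a (col j))\<^sup>*\<^sup>* (f VU) (f (en j))) a (f(VU := v))))"
  have V: "i \<in> J \<Longrightarrow> VX i \<in> insert VU V0" "i \<in> J \<Longrightarrow> VY i \<in> insert VU V0"
    "i \<in> J \<Longrightarrow> st i \<in> insert VU V0" "i \<in> J \<Longrightarrow> en i \<in> insert VU V0" for i
    by (auto simp: V0_def st_def en_def)
  have "dec V0 L (Suc 14)"
    unfolding L_def
  proof (intro dec_Ball finite_J dec_imp dec_const dec_not dec_ex)
    fix i j assume ij: "i \<in> J" "j \<in> J"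
    show "dec (insert VU V0) (\<lambda>a f. (\<forall>g\<in>J. f VU \<noteq> f (VX g) \<and> f VU \<noteq> f (VY g)) \<and>
       (aup a (col i))\<^sup>*\<^sup>* (f (st i)) (f VU) \<and> (aup a (col i))\<^sup>*\<^sup>* (f VU) (f (en i)) \<and>
       (aup a (col j))\<^sup>*\<^sup>* (f (st j)) (f VU) \<and> (aup a (col j))\<^sup>*\<^sup>* (f VU) (f (en j))) 14"
      by (intro dec_and dec_Ball finite_J dec_not dec_eq dec_ups) (use V ij col_J[OF a0] in auto)
  qed
  then have "dec V0 L 15" by simp
  then show ?thesis
  proof (rule dec_cong)
    fix a and f :: "var \<Rightarrow> nat"
    assume a: "a \<in> instances k"
    interpret terminals "adj a" "{..<vnum a}" k C "source a" "target a" for C by (rule inst_terminals[OF a])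
    have upd: "(f(VU := v)) (VX i) = f (VX i)" "(f(VU := v)) (VY i) = f (VY i)" "(f(VU := v)) VU = v" for i v by simp_all
    have st: "(f(VU := v)) (st i) = (if ori i then f (VX i) else f (VY i))"
      "(f(VU := v)) (en i) = (if ori i then f (VY i) else f (VX i))" for i v
      by (simp_all add: st_def en_def)
    have G: "v \<notin> guess m (\<lambda>i. f (VX i)) (\<lambda>i. f (VY i)) \<longleftrightarrow> (\<forall>g\<in>J. v \<noteq> f (VX g) \<and> v \<noteq> f (VY g))" for v
      by (auto simp: guess_def Ix_J[OF a])
    show "sepF a f = L a f"
      unfolding sepF_def L_def separated_def onint_def Ix_J[OF a] upd st G by blast
  qed
qed (rule dec_empty)

definition vs :: "var list" where "vs = map VX js @ map VY js"

lemma set_vs: "set vs = V0" by (simp add: vs_def V0_def js(1))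

text \<open>The positions of the pebbles form one tuple with an entry per piece, and a play is a
  walk on such tuples. The closure contributes \<open>4 * card J\<close>, the rule for moves
  10.\<close>

lemma dec_rouF: "dec V0 rouF (4 * card J + 10)"
proof (cases "instances k = {}")
  case False
  then obtain a0 where a0: "a0 \<in> instances k" by blast
  let ?xs = "map VZ js" and ?ys = "map VW js"
  define \<alpha> where "\<alpha> = (\<lambda>(a :: nat pair_pre_digraph \<times> (nat \<times> nat) list) (f :: var \<Rightarrow> nat). \<forall>i\<in>J. f (st i) = f (VZ i))"
  define \<omega> where "\<omega> = (\<lambda>(a :: nat pair_pre_digraph \<times> (nat \<times> nat) list) (f :: var \<Rightarrow> nat). \<forall>i\<in>J. f (en i) = f (VZ i))"
  define \<psi> where "\<psi> = (\<lambda>a (f :: var \<Rightarrow> nat). \<exists>i\<in>J. f (en i) \<noteq> f (VZ i) \<and> aup a (col i) (f (VZ i)) (f (VW i)) \<and>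
     (f (en i) = f (VW i) \<or> ((\<forall>g\<in>J. f (VX g) \<noteq> f (VW i) \<and> f (VY g) \<noteq> f (VW i)) \<and>
        (\<forall>j\<in>J. j \<noteq> i \<longrightarrow> f (VZ j) \<noteq> f (VW i)))) \<and> (\<forall>j\<in>J. j \<noteq> i \<longrightarrow> f (VZ j) = f (VW j)) \<and>
     (\<forall>j\<in>J. col j = col i \<longrightarrow> f (en j) \<noteq> f (VZ j) \<longrightarrow>
        ((adj a)\<^sup>*\<^sup>* (source a (col i)) (f (VZ j)) \<longrightarrow> (adj a)\<^sup>*\<^sup>* (source a (col i)) (f (VZ i)) \<and>
           adist a (col i) (f (VZ i)) \<le> adist a (col i) (f (VZ j)))))"
  have V: "VX i \<in> V0" "VY i \<in> V0" "st i \<in> V0" "en i \<in> V0" if "i \<in> J" for i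
    using that
    by (auto simp: V0_def st_def en_def)
  have "dec V0 (tc \<alpha> \<psi> \<omega> ?xs ?ys) (4 * length ?xs + 10)"
  proof (rule dec_tc)
    show "dec (V0 \<union> set ?xs) \<alpha> 10" "dec (V0 \<union> set ?xs) \<omega> 10"
      unfolding \<alpha>_def \<omega>_def by (intro dec_Ball finite_J dec_eq; simp add: V js(1))+
    have Z: "i \<in> J \<Longrightarrow> VZ i \<in> V0 \<union> set ?xs \<union> set ?ys" "i \<in> J \<Longrightarrow> VW i \<in> V0 \<union> set ?xs \<union> set ?ys" for i
      by (auto simp: js(1))
    show "dec (V0 \<union> set ?xs \<union> set ?ys) \<psi> 10"
      unfolding \<psi>_def
      by (intro dec_Bex dec_Ball finite_J dec_and dec_or dec_imp dec_not dec_const dec_eq dec_up dec_closer)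
        (simp_all add: V Z col_J[OF a0] js(1))
  qed auto
  then have tcd: "dec V0 (tc \<alpha> \<psi> \<omega> ?xs ?ys) (4 * card J + 10)" by (simp add: js(3))
  show ?thesis
  proof (rule dec_cong[OF tcd])
    fix a and f :: "var \<Rightarrow> nat"
    assume a: "a \<in> instances k" and f: "\<And>v. v \<in> V0 \<Longrightarrow> f v < vnum a"
    interpret terminals "adj a" "{..<vnum a}" k C "source a" "target a" for C by (rule inst_terminals[OF a])
    define x where "x = (\<lambda>i. f (VX i))"
    define y where "y = (\<lambda>i. f (VY i))"
    define mv where "mv = (\<lambda>z z'. move (source a) J col (guess m x y) (\<lambda>i. endv ori x y i) z z' \<and>
      (\<forall>i\<in>J. z i \<in> {..<vnum a} \<and> z' i \<in> {..<vnum a}))"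
    define R where "R = tc_step \<psi> ?xs ?ys a f"
    define zf where "zf = (\<lambda>P i. upds f ?xs P (VZ i))"
    let ?T = "tuples (vnum a) (length js)"
    have pos: "upds f (?xs @ ?ys) (P @ Q) (VX i) = x i" "upds f (?xs @ ?ys) (P @ Q) (VY i) = y i"
      "upds f (?xs @ ?ys) (P @ Q) (st i) = startv ori x y i" "upds f (?xs @ ?ys) (P @ Q) (en i) = endv ori x y i"
      if "P \<in> ?T" "Q \<in> ?T" for P Q i
    proof -
      have l: "length (?xs @ ?ys) = length (P @ Q)" using that by (simp add: tuples_def)
      show vx: "upds f (?xs @ ?ys) (P @ Q) (VX i) = x i" "upds f (?xs @ ?ys) (P @ Q) (VY i) = y i"
        unfolding x_def y_def by (rule upds_outside[OF l]; auto)+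
      then show "upds f (?xs @ ?ys) (P @ Q) (st i) = startv ori x y i" "upds f (?xs @ ?ys) (P @ Q) (en i) = endv ori x y i"
        by (auto simp: st_def en_def)
    qed
    have posZ: "upds f (?xs @ ?ys) (P @ Q) (VZ i) = zf P i" "upds f (?xs @ ?ys) (P @ Q) (VW i) = zf Q i"
      if "P \<in> ?T" "Q \<in> ?T" "i \<in> J" for P Q i
    proof -
      have l: "length P = length js" "length Q = length js" "i \<in> set js" using that by (auto simp: tuples_def js(1))
      have app: "upds f (?xs @ ?ys) (P @ Q) = upds (upds f ?ys Q) ?xs P" using l by (intro upds_append) simp
      show "upds f (?xs @ ?ys) (P @ Q) (VZ i) = zf P i"
        unfolding app zf_def using l js(2) by (simp add: upds_map_index)
      have "upds (upds f ?ys Q) ?xs P (VW i) = upds f ?ys Q (VW i)"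
        using l by (intro upds_outside) auto
      then show "upds f (?xs @ ?ys) (P @ Q) (VW i) = zf Q i"
        unfolding app zf_def using l js(2) by (simp add: upds_map_index)
    qed
    have pos1: "upds f ?xs P (st i) = startv ori x y i" "upds f ?xs P (en i) = endv ori x y i" if "P \<in> ?T" for P i
      using that by (auto simp: st_def en_def x_def y_def tuples_def intro!: upds_outside)
    have zf_less: "zf P i < vnum a" if "P \<in> ?T" "i \<in> J" for P i
      unfolding zf_def by (rule upds_less) (use that js(1) in auto)
    have zf_map: "zf (map z js) i = z i" if "i \<in> J" for z i
      unfolding zf_def using that js(1) by (intro upds_map_map) auto
    have map_T: "map z js \<in> ?T" if "\<And>i. i \<in> J \<Longrightarrow> z i < vnum a" for z
      using that js(1) by (auto simp: tuples_def)
    have G: "v \<notin> guess m x y \<longleftrightarrow> (\<forall>g\<in>J. x g \<noteq> v \<and> y g \<noteq> v)" for v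
      by (auto simp: guess_def Ix_J[OF a])
    have step: "(P, Q) \<in> R \<longleftrightarrow> mv (zf P) (zf Q)" if PQ: "P \<in> ?T" "Q \<in> ?T" for P Q
    proof -
      have "(P, Q) \<in> R \<longleftrightarrow> \<psi> a (upds f (?xs @ ?ys) (P @ Q))" using PQ by (simp add: R_def tc_step_def)
      \<comment> \<open>The formula also demands that the moving pebble be reachable from the
        source, which \<open>up\<close> already guarantees.\<close>
      also have "\<dots> \<longleftrightarrow> move (source a) J col (guess m x y) (\<lambda>i. endv ori x y i) (zf P) (zf Q)"
        unfolding \<psi>_def move_def G pos[OF PQ] using posZ[OF PQ]
        by (intro bex_cong refl) (auto simp: up_def)
      also have "\<dots> \<longleftrightarrow> mv (zf P) (zf Q)" using zf_less[OF PQ(1)] zf_less[OF PQ(2)] by (auto simp: mv_def)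
      finally show ?thesis .
    qed
    have RT: "R \<subseteq> ?T \<times> ?T" by (auto simp: R_def tc_step_def)
    have A: "P \<in> ?T \<Longrightarrow> Q \<in> ?T \<and> mv\<^sup>*\<^sup>* (zf P) (zf Q)" if "(P, Q) \<in> R\<^sup>*" for P Q
      using that
    proof (induction rule: rtrancl_induct)
      case (step Q Q')
      then have "Q \<in> ?T" "Q' \<in> ?T" "mv\<^sup>*\<^sup>* (zf P) (zf Q)" using RT by auto
      moreover from this step(2) \<open>\<And>Q P. P \<in> ?T \<Longrightarrow> Q \<in> ?T \<Longrightarrow> ((P, Q) \<in> R) = mv (zf P) (zf Q)\<close> have "mv (zf Q) (zf Q')" by blast
      ultimately show ?case by auto
    qed simp
    have B: "(\<forall>i\<in>J. z i < vnum a) \<and> (map z0 js, map z js) \<in> R\<^sup>*" if "mv\<^sup>*\<^sup>* z0 z" "\<forall>i\<in>J. z0 i < vnum a" for z0 z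
      using that(1)
    proof (induction rule: rtranclp_induct)
      case base
      then show ?case using that(2) by auto
    next
      case (step y1 z1)
      have lt: "\<forall>i\<in>J. y1 i < vnum a" "\<forall>i\<in>J. z1 i < vnum a" using step(2) by (auto simp: mv_def)
      have "mv (zf (map y1 js)) (zf (map z1 js))"
        using step(2) zf_map move_cong_on[of J "zf (map y1 js)" y1 "zf (map z1 js)" z1] by (simp add: mv_def)
      then have "(map y1 js, map z1 js) \<in> R"
        using \<open>\<And>Q P. P \<in> ?T \<Longrightarrow> Q \<in> ?T \<Longrightarrow> ((P, Q) \<in> R) = mv (zf P) (zf Q)\<close> map_T lt by auto
      then show ?case using step lt by auto
    qed
    have \<alpha>: "\<alpha> a (upds f ?xs P) \<longleftrightarrow> (\<forall>i\<in>J. zf P i = startv ori x y i)"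
      and \<omega>: "\<omega> a (upds f ?xs P) \<longleftrightarrow> (\<forall>i\<in>J. zf P i = endv ori x y i)" if "P \<in> ?T" for P
      unfolding \<alpha>_def \<omega>_def pos1[OF that] zf_def by auto
    have xy_less: "x i < vnum a" "y i < vnum a" if "i \<in> J" for i
      using f that by (auto simp: x_def y_def V0_def)
    have ro: "rouF a f \<longleftrightarrow> (\<exists>z0 z. (\<forall>i\<in>J. z0 i = startv ori x y i) \<and> mv\<^sup>*\<^sup>* z0 z \<and> (\<forall>i\<in>J. z i = endv ori x y i))"
      unfolding rouF_def routable_def Ix_J[OF a] mv_def x_def y_def by simp
    have tc: "tc \<alpha> \<psi> \<omega> ?xs ?ys a f \<longleftrightarrow> (\<exists>P\<in>?T. \<exists>Q\<in>?T. (\<forall>i\<in>J. zf P i = startv ori x y i) \<and> (P, Q) \<in> R\<^sup>* \<and>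
        (\<forall>i\<in>J. zf Q i = endv ori x y i))"
      unfolding tc_def R_def[symmetric] length_map using \<alpha> \<omega> by (intro bex_cong refl) auto
    show "rouF a f = tc \<alpha> \<psi> \<omega> ?xs ?ys a f"
    proof
      assume "rouF a f"
      then obtain z0 z where z: "\<forall>i\<in>J. z0 i = startv ori x y i" "mv\<^sup>*\<^sup>* z0 z" "\<forall>i\<in>J. z i = endv ori x y i"
        unfolding ro by blast
      have "\<forall>i\<in>J. z0 i < vnum a" using z(1) xy_less by auto
      note Bz = B[OF z(2) this]
      then have "map z0 js \<in> ?T" "map z js \<in> ?T" using \<open>\<forall>i\<in>J. z0 i < vnum a\<close> by (auto intro!: map_T)
      then show "tc \<alpha> \<psi> \<omega> ?xs ?ys a f"
        unfolding tc using z(1,3) zf_map Bz by (intro bexI[of _ "map z0 js"] bexI[of _ "map z js"]) auto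
    next
      assume "tc \<alpha> \<psi> \<omega> ?xs ?ys a f"
      then obtain P Q where PQ: "P \<in> ?T" "Q \<in> ?T" "\<forall>i\<in>J. zf P i = startv ori x y i" "(P, Q) \<in> R\<^sup>*" "\<forall>i\<in>J. zf Q i = endv ori x y i"
        unfolding tc by blast
      with A[OF PQ(4,1)] show "rouF a f" unfolding ro by blast
    qed
  qed
qed (rule dec_empty)

definition accepts where
  "accepts a \<longleftrightarrow> (\<exists>x y. (\<forall>i\<in>J. x i < vnum a \<and> y i < vnum a) \<and>
     terminals.local_ok (adj a) k (source a) (target a) m cost x y \<and>
     terminals.separated (adj a) {..<vnum a} k (source a) m col ori x y \<and>
     terminals.routable (adj a) {..<vnum a} k (source a) m col ori x y)"

text \<open>The two end points of each piece are found by \<open>2 * card J\<close> nested loops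
  around a formula of exponent \<open>4 * card J + 15\<close>.\<close>

lemma dec_accepts: "dec ({} :: var set) (\<lambda>a f. accepts a) (6 * card J + 15)"
proof -
  let ?\<phi> = "\<lambda>a f. locF a f \<and> sepF a f \<and> rouF a f"
  have \<phi>: "dec V0 ?\<phi> (4 * card J + 15)"
    by (intro dec_and dec_weaken[OF dec_locF] dec_weaken[OF dec_sepF] dec_weaken[OF dec_rouF]) auto
  have "dec {} (\<lambda>a f. \<exists>ys\<in>tuples (vnum a) (length vs). ?\<phi> a (upds f vs ys)) (length vs + (4 * card J + 15))"
    by (rule dec_exs) (use \<phi> in \<open>simp add: set_vs\<close>)
  moreover have "length vs + (4 * card J + 15) = 6 * card J + 15" by (simp add: vs_def js(3))
  ultimately have d: "dec {} (\<lambda>a f. \<exists>ys\<in>tuples (vnum a) (length vs). ?\<phi> a (upds f vs ys)) (6 * card J + 15)" by simp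
  show ?thesis
  proof (rule dec_cong[OF d])
    fix a and f :: "var \<Rightarrow> nat"
    assume a: "a \<in> instances k"
    show "accepts a = (\<exists>ys\<in>tuples (vnum a) (length vs). ?\<phi> a (upds f vs ys))"
    proof
      assume "accepts a"
      then obtain x y where xy: "\<forall>i\<in>J. x i < vnum a \<and> y i < vnum a"
        "terminals.local_ok (adj a) k (source a) (target a) m cost x y"
        "terminals.separated (adj a) {..<vnum a} k (source a) m col ori x y"
        "terminals.routable (adj a) {..<vnum a} k (source a) m col ori x y"
        unfolding accepts_def by blast
      define g where "g = (\<lambda>v. case v of VX i \<Rightarrow> x i | VY i \<Rightarrow> y i | _ \<Rightarrow> 0)"
      have g: "?\<phi> a g" using xy(2-4) by (simp add: locF_def sepF_def rouF_def g_def)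
      define ys where "ys = map x js @ map y js"
      have l: "length (map VX js) = length (map x js)" by simp
      have ys: "ys \<in> tuples (vnum a) (length vs)" using xy(1) js(1) by (auto simp: ys_def vs_def tuples_def)
      have up: "upds f vs ys = upds (upds f (map VY js) (map y js)) (map VX js) (map x js)"
        unfolding vs_def ys_def by (rule upds_append[OF l])
      have "upds f vs ys v = g v" if "v \<in> V0" for v
      proof -
        from that consider i where "i \<in> J" "v = VX i" | i where "i \<in> J" "v = VY i" by (auto simp: V0_def)
        then show ?thesis
        proof cases
          case 1
          then show ?thesis unfolding up using upds_map_map[of VX i js _ x] js(1) by (simp add: g_def)
        next
          case 2
          then have "upds f vs ys v = upds f (map VY js) (map y js) v" unfolding up by (intro upds_outside) auto
          then show ?thesis using upds_map_map[of VY i js _ y] js(1) 2 by (simp add: g_def)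
        qed
      qed
      moreover have "g v < vnum a" if "v \<in> V0" for v using that xy(1) by (auto simp: V0_def g_def)
      ultimately have "?\<phi> a g = ?\<phi> a (upds f vs ys)" by (intro dec_local[OF \<phi> a]) auto
      then show "\<exists>ys\<in>tuples (vnum a) (length vs). ?\<phi> a (upds f vs ys)" using g ys by blast
    next
      assume "\<exists>ys\<in>tuples (vnum a) (length vs). ?\<phi> a (upds f vs ys)"
      then obtain ys where ys: "ys \<in> tuples (vnum a) (length vs)" "?\<phi> a (upds f vs ys)" by blast
      have "upds f vs ys v < vnum a" if "v \<in> V0" for v using that by (intro upds_less[OF ys(1)]) (simp add: set_vs)
      then show "accepts a"
        unfolding accepts_def using ys(2)
        by (intro exI[of _ "\<lambda>i. upds f vs ys (VX i)"] exI[of _ "\<lambda>i. upds f vs ys (VY i)"])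
          (auto simp: locF_def sepF_def rouF_def V0_def)
    qed
  qed
qed

end

section \<open>The final exponent, the link to the problem as stated, and the program\<close>

section \<open>The algorithm\<close>

text \<open>For \<open>k \<ge> 2\<close> also \<open>B \<ge> 2\<close>, so constants disappear in
  powers of \<open>B\<close>: \<open>5 * N\<^sup>2 \<le> 20 * B\<^sup>2 \<le> B ^ 7\<close>, and
  \<open>7 * Suc k \<le> 5 ^ k\<close>. For \<open>k = 1\<close> it suffices that
  \<open>N \<le> 2 * B\<close>. In both cases at most \<open>2 * B ^ (5 ^ k)\<close> pieces remain,
  and \<open>27 = 6 * 2 + 15\<close>.\<close>

lemma exponent_bound:
  fixes k C :: nat
  assumes "0 < k"
  defines "N \<equiv> k + k * C" and "B \<equiv> max 1 C * k"
  shows "6 * (if k = 1 then N else (5 * N\<^sup>2) ^ Suc k) + 15 \<le> 27 * B ^ (5 ^ k)"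
proof -
  have N: "N \<le> 2 * B" by (cases "C = 0") (auto simp: N_def B_def algebra_simps)
  have B1: "1 \<le> B" using assms(1) by (simp add: B_def)
  have "(if k = 1 then N else (5 * N\<^sup>2) ^ Suc k) \<le> 2 * B ^ (5 ^ k)"
  proof (cases "k = 1")
    case True
    have "B ^ 1 \<le> B ^ (5 ^ k)" by (rule power_increasing) (use B1 in simp_all)
    then show ?thesis using N True by simp
  next
    case False
    then have k: "2 \<le> k" using assms(1) by simp
    have "k \<le> B" by (simp add: B_def)
    then have B2: "2 \<le> B" using k by simp
    have "(2::nat) ^ 5 \<le> B ^ 5" using B2 by (rule power_mono) simp
    then have B5: "20 \<le> B ^ 5" by simp
    have "5 * N\<^sup>2 \<le> 5 * (2 * B)\<^sup>2" using N by (intro mult_left_mono power_mono) auto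
    also have "\<dots> = 20 * B\<^sup>2" by (simp add: power2_eq_square)
    also have "\<dots> \<le> B ^ 5 * B\<^sup>2" using B5 by (rule mult_right_mono) simp
    also have "\<dots> = B ^ 7" by (simp flip: power_add)
    finally have "(5 * N\<^sup>2) ^ Suc k \<le> (B ^ 7) ^ Suc k" by (rule power_mono) simp
    also have "\<dots> = B ^ (7 * Suc k)" by (rule power_mult[symmetric])
    also have "\<dots> \<le> B ^ (5 ^ k)"
    proof (rule power_increasing)
      show "7 * Suc k \<le> 5 ^ k" using k by (induction k rule: dec_induct) auto
    qed (rule B1)
    finally show ?thesis using False by simp
  qed
  moreover have "1 \<le> B ^ (5 ^ k)" using B1 by simp
  ultimately show ?thesis by linarith
qed

text \<open>The frame around the compiled formula loads \<open>n\<close> from the input into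
  register 1, lets the heap start at \<open>w\<close>, and copies the truth value from register 2 to
  register 0.\<close>

lemma (in positive_k) decides_dec:
  assumes "dec ({} :: var set) (\<lambda>a f. Q a) e"
  shows "\<exists>p K. decides_in_time p (instances k) encode Q (\<lambda>a. K * vnum a ^ e)"
proof -
  have "{} \<subseteq> {2..<2 :: nat}" by simp
  then obtain p w K where p: "evaluates ({} :: var set) (\<lambda>a f. Q a) (\<lambda>_. 0) 2 p w K e"
    using dec_evaluates[OF assms, of 2 "\<lambda>_. 0"] by auto
  let ?p = "SEQ (SETC 0 0) (SEQ (READ 1 0) (SEQ (SETC 0 w) (SEQ p (SEQ (SETC 0 0) (ADD 0 0 2)))))"
  have return: "runs x (SEQ (SETC 0 0) (ADD 0 0 2)) R (1 + 1) (\<lambda>R'. R' 0 = R 2)" for x R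
    by (rule runs_SEQ, rule runs_SETC, rule runs_ADD) simp
  have "runs (encode a) ?p (\<lambda>_. 0) (1 + (1 + (1 + (K * vnum a ^ e + (1 + 1))))) (\<lambda>R. R 0 = of_bool (Q a))"
    if a: "a \<in> instances k" for a
    by (rule runs_SEQ, rule runs_SETC, rule runs_SEQ, rule runs_READ, rule runs_SEQ, rule runs_SETC, rule runs_SEQ,
        rule runs_mono[OF evaluatesD[OF p a]])
      (auto simp: encode_reads(1)[OF a] intro!: runs_mono[OF return])
  moreover have "1 + (1 + (1 + (K * vnum a ^ e + (1 + 1)))) \<le> (K + 5) * vnum a ^ e" if "a \<in> instances k" for a
    using sz_pow[OF that, of 5 e] by (simp add: algebra_simps)
  ultimately have "decides_in_time ?p (instances k) encode Q (\<lambda>a. (K + 5) * vnum a ^ e)"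
    unfolding decides_in_time_def runs_def by (smt (verit) le_trans of_bool_eq_0_iff)
  then show ?thesis by blast
qed

lemma vwalk_arcs_successively: "set (vwalk_arcs p) \<subseteq> A \<longleftrightarrow> successively (\<lambda>u v. (u, v) \<in> A) p"
  by (induction p rule: vwalk_arcs.induct) auto

lemma successively_closed:
  "successively E p \<Longrightarrow> hd p \<in> V \<Longrightarrow> (\<And>u v. E u v \<Longrightarrow> v \<in> V) \<Longrightarrow> set p \<subseteq> V"
  by (induction p rule: induct_list012) auto

lemma successively_hd_last:
  assumes "successively E p" "p \<noteq> []"
  shows "(E ^^ (length p - 1)) (hd p) (last p)"
  unfolding relpowp_fun_conv
  by (rule exI[of _ "\<lambda>i. p ! i"]) (use assms in \<open>auto simp: hd_conv_nth last_conv_nth successively_conv_nth\<close>)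

lemma path_between_iff:
  assumes "(G, ts) \<in> instances k" "u \<in> pverts G"
  shows "path_between G u p v \<longleftrightarrow>
    p \<noteq> [] \<and> hd p = u \<and> last p = v \<and> successively (adj (G, ts)) p \<and> distinct p"
proof -
  have "set p \<subseteq> pverts G" if "successively (adj (G, ts)) p" "hd p = u"
    using that assms instanceD(2)[OF assms(1)] successively_closed[of "adj (G, ts)" p "pverts G"]
    by (auto simp: instances_def vnum_def)
  then show ?thesis
    by (auto simp: path_between_def vpath_def vwalk_def vwalk_arcs_successively adj_def)
qed

text \<open>A shortest walk repeats no vertex, so the minimum over walks is attained by a path. The
  path \<open>p\<close> guarantees reachability; without it \<open>gdist\<close> is infinite,
  whereas \<open>dist\<close> is an arbitrary natural number.\<close>

lemma gdist_eq_dist: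
  assumes a: "(G, ts) \<in> instances k" and u: "u \<in> pverts G" and p: "path_between G u p v"
  shows "gdist G u v = enat (ugraph.dist (adj (G, ts)) u v)"
proof -
  interpret ugraph "adj (G, ts)" by (rule ugraph_adj[OF a])
  have ge: "dist u v \<le> vwalk_length q" if "path_between G u q v" for q
    using that successively_hd_last[of "adj (G, ts)" q] dist_le[of "length q - 1" u v]
    by (auto simp: path_between_iff[OF a u])
  have V: "finite (pverts G)" "adj (G, ts) x y \<Longrightarrow> y \<in> pverts G" for x y
    using a instanceD(2)[OF a] by (auto simp: instances_def vnum_def) (metis finite_lessThan)
  have reach: "(adj (G, ts))\<^sup>*\<^sup>* u v"
    using p successively_hd_last[of "adj (G, ts)" p] relpowp_reach by (auto simp: path_between_iff[OF a u])
  obtain m f where f: "f 0 = u" "f m = v" "\<And>i. i < m \<Longrightarrow> adj (G, ts) (f i) (f (Suc i))" "inj_on f {..m}"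
    and m: "\<And>m'. ((adj (G, ts)) ^^ m') u v \<Longrightarrow> m \<le> m'"
  proof (rule relpowp_short[OF reach V(1) u])
    show "adj (G, ts) x y \<Longrightarrow> y \<in> pverts G" for x y by (rule V(2))
  qed (rule that)
  have q: "path_between G u (map f [0..<Suc m]) v"
    unfolding path_between_iff[OF a u] using f
    by (auto simp: hd_map last_map successively_conv_nth distinct_map atLeast0LessThan lessThan_Suc_atMost nth_append simp del: upt_Suc)
  have "((adj (G, ts)) ^^ dist u v) u v" by (rule dist_walk[OF reach])
  then have "vwalk_length (map f [0..<Suc m]) \<le> dist u v" using m by simp
  then have "vwalk_length (map f [0..<Suc m]) = dist u v" using ge[OF q] by simp
  then have "(INF q \<in> {q. path_between G u q v}. enat (vwalk_length q)) \<le> enat (dist u v)"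
    using q by (intro INF_lower2[of "map f [0..<Suc m]"]) auto
  moreover have "enat (dist u v) \<le> (INF q \<in> {q. path_between G u q v}. enat (vwalk_length q))"
    using ge by (intro INF_greatest) auto
  ultimately show ?thesis by (simp add: gdist_def)
qed

lemma has_short_disjoint_paths_iff:
  assumes a: "(G, ts) \<in> instances k"
  shows "has_short_disjoint_paths C G ts \<longleftrightarrow>
    (\<exists>Q. terminals.solution (adj (G, ts)) k C (source (G, ts)) (target (G, ts)) Q)"
proof -
  interpret terminals "adj (G, ts)" "{..<vnum (G, ts)}" k C "source (G, ts)" "target (G, ts)"
    using instanceD[OF a] by unfold_locales auto
  have len: "length ts = k" using a by (simp add: instances_def)
  have src: "source (G, ts) p \<in> pverts G" if "p < k" for p
    using a instanceD(4)[OF a that] by (auto simp: instances_def vnum_def)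
  have pq: "(case ts ! p of (s, t) \<Rightarrow> path_between G s q t \<and> enat (vwalk_length q) \<le> gdist G s t + enat C) \<longleftrightarrow>
      q \<noteq> [] \<and> hd q = source (G, ts) p \<and> last q = target (G, ts) p \<and> successively (adj (G, ts)) q \<and> distinct q \<and>
      length q \<le> dist (source (G, ts) p) (target (G, ts) p) + C + 1" (is "?L \<longleftrightarrow> ?R") if "p < k" for p q
  proof -
    have "?L \<longleftrightarrow> path_between G (source (G, ts) p) q (target (G, ts) p) \<and>
        enat (vwalk_length q) \<le> gdist G (source (G, ts) p) (target (G, ts) p) + enat C"
      by (simp add: source_def target_def split: prod.split)
    also have "\<dots> \<longleftrightarrow> path_between G (source (G, ts) p) q (target (G, ts) p) \<and>
        length q \<le> dist (source (G, ts) p) (target (G, ts) p) + C + 1"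
      using gdist_eq_dist[OF a src[OF that]] by auto
    finally show ?thesis by (simp add: path_between_iff[OF a src[OF that]])
  qed
  show ?thesis
  proof
    assume "has_short_disjoint_paths C G ts"
    then obtain Ps where "length Ps = k" "internally_disjoint Ps"
      "\<And>p. p < k \<Longrightarrow> case ts ! p of (s, t) \<Rightarrow> path_between G s (Ps ! p) t \<and> enat (vwalk_length (Ps ! p)) \<le> gdist G s t + enat C"
      unfolding has_short_disjoint_paths_def len by blast
    then have "solution (\<lambda>p. Ps ! p)"
      unfolding solution_def internally_disjoint_def internal_vertices_def using pq by simp
    then show "\<exists>Q. solution Q" by blast
  next
    assume "\<exists>Q. solution Q"
    then obtain Q where Q: "solution Q" ..
    then have "internally_disjoint (map Q [0..<k])"
      unfolding solution_def internally_disjoint_def internal_vertices_def by simp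
    then show "has_short_disjoint_paths C G ts"
      unfolding has_short_disjoint_paths_def len using Q pq
      by (intro exI[of _ "map Q [0..<k]"]) (simp add: solution_def)
  qed
qed

lemma solution_iff_accepts:
  fixes k C :: nat
  assumes k: "0 < k"
  defines "N \<equiv> k + k * C"
  defines "M \<equiv> (if k = 1 then N else (5 * N\<^sup>2) ^ Suc k)"
  shows "\<exists>S. finite S \<and>
    (\<forall>(m, cost, col, ori)\<in>S. certificate_formula k m col \<and> (\<Sum>p<k. m p) \<le> M) \<and>
    (\<forall>a\<in>instances k. (\<exists>Q. terminals.solution (adj a) k C (source a) (target a) Q) \<longleftrightarrow>
      (\<exists>(m, cost, col, ori)\<in>S. certificate_formula.accepts k m cost col ori a))"
proof -
  let ?A = "{..<k} \<times> {..<M}"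
  \<comment> \<open>Fixed default values outside finite ranges make this a finite set of
    functions.\<close>
  define S0 where "S0 = {m :: nat \<Rightarrow> nat. \<forall>p. (p \<in> {..<k} \<longrightarrow> m p \<in> {..M}) \<and> (p \<notin> {..<k} \<longrightarrow> m p = 0)} \<times>
    {cost :: nat \<times> nat \<Rightarrow> nat. \<forall>i. (i \<in> ?A \<longrightarrow> cost i \<in> {..2}) \<and> (i \<notin> ?A \<longrightarrow> cost i = 0)} \<times>
    {col :: nat \<times> nat \<Rightarrow> nat. \<forall>i. (i \<in> ?A \<longrightarrow> col i \<in> {..<k}) \<and> (i \<notin> ?A \<longrightarrow> col i = 0)} \<times>
    {ori :: nat \<times> nat \<Rightarrow> bool. \<forall>i. (i \<in> ?A \<longrightarrow> ori i \<in> UNIV) \<and> (i \<notin> ?A \<longrightarrow> ori i = False)}"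
  define sh where "sh = (\<lambda>(m :: nat \<Rightarrow> nat) cost (col :: nat \<times> nat \<Rightarrow> nat).
    (\<forall>p<k. 1 \<le> m p \<and> (\<Sum>r\<in>{1..<m p}. cost (p, r)) \<le> C) \<and> (\<forall>i\<in>(SIGMA p:{..<k}. {..<m p}). col i < k \<and> cost i \<le> (2 :: nat)))"
  define S where "S = {(m, cost, col, ori) \<in> S0. sh m cost col \<and> (\<Sum>p<k. m p) \<le> M}"
  have "finite S0"
    unfolding S0_def by (intro finite_cartesian_product finite_set_of_finite_funs) auto
  then have fin: "finite S" unfolding S_def by (rule rev_finite_subset) auto
  \<comment> \<open>A dummy graph: \<open>Ix\<close> depends on \<open>k\<close> and
    \<open>m\<close> only, but its defining equation is available only for an instance of the
    locale.\<close>
  interpret T: terminals "\<lambda>_ _. False" UNIV k C "\<lambda>_. ()" "\<lambda>_. ()" by unfold_locales auto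
  have cf: "certificate_formula k m col" if "sh m cost col" for m cost col
    using that k by unfold_locales (auto simp: sh_def T.Ix_def)
  have S_iff: "(\<exists>Q. terminals.solution (adj a) k C (source a) (target a) Q) \<longleftrightarrow>
      (\<exists>(m, cost, col, ori)\<in>S. certificate_formula.accepts k m cost col ori a)" if a: "a \<in> instances k" for a
  proof -
    interpret terminals "adj a" "{..<vnum a}" k C "source a" "target a"
      using instanceD[OF a] by unfold_locales auto
    have shape_iff: "shape m cost col \<longleftrightarrow> sh m cost col" for m cost col
      by (simp add: shape_def sh_def Ix_def)
    have acc: "certificate_formula.accepts k m cost col ori a \<longleftrightarrow>
        (\<exists>x y. (\<forall>i\<in>Ix m. x i < vnum a \<and> y i < vnum a) \<and>
          local_ok m cost x y \<and> separated m col ori x y \<and> routable m col ori x y)" if "sh m cost col" for m cost col ori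
      unfolding certificate_formula.accepts_def[OF cf[OF that]] certificate_formula.Ix_J[OF cf[OF that] a] ..
    show ?thesis
    proof
      assume "\<exists>Q. solution Q"
      then obtain Q where "solution Q" ..
      from certificate_complete[OF this] obtain m cost col ori x y where c: "shape m cost col" "(\<Sum>p<k. m p) \<le> M"
        "\<forall>i\<in>Ix m. x i < vnum a \<and> y i < vnum a" "local_ok m cost x y" "separated m col ori x y" "routable m col ori x y"
        unfolding M_def N_def by auto
      have mM: "m p \<le> M" if "p < k" for p
        using c(2) member_le_sum[of p "{..<k}" m] that by simp
      define m' where "m' = (\<lambda>p. if p < k then m p else 0)"
      define cost' where "cost' = (\<lambda>i. if i \<in> Ix m then cost i else 0)"
      define col' where "col' = (\<lambda>i. if i \<in> Ix m then col i else 0)"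
      define ori' where "ori' = (\<lambda>i. i \<in> Ix m \<and> ori i)"
      note cong = certificate_cong[of m m' cost cost' col col' ori ori']
      have c': "shape m' cost' col'" "\<forall>i\<in>Ix m'. x i < vnum a \<and> y i < vnum a" "local_ok m' cost' x y"
        "separated m' col' ori' x y" "routable m' col' ori' x y"
        using c cong by (simp_all add: m'_def cost'_def col'_def ori'_def)
      have A: "Ix m \<subseteq> ?A" using mM by (fastforce simp: Ix_def)
      have "i \<in> Ix m \<Longrightarrow> cost i \<le> 2" "i \<in> Ix m \<Longrightarrow> col i < k" for i using c(1) by (auto simp: shape_def)
      then have "(m', cost', col', ori') \<in> S0"
        using A k mM by (auto simp: S0_def m'_def cost'_def col'_def ori'_def)
      moreover have "(\<Sum>p<k. m' p) = (\<Sum>p<k. m p)" by (simp add: m'_def)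
      ultimately have "(m', cost', col', ori') \<in> S" using c(2) c'(1) shape_iff by (simp add: S_def)
      moreover have "certificate_formula.accepts k m' cost' col' ori' a"
        using acc c' shape_iff by blast
      ultimately show "\<exists>(m, cost, col, ori)\<in>S. certificate_formula.accepts k m cost col ori a" by blast
    next
      assume "\<exists>(m, cost, col, ori)\<in>S. certificate_formula.accepts k m cost col ori a"
      then obtain m cost col ori where m: "sh m cost col" "certificate_formula.accepts k m cost col ori a"
        by (auto simp: S_def)
      then show "\<exists>Q. solution Q"
        using certificate_sound acc[OF m(1)] shape_iff by blast
    qed
  qed
  have "\<forall>(m, cost, col, ori)\<in>S. certificate_formula k m col \<and> (\<Sum>p<k. m p) \<le> M"
    using cf by (auto simp: S_def)
  then show ?thesis by (intro exI[of _ S] conjI fin) (assumption, intro ballI, rule S_iff)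
qed

lemma dec_solution:
  fixes k C :: nat
  assumes k: "0 < k"
  defines "N \<equiv> k + k * C"
  shows "\<exists>p K. decides_in_time p (instances k) encode (\<lambda>(G, ts). has_short_disjoint_paths C G ts)
    (\<lambda>a. K * vnum a ^ (6 * (if k = 1 then N else (5 * N\<^sup>2) ^ Suc k) + 15))"
proof -
  let ?M = "if k = 1 then N else (5 * N\<^sup>2) ^ Suc k"
  interpret positive_k k by unfold_locales (rule k)
  obtain S where S: "finite S" "\<forall>(m, cost, col, ori)\<in>S. certificate_formula k m col \<and> (\<Sum>p<k. m p) \<le> ?M"
    "\<forall>a\<in>instances k. (\<exists>Q. terminals.solution (adj a) k C (source a) (target a) Q) \<longleftrightarrow>
      (\<exists>(m, cost, col, ori)\<in>S. certificate_formula.accepts k m cost col ori a)"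
    using solution_iff_accepts[OF k, of C, folded N_def] by (elim exE conjE) (rule that)
  have "dec ({} :: var set) (\<lambda>a f. \<exists>w\<in>S. (\<lambda>(m, cost, col, ori) a f. certificate_formula.accepts k m cost col ori a) w a f) (6 * ?M + 15)"
  proof (rule dec_Bex[OF S(1)])
    fix w assume w: "w \<in> S"
    obtain m cost col ori where w': "w = (m, cost, col, ori)" by (cases w) auto
    interpret certificate_formula k m cost col ori using S(2) w w' by fast
    have "card J = (\<Sum>p<k. m p)" by (simp add: J_def)
    then have "6 * card J + 15 \<le> 6 * ?M + 15" using S(2) w w' by auto
    then show "dec ({} :: var set) ((\<lambda>(m, cost, col, ori) a f. certificate_formula.accepts k m cost col ori a) w) (6 * ?M + 15)"
      using dec_mono[OF dec_accepts] w' by simp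
  qed
  then have "dec ({} :: var set) (\<lambda>a f. case a of (G, ts) \<Rightarrow> has_short_disjoint_paths C G ts) (6 * ?M + 15)"
  proof (rule dec_cong)
    fix a and f :: "var \<Rightarrow> nat"
    assume a: "a \<in> instances k"
    obtain G ts where a': "a = (G, ts)" by (cases a)
    show "(case a of (G, ts) \<Rightarrow> has_short_disjoint_paths C G ts) =
        (\<exists>w\<in>S. (\<lambda>(m, cost, col, ori) a f. certificate_formula.accepts k m cost col ori a) w a f)"
      using bspec[OF S(3) a] has_short_disjoint_paths_iff[of G ts k C] a unfolding a' by (simp add: case_prod_unfold)
  qed
  then show ?thesis by (rule decides_dec)
qed

text \<open>With \<open>C\<close> in place of \<open>max 1 C\<close> the bound for
  \<open>C = 0\<close> and positive \<open>k\<close> would be a constant, too little to inspect the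
  graph. The factor \<open>K\<close> may depend on \<open>k\<close> and \<open>C\<close>, while
  \<open>c\<close> may not.\<close>

theorem corollary2:
  shows "\<exists>c::nat. \<forall>k C :: nat. \<exists>p :: ram. \<exists>K :: nat.
    decides_in_time p (instances k) encode
      (\<lambda>(G, ts). has_short_disjoint_paths C G ts)
      (\<lambda>(G, ts). K * card (pverts G) ^ (c * (max 1 C * k) ^ (5 ^ k)))"
proof (intro exI[of _ 27] allI)
  fix k C :: nat
  have vn: "(\<lambda>(G, ts). K * card (pverts G) ^ e) = (\<lambda>a. K * vnum a ^ e)" for K e
    by (auto simp: vnum_def)
  show "\<exists>p K. decides_in_time p (instances k) encode (\<lambda>(G, ts). has_short_disjoint_paths C G ts)
      (\<lambda>(G, ts). K * card (pverts G) ^ (27 * (max 1 C * k) ^ (5 ^ k)))"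
  proof (cases "k = 0")
    \<comment> \<open>Without pairs the exponent is 0 and the empty list of paths is a solution. The
      graph may have no vertices here, which is why the compiled formulas do not cover this
      case.\<close>
    case True
    have "exec x (SETC 0 1) (\<lambda>_. 0) 1 ((\<lambda>_. 0)(0 := 1))" for x by (rule exec.setc)
    moreover have "has_short_disjoint_paths C G ts" if "(G, ts) \<in> instances 0" for G ts
      using that by (auto simp: instances_def has_short_disjoint_paths_def internally_disjoint_def)
    ultimately have "decides_in_time (SETC 0 1) (instances k) encode (\<lambda>(G, ts). has_short_disjoint_paths C G ts)
      (\<lambda>(G, ts). 1 * card (pverts G) ^ (27 * (max 1 C * k) ^ (5 ^ k)))"
      unfolding decides_in_time_def using True by fastforce
    then show ?thesis by blast
  next
    case False
    then have k: "0 < k" by simp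
    interpret positive_k k by unfold_locales (rule k)
    obtain p K where p: "decides_in_time p (instances k) encode (\<lambda>(G, ts). has_short_disjoint_paths C G ts)
      (\<lambda>a. K * vnum a ^ (6 * (if k = 1 then k + k * C else (5 * (k + k * C)\<^sup>2) ^ Suc k) + 15))"
      using dec_solution[OF k] by blast
    have "K * vnum a ^ (6 * (if k = 1 then k + k * C else (5 * (k + k * C)\<^sup>2) ^ Suc k) + 15) \<le>
        K * vnum a ^ (27 * (max 1 C * k) ^ (5 ^ k))" if "a \<in> instances k" for a
      using sz_pos[OF that] by (intro mult_left_mono power_increasing exponent_bound[OF k]) auto
    with p have "decides_in_time p (instances k) encode (\<lambda>(G, ts). has_short_disjoint_paths C G ts)
      (\<lambda>a. K * vnum a ^ (27 * (max 1 C * k) ^ (5 ^ k)))"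
      unfolding decides_in_time_def by (meson le_trans)
    then show ?thesis unfolding vn by blast
  qed
qed

end
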